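(* If $\psi$ is a strict $4$-coloring of a triangulation $T$ of the $2$-sphere $\mathbb{S}^2$, then there exists a triangulation $T'$ of the $3$-disk $\mathbb{D}^3$ such that $T$ is the triangulation induced by $T'$ on the boundary $\partial\mathbb{D}^3=\mathbb{S}^2$ of the disk, the vertices of $T'$ are in $T$ (that is, every vertex of $T'$ is a vertex of $T$), and $\psi$ is a $4$-coloring of $T'$.
   Context: Let $\Delta^n=\{(t_0,\dots,t_n)\in\mathbb{R}^{n+1}:\sum_i t_i=1 \text{ and } t_i\ge 0 \text{ for all } i\}$ be the standard $n$-simplex. A $k$-dimensional face of $\Delta^n$ ($k<n$) is a subset of $\Delta^n$ where $n-k$ prescribed coordinates are equal to zero. The open $n$-simplex is $\mathring{\Delta}^n=\{(t_0,\dots,t_n)\in\Delta^n: t_i>0\text{ for all } i\}$. A triangulation of a space $X$ means a $\Delta$-complex structure on $X$: a (finite) collection of maps $\sigma_\alpha:\Delta^n\to X$, with $n$ depending on the index $\alpha$, such that (i) the restriction $\sigma_\alpha|\mathring{\Delta}^n$ is injective, and each point of $X$ is in the image of exactly one such restriction; (ii) each restriction of $\sigma_\alpha$ to a face of dimension $k<n$ of $\Delta^n$ is one of the maps $\sigma_\beta:\Delta^k\to X$, where the face is identified with $\Delta^k$ by the canonical linear homeomorphism that preserves the ordering of the vertices; (iii) a set $A\subset X$ is open iff $\sigma_\alpha^{-1}(A)$ is open in $\Delta^n$ for each $\sigma_\alpha$. In particular, several edges may join the same pair of vertices. The triangulation induced by $T'$ on the boundary of the disk is the collection of those maps of $T'$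 whose image lies in the boundary. The vertices and edges of a triangulation are the images of its $0$-simplices and $1$-simplices respectively; they form the graph of the triangulation. A coloring of a triangulation is a proper coloring of the vertices of its graph (the two ends of each edge have different colors). A $4$-coloring is a coloring with colors from a set of four colors, and it is strict if all four colors are used. *)

theory Defs
  imports "HOL-Homology.Simplices" "HOL-Analysis.Analysis"
begin

abbreviation simplex_topology :: "nat \<Rightarrow> (nat \<Rightarrow> real) topology" where
  "simplex_topology n \<equiv> subtopology (powertop_real UNIV) (standard_simplex n)"

definition open_simplex :: "nat \<Rightarrow> (nat \<Rightarrow> real) set" where
  "open_simplex n = {t \<in> standard_simplex n. \<forall>i\<le>n. 0 < t i}"

definition simplex_vertex :: "nat \<Rightarrow> nat \<Rightarrow> real" where
  "simplex_vertex i = (\<lambda>j. if j = i then 1 else 0)"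

text \<open>
  The restriction of \<open>\<sigma>\<close> to the face spanned by the vertices \<open>j 0 < \<dots> < j k\<close>, precomposed with
  the linear map from the standard \<open>k\<close>-simplex onto this face that sends vertex \<open>m\<close> to
  vertex \<open>j m\<close>.
\<close>
definition face_restriction ::
    "nat \<Rightarrow> (nat \<Rightarrow> nat) \<Rightarrow> ((nat \<Rightarrow> real) \<Rightarrow> 'a) \<Rightarrow> (nat \<Rightarrow> real) \<Rightarrow> 'a" where
  "face_restriction k j \<sigma> = simplex_map k \<sigma> (oriented_simplex k (\<lambda>m. simplex_vertex (j m)))"

text \<open>
  A collection of maps is a set of pairs \<open>(n, \<sigma>)\<close>, where \<open>\<sigma>\<close> has domain the standard \<open>n\<close>-simplex.
  The maps are extensional, so that equality of pairs is equality of maps. A set suffices in place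
  of an indexed family, because in a \<open>\<Delta>\<close>-complex structure each point of the space lies in the
  image of only one open simplex, so that no map can be listed twice.
\<close>
type_synonym 'a simplices = "(nat \<times> ((nat \<Rightarrow> real) \<Rightarrow> 'a)) set"

definition is_triangulation :: "'a topology \<Rightarrow> 'a simplices \<Rightarrow> bool" where
  "is_triangulation X K \<longleftrightarrow>
     finite K \<and>
     (\<forall>(n, \<sigma>) \<in> K. \<sigma> \<in> standard_simplex n \<rightarrow>\<^sub>E topspace X) \<and>
     (\<forall>(n, \<sigma>) \<in> K. inj_on \<sigma> (open_simplex n)) \<and>
     (\<forall>x \<in> topspace X. \<exists>!s. s \<in> K \<and> x \<in> snd s ` open_simplex (fst s)) \<and>
     (\<forall>(n, \<sigma>) \<in> K. \<forall>k<n. \<forall>j. strict_mono_on {..k} j \<and> j ` {..k} \<subseteq> {..n} \<longrightarrow>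
        (k, face_restriction k j \<sigma>) \<in> K) \<and>
     (\<forall>A \<subseteq> topspace X. openin X A \<longleftrightarrow>
        (\<forall>(n, \<sigma>) \<in> K. openin (simplex_topology n) {t \<in> standard_simplex n. \<sigma> t \<in> A}))"

definition induced_triangulation :: "'a set \<Rightarrow> 'a simplices \<Rightarrow> 'a simplices" where
  "induced_triangulation B K = {(n, \<sigma>) \<in> K. \<sigma> ` standard_simplex n \<subseteq> B}"

text \<open>
  The vertices are taken as points of the space. Each edge is given by its 1-simplex \<open>\<sigma>\<close>, so that
  parallel edges remain distinct, and its two ends are \<open>\<sigma> (simplex_vertex 0)\<close> and
  \<open>\<sigma> (simplex_vertex 1)\<close>. A triangulation with a loop has no proper coloring.
\<close>
definition vertices :: "'a simplices \<Rightarrow> 'a set" where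
  "vertices K = {\<sigma> (simplex_vertex 0) | \<sigma>. (0, \<sigma>) \<in> K}"

definition proper_coloring :: "'a simplices \<Rightarrow> ('a \<Rightarrow> 'c) \<Rightarrow> bool" where
  "proper_coloring K \<psi> \<longleftrightarrow>
     (\<forall>\<sigma>. (1, \<sigma>) \<in> K \<longrightarrow> \<psi> (\<sigma> (simplex_vertex 0)) \<noteq> \<psi> (\<sigma> (simplex_vertex 1)))"

text \<open>Only the values of \<open>\<psi>\<close> on the vertices matter; \<open>C\<close> is the set of colors.\<close>
definition four_coloring :: "'c set \<Rightarrow> 'a simplices \<Rightarrow> ('a \<Rightarrow> 'c) \<Rightarrow> bool" where
  "four_coloring C K \<psi> \<longleftrightarrow> card C = 4 \<and> \<psi> ` vertices K \<subseteq> C \<and> proper_coloring K \<psi>"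

definition strict_four_coloring :: "'c set \<Rightarrow> 'a simplices \<Rightarrow> ('a \<Rightarrow> 'c) \<Rightarrow> bool" where
  "strict_four_coloring C K \<psi> \<longleftrightarrow> four_coloring C K \<psi> \<and> \<psi> ` vertices K = C"

end

theory Submission
  imports Defs
begin

text \<open>
  The ball is built from ordered tetrahedra that are attached to the sphere from inside. If two or
  three triangles of the sphere form one of the two discs into which the boundary of a tetrahedron
  with differently colored vertices is divided, they can be replaced by the other disc: a
  triangulated ball bounded by the new sphere is pushed radially inwards, and the tetrahedron fills
  the gap. With two triangles this flips an edge whose opposite vertices have different colors, and
  one of the two directions of the new edge is always compatible with the order of the vertices.
  With three triangles it removes a vertex of degree three, provided that its link is not a directed
  cycle. While two vertices have the same color, flips reduce the degree of one of them to three,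
  with a link that is not a directed cycle, so the number of vertices can be reduced to four. After
  at most one more flip any two of the four vertices are adjacent; by the Jordan curve theorem there
  are no parallel edges, so the triangulation is the boundary of a tetrahedron, filled by a cone.
\<close>

section \<open>Faces of simplices indexed by vertex sets\<close>

text \<open>The simplices of a Delta-complex have ordered vertices, and this is the obstacle that
  shapes the proof. A tetrahedron fits onto triangles of the sphere only if the orientations of
  their edges extend to a linear order of its four vertices. In a flip the direction of the new edge
  can be adapted; at a vertex of degree three nothing can be chosen. Therefore a local source or
  sink in the link of the vertex to be removed has to be preserved through all flips, in part by
  choosing the direction of new edges. The coloring enters in three ways. Different colors at its
  corners make the vertices of a tetrahedron distinct and keep the coloring proper. The absence of
  loops makes closed simplices embedded. Strictness lets a vertex see all four colors, which yields
  the flips that lower its degree; as only vertices with a repeated color are removed, strictness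
  survives the induction. The conclusion demands equality of maps on the sphere, not merely an
  isomorphism. Hence the new disc is parametrized so that it covers exactly the old one, and only
  the ball inside is deformed.\<close>

definition vrank :: "nat set \<Rightarrow> nat \<Rightarrow> nat" where
  "vrank s i = card {j \<in> s. j < i}"

text \<open>\<open>vrank s\<close> is the order isomorphism of a finite set \<open>s\<close> onto
  \<open>{..<card s}\<close>, so \<open>push s\<close> is the affine map of the standard simplex of
  dimension \<open>card s - 1\<close> onto the face spanned by \<open>s\<close> that preserves the
  order of the vertices.\<close>

definition push :: "nat set \<Rightarrow> (nat \<Rightarrow> real) \<Rightarrow> nat \<Rightarrow> real" where
  "push s x = (\<lambda>i. if i \<in> s then x (vrank s i) else 0)"

text \<open>Faces are indexed by vertex sets instead of increasing maps: iterated faces then become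
  subsets, and faces can be compared through their sets. The value is a pair, hence directly a
  candidate member of a set of simplices.\<close>

definition cell :: "nat set \<Rightarrow> ((nat \<Rightarrow> real) \<Rightarrow> 'a) \<Rightarrow> nat \<times> ((nat \<Rightarrow> real) \<Rightarrow> 'a)" where
  "cell s \<sigma> = (card s - 1, restrict (\<sigma> \<circ> push s) (standard_simplex (card s - 1)))"

text \<open>For a point of a simplex this is the vertex set of the smallest face that contains
  it.\<close>

definition supp :: "(nat \<Rightarrow> real) \<Rightarrow> nat set" where
  "supp t = {i. 0 < t i}"

lemma rank_less:
  assumes "finite s" "i \<in> s" "j \<in> s" "i < j"
  shows "vrank s i < vrank s j"
  unfolding vrank_def
  using assms by (intro psubset_card_mono) auto

lemma rank_less_iff:
  assumes "finite s" "i \<in> s" "j \<in> s"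
  shows "vrank s i < vrank s j \<longleftrightarrow> i < j"
  using rank_less assms by (metis linorder_neqE_nat not_less_iff_gr_or_eq)

lemma rank_inj: "finite s \<Longrightarrow> inj_on (vrank s) s"
  by (metis inj_onI nat_neq_iff rank_less)

lemma rank_lt_card:
  assumes "finite s" "i \<in> s" shows "vrank s i < card s"
  unfolding vrank_def using assms by (intro psubset_card_mono) auto

lemma rank_bij:
  assumes "finite s" shows "bij_betw (vrank s) s {..<card s}"
proof -
  have "vrank s ` s \<subseteq> {..<card s}" using rank_lt_card[OF assms] by blast
  moreover have "card (vrank s ` s) = card {..<card s}"
    using card_image[OF rank_inj[OF assms]] by simp
  ultimately have "vrank s ` s = {..<card s}" by (intro card_subset_eq) auto
  then show ?thesis using rank_inj[OF assms] by (simp add: bij_betw_def)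
qed

lemma rank_image: "finite s \<Longrightarrow> vrank s ` s = {..<card s}"
  by (rule bij_betw_imp_surj_on[OF rank_bij])

lemma rank_id: "i \<le> n \<Longrightarrow> vrank {..n} i = i"
proof -
  assume "i \<le> n"
  then have "{j \<in> {..n}. j < i} = {..<i}" by auto
  then show ?thesis by (simp add: vrank_def)
qed

lemma rank_rank:
  assumes "finite s" "r \<subseteq> s" "i \<in> r"
  shows "vrank (vrank s ` r) (vrank s i) = vrank r i"
proof -
  have "{j \<in> vrank s ` r. j < vrank s i} = vrank s ` {j \<in> r. j < i}"
    using assms by (auto simp: rank_less_iff subset_iff)
  moreover have "inj_on (vrank s) {j \<in> r. j < i}"
    using rank_inj[OF assms(1)] assms(2) by (auto intro: inj_on_subset)
  ultimately have "card {j \<in> vrank s ` r. j < vrank s i} = card {j \<in> r. j < i}"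
    by (simp only: card_image)
  then show ?thesis by (simp only: vrank_def[of "vrank s ` r"] vrank_def[of r])
qed

lemma simplex_nonneg: "t \<in> standard_simplex n \<Longrightarrow> 0 \<le> t i"
  and simplex_le1: "t \<in> standard_simplex n \<Longrightarrow> t i \<le> 1"
  and simplex_beyond: "t \<in> standard_simplex n \<Longrightarrow> n < i \<Longrightarrow> t i = 0"
  and simplex_sum: "t \<in> standard_simplex n \<Longrightarrow> (\<Sum>i\<le>n. t i) = 1"
  by (auto simp: standard_simplex_def)

lemma in_simplexI:
  assumes "\<And>i. i \<le> n \<Longrightarrow> 0 \<le> t i" "\<And>i. n < i \<Longrightarrow> t i = 0" "(\<Sum>i\<le>n. t i) = 1"
  shows "t \<in> standard_simplex n"
proof -
  have ge: "0 \<le> t i" for i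
    using assms(1,2)[of i] by (cases "i \<le> n") auto
  have "t i \<le> 1" for i
  proof (cases "i \<le> n")
    case True
    then have "t i \<le> (\<Sum>i\<le>n. t i)"
      using assms by (intro member_le_sum) auto
    then show ?thesis using assms by simp
  qed (use assms in auto)
  then show ?thesis
    using ge assms(2,3) by (simp add: standard_simplex_def)
qed

lemma supp_zero: "t \<in> standard_simplex n \<Longrightarrow> i \<notin> supp t \<longleftrightarrow> t i = 0"
  by (auto simp: supp_def not_less dest: simplex_nonneg[where i=i])

lemma supp_sub: "t \<in> standard_simplex n \<Longrightarrow> supp t \<subseteq> {..n}"
  by (force simp: supp_def not_le dest: simplex_beyond)

lemma supp_finite: "t \<in> standard_simplex n \<Longrightarrow> finite (supp t)"
  using supp_sub finite_subset by blast

lemma supp_ne: "t \<in> standard_simplex n \<Longrightarrow> supp t \<noteq> {}"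
  using supp_zero simplex_sum by fastforce

lemma open_simplex_iff: "t \<in> open_simplex n \<longleftrightarrow> t \<in> standard_simplex n \<and> supp t = {..n}"
  using supp_sub by (force simp: open_simplex_def supp_def)

lemma open_simplex_sub: "open_simplex n \<subseteq> standard_simplex n"
  by (auto simp: open_simplex_def)

lemma push_sum:
  assumes "finite s" "s \<subseteq> r" "finite r"
  shows "(\<Sum>i\<in>r. push s x i) = (\<Sum>m<card s. x m)"
proof -
  have "(\<Sum>i\<in>r. push s x i) = (\<Sum>i\<in>s. x (vrank s i))"
    unfolding push_def using assms by (simp add: sum.If_cases Int_absorb1)
  also have "\<dots> = (\<Sum>m<card s. x m)"
    using sum.reindex_bij_betw[OF rank_bij[OF assms(1)], of x] by simp
  finally show ?thesis .
qed

lemma card_less_Suc: "finite s \<Longrightarrow> s \<noteq> {} \<Longrightarrow> {..<card s} = {..card s - 1}"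
  by (cases "card s") (simp_all add: lessThan_Suc_atMost)

lemma push_simplex:
  assumes "s \<subseteq> {..n}" "s \<noteq> {}" "x \<in> standard_simplex (card s - 1)"
  shows "push s x \<in> standard_simplex n"
proof (rule in_simplexI)
  have fs: "finite s" using assms finite_subset by blast
  show "(\<Sum>i\<le>n. push s x i) = 1"
    using push_sum[OF fs assms(1)] simplex_sum[OF assms(3)] card_less_Suc[OF fs assms(2)] by simp
qed (use assms in \<open>auto simp: push_def simplex_nonneg\<close>)

lemma push_supp:
  assumes "s \<subseteq> {..n}" "s \<noteq> {}" "x \<in> standard_simplex (card s - 1)"
  shows "supp (push s x) \<subseteq> s" "supp (push s x) = {i\<in>s. vrank s i \<in> supp x}"
  by (auto simp: supp_def push_def split: if_splits)

lemma push_open: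
  assumes "s \<subseteq> {..n}" "s \<noteq> {}" "x \<in> standard_simplex (card s - 1)"
  shows "x \<in> open_simplex (card s - 1) \<longleftrightarrow> supp (push s x) = s"
proof -
  have fs: "finite s" using assms finite_subset by blast
  have "supp (push s x) = s \<longleftrightarrow> vrank s ` s \<subseteq> supp x"
    using push_supp[OF assms] by auto
  also have "\<dots> \<longleftrightarrow> {..card s - 1} \<subseteq> supp x"
    using rank_image[OF fs] card_less_Suc[OF fs assms(2)] by simp
  finally show ?thesis using open_simplex_iff assms supp_sub by blast
qed

lemma push_inj:
  assumes "finite s" "s \<noteq> {}"
  shows "inj_on (push s) (standard_simplex (card s - 1))"
proof
  fix x y assume x: "x \<in> standard_simplex (card s - 1)" and y: "y \<in> standard_simplex (card s - 1)"
    and eq: "push s x = push s y"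
  show "x = y"
  proof
    fix m
    show "x m = y m"
    proof (cases "m < card s")
      case True
      then have "m \<in> vrank s ` s" using rank_image[OF assms(1)] by simp
      then obtain i where "i \<in> s" "vrank s i = m" by auto
      then show ?thesis using fun_cong[OF eq, of i] by (simp add: push_def)
    next
      case False
      moreover have "0 < card s" using assms by (simp add: card_gt_0_iff)
      ultimately have "card s - 1 < m" by linarith
      then show ?thesis using simplex_beyond[OF x] simplex_beyond[OF y] by simp
    qed
  qed
qed

lemma push_onto:
  assumes "t \<in> standard_simplex n" "supp t \<subseteq> s" "s \<subseteq> {..n}"
  shows "\<exists>x \<in> standard_simplex (card s - 1). push s x = t"
proof -
  have fs: "finite s" using assms(3) finite_subset by blast
  have ne: "s \<noteq> {}" using assms(2) supp_ne[OF assms(1)] by blast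
  define e where "e = the_inv_into s (vrank s)"
  have e: "e (vrank s i) = i" if "i \<in> s" for i
    using the_inv_into_f_f[OF rank_inj[OF fs] that] by (simp add: e_def)
  define x where "x = (\<lambda>m. if m < card s then t (e m) else 0)"
  have p: "push s x = t"
  proof
    fix i show "push s x i = t i"
      using rank_lt_card[OF fs] e supp_zero[OF assms(1)] assms(2)
      by (auto simp: push_def x_def)
  qed
  have "x \<in> standard_simplex (card s - 1)"
  proof (rule in_simplexI)
    show "(\<Sum>i\<le>card s - 1. x i) = 1"
      using push_sum[OF fs assms(3), of x] p simplex_sum[OF assms(1)] card_less_Suc[OF fs ne] by simp
  qed (use simplex_nonneg[OF assms(1)] in \<open>auto simp: x_def\<close>)
  then show ?thesis using p by blast
qed

lemma push_image_face:
  assumes "s \<subseteq> {..n}" "s \<noteq> {}"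
  shows "push s ` standard_simplex (card s - 1) = {t \<in> standard_simplex n. supp t \<subseteq> s}"
  using push_onto[of _ n s] push_simplex[OF assms] push_supp(1)[OF assms] assms(1) by force

lemma push_image_open:
  assumes "s \<subseteq> {..n}" "s \<noteq> {}"
  shows "push s ` open_simplex (card s - 1) = {t \<in> standard_simplex n. supp t = s}"
proof -
  have "t \<in> push s ` open_simplex (card s - 1)" if "t \<in> standard_simplex n" "supp t = s" for t
    using push_onto[of t n s] push_open[OF assms] assms(1) that by force
  then show ?thesis
    using push_simplex[OF assms] push_open[OF assms] open_simplex_sub by blast
qed

lemma push_push:
  assumes "finite s" "r \<subseteq> s"
  shows "push s (push (vrank s ` r) x) = push r x"
proof
  fix i
  have "vrank s i \<in> vrank s ` r \<longleftrightarrow> i \<in> r" if "i \<in> s"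
    using rank_inj[OF assms(1)] assms(2) that by (auto simp: inj_on_def)
  then show "push s (push (vrank s ` r) x) i = push r x i"
    using assms rank_rank[OF assms] by (auto simp: push_def)
qed

lemma push_full:
  assumes "x \<in> standard_simplex n"
  shows "push {..n} x = x"
  using assms simplex_beyond by (fastforce simp: push_def rank_id)

lemma cell_full:
  assumes "\<sigma> \<in> extensional (standard_simplex n)"
  shows "cell {..n} \<sigma> = (n, \<sigma>)"
  using assms by (auto simp: cell_def fun_eq_iff restrict_def extensional_def push_full)

lemma card_rank_image: "finite s \<Longrightarrow> r \<subseteq> s \<Longrightarrow> card (vrank s ` r) = card r"
  by (rule card_image) (rule inj_on_subset[OF rank_inj])

lemma rank_image_sub: "finite s \<Longrightarrow> s \<noteq> {} \<Longrightarrow> r \<subseteq> s \<Longrightarrow> vrank s ` r \<subseteq> {..card s - 1}"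
  using image_mono[of r s "vrank s"] rank_image[of s] card_less_Suc[of s] by simp

text \<open>A subset \<open>r\<close> of \<open>s\<close> has to be renumbered by
  \<open>vrank s\<close> before it can index a face of the face \<open>s\<close>; with this
  renumbering the two inclusions compose to the inclusion of \<open>r\<close>.\<close>

lemma cell_cell:
  assumes "finite s" "r \<subseteq> s" "r \<noteq> {}"
  shows "cell (vrank s ` r) (snd (cell s G)) = cell r G"
proof -
  have c: "card (vrank s ` r) = card r" using card_rank_image assms by blast
  have ne: "s \<noteq> {}" using assms by blast
  have "push (vrank s ` r) x \<in> standard_simplex (card s - 1)" if "x \<in> standard_simplex (card r - 1)" for x
    using push_simplex[OF rank_image_sub[OF assms(1) ne assms(2)]] that assms c by simp
  then show ?thesis
    unfolding cell_def using c by (auto simp: restrict_def push_push[OF assms(1,2)])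
qed

lemma rank_preimage:
  assumes "finite s" "s \<noteq> {}" "r' \<subseteq> {..card s - 1}"
  obtains r where "r \<subseteq> s" "r' = vrank s ` r"
proof -
  have "r' \<subseteq> vrank s ` s"
    using rank_image[OF assms(1)] card_less_Suc[OF assms(1,2)] assms(3) by simp
  then show ?thesis using that by (auto simp: subset_image_iff)
qed

lemma fst_cell[simp]: "fst (cell s G) = card s - 1"
  by (simp add: cell_def)

lemma snd_cell: "x \<in> standard_simplex (card s - 1) \<Longrightarrow> snd (cell s G) x = G (push s x)"
  by (simp add: cell_def)

lemma cell_image:
  assumes "s \<subseteq> {..n}" "s \<noteq> {}"
  shows "snd (cell s G) ` standard_simplex (card s - 1) = G ` {t \<in> standard_simplex n. supp t \<subseteq> s}"
  unfolding push_image_face[OF assms, symmetric] by (auto simp: cell_def)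

lemma cell_image_open:
  assumes "s \<subseteq> {..n}" "s \<noteq> {}"
  shows "snd (cell s G) ` open_simplex (card s - 1) = G ` {t \<in> standard_simplex n. supp t = s}"
  unfolding push_image_open[OF assms, symmetric] cell_def using open_simplex_sub
  by (auto simp: image_image image_iff subset_iff)

lemma cell_cong:
  assumes "s \<subseteq> {..n}" "s \<noteq> {}" "\<And>t. t \<in> standard_simplex n \<Longrightarrow> supp t \<subseteq> s \<Longrightarrow> G t = G' t"
  shows "cell s G = cell s G'"
  unfolding cell_def using push_simplex[OF assms(1,2)] push_supp(1)[OF assms(1,2)] assms(3)
  by (auto simp: restrict_def fun_eq_iff)

lemma vertex_simplex: "simplex_vertex i \<in> standard_simplex n \<longleftrightarrow> i \<le> n"
  by (simp add: simplex_vertex_def)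

lemma supp_vertex: "supp (simplex_vertex i) = {i}"
  by (auto simp: supp_def simplex_vertex_def)

lemma push_vertex:
  assumes "finite s" "i \<in> s"
  shows "push s (simplex_vertex (vrank s i)) = simplex_vertex i"
  using rank_inj[OF assms(1)] assms by (auto simp: push_def simplex_vertex_def fun_eq_iff inj_on_def)

lemma cell_vertex:
  assumes "finite s" "i \<in> s"
  shows "snd (cell s G) (simplex_vertex (vrank s i)) = G (simplex_vertex i)"
proof -
  have "vrank s i \<le> card s - 1"
    using rank_lt_card[OF assms] by linarith
  then show ?thesis
    using push_vertex[OF assms] by (simp add: snd_cell vertex_simplex)
qed

lemma cell_vertices:
  assumes "finite s" "s \<noteq> {}"
  shows "(\<lambda>i. snd (cell s G) (simplex_vertex i)) ` {..card s - 1} = (\<lambda>i. G (simplex_vertex i)) ` s"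
proof -
  have "{..card s - 1} = vrank s ` s"
    using rank_image[OF assms(1)] card_less_Suc[OF assms] by simp
  then have "(\<lambda>i. snd (cell s G) (simplex_vertex i)) ` {..card s - 1}
      = (\<lambda>i. snd (cell s G) (simplex_vertex (vrank s i))) ` s"
    by (simp add: image_image)
  also have "\<dots> = (\<lambda>i. G (simplex_vertex i)) ` s"
    using cell_vertex[OF assms(1)] by (auto intro!: image_cong)
  finally show ?thesis .
qed

lemma face_restriction_cell:
  assumes "strict_mono_on {..k} j"
  shows "(k, face_restriction k j \<sigma>) = cell (j ` {..k}) \<sigma>"
proof -
  let ?s = "j ` {..k}"
  have inj: "inj_on j {..k}" using assms strict_mono_on_imp_inj_on by blast
  have c: "card ?s = Suc k" using card_image[OF inj] by simp
  have rk: "vrank ?s (j m) = m" if "m \<le> k" for m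
  proof -
    have "{i \<in> ?s. i < j m} = j ` {..<m}"
      using that assms by (auto simp: strict_mono_on_less) 
    moreover have "inj_on j {..<m}" using inj that by (auto intro: inj_on_subset)
    ultimately show ?thesis by (simp add: vrank_def card_image)
  qed
  have "oriented_simplex k (\<lambda>m. simplex_vertex (j m)) x = push ?s x" if "x \<in> standard_simplex k" for x
  proof
    fix i
    have e: "oriented_simplex k (\<lambda>m. simplex_vertex (j m)) x i = (\<Sum>m\<le>k. (if i = j m then x m else 0))"
      using that by (auto simp: oriented_simplex_def simplex_vertex_def intro!: sum.cong)
    show "oriented_simplex k (\<lambda>m. simplex_vertex (j m)) x i = push ?s x i"
    proof (cases "i \<in> ?s")
      case True
      then obtain m0 where m0: "m0 \<le> k" "i = j m0" by auto
      have "(\<Sum>m\<le>k. (if i = j m then x m else 0)) = (\<Sum>m\<le>k. (if m = m0 then x m else 0))"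
        using m0 inj by (intro sum.cong) (auto simp: inj_on_def)
      then show ?thesis using e m0 rk by (simp add: push_def)
    next
      case False
      then have "(\<Sum>m\<le>k. (if i = j m then x m else 0)) = 0" by (intro sum.neutral) auto
      with False e show ?thesis by (simp add: push_def)
    qed
  qed
  then show ?thesis
    using c by (auto simp: face_restriction_def simplex_map_def cell_def restrict_def)
qed

text \<open>An increasing map is determined by its image, and for \<open>k < n\<close> the image of
  \<open>{..k}\<close> is a nonempty proper subset of \<open>{..n}\<close>. From here on condition
  (ii) is used in the form on the right.\<close>

lemma face_closed_iff:
  "(\<forall>k<n. \<forall>j. strict_mono_on {..k} j \<and> j ` {..k} \<subseteq> {..n} \<longrightarrow> (k, face_restriction k j \<sigma>) \<in> K)
   \<longleftrightarrow> (\<forall>s. s \<subset> {..n} \<and> s \<noteq> {} \<longrightarrow> cell s \<sigma> \<in> K)" (is "?L \<longleftrightarrow> ?R")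
proof
  assume L: ?L
  show ?R
  proof (intro allI impI)
    fix s assume s: "s \<subset> {..n} \<and> s \<noteq> {}"
    then have fs: "finite s" by (meson finite_atMost finite_subset psubset_imp_subset)
    from ex_bij_betw_strict_mono_card[OF fs]
    obtain h where h: "bij_betw h {..<card s} s" "strict_mono_on {..<card s} h"
      by (auto simp: atLeast0LessThan)
    let ?k = "card s - 1"
    have eq: "{..<card s} = {..?k}" using card_less_Suc[OF fs] s by simp
    have "card s < card {..n}" using s by (intro psubset_card_mono) auto
    moreover have "0 < card s" using s fs by (simp add: card_gt_0_iff)
    ultimately have "?k < n" by simp
    have h': "strict_mono_on {..?k} h" "h ` {..?k} = s"
      using h bij_betw_imp_surj_on[OF h(1)] by (simp_all add: eq)
    with L \<open>?k < n\<close> s have "(?k, face_restriction ?k h \<sigma>) \<in> K" by blast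
    then show "cell s \<sigma> \<in> K"
      using face_restriction_cell[OF h'(1), of \<sigma>] h'(2) by simp
  qed
next
  assume R: ?R
  show ?L
  proof (intro allI impI)
    fix k j assume k: "k < n" and j: "strict_mono_on {..k} j \<and> j ` {..k} \<subseteq> {..n}"
    have "card (j ` {..k}) = Suc k"
      using card_image[OF strict_mono_on_imp_inj_on[of "{..k}" j]] j by simp
    then have "j ` {..k} \<noteq> {..n}" using k by auto
    then show "(k, face_restriction k j \<sigma>) \<in> K"
      using R face_restriction_cell[of k j \<sigma>] j by (simp add: psubset_eq)
  qed
qed

section \<open>Triangulations of subspaces\<close>

lemma simplex_topology_eq: "simplex_topology n = top_of_set (standard_simplex n)"
  by (simp add: euclidean_product_topology)

lemma compact_simplex: "compact (standard_simplex n)"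
  using compactin_standard_simplex[of n] by (simp add: euclidean_product_topology)

lemma continuous_on_coord: "continuous_on S (\<lambda>t::nat \<Rightarrow> real. t i)"
  by (rule continuous_on_subset[OF continuous_on_product_coordinates]) simp

lemma continuous_on_push: "continuous_on S (push s)"
proof -
  have "continuous_on S (\<lambda>x. push s x i)" for i
    unfolding push_def by (cases "i \<in> s") (auto intro: continuous_on_coord)
  then show ?thesis by (rule continuous_on_coordinatewise_then_product)
qed

abbreviation tri :: "'a::topological_space set \<Rightarrow> 'a simplices \<Rightarrow> bool" where
  "tri S K \<equiv> is_triangulation (top_of_set S) K"

lemma tri_finite: "tri S K \<Longrightarrow> finite K"
  by (simp add: is_triangulation_def)

lemma tri_maps:
  assumes "tri S K" "(n, \<sigma>) \<in> K"
  shows "\<sigma> \<in> extensional (standard_simplex n)" "\<sigma> ` standard_simplex n \<subseteq> S"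
    "inj_on \<sigma> (open_simplex n)"
proof -
  have "\<sigma> \<in> standard_simplex n \<rightarrow>\<^sub>E S" "inj_on \<sigma> (open_simplex n)"
    using assms unfolding is_triangulation_def by auto
  then show "\<sigma> \<in> extensional (standard_simplex n)" "\<sigma> ` standard_simplex n \<subseteq> S"
    "inj_on \<sigma> (open_simplex n)" by (auto simp: PiE_def)
qed

lemma tri_cont:
  assumes "tri S K" "(n, \<sigma>) \<in> K"
  shows "continuous_on (standard_simplex n) \<sigma>"
proof -
  have top: "\<forall>A \<subseteq> S. openin (top_of_set S) A \<longleftrightarrow>
        (\<forall>(n, \<sigma>) \<in> K. openin (simplex_topology n) {t \<in> standard_simplex n. \<sigma> t \<in> A})"
    using assms unfolding is_triangulation_def by simp
  have "openin (top_of_set (standard_simplex n)) (standard_simplex n \<inter> \<sigma> -` B)"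
    if "openin (top_of_set S) B" for B
  proof -
    have "B \<subseteq> S" using that openin_imp_subset by blast
    then have "openin (simplex_topology n) {t \<in> standard_simplex n. \<sigma> t \<in> B}"
      using top that assms(2) by blast
    moreover have "{t \<in> standard_simplex n. \<sigma> t \<in> B} = standard_simplex n \<inter> \<sigma> -` B" by auto
    ultimately show ?thesis by (simp add: simplex_topology_eq)
  qed
  moreover have "\<sigma> \<in> standard_simplex n \<rightarrow> S" using tri_maps[OF assms] by auto
  ultimately show ?thesis using continuous_on_open_gen by blast
qed

lemma tri_ex1: "tri S K \<Longrightarrow> x \<in> S \<Longrightarrow> \<exists>!s. s \<in> K \<and> x \<in> snd s ` open_simplex (fst s)"
  by (simp add: is_triangulation_def)

lemma tri_point:
  assumes "tri S K" "x \<in> S"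
  obtains n \<sigma> t where "(n, \<sigma>) \<in> K" "t \<in> open_simplex n" "\<sigma> t = x"
  using tri_ex1[OF assms] by (metis imageE prod.collapse)

lemma tri_unique:
  assumes "tri S K" "(n, \<sigma>) \<in> K" "(m, \<tau>) \<in> K" "t \<in> open_simplex n" "t' \<in> open_simplex m" "\<sigma> t = \<tau> t'"
  shows "n = m" "\<sigma> = \<tau>" "t = t'"
proof -
  have "\<sigma> t \<in> S" using tri_maps(2)[OF assms(1,2)] assms(4) open_simplex_sub by blast
  from tri_ex1[OF assms(1) this] have "(n, \<sigma>) = (m, \<tau>)"
    using assms by (metis fst_conv image_eqI snd_conv)
  then show "n = m" "\<sigma> = \<tau>" by auto
  then show "t = t'" using tri_maps(3)[OF assms(1,2)] assms by (auto dest: inj_onD)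
qed

lemma tri_cell:
  assumes "tri S K" "(n, \<sigma>) \<in> K" "s \<subseteq> {..n}" "s \<noteq> {}"
  shows "cell s \<sigma> \<in> K"
proof (cases "s = {..n}")
  case True
  then show ?thesis using cell_full[OF tri_maps(1)[OF assms(1,2)]] assms(2) by simp
next
  case False
  have "\<forall>(n, \<sigma>) \<in> K. \<forall>k<n. \<forall>j. strict_mono_on {..k} j \<and> j ` {..k} \<subseteq> {..n} \<longrightarrow>
        (k, face_restriction k j \<sigma>) \<in> K"
    using assms(1) unfolding is_triangulation_def by (elim conjE)
  with assms(2) show ?thesis using face_closed_iff[of n \<sigma> K] assms(3,4) False by blast
qed

lemma tri_cell':
  "tri S K \<Longrightarrow> (n, \<sigma>) \<in> K \<Longrightarrow> s \<subseteq> {..n} \<Longrightarrow> s \<noteq> {} \<Longrightarrow> (card s - 1, snd (cell s \<sigma>)) \<in> K"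
  using tri_cell[of S K n \<sigma> s] by (simp add: cell_def)

text \<open>Condition (iii) is replaced by continuity of the maps: a Hausdorff space that is a union
  of finitely many compact images carries the quotient topology.\<close>

lemma triI:
  fixes S :: "'a::t2_space set"
  assumes fin: "finite K"
    and ext: "\<And>n \<sigma>. (n, \<sigma>) \<in> K \<Longrightarrow> \<sigma> \<in> extensional (standard_simplex n)"
    and sub: "\<And>n \<sigma>. (n, \<sigma>) \<in> K \<Longrightarrow> \<sigma> ` standard_simplex n \<subseteq> S"
    and cont: "\<And>n \<sigma>. (n, \<sigma>) \<in> K \<Longrightarrow> continuous_on (standard_simplex n) \<sigma>"
    and inj: "\<And>n \<sigma>. (n, \<sigma>) \<in> K \<Longrightarrow> inj_on \<sigma> (open_simplex n)"
    and cover: "\<And>x. x \<in> S \<Longrightarrow> \<exists>n \<sigma>. (n, \<sigma>) \<in> K \<and> x \<in> \<sigma> ` open_simplex n"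
    and uniq: "\<And>n \<sigma> m \<tau> t t'. (n, \<sigma>) \<in> K \<Longrightarrow> (m, \<tau>) \<in> K \<Longrightarrow> t \<in> open_simplex n \<Longrightarrow>
      t' \<in> open_simplex m \<Longrightarrow> \<sigma> t = \<tau> t' \<Longrightarrow> n = m \<and> \<sigma> = \<tau>"
    and face: "\<And>n \<sigma> s. (n, \<sigma>) \<in> K \<Longrightarrow> s \<subset> {..n} \<Longrightarrow> s \<noteq> {} \<Longrightarrow> cell s \<sigma> \<in> K"
  shows "tri S K"
proof -
  have ex1: "\<exists>!s. s \<in> K \<and> x \<in> snd s ` open_simplex (fst s)" if "x \<in> S" for x
  proof -
    from cover[OF that] obtain n \<sigma> where *: "(n, \<sigma>) \<in> K" "x \<in> \<sigma> ` open_simplex n" by blast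
    show ?thesis using *
      by (intro ex1I[of _ "(n, \<sigma>)"]) (auto dest: uniq)
  qed
  have top: "openin (top_of_set S) A \<longleftrightarrow>
        (\<forall>(n, \<sigma>) \<in> K. openin (simplex_topology n) {t \<in> standard_simplex n. \<sigma> t \<in> A})"
    if A: "A \<subseteq> S" for A
  proof
    assume o: "openin (top_of_set S) A"
    have "openin (simplex_topology n) {t \<in> standard_simplex n. \<sigma> t \<in> A}" if "(n, \<sigma>) \<in> K" for n \<sigma>
    proof -
      have "\<sigma> \<in> standard_simplex n \<rightarrow> S" using sub[OF that] by auto
      then have "openin (top_of_set (standard_simplex n)) (standard_simplex n \<inter> \<sigma> -` A)"
        using cont[OF that] o continuous_on_open_gen by blast
      moreover have "{t \<in> standard_simplex n. \<sigma> t \<in> A} = standard_simplex n \<inter> \<sigma> -` A" by auto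
      ultimately show ?thesis by (simp add: simplex_topology_eq)
    qed
    then show "\<forall>(n, \<sigma>) \<in> K. openin (simplex_topology n) {t \<in> standard_simplex n. \<sigma> t \<in> A}" by blast
  next
    assume R: "\<forall>(n, \<sigma>) \<in> K. openin (simplex_topology n) {t \<in> standard_simplex n. \<sigma> t \<in> A}"
    \<comment> \<open>This will be the complement of \<open>A\<close> in \<open>S\<close>; as a
      finite union of compact images it is closed.\<close>
    define B where "B = (\<Union>(n, \<sigma>)\<in>K. \<sigma> ` (standard_simplex n - {t \<in> standard_simplex n. \<sigma> t \<in> A}))"
    have "compact (\<sigma> ` (standard_simplex n - {t \<in> standard_simplex n. \<sigma> t \<in> A}))" if "(n, \<sigma>) \<in> K" for n \<sigma>
    proof (rule compact_continuous_image)
      show "continuous_on (standard_simplex n - {t \<in> standard_simplex n. \<sigma> t \<in> A}) \<sigma>"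
        using cont[OF that] continuous_on_subset by blast
      have "openin (top_of_set (standard_simplex n)) {t \<in> standard_simplex n. \<sigma> t \<in> A}"
        using R that by (auto simp: simplex_topology_eq)
      then have "closedin (top_of_set (standard_simplex n)) (standard_simplex n - {t \<in> standard_simplex n. \<sigma> t \<in> A})"
        by (metis closedin_diff closedin_topspace topspace_euclidean_subtopology)
      then show "compact (standard_simplex n - {t \<in> standard_simplex n. \<sigma> t \<in> A})"
        using compact_simplex closedin_compact by blast
    qed
    then have "closed B" unfolding B_def
      by (intro compact_imp_closed compact_UN fin) auto
    moreover have "A = S - B"
    proof -
      have "x \<in> B" if "x \<in> S" "x \<notin> A" for x
        using cover[OF that(1)] open_simplex_sub that(2) unfolding B_def by fastforce
      moreover have "x \<notin> A" if "x \<in> B" for x using that unfolding B_def by auto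
      ultimately show ?thesis using A by blast
    qed
    ultimately show "openin (top_of_set S) A"
      by (metis closed_closedin closedin_diff Diff_Diff_Int closed_def openin_open_Int inf_commute Diff_eq)
  qed
  have ext': "\<sigma> \<in> standard_simplex n \<rightarrow>\<^sub>E S" if "(n, \<sigma>) \<in> K" for n \<sigma>
    using ext[OF that] sub[OF that] by (auto simp: PiE_def)
  have f: "\<forall>k<n. \<forall>j. strict_mono_on {..k} j \<and> j ` {..k} \<subseteq> {..n} \<longrightarrow>
        (k, face_restriction k j \<sigma>) \<in> K" if "(n, \<sigma>) \<in> K" for n \<sigma>
    using face_closed_iff[of n \<sigma> K] face[OF that] by blast
  show ?thesis
    unfolding is_triangulation_def topspace_euclidean_subtopology
  proof (intro conjI)
    show "finite K" by (rule fin)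
    show "\<forall>(n, \<sigma>)\<in>K. \<sigma> \<in> standard_simplex n \<rightarrow>\<^sub>E S" using ext' by auto
    show "\<forall>(n, \<sigma>)\<in>K. inj_on \<sigma> (open_simplex n)" using inj by auto
    show "\<forall>x\<in>S. \<exists>!s. s \<in> K \<and> x \<in> snd s ` open_simplex (fst s)" using ex1 by (rule ballI)
    show "\<forall>(n, \<sigma>)\<in>K. \<forall>k<n. \<forall>j. strict_mono_on {..k} j \<and> j ` {..k} \<subseteq> {..n} \<longrightarrow>
        (k, face_restriction k j \<sigma>) \<in> K" using f by auto
    show "\<forall>A\<subseteq>S. openin (top_of_set S) A \<longleftrightarrow>
        (\<forall>(n, \<sigma>) \<in> K. openin (simplex_topology n) {t \<in> standard_simplex n. \<sigma> t \<in> A})"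
      using top by (intro allI impI)
  qed
qed

text \<open>The common point is an interior point of its smallest face in either simplex. Both faces
  belong to \<open>K\<close>, so uniqueness of the open simplex through a point identifies the faces
  and the coordinates. Closed simplices thus meet in common faces only.\<close>

lemma tri_coincidence:
  assumes K: "tri S K" and "(n, \<sigma>) \<in> K" "(m, \<tau>) \<in> K" "t \<in> standard_simplex n" "t' \<in> standard_simplex m"
    and eq: "\<sigma> t = \<tau> t'"
  shows "cell (supp t) \<sigma> = cell (supp t') \<tau>"
    "\<exists>x \<in> open_simplex (card (supp t) - 1). push (supp t) x = t \<and> push (supp t') x = t'"
    "card (supp t) = card (supp t')"
proof -
  let ?s = "supp t" and ?s' = "supp t'"
  note s = supp_sub[OF assms(4)] supp_ne[OF assms(4)]
  note s' = supp_sub[OF assms(5)] supp_ne[OF assms(5)]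
  obtain x where x: "x \<in> open_simplex (card ?s - 1)" "push ?s x = t"
    using push_image_open[OF s] assms(4) by force
  obtain x' where x': "x' \<in> open_simplex (card ?s' - 1)" "push ?s' x' = t'"
    using push_image_open[OF s'] assms(5) by force
  have e: "snd (cell ?s \<sigma>) x = snd (cell ?s' \<tau>) x'"
    using x x' eq open_simplex_sub by (metis snd_cell subsetD)
  note u = tri_unique[OF K tri_cell'[OF K assms(2) s] tri_cell'[OF K assms(3) s'] x(1) x'(1) e]
  have p: "0 < card ?s" "0 < card ?s'"
    using s s' supp_finite[OF assms(4)] supp_finite[OF assms(5)] by (simp_all add: card_gt_0_iff)
  show "cell ?s \<sigma> = cell ?s' \<tau>" using u(1,2) by (intro prod_eqI) simp_all
  show "card ?s = card ?s'" using u(1) p by linarith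
  show "\<exists>x \<in> open_simplex (card ?s - 1). push ?s x = t \<and> push ?s' x = t'"
    using x x' u(3) by blast
qed

section \<open>Exchanging the two sides of a tetrahedron\<close>

text \<open>On the facet where coordinate \<open>i\<close> vanishes this inverts
  \<open>push ({..n} - {i})\<close>.\<close>

definition omit :: "nat \<Rightarrow> (nat \<Rightarrow> real) \<Rightarrow> nat \<Rightarrow> real" where
  "omit i t = (\<lambda>m. if m < i then t m else t (Suc m))"

lemma vrank_omit:
  assumes "k \<le> n" "k \<noteq> i"
  shows "vrank ({..n} - {i}) k = (if k < i then k else k - 1)"
proof (cases "k < i")
  case True
  then have "{j \<in> {..n} - {i}. j < k} = {..<k}" using assms by auto
  then show ?thesis using True by (simp add: vrank_def)
next
  case False
  then have "{j \<in> {..n} - {i}. j < k} = {..<k} - {i}" using assms by auto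
  moreover have "i \<in> {..<k}" using False assms by simp
  ultimately show ?thesis using False by (simp add: vrank_def)
qed

lemma push_omit:
  assumes "t \<in> standard_simplex n" "t i = 0"
  shows "push ({..n} - {i}) (omit i t) = t"
proof
  fix k
  show "push ({..n} - {i}) (omit i t) k = t k"
    using vrank_omit[of k n i] assms simplex_beyond[OF assms(1), of k]
    by (cases "k \<le> n \<and> k \<noteq> i") (auto simp: push_def omit_def)
qed

lemma omit_push:
  assumes "x \<in> standard_simplex n" "i \<le> Suc n"
  shows "omit i (push ({..Suc n} - {i}) x) = x"
proof
  fix m
  have "m \<le> n \<or> x m = 0" using simplex_beyond[OF assms(1), of m] by linarith
  then show "omit i (push ({..Suc n} - {i}) x) m = x m"
    using assms(2) vrank_omit[of m "Suc n" i] vrank_omit[of "Suc m" "Suc n" i]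
    by (auto simp: push_def omit_def)
qed

lemma omit_simplex:
  assumes "t \<in> standard_simplex (Suc n)" "t i = 0" "i \<le> Suc n"
  shows "omit i t \<in> standard_simplex n"
proof -
  have "supp t \<subseteq> {..Suc n} - {i}" using supp_sub[OF assms(1)] assms(2) by (auto simp: supp_def)
  then obtain x where x: "x \<in> standard_simplex (card ({..Suc n} - {i}) - 1)" "push ({..Suc n} - {i}) x = t"
    using push_onto[OF assms(1)] by blast
  then have "x \<in> standard_simplex n" using assms(3) by simp
  then show ?thesis using omit_push[of x n i] assms(3) x(2) by auto
qed

lemma continuous_on_omit: "continuous_on S (omit i)"
proof -
  have "continuous_on S (\<lambda>x. omit i x m)" for m
    unfolding omit_def by (cases "m < i") (auto intro: continuous_on_coord)
  then show ?thesis by (rule continuous_on_coordinatewise_then_product)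
qed

text \<open>A simplicial identity: once \<open>i\<close> has been deleted, the larger index
  \<open>j\<close> has become \<open>j - 1\<close>.\<close>

lemma omit_omit:
  assumes "i < j"
  shows "omit (j - 1) (omit i t) = omit i (omit j t)"
  using assms by (auto simp: omit_def fun_eq_iff)

lemma continuous_on_Min_coord:
  fixes U :: "nat set"
  assumes "finite U" "U \<noteq> {}"
  shows "continuous_on S (\<lambda>t::nat \<Rightarrow> real. Min (t ` U))"
  using assms
proof (induction U rule: finite_ne_induct)
  case (singleton x)
  then show ?case by (simp add: continuous_on_coord)
next
  case (insert x F)
  have "continuous_on S (\<lambda>t. min (t x) (Min (t ` F)))"
    by (intro continuous_on_min continuous_on_coord insert.IH)
  then show ?case using insert by simp
qed

text \<open>
  The boundary of the tetrahedron is the union of an upper disc, consisting of the facets opposite to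
  the vertices in \<open>U\<close>, and a lower disc. Both are graphs over the same disc with respect to the
  direction from the barycenter of \<open>U\<close> to that of the remaining vertices \<open>L\<close>; \<open>drop\<close> is the
  projection onto the upper disc in this direction.
\<close>

definition low :: "nat set \<Rightarrow> (nat \<Rightarrow> real) \<Rightarrow> real" where
  "low U t = Min (t ` U)"

definition upper_of :: "nat set \<Rightarrow> (nat \<Rightarrow> real) set" where
  "upper_of U = {t \<in> standard_simplex 3. low U t = 0}"

lemma low_lower_bound: "finite U \<Longrightarrow> i \<in> U \<Longrightarrow> low U t \<le> t i"
  by (simp add: low_def)

lemma low_is_coord:
  assumes "finite U" "U \<noteq> {}" shows "\<exists>i\<in>U. t i = low U t"
proof -
  have "low U t \<in> t ` U" unfolding low_def by (rule Min_in) (use assms in auto)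
  then show ?thesis by (metis imageE)
qed

lemma low_simplex_bounds:
  assumes "finite U" "U \<noteq> {}" "t \<in> standard_simplex n" shows "0 \<le> low U t" "low U t \<le> 1"
  using low_is_coord[OF assms(1,2), of t] simplex_nonneg[OF assms(3)] simplex_le1[OF assms(3)] by metis+

lemma low_positive_iff:
  assumes "finite U" "U \<noteq> {}"
  shows "0 < low U t \<longleftrightarrow> U \<subseteq> supp t"
  using low_is_coord[OF assms, of t] low_lower_bound[OF assms(1), of _ t] by (fastforce simp: supp_def)

lemma upper_of_supp:
  assumes "finite U" "U \<noteq> {}"
  shows "t \<in> upper_of U \<longleftrightarrow> t \<in> standard_simplex 3 \<and> \<not> U \<subseteq> supp t"
  using low_positive_iff[OF assms, of t] low_simplex_bounds(1)[OF assms, of t] by (force simp: upper_of_def)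

lemma compact_upper_of:
  assumes "finite U" "U \<noteq> {}" shows "compact (upper_of U)"
proof -
  have "closedin (top_of_set (standard_simplex 3)) (standard_simplex 3 \<inter> low U -` {0})"
    unfolding low_def by (intro continuous_closedin_preimage continuous_on_Min_coord assms) auto
  moreover have "standard_simplex 3 \<inter> low U -` {0} = upper_of U" by (auto simp: upper_of_def)
  ultimately show ?thesis using compact_simplex closedin_compact by metis
qed

locale tetra_sides =
  fixes U L :: "nat set"
  assumes UL: "U \<union> L = {..3}" "U \<inter> L = {}" "U \<noteq> {}" "L \<noteq> {}"
begin

text \<open>Moving in the projection direction lowers every coordinate in \<open>U\<close> by the
  same amount and raises every coordinate in \<open>L\<close> by \<open>slope\<close> times this
  amount; the ratio is the one that keeps the sum of the coordinates equal to 1.\<close>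

definition slope :: real where "slope = real (card U) / real (card L)"

abbreviation upper :: "(nat \<Rightarrow> real) set" where
  "upper \<equiv> upper_of U"

lemmas upper_def = upper_of_def[of U]

definition drop :: "(nat \<Rightarrow> real) \<Rightarrow> nat \<Rightarrow> real" where
  "drop t = (\<lambda>i. if i \<in> U then t i - low U t else if i \<in> L then t i + slope * low U t else 0)"

lemma fin: "finite U" "finite L"
  using UL(1) by (metis finite_Un finite_atMost)+

lemma beyond: "3 < i \<Longrightarrow> i \<notin> U \<and> i \<notin> L"
  using UL(1) by (metis Un_iff atMost_iff not_le)

lemma card_pos: "0 < real (card U)" "0 < real (card L)"
  using fin UL by (simp_all add: card_gt_0_iff)

lemma slope_pos: "0 < slope"
  using card_pos by (simp add: slope_def)

lemma slope_card: "real (card L) * slope = real (card U)"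
  using card_pos by (simp add: slope_def)

lemma sum_UL: "(\<Sum>i\<le>3. f i) = (\<Sum>i\<in>U. f i) + (\<Sum>i\<in>L. f i)" for f :: "nat \<Rightarrow> real"
  using sum.union_disjoint[OF fin UL(2), of f] UL(1) by simp

lemmas low_le = low_lower_bound[OF fin(1)] low_lower_bound[OF fin(2)]

lemmas low_attained = low_is_coord[OF fin(1) UL(3)] low_is_coord[OF fin(2) UL(4)]

lemmas low_nonneg = low_simplex_bounds(1)[OF fin(1) UL(3)] low_simplex_bounds(1)[OF fin(2) UL(4)]

lemmas low_le1 = low_simplex_bounds(2)[OF fin(1) UL(3)] low_simplex_bounds(2)[OF fin(2) UL(4)]

lemmas low_pos_iff = low_positive_iff[OF fin(1) UL(3)] low_positive_iff[OF fin(2) UL(4)]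

lemma low_zero_iff:
  assumes "t \<in> standard_simplex 3"
  shows "low U t = 0 \<longleftrightarrow> \<not> U \<subseteq> supp t" "low L t = 0 \<longleftrightarrow> \<not> L \<subseteq> supp t"
  using low_pos_iff[of t] low_nonneg[OF assms] by linarith+

lemma drop_L: "i \<in> L \<Longrightarrow> drop t i = t i + slope * low U t"
  using UL(2) by (auto simp: drop_def)

lemma drop_U: "i \<in> U \<Longrightarrow> drop t i = t i - low U t"
  by (auto simp: drop_def)

lemma drop_simplex:
  assumes t: "t \<in> standard_simplex 3" shows "drop t \<in> standard_simplex 3"
proof (rule in_simplexI)
  have "(\<Sum>i\<le>3. drop t i) = (\<Sum>i\<in>U. t i - low U t) + (\<Sum>i\<in>L. t i + slope * low U t)"
    unfolding sum_UL using drop_U drop_L by (simp cong: sum.cong)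
  also have "\<dots> = (\<Sum>i\<le>3. t i) + (real (card L) * slope - real (card U)) * low U t"
    unfolding sum_UL by (simp add: sum_subtractf sum.distrib algebra_simps)
  finally show "(\<Sum>i\<le>3. drop t i) = 1" using simplex_sum[OF t] slope_card by simp
  show "0 \<le> drop t i" for i
    using low_le(1)[of i t] low_nonneg[OF t] simplex_nonneg[OF t, of i] slope_pos by (auto simp: drop_def)
  show "drop t i = 0" if "3 < i" for i
    using beyond[OF that] by (auto simp: drop_def)
qed

lemma low_U_drop: "low U (drop t) = 0"
proof -
  obtain i where i: "i \<in> U" "t i = low U t" using low_attained by blast
  obtain j where j: "j \<in> U" "drop t j = low U (drop t)" using low_attained by blast
  have "drop t i = 0" using drop_U i by simp
  then have "low U (drop t) \<le> 0" using low_le(1)[OF i(1), of "drop t"] by simp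
  moreover have "0 \<le> drop t j" using drop_U[OF j(1)] low_le(1)[OF j(1), of t] by simp
  ultimately show ?thesis using j by simp
qed

lemma low_L_drop: "low L (drop t) = low L t + slope * low U t"
proof -
  obtain i where i: "i \<in> L" "t i = low L t" using low_attained by blast
  obtain j where j: "j \<in> L" "drop t j = low L (drop t)" using low_attained by blast
  show ?thesis
    using low_le(2)[OF i(1), of "drop t"] low_le(2)[OF j(1), of t] drop_L[OF i(1)] drop_L[OF j(1)] i j by simp
qed

lemma drop_upper: "t \<in> standard_simplex 3 \<Longrightarrow> drop t \<in> upper"
  by (simp add: upper_def drop_simplex low_U_drop)

lemma drop_id: "t \<in> upper \<Longrightarrow> drop t = t"
  using UL(1) simplex_beyond[of t 3]
  by (auto simp: drop_def upper_def fun_eq_iff)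

text \<open>\<open>drop t\<close> names the fiber of \<open>t\<close>, and \<open>low U t\<close> is
  the height of \<open>t\<close> in this fiber over the upper disc; together they are coordinates on
  the tetrahedron.\<close>

lemma drop_inj:
  assumes "t \<in> standard_simplex 3" "t' \<in> standard_simplex 3" "drop t = drop t'" "low U t = low U t'"
  shows "t = t'"
proof
  fix i
  consider "i \<in> U" | "i \<in> L" | "3 < i" using UL(1) by (metis Un_iff atMost_iff not_le)
  then show "t i = t' i"
  proof cases
    case 3
    then show ?thesis using simplex_beyond assms by metis
  qed (use fun_cong[OF assms(3), of i] drop_U drop_L assms(4) in auto)
qed

text \<open>The fiber over \<open>y\<close> is a segment of heights from 0 to
  \<open>low L y / slope\<close>. At the far end the smallest coordinate in \<open>L\<close> has
  dropped to 0, so this end lies in the lower disc.\<close>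

lemma drop_onto:
  assumes y: "y \<in> upper" "0 \<le> \<mu>" "slope * \<mu> \<le> low L y"
  shows "\<exists>t\<in>standard_simplex 3. drop t = y \<and> low U t = \<mu>"
proof -
  define t where "t = (\<lambda>i. if i \<in> U then y i + \<mu> else if i \<in> L then y i - slope * \<mu> else 0)"
  have y3: "y \<in> standard_simplex 3" and yU: "low U y = 0" using y(1) by (auto simp: upper_def)
  have tL: "t i = y i - slope * \<mu>" if "i \<in> L" for i using that UL(2) by (auto simp: t_def)
  have tU: "t i = y i + \<mu>" if "i \<in> U" for i using that by (auto simp: t_def)
  have low: "low U t = \<mu>"
  proof -
    obtain i where i: "i \<in> U" "y i = low U y" using low_attained by blast
    obtain j where j: "j \<in> U" "t j = low U t" using low_attained by blast
    show ?thesis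
      using low_le(1)[OF i(1), of t] low_le(1)[OF j(1), of y] tU[OF i(1)] tU[OF j(1)] i j yU by simp
  qed
  have "t \<in> standard_simplex 3"
  proof (rule in_simplexI)
    have "(\<Sum>i\<le>3. t i) = (\<Sum>i\<in>U. y i + \<mu>) + (\<Sum>i\<in>L. y i - slope * \<mu>)"
      unfolding sum_UL using tU tL by (simp cong: sum.cong)
    also have "\<dots> = (\<Sum>i\<le>3. y i) + (real (card U) - real (card L) * slope) * \<mu>"
      unfolding sum_UL by (simp add: sum_subtractf sum.distrib algebra_simps)
    finally show "(\<Sum>i\<le>3. t i) = 1" using simplex_sum[OF y3] slope_card by simp
    show "0 \<le> t i" for i
      using low_le(2)[of i y] simplex_nonneg[OF y3, of i] y(2,3) by (auto simp: t_def)
    show "t i = 0" if "3 < i" for i using beyond[OF that] by (auto simp: t_def)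
  qed
  moreover have "drop t = y"
  proof
    fix i
    consider "i \<in> U" | "i \<in> L" | "3 < i" using UL(1) by (metis Un_iff atMost_iff not_le)
    then show "drop t i = y i"
    proof cases
      case 3
      then show ?thesis using simplex_beyond[OF y3] beyond by (auto simp: drop_def)
    qed (use drop_U drop_L tU tL low in auto)
  qed
  ultimately show ?thesis using low by blast
qed

lemma continuous_on_low: "continuous_on S (low U)" "continuous_on S (low L)"
  unfolding low_def using continuous_on_Min_coord fin UL by blast+

lemma continuous_on_drop: "continuous_on S drop"
proof -
  have "continuous_on S (\<lambda>t. drop t i)" for i
    unfolding drop_def
    by (cases "i \<in> U"; cases "i \<in> L") (auto intro!: continuous_intros continuous_on_coord continuous_on_low)
  then show ?thesis by (rule continuous_on_coordinatewise_then_product)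
qed

lemmas compact_upper = compact_upper_of[OF fin(1) UL(3)]

end

text \<open>Triangles of \<open>T\<close> that are to become facets of one tetrahedron,
  \<open>A i\<close> opposite to vertex \<open>i\<close>. The vertices of \<open>A i\<close> are
  numbered with \<open>i\<close> left out, so a vertex \<open>k > i\<close> of the tetrahedron has
  number \<open>k - 1\<close> there; this is the origin of \<open>j - 1\<close> in
  \<open>glued\<close> and of the case distinction in \<open>corner\<close>. Since there are at
  least two facets, every vertex lies on one of them.\<close>

locale facet_family =
  fixes U :: "nat set" and T :: "('a::euclidean_space) simplices" and A :: "nat \<Rightarrow> (nat \<Rightarrow> real) \<Rightarrow> 'a"
    and p :: "nat \<Rightarrow> 'a"
  assumes T: "tri (sphere 0 1) T"
    and U_sub: "U \<subseteq> {..3}"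
    and two: "2 \<le> card U"
    and facet: "i \<in> U \<Longrightarrow> (2, A i) \<in> T"
    and glued: "i \<in> U \<Longrightarrow> j \<in> U \<Longrightarrow> i < j \<Longrightarrow> cell ({..2} - {j - 1}) (A i) = cell ({..2} - {i}) (A j)"
    and corner: "i \<in> U \<Longrightarrow> k \<le> 3 \<Longrightarrow> k \<noteq> i \<Longrightarrow> A i (simplex_vertex (if k < i then k else k - 1)) = p k"
    and p_inj: "inj_on p {..3}"
begin

lemma finU: "finite U"
  using U_sub finite_subset by blast

lemma neU: "U \<noteq> {}"
  using two by auto

text \<open>The union of the facet maps. On a point of several facets any choice gives the same
  value, by \<open>facets_agree\<close>.\<close>

definition g :: "(nat \<Rightarrow> real) \<Rightarrow> 'a" where
  "g t = (let i = (SOME i. i \<in> U \<and> t i = 0) in A i (omit i t))"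

lemma U3: "i \<in> U \<Longrightarrow> i \<le> 3"
  using U_sub by blast

text \<open>A point of both facets lies on their common edge, where the restrictions coincide by
  \<open>glued\<close>; deleting the two coordinates in either order gives the same parameter on
  that edge.\<close>

lemma facets_agree:
  assumes t: "t \<in> standard_simplex 3" and i: "i \<in> U" "t i = 0" and j: "j \<in> U" "t j = 0" and ij: "i < j"
  shows "A i (omit i t) = A j (omit j t)"
proof -
  define y where "y = omit i (omit j t)"
  have j3: "j \<le> Suc 2" "i \<le> Suc 2" using U3 i(1) j(1) by force+
  have t': "t \<in> standard_simplex (Suc 2)" using t by (simp add: numeral_3_eq_3 numeral_2_eq_2)
  have oi: "omit i t \<in> standard_simplex 2" and oj: "omit j t \<in> standard_simplex 2"
    using omit_simplex[OF t'] i j j3 by auto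
  have z: "omit i t (j - 1) = 0" "omit j t i = 0" using i j ij by (auto simp: omit_def)
  have p1: "push ({..2} - {j - 1}) y = omit i t"
    using push_omit[OF oi z(1)] omit_omit[OF ij, of t] by (simp add: y_def)
  have p2: "push ({..2} - {i}) y = omit j t"
    using push_omit[OF oj z(2)] by (simp add: y_def)
  have y1: "y \<in> standard_simplex 1"
    using omit_simplex[of "omit j t" 1 i] oj z(2) ij j3 by (simp add: y_def numeral_2_eq_2)
  have c: "card ({..2} - {j - 1}) - 1 = 1" "card ({..2} - {i}) - 1 = 1" using ij j3 by auto
  have "snd (cell ({..2} - {j - 1}) (A i)) y = snd (cell ({..2} - {i}) (A j)) y"
    using glued[OF i(1) j(1) ij] by simp
  then show ?thesis using y1 c p1 p2 by (simp add: cell_def)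
qed

lemma g_eq:
  assumes t: "t \<in> standard_simplex 3" and i: "i \<in> U" "t i = 0"
  shows "g t = A i (omit i t)"
proof -
  define j where "j = (SOME i. i \<in> U \<and> t i = 0)"
  have j: "j \<in> U \<and> t j = 0" unfolding j_def by (rule someI[of _ i]) (use i in auto)
  have "g t = A j (omit j t)" by (simp add: g_def j_def Let_def)
  then show ?thesis using facets_agree[OF t i, of j] facets_agree[OF t _ _ i, of j] j
    by (metis linorder_neqE_nat)
qed

lemma upper_alt: "upper_of U = (\<Union>i\<in>U. {t \<in> standard_simplex 3. t i = 0})"
proof -
  have "low U t = 0 \<longleftrightarrow> (\<exists>i\<in>U. t i = 0)" if "t \<in> standard_simplex 3" for t
    using low_is_coord[OF finU neU, of t] low_lower_bound[OF finU, of _ t] low_simplex_bounds(1)[OF finU neU that] by force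
  then show ?thesis by (auto simp: upper_of_def)
qed

lemma continuous_on_g: "continuous_on (upper_of U) g"
  unfolding upper_alt
proof (rule continuous_on_closed_Union[OF finU])
  fix i assume i: "i \<in> U"
  let ?F = "{t \<in> standard_simplex 3. t i = 0}"
  have "closedin (top_of_set (standard_simplex 3)) (standard_simplex 3 \<inter> (\<lambda>t. t i) -` {0})"
    by (intro continuous_closedin_preimage continuous_on_coord) auto
  moreover have "standard_simplex 3 \<inter> (\<lambda>t. t i) -` {0} = ?F" by auto
  ultimately show "closed ?F" using compact_simplex closedin_compact compact_imp_closed by metis
  have "omit i t \<in> standard_simplex 2" if "t \<in> ?F" for t
    using omit_simplex[of t 2 i] that U3[OF i] by (simp add: numeral_3_eq_3 numeral_2_eq_2)
  then have "continuous_on ?F (\<lambda>t. A i (omit i t))"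
    using continuous_on_compose2[OF tri_cont[OF T facet[OF i]] continuous_on_omit] by blast
  then show "continuous_on ?F g"
    by (rule continuous_on_eq) (use g_eq i in auto)
qed

lemma cell_facet:
  assumes i: "i \<in> U"
  shows "cell ({..3} - {i}) g = (2, A i)"
proof -
  have i3: "i \<le> Suc 2" using U3[OF i] by simp
  have c: "card ({..3} - {i}) - 1 = 2" using U3[OF i] by simp
  then have ne: "{..3} - {i} \<noteq> {}" by (intro notI) simp
  have "g (push ({..3} - {i}) x) = A i x" if x: "x \<in> standard_simplex 2" for x
  proof -
    let ?t = "push ({..3} - {i}) x"
    have "?t \<in> standard_simplex 3"
      using push_simplex[of "{..3} - {i}" 3 x] c x ne by simp
    moreover have "?t i = 0" by (simp add: push_def)
    ultimately have "g ?t = A i (omit i ?t)" using g_eq i by blast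
    also have "omit i ?t = x" using omit_push[OF x i3] by (simp add: numeral_3_eq_3 numeral_2_eq_2)
    finally show ?thesis .
  qed
  then have "restrict (g \<circ> push ({..3} - {i})) (standard_simplex 2) = A i"
    using tri_maps(1)[OF T facet[OF i]] by (auto simp: restrict_def extensional_def fun_eq_iff)
  then show ?thesis using c by (simp add: cell_def)
qed

lemma cell_upper_in_T:
  assumes s: "s \<subseteq> {..3}" "s \<noteq> {}" "\<not> U \<subseteq> s"
  shows "cell s g \<in> T"
proof -
  obtain i where i: "i \<in> U" "i \<notin> s" using s by blast
  have sub: "s \<subseteq> {..3} - {i}" using s i by blast
  have "cell s g = cell (vrank ({..3} - {i}) ` s) (A i)"
    using cell_cell[OF _ sub s(2), of g] cell_facet[OF i(1)] by simp
  moreover have "vrank ({..3} - {i}) ` s \<subseteq> {..2}"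
    using rank_image_sub[OF _ _ sub] s(2) sub U3[OF i(1)] by force
  ultimately show ?thesis using tri_cell[OF T facet[OF i(1)]] s(2) by simp
qed

lemma g_vertex: "k \<le> 3 \<Longrightarrow> g (simplex_vertex k) = p k"
proof -
  assume k: "k \<le> 3"
  have "\<not> U \<subseteq> {k}" using two card_mono[of "{k}" U] by auto
  then obtain i where i: "i \<in> U" "i \<noteq> k" by blast
  have v: "simplex_vertex k \<in> standard_simplex 3" "simplex_vertex k i = 0"
    using k i by (auto simp: vertex_simplex simplex_vertex_def)
  have "omit i (simplex_vertex k) = simplex_vertex (if k < i then k else k - 1)"
    using i(2) by (auto simp: omit_def simplex_vertex_def fun_eq_iff)
  then show ?thesis using g_eq[OF v(1) i(1) v(2)] corner[OF i(1) k] i(2) by simp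
qed

text \<open>The corners of a cell recover its vertex set because \<open>p\<close> is injective. This
  is what makes \<open>g\<close> injective across different facets.\<close>

lemma cell_g_inj:
  assumes s: "s \<subseteq> {..3}" "s \<noteq> {}" and r: "r \<subseteq> {..3}" "r \<noteq> {}" and eq: "cell s g = cell r g"
  shows "s = r"
proof -
  have f: "finite s" "finite r" using s r finite_subset by blast+
  have "(\<lambda>i. g (simplex_vertex i)) ` s = (\<lambda>i. g (simplex_vertex i)) ` r"
    using cell_vertices[OF f(1) s(2), of g] cell_vertices[OF f(2) r(2), of g] eq
    by (metis fst_cell)
  moreover have "(\<lambda>i. g (simplex_vertex i)) ` s = p ` s" "(\<lambda>i. g (simplex_vertex i)) ` r = p ` r"
    using g_vertex s r by (auto intro!: image_cong)
  ultimately show ?thesis using inj_on_image_eq_iff[OF p_inj s(1) r(1)] by simp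
qed

lemmas upper_supp = upper_of_supp[OF finU neU]

lemma upper_sub: "upper_of U \<subseteq> standard_simplex 3"
  by (auto simp: upper_of_def)

lemma open_cell:
  assumes "t \<in> standard_simplex n"
  obtains x where "x \<in> open_simplex (card (supp t) - 1)" "push (supp t) x = t" "\<And>f. snd (cell (supp t) f) x = f t"
proof -
  obtain x where x: "x \<in> open_simplex (card (supp t) - 1)" "push (supp t) x = t"
    using push_image_open[OF supp_sub supp_ne] assms by force
  moreover have "snd (cell (supp t) f) x = f t" for f
    using snd_cell[of x "supp t" f] x open_simplex_sub by auto
  ultimately show ?thesis using that by blast
qed

lemma cell_g_in_T':
  assumes "t \<in> upper_of U" shows "(card (supp t) - 1, snd (cell (supp t) g)) \<in> T"
  using cell_upper_in_T[of "supp t"] assms supp_sub supp_ne unfolding upper_supp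
  by (metis fst_cell prod.collapse)

lemma g_inj: "inj_on g (upper_of U)"
proof
  fix t t' assume t: "t \<in> upper_of U" and t': "t' \<in> upper_of U" and eq: "g t = g t'"
  have ts: "t \<in> standard_simplex 3" "t' \<in> standard_simplex 3" using t t' upper_sub by auto
  obtain x where x: "x \<in> open_simplex (card (supp t) - 1)" "push (supp t) x = t" "snd (cell (supp t) g) x = g t"
    using open_cell[OF ts(1)] by metis
  obtain x' where x': "x' \<in> open_simplex (card (supp t') - 1)" "push (supp t') x' = t'" "snd (cell (supp t') g) x' = g t'"
    using open_cell[OF ts(2)] by metis
  have e: "snd (cell (supp t) g) x = snd (cell (supp t') g) x'" using x x' eq by simp
  note u = tri_unique[OF T cell_g_in_T'[OF t] cell_g_in_T'[OF t'] x(1) x'(1) e]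
  have "cell (supp t) g = cell (supp t') g" using u(1,2) by (intro prod_eqI) simp_all
  then have st: "supp t = supp t'"
    by (rule cell_g_inj[OF supp_sub[OF ts(1)] supp_ne[OF ts(1)] supp_sub[OF ts(2)] supp_ne[OF ts(2)]])
  show "t = t'" by (metis st u(3) x(2) x'(2))
qed

lemma g_sphere: "t \<in> upper_of U \<Longrightarrow> g t \<in> sphere 0 1"
proof -
  assume t: "t \<in> upper_of U"
  then obtain x where "x \<in> open_simplex (card (supp t) - 1)" "snd (cell (supp t) g) x = g t"
    using open_cell[of t 3] upper_sub by (metis subsetD)
  then show ?thesis using tri_maps(2)[OF T cell_g_in_T'[OF t]] open_simplex_sub by (metis image_subset_iff subsetD)
qed

end

section \<open>Replacing the upper disc of a tetrahedron in the sphere by the lower disc\<close>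

locale disc_pair = tetra_sides U L + facet_family U T A p
  for U L :: "nat set" and T :: "('a::euclidean_space) simplices" and A p
begin

text \<open>A face lies in the upper disc when it omits a vertex of \<open>U\<close>, and on the
  common boundary circle of the two discs when it also omits a vertex of \<open>L\<close>. These are
  therefore the cells in the interior of the upper disc; \<open>lower_cells\<close> is the
  counterpart.\<close>

definition upper_cells :: "'a simplices" where
  "upper_cells = {cell s g |s. s \<subseteq> {..3} \<and> L \<subseteq> s \<and> \<not> U \<subseteq> s}"

definition upper_int :: "(nat \<Rightarrow> real) set" where
  "upper_int = {t \<in> upper. 0 < low L t}"

text \<open>Extends \<open>g\<close> to the whole tetrahedron along the projection. On the lower
  disc it parametrizes the same disc of the sphere, and it agrees with \<open>g\<close> on the
  boundary circle.\<close>

definition G :: "(nat \<Rightarrow> real) \<Rightarrow> 'a" where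
  "G t = g (drop t)"

lemma G_upper: "t \<in> upper \<Longrightarrow> G t = g t"
  by (simp add: G_def drop_id)

lemma continuous_on_G: "continuous_on (standard_simplex 3) G"
  unfolding G_def using continuous_on_compose2[OF continuous_on_g continuous_on_drop] drop_upper by blast

lemma G_sphere: "t \<in> standard_simplex 3 \<Longrightarrow> G t \<in> sphere 0 1"
  unfolding G_def using g_sphere drop_upper by blast

definition lower_cells :: "'a simplices" where
  "lower_cells = {cell s G |s. s \<subseteq> {..3} \<and> U \<subseteq> s \<and> \<not> L \<subseteq> s}"

definition switched :: "'a simplices" where
  "switched = (T - upper_cells) \<union> lower_cells"

end

text \<open>\<open>star\<close> expresses that the interior of the upper disc is open in the sphere:
  no simplex of \<open>T\<close> from outside has an interior cell as a face.\<close>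

locale disc_switch = disc_pair +
  assumes star: "(n, \<sigma>) \<in> T \<Longrightarrow> s \<subseteq> {..n} \<Longrightarrow> s \<noteq> {} \<Longrightarrow> cell s \<sigma> \<in> upper_cells \<Longrightarrow> (n, \<sigma>) \<in> upper_cells"
begin

definition Q_int :: "'a set" where "Q_int = g ` upper_int"

lemma upper_int_supp: "t \<in> upper_int \<longleftrightarrow> t \<in> standard_simplex 3 \<and> \<not> U \<subseteq> supp t \<and> L \<subseteq> supp t"
  using low_pos_iff(2) by (auto simp: upper_int_def upper_supp)

lemma upper_int_upper: "t \<in> upper_int \<Longrightarrow> t \<in> upper"
  by (simp add: upper_int_def)

lemma upper_cell_open:
  assumes "t \<in> upper_int"
  shows "cell (supp t) g \<in> upper_cells"
  using assms supp_sub unfolding upper_int_supp upper_cells_def by blast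

lemma upper_cells_open_image:
  assumes "(n, \<sigma>) \<in> upper_cells" "t \<in> open_simplex n"
  shows "\<sigma> t \<in> Q_int"
proof -
  obtain s where s: "(n, \<sigma>) = cell s g" "s \<subseteq> {..3}" "L \<subseteq> s" "\<not> U \<subseteq> s"
    using assms unfolding upper_cells_def by blast
  have ne: "s \<noteq> {}" using s UL by blast
  have n: "n = card s - 1" using s(1) by (simp add: cell_def)
  have "\<sigma> t \<in> g ` {t \<in> standard_simplex 3. supp t = s}"
    using cell_image_open[OF s(2) ne, of g] s(1) assms(2) n by (metis image_eqI snd_conv)
  then obtain t' where "t' \<in> standard_simplex 3" "supp t' = s" "\<sigma> t = g t'" by blast
  moreover from this have "t' \<in> upper_int" using s(3,4) by (simp add: upper_int_supp)
  ultimately show ?thesis by (simp add: Q_int_def)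
qed

text \<open>By uniqueness, a point shared by a kept simplex and the interior would make an interior
  cell a face of the kept simplex, against \<open>star\<close>.\<close>

lemma kept_not_int:
  assumes K: "(n, \<sigma>) \<in> T - upper_cells" and t: "t \<in> standard_simplex n"
  shows "\<sigma> t \<notin> Q_int"
proof
  assume "\<sigma> t \<in> Q_int"
  then obtain t' where t': "t' \<in> upper_int" "\<sigma> t = g t'" by (auto simp: Q_int_def)
  have t3: "t' \<in> standard_simplex 3" using t'(1) by (simp add: upper_int_supp)
  obtain x where x: "x \<in> open_simplex (card (supp t) - 1)" "snd (cell (supp t) \<sigma>) x = \<sigma> t"
    using open_cell[OF t] by metis
  obtain x' where x': "x' \<in> open_simplex (card (supp t') - 1)" "snd (cell (supp t') g) x' = g t'"
    using open_cell[OF t3] by metis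
  have cT: "(card (supp t) - 1, snd (cell (supp t) \<sigma>)) \<in> T"
    using tri_cell'[OF T _ supp_sub[OF t] supp_ne[OF t]] K by blast
  have e: "snd (cell (supp t) \<sigma>) x = snd (cell (supp t') g) x'" using x x' t' by simp
  note u = tri_unique[OF T cT cell_g_in_T'[OF upper_int_upper[OF t'(1)]] x(1) x'(1) e]
  have "cell (supp t) \<sigma> = cell (supp t') g" using u(1,2) by (intro prod_eqI) simp_all
  then have "cell (supp t) \<sigma> \<in> upper_cells" using upper_cell_open[OF t'(1)] by simp
  then have "(n, \<sigma>) \<in> upper_cells" using star[OF _ supp_sub[OF t] supp_ne[OF t]] K by blast
  then show False using K by blast
qed

definition lower_int :: "(nat \<Rightarrow> real) set" where
  "lower_int = {t \<in> standard_simplex 3. low L t = 0 \<and> 0 < low U t}"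

lemma lower_int_supp: "t \<in> lower_int \<longleftrightarrow> t \<in> standard_simplex 3 \<and> U \<subseteq> supp t \<and> \<not> L \<subseteq> supp t"
  using low_pos_iff(1) low_zero_iff(2) by (auto simp: lower_int_def)

lemma G_lower_int: "t \<in> lower_int \<Longrightarrow> G t \<in> Q_int"
  using drop_upper[of t] low_L_drop[of t] slope_pos
  by (auto simp: lower_int_def Q_int_def G_def upper_int_def)

lemma G_lower_onto:
  assumes "x \<in> Q_int" obtains t where "t \<in> lower_int" "G t = x"
proof -
  obtain y where y: "y \<in> upper" "0 < low L y" "g y = x" using assms by (auto simp: Q_int_def upper_int_def)
  \<comment> \<open>This is the height at which the fiber over \<open>y\<close> reaches the lower
    disc.\<close>
  have "0 \<le> low L y / slope" "slope * (low L y / slope) \<le> low L y" using y slope_pos by auto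
  from drop_onto[OF y(1) this] obtain t where t: "t \<in> standard_simplex 3" "drop t = y" "low U t = low L y / slope"
    by blast
  have "low L t = 0" using low_L_drop[of t] t slope_pos by simp
  then have "t \<in> lower_int" using t y slope_pos by (simp add: lower_int_def)
  moreover have "G t = x" using t y by (simp add: G_def)
  ultimately show ?thesis using that by blast
qed

lemma G_lower_inj:
  assumes "t \<in> lower_int" "t' \<in> lower_int" "G t = G t'" shows "t = t'"
proof -
  have s: "t \<in> standard_simplex 3" "t' \<in> standard_simplex 3" using assms by (auto simp: lower_int_def)
  have d: "drop t = drop t'" using assms(3) g_inj drop_upper s by (auto simp: G_def inj_on_def)
  moreover have "low L t = 0" "low L t' = 0" using assms(1,2) by (simp_all add: lower_int_def)
  ultimately have "slope * low U t = slope * low U t'"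
    by (metis low_L_drop add_0)
  then have "low U t = low U t'" using slope_pos by simp
  then show ?thesis by (rule drop_inj[OF s d])
qed

lemma G_boundary:
  assumes "s \<subseteq> {..3}" "s \<noteq> {}" "\<not> U \<subseteq> s"
  shows "cell s G = cell s g"
proof (rule cell_cong[OF assms(1,2)])
  fix t assume "t \<in> standard_simplex 3" "supp t \<subseteq> s"
  then have "t \<in> upper" using assms(3) by (auto simp: upper_supp)
  then show "G t = g t" by (rule G_upper)
qed

lemma lower_cellE:
  assumes "(n, \<sigma>) \<in> lower_cells"
  obtains s where "(n, \<sigma>) = cell s G" "s \<subseteq> {..3}" "U \<subseteq> s" "\<not> L \<subseteq> s" "s \<noteq> {}" "n = card s - 1" "finite s"
proof -
  obtain s where s: "(n, \<sigma>) = cell s G" "s \<subseteq> {..3}" "U \<subseteq> s" "\<not> L \<subseteq> s"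
    using assms unfolding lower_cells_def by blast
  moreover have "s \<noteq> {}" using s UL by blast
  moreover have "n = card s - 1" using s(1) by (simp add: cell_def)
  moreover have "finite s" using s(2) finite_subset by blast
  ultimately show ?thesis using that by blast
qed

lemma lower_cell_point:
  assumes "(n, \<sigma>) = cell s G" "s \<subseteq> {..3}" "U \<subseteq> s" "\<not> L \<subseteq> s" "s \<noteq> {}" "x \<in> open_simplex n"
  shows "push s x \<in> lower_int" "supp (push s x) = s" "\<sigma> x = G (push s x)"
proof -
  have n: "n = card s - 1" and \<sigma>: "\<sigma> = snd (cell s G)" using assms(1) by (simp_all add: cell_def)
  have x: "x \<in> standard_simplex (card s - 1)" using assms(6) n open_simplex_sub by blast
  show sp: "supp (push s x) = s" using push_open[OF assms(2,5) x] assms(6) n by blast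
  show "push s x \<in> lower_int" unfolding lower_int_supp
    using push_simplex[OF assms(2,5) x] sp assms(3,4) by simp
  show "\<sigma> x = G (push s x)" using snd_cell[OF x, of G] \<sigma> by simp
qed

lemma continuous_on_cell:
  assumes "s \<subseteq> {..n}" "s \<noteq> {}" "continuous_on (standard_simplex n) f"
  shows "continuous_on (standard_simplex (card s - 1)) (snd (cell s f))"
proof -
  have "continuous_on (standard_simplex (card s - 1)) (\<lambda>x. f (push s x))"
    using continuous_on_compose2[OF assms(3) continuous_on_push] push_simplex[OF assms(1,2)] by blast
  then show ?thesis by (rule continuous_on_eq) (simp add: snd_cell)
qed

lemma boundary_cell_switched:
  assumes "s \<subseteq> {..3}" "s \<noteq> {}" "\<not> U \<subseteq> s" "\<not> L \<subseteq> s"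
  shows "cell s g \<in> T - upper_cells"
proof -
  have "cell s g \<noteq> cell r g" if r: "r \<subseteq> {..3}" "L \<subseteq> r" for r
  proof
    assume e: "cell s g = cell r g"
    have "r \<noteq> {}" using r UL by blast
    from cell_g_inj[OF assms(1,2) r(1) this e] show False using r assms by blast
  qed
  then have "cell s g \<notin> upper_cells" unfolding upper_cells_def by blast
  then show ?thesis using cell_upper_in_T[OF assms(1-3)] by blast
qed

lemma switched_cell:
  assumes "s \<subseteq> {..3}" "s \<noteq> {}" "\<not> L \<subseteq> s"
  shows "cell s G \<in> switched"
proof (cases "U \<subseteq> s")
  case True
  then show ?thesis using assms unfolding switched_def lower_cells_def by blast
next
  case False
  then show ?thesis using boundary_cell_switched[OF assms(1,2) False assms(3)] G_boundary[OF assms(1,2) False]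
    by (simp add: switched_def)
qed

text \<open>Both families of interior cells decompose the same set \<open>Q_int\<close> into open
  simplices, and every kept simplex avoids that set, so nothing changes outside it.\<close>

theorem tri_switched: "tri (sphere 0 1) switched"
proof (rule triI)
  have "finite {s. s \<subseteq> {..3::nat}}" by simp
  then have "finite lower_cells" unfolding lower_cells_def
    by (rule finite_subset[rotated, OF finite_imageI[where h="\<lambda>s. cell s G"]]) auto
  then show "finite switched" using tri_finite[OF T] by (simp add: switched_def)
next
  fix n \<sigma> assume "(n, \<sigma>) \<in> switched"
  then consider "(n, \<sigma>) \<in> T" | "(n, \<sigma>) \<in> lower_cells" by (auto simp: switched_def)
  then have "\<sigma> \<in> extensional (standard_simplex n) \<and> \<sigma> ` standard_simplex n \<subseteq> sphere 0 1 \<and>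
      continuous_on (standard_simplex n) \<sigma> \<and> inj_on \<sigma> (open_simplex n)"
  proof cases
    case 1
    then show ?thesis using tri_maps[OF T] tri_cont[OF T] by blast
  next
    case 2
    then obtain s where s: "(n, \<sigma>) = cell s G" "s \<subseteq> {..3}" "U \<subseteq> s" "\<not> L \<subseteq> s" "s \<noteq> {}" "n = card s - 1" "finite s"
      by (rule lower_cellE)
    have \<sigma>: "\<sigma> = snd (cell s G)" using s(1) by (metis snd_conv)
    have "\<sigma> \<in> extensional (standard_simplex n)" using s(1) by (auto simp: cell_def)
    moreover have "\<sigma> ` standard_simplex n \<subseteq> sphere 0 1"
      using cell_image[OF s(2,5), of G] G_sphere unfolding \<sigma> s(6) by auto
    moreover have "continuous_on (standard_simplex n) \<sigma>"
      using continuous_on_cell[OF s(2,5) continuous_on_G] unfolding \<sigma> s(6) .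
    moreover have "inj_on \<sigma> (open_simplex n)"
    proof
      fix x y assume x: "x \<in> open_simplex n" and y: "y \<in> open_simplex n" and e: "\<sigma> x = \<sigma> y"
      note px = lower_cell_point[OF s(1-5) x] and py = lower_cell_point[OF s(1-5) y]
      have "push s x = push s y" using G_lower_inj px py e by metis
      then show "x = y" using push_inj[OF s(7,5)] x y s(6) open_simplex_sub by (meson inj_onD subsetD)
    qed
    ultimately show ?thesis by blast
  qed
  then show "\<sigma> \<in> extensional (standard_simplex n)" "\<sigma> ` standard_simplex n \<subseteq> sphere 0 1"
      "continuous_on (standard_simplex n) \<sigma>" "inj_on \<sigma> (open_simplex n)" by blast+
next
  fix x :: 'a assume x: "x \<in> sphere 0 1"
  show "\<exists>n \<sigma>. (n, \<sigma>) \<in> switched \<and> x \<in> \<sigma> ` open_simplex n"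
  proof (cases "x \<in> Q_int")
    case True
    then obtain t where t: "t \<in> lower_int" "G t = x" by (rule G_lower_onto)
    have t3: "t \<in> standard_simplex 3" using t(1) by (simp add: lower_int_def)
    obtain y where y: "y \<in> open_simplex (card (supp t) - 1)" "snd (cell (supp t) G) y = G t"
      using open_cell[OF t3] by metis
    have "cell (supp t) G \<in> switched"
      using switched_cell[OF supp_sub[OF t3] supp_ne[OF t3]] t(1) by (simp add: lower_int_supp)
    then have "(card (supp t) - 1, snd (cell (supp t) G)) \<in> switched" by (simp add: cell_def)
    moreover have "x \<in> snd (cell (supp t) G) ` open_simplex (card (supp t) - 1)"
      using y t(2) by (metis image_eqI)
    ultimately show ?thesis by blast
  next
    case False
    obtain n \<sigma> t where nt: "(n, \<sigma>) \<in> T" "t \<in> open_simplex n" "\<sigma> t = x" using tri_point[OF T x] .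
    then have "(n, \<sigma>) \<notin> upper_cells" using upper_cells_open_image False by blast
    then show ?thesis using nt unfolding switched_def by blast
  qed
next
  fix n \<sigma> m \<tau> t t'
  assume "(n, \<sigma>) \<in> switched" "(m, \<tau>) \<in> switched" and t: "t \<in> open_simplex n" "t' \<in> open_simplex m"
    and eq: "\<sigma> t = \<tau> t'"
  have mixed: False if A: "(n, \<sigma>) \<in> T - upper_cells" "(m, \<tau>) \<in> lower_cells" "t \<in> open_simplex n" "t' \<in> open_simplex m" "\<sigma> t = \<tau> t'"
    for n \<sigma> m \<tau> t t'
  proof -
    obtain s where s: "(m, \<tau>) = cell s G" "s \<subseteq> {..3}" "U \<subseteq> s" "\<not> L \<subseteq> s" "s \<noteq> {}"
      using lower_cellE[OF A(2)] by metis
    have "\<tau> t' \<in> Q_int" using lower_cell_point[OF s A(4)] G_lower_int by metis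
    moreover have "\<sigma> t \<notin> Q_int" using kept_not_int[OF A(1)] A(3) open_simplex_sub by blast
    ultimately show False using A(5) by simp
  qed
  consider "(n, \<sigma>) \<in> T - upper_cells" "(m, \<tau>) \<in> T - upper_cells"
    | "(n, \<sigma>) \<in> T - upper_cells" "(m, \<tau>) \<in> lower_cells" | "(n, \<sigma>) \<in> lower_cells" "(m, \<tau>) \<in> T - upper_cells"
    | "(n, \<sigma>) \<in> lower_cells" "(m, \<tau>) \<in> lower_cells"
    using \<open>(n, \<sigma>) \<in> switched\<close> \<open>(m, \<tau>) \<in> switched\<close> unfolding switched_def by blast
  then show "n = m \<and> \<sigma> = \<tau>"
  proof cases
    case 1
    then show ?thesis using tri_unique(1,2)[OF T, of n \<sigma> m \<tau> t t'] t eq by blast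
  next
    case 2
    then show ?thesis using mixed t eq by blast
  next
    case 3
    then show ?thesis using mixed t eq by metis
  next
    case 4
    obtain s where s: "(n, \<sigma>) = cell s G" "s \<subseteq> {..3}" "U \<subseteq> s" "\<not> L \<subseteq> s" "s \<noteq> {}"
      using lower_cellE[OF 4(1)] by metis
    obtain r where r: "(m, \<tau>) = cell r G" "r \<subseteq> {..3}" "U \<subseteq> r" "\<not> L \<subseteq> r" "r \<noteq> {}"
      using lower_cellE[OF 4(2)] by metis
    note ps = lower_cell_point[OF s t(1)] and pr = lower_cell_point[OF r t(2)]
    have "push s t = push r t'" using G_lower_inj ps pr eq by metis
    then have "s = r" using ps(2) pr(2) by simp
    then show ?thesis using s(1) r(1) by (metis prod.inject)
  qed
next
  fix n \<sigma> s assume "(n, \<sigma>) \<in> switched" and s: "s \<subset> {..n}" "s \<noteq> {}"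
  then consider "(n, \<sigma>) \<in> T - upper_cells" | "(n, \<sigma>) \<in> lower_cells" by (auto simp: switched_def)
  then show "cell s \<sigma> \<in> switched"
  proof cases
    case 1
    then have "cell s \<sigma> \<in> T" using tri_cell[OF T] s by blast
    moreover have "cell s \<sigma> \<notin> upper_cells" using star[of n \<sigma> s] 1 s by blast
    ultimately show ?thesis by (simp add: switched_def)
  next
    case 2
    then obtain q where q: "(n, \<sigma>) = cell q G" "q \<subseteq> {..3}" "U \<subseteq> q" "\<not> L \<subseteq> q" "q \<noteq> {}" "n = card q - 1" "finite q"
      by (rule lower_cellE)
    obtain r where r: "r \<subseteq> q" "s = vrank q ` r" using rank_preimage[OF q(7,5), of s] s q(6) by blast
    have rne: "r \<noteq> {}" using r s by blast
    have "cell s \<sigma> = cell r G" using cell_cell[OF q(7) r(1) rne, of G] r(2) q(1) by (metis snd_conv)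
    then show ?thesis using switched_cell[of r] r(1) q rne by auto
  qed
qed

end

section \<open>Extending a filling of the switched sphere across the tetrahedron\<close>

definition fillable :: "('a::euclidean_space) simplices \<Rightarrow> ('a \<Rightarrow> 'c) \<Rightarrow> bool" where
  "fillable T \<psi> \<longleftrightarrow> (\<exists>K. tri (cball 0 1) K \<and> induced_triangulation (sphere 0 1) K = T \<and>
     vertices K \<subseteq> vertices T \<and> proper_coloring K \<psi>)"

lemma open_simplex_nonempty: "open_simplex n \<noteq> {}"
proof -
  define t :: "nat \<Rightarrow> real" where "t = (\<lambda>i. if i \<le> n then 1 / (real n + 1) else 0)"
  have "t \<in> standard_simplex n"
    by (rule in_simplexI) (auto simp: t_def field_simps)
  then have "t \<in> open_simplex n" by (auto simp: open_simplex_def t_def)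
  then show ?thesis by blast
qed

lemma sgn_unit: "norm x = 1 \<Longrightarrow> sgn x = x" for x :: "'a::real_normed_vector"
  by (simp add: sgn_div_norm)

lemma sgn_scale_unit: "0 < r \<Longrightarrow> norm x = 1 \<Longrightarrow> sgn (r *\<^sub>R x) = x" for x :: "'a::real_normed_vector"
  by (simp add: sgn_scaleR sgn_unit)

lemma cell_is:
  "(card s - 1, snd (cell s f)) = cell s f"
  by (simp add: cell_def)

lemma vertexI: "(0, \<sigma>) \<in> K \<Longrightarrow> \<sigma> (simplex_vertex 0) \<in> vertices K"
  by (auto simp: vertices_def)

lemma corner_vertex:
  assumes "tri S K" "(n, \<sigma>) \<in> K" "i \<le> n"
  shows "\<sigma> (simplex_vertex i) \<in> vertices K"
proof -
  have "(0, snd (cell {i} \<sigma>)) \<in> K" using tri_cell'[OF assms(1,2), of "{i}"] assms(3) by simp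
  moreover have "{j \<in> {i}. j < i} = {}" by auto
  then have "vrank {i} i = 0" unfolding vrank_def by simp
  then have "snd (cell {i} \<sigma>) (simplex_vertex 0) = \<sigma> (simplex_vertex i)"
    using cell_vertex[of "{i}" i \<sigma>] by simp
  ultimately show ?thesis using vertexI by metis
qed

text \<open>
  The unit ball is pushed radially inwards by \<open>shrink\<close> below the interior of the disc, by an amount
  that tends to zero at the boundary of the disc. The gap is filled by the tetrahedron \<open>\<tau>\<close>.
\<close>

context disc_switch
begin

text \<open>Positive exactly on the interior of the disc. At \<open>g y\<close> it equals
  \<open>slope\<close> times the largest height in the fiber over \<open>y\<close>.\<close>

definition depth :: "'a \<Rightarrow> real" where
  "depth x = (if x \<in> g ` upper then low L (the_inv_into upper g x) else 0)"

text \<open>The factor one half keeps the radius at least 1/2, so \<open>shrink\<close> preserves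
  directions and is injective.\<close>

definition radius :: "'a \<Rightarrow> real" where
  "radius x = 1 - depth x / 2"

definition shrink :: "'a \<Rightarrow> 'a" where
  "shrink y = radius (sgn y) *\<^sub>R y"

text \<open>Places the fiber over \<open>y\<close> on the ray through \<open>g y\<close>: height 0
  gets norm 1, and the largest height gets norm \<open>radius (g y)\<close>, where the shrunken ball
  begins.\<close>

definition \<tau> :: "(nat \<Rightarrow> real) \<Rightarrow> 'a" where
  "\<tau> t = (1 - slope * low U t / 2) *\<^sub>R G t"

lemma depth_g: "t \<in> upper \<Longrightarrow> depth (g t) = low L t"
  by (simp add: depth_def the_inv_into_f_f[OF g_inj])

lemma upper_low_bounds: "t \<in> upper \<Longrightarrow> 0 \<le> low L t \<and> low L t \<le> 1"
  using low_nonneg(2) low_le1(2) upper_sub by blast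

lemma depth_bounds: "0 \<le> depth x" "depth x \<le> 1"
  using depth_g upper_low_bounds by (auto simp: depth_def the_inv_into_f_f[OF g_inj])

lemma depth_zero: "x \<notin> Q_int \<Longrightarrow> depth x = 0"
  using upper_low_bounds unfolding depth_def Q_int_def upper_int_def
  by (auto simp: the_inv_into_f_f[OF g_inj]) (metis (mono_tags, lifting) image_eqI mem_Collect_eq order_le_less)

lemma radius_bounds: "1 / 2 \<le> radius x" "radius x \<le> 1" "0 < radius x"
  using depth_bounds[of x] by (auto simp: radius_def)

text \<open>The right-hand side is a finite union of compact images. Hence the complement of
  \<open>Q_int\<close> is closed, which allows continuity of \<open>depth\<close> to be pasted from
  two closed pieces.\<close>

lemma kept_region: "sphere 0 1 - Q_int = (\<Union>(n, \<sigma>)\<in>T - upper_cells. \<sigma> ` standard_simplex n)"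
proof
  show "sphere 0 1 - Q_int \<subseteq> (\<Union>(n, \<sigma>)\<in>T - upper_cells. \<sigma> ` standard_simplex n)"
  proof
    fix x assume x: "x \<in> sphere 0 1 - Q_int"
    then obtain n \<sigma> t where nt: "(n, \<sigma>) \<in> T" "t \<in> open_simplex n" "\<sigma> t = x" using tri_point[OF T] by blast
    then have "(n, \<sigma>) \<in> T - upper_cells" using upper_cells_open_image x by blast
    then show "x \<in> (\<Union>(n, \<sigma>)\<in>T - upper_cells. \<sigma> ` standard_simplex n)"
      using nt open_simplex_sub by fastforce
  qed
  show "(\<Union>(n, \<sigma>)\<in>T - upper_cells. \<sigma> ` standard_simplex n) \<subseteq> sphere 0 1 - Q_int"
    using kept_not_int tri_maps(2)[OF T] by fastforce
qed

lemma continuous_on_depth: "continuous_on (sphere 0 1) depth"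
proof -
  have c1: "compact (g ` upper)" by (rule compact_continuous_image[OF continuous_on_g compact_upper])
  have "compact (\<sigma> ` standard_simplex n)" if "(n, \<sigma>) \<in> T - upper_cells" for n \<sigma>
    using compact_continuous_image[OF tri_cont[OF T] compact_simplex] that by blast
  then have c2: "compact (sphere 0 1 - Q_int)"
    unfolding kept_region using tri_finite[OF T] by (intro compact_UN) auto
  have i: "continuous_on (g ` upper) (the_inv_into upper g)"
    by (rule continuous_on_inv_into[OF continuous_on_g compact_upper g_inj])
  have "continuous_on (g ` upper) (\<lambda>x. low L (the_inv_into upper g x))"
    using continuous_on_compose2[OF continuous_on_low(2)[of UNIV] i] by blast
  then have d1: "continuous_on (g ` upper) depth"
    by (rule continuous_on_eq) (simp add: depth_def)
  have d2: "continuous_on (sphere 0 1 - Q_int) depth"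
    by (rule continuous_on_eq[OF continuous_on_const[of _ 0]]) (simp add: depth_zero)
  have "g ` upper \<union> (sphere 0 1 - Q_int) = sphere 0 1"
    using g_sphere upper_int_upper by (auto simp: Q_int_def)
  then show ?thesis
    using continuous_on_closed_Un[OF compact_imp_closed[OF c1] compact_imp_closed[OF c2] d1 d2] by simp
qed

lemma sgn_shrink: "sgn (shrink y) = sgn y"
  using radius_bounds(3)[of "sgn y"] by (simp add: shrink_def sgn_scaleR)

lemma norm_shrink: "norm (shrink y) = radius (sgn y) * norm y"
  using radius_bounds(3)[of "sgn y"] by (simp add: shrink_def)

lemma shrink_le: "norm (shrink y) \<le> norm y"
  using mult_right_mono[OF radius_bounds(2), of "norm y" "sgn y"] by (simp add: norm_shrink)

lemma shrink_inj: "shrink y = shrink y' \<Longrightarrow> y = y'"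
proof -
  assume e: "shrink y = shrink y'"
  then have "sgn y = sgn y'" using sgn_shrink by metis
  then show ?thesis using e radius_bounds(3)[of "sgn y'"] by (simp add: shrink_def)
qed

lemma continuous_on_shrink: "continuous_on S shrink"
proof -
  have "isCont shrink y" for y
  proof (cases "y = 0")
    case True
    \<comment> \<open>\<open>sgn\<close> is discontinuous at 0, but \<open>shrink\<close> does not
      increase the norm.\<close>
    have "(shrink \<longlongrightarrow> 0) (at 0)"
      by (rule Lim_null_comparison[where g=norm]) (auto simp: shrink_le tendsto_norm_zero)
    moreover have "shrink 0 = 0" by (simp add: shrink_def)
    ultimately show ?thesis using True by (simp add: isCont_def)
  next
    case False
    have "continuous_on (UNIV - {0::'a}) sgn" by (intro continuous_on_sgn continuous_on_id) auto
    moreover have "sgn ` (UNIV - {0::'a}) \<subseteq> sphere 0 1" by (auto simp: norm_sgn split: if_splits)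
    ultimately have "continuous_on (UNIV - {0::'a}) (\<lambda>y. depth (sgn y))"
      using continuous_on_compose2[OF continuous_on_depth] by blast
    then have "continuous_on (UNIV - {0::'a}) shrink"
      unfolding shrink_def radius_def by (intro continuous_intros) auto
    moreover have "open (UNIV - {0::'a})" by (simp add: open_delete)
    ultimately show ?thesis using False by (simp add: continuous_on_eq_continuous_at)
  qed
  then show ?thesis by (simp add: continuous_at_imp_continuous_on)
qed

lemma shrink_fixed: "x \<in> sphere 0 1 \<Longrightarrow> x \<notin> Q_int \<Longrightarrow> shrink x = x"
  by (simp add: shrink_def radius_def sgn_unit depth_zero)

lemma shrink_sphereD:
  assumes "norm y \<le> 1" "norm (shrink y) = 1"
  shows "norm y = 1" "y \<notin> Q_int"
proof -
  show n: "norm y = 1" using assms shrink_le[of y] by simp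
  have "radius y = 1" using assms n by (simp add: norm_shrink sgn_unit)
  then have "depth y = 0" by (simp add: radius_def)
  then show "y \<notin> Q_int" using depth_g unfolding Q_int_def upper_int_def by auto
qed

lemma depth_G: "t \<in> standard_simplex 3 \<Longrightarrow> depth (G t) = low L t + slope * low U t"
  unfolding G_def using depth_g[OF drop_upper] low_L_drop by simp

lemma slope_low_bounds:
  assumes "t \<in> standard_simplex 3" shows "0 \<le> slope * low U t" "slope * low U t \<le> 1"
  using depth_G[OF assms] depth_bounds(2)[of "G t"] low_nonneg[OF assms] slope_pos by auto

lemma norm_\<tau>: "t \<in> standard_simplex 3 \<Longrightarrow> norm (\<tau> t) = 1 - slope * low U t / 2"
  using slope_low_bounds[of t] G_sphere[of t] by (simp add: \<tau>_def)

lemma sgn_\<tau>: "t \<in> standard_simplex 3 \<Longrightarrow> sgn (\<tau> t) = G t"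
  unfolding \<tau>_def using slope_low_bounds[of t] G_sphere[of t] by (intro sgn_scale_unit) auto

lemma \<tau>_inj: "inj_on \<tau> (standard_simplex 3)"
proof
  fix t t' assume t: "t \<in> standard_simplex 3" "t' \<in> standard_simplex 3" and e: "\<tau> t = \<tau> t'"
  have "G t = G t'" using sgn_\<tau> t e by metis
  then have "drop t = drop t'" using g_inj drop_upper t by (auto simp: G_def inj_on_def)
  moreover have "1 - slope * low U t / 2 = 1 - slope * low U t' / 2" using norm_\<tau> t e by metis
  then have "low U t = low U t'" using slope_pos by simp
  ultimately show "t = t'" using drop_inj[OF t] by blast
qed

lemma continuous_on_\<tau>: "continuous_on (standard_simplex 3) \<tau>"
  unfolding \<tau>_def by (intro continuous_intros continuous_on_G continuous_on_low) auto

lemma \<tau>_lower: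
  assumes "t \<in> standard_simplex 3" "low L t = 0" shows "\<tau> t = shrink (G t)"
  using assms depth_G[OF assms(1)] G_sphere[OF assms(1)] by (simp add: \<tau>_def shrink_def radius_def sgn_unit)

lemma \<tau>_upper: "t \<in> upper \<Longrightarrow> \<tau> t = g t"
  by (simp add: \<tau>_def G_upper) (simp add: upper_def)

text \<open>On a common ray \<open>shrink\<close> stays within \<open>radius\<close>, whereas a
  positive \<open>low L t\<close> puts \<open>\<tau> t\<close> strictly beyond it.\<close>

lemma \<tau>_not_shrink:
  assumes t: "t \<in> standard_simplex 3" "0 < low L t" and y: "norm y \<le> 1"
  shows "\<tau> t \<noteq> shrink y"
proof
  assume e: "\<tau> t = shrink y"
  have "sgn y = G t" using sgn_shrink[of y] sgn_\<tau>[OF t(1)] e by simp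
  then have "norm (shrink y) \<le> radius (G t)"
    using mult_left_mono[OF y, of "radius (G t)"] radius_bounds(3)[of "G t"] by (simp add: norm_shrink)
  also have "\<dots> < norm (\<tau> t)" using t depth_G[OF t(1)] by (simp add: radius_def norm_\<tau>)
  finally show False using e by simp
qed

lemma gap_cases:
  assumes "norm z \<le> 1"
  obtains y where "norm y \<le> 1" "shrink y = z"
  | t where "t \<in> standard_simplex 3" "0 < low L t" "\<tau> t = z"
proof (cases "norm z \<le> radius (sgn z)")
  case True
  define y where "y = (1 / radius (sgn z)) *\<^sub>R z"
  have pos: "0 < radius (sgn z)" by (rule radius_bounds(3))
  have "norm y \<le> 1" using True pos by (simp add: y_def divide_le_eq)
  moreover have "sgn y = sgn z" using pos by (simp add: y_def sgn_scaleR)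
  then have "shrink y = z" using pos by (simp add: shrink_def) (simp add: y_def)
  ultimately show ?thesis using that(1) by blast
next
  case False
  then have z0: "z \<noteq> 0" using radius_bounds(3)[of 0] by auto
  have d: "0 < depth (sgn z)" using False assms by (simp add: radius_def)
  then obtain y where y: "y \<in> upper" "g y = sgn z" by (auto simp: depth_def split: if_splits)
  then have dy: "depth (sgn z) = low L y" using depth_g by metis
  \<comment> \<open>The solution of \<open>1 - slope * \<mu> / 2 = norm z\<close>: the point of this
    height in the fiber has the norm of \<open>z\<close>.\<close>
  define \<mu> where "\<mu> = 2 * (1 - norm z) / slope"
  have s\<mu>: "slope * \<mu> = 2 * (1 - norm z)" using slope_pos by (simp add: \<mu>_def)
  have lt: "slope * \<mu> < low L y" using False dy s\<mu> by (simp add: radius_def)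
  have "0 \<le> \<mu>" using slope_pos assms by (simp add: \<mu>_def)
  from drop_onto[OF y(1) this] lt obtain t where t: "t \<in> standard_simplex 3" "drop t = y" "low U t = \<mu>" by auto
  have "0 < low L t" using low_L_drop[of t] t lt by simp
  moreover have "1 - 2 * (1 - norm z) / 2 = norm z" by (simp add: field_simps)
  then have "\<tau> t = norm z *\<^sub>R sgn z" unfolding \<tau>_def G_def t y(2) s\<mu> by simp
  then have "\<tau> t = z" using z0 by (simp add: sgn_div_norm)
  ultimately show ?thesis using that(2) t(1) by blast
qed

end

section \<open>The triangulated ball made of the shrunken ball and the tetrahedron\<close>

context disc_switch
begin

definition shrink_simplex :: "nat \<times> ((nat \<Rightarrow> real) \<Rightarrow> 'a) \<Rightarrow> nat \<times> ((nat \<Rightarrow> real) \<Rightarrow> 'a)" where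
  "shrink_simplex s = (fst s, restrict (shrink \<circ> snd s) (standard_simplex (fst s)))"

lemma shrink_simplex_snd:
  "t \<in> standard_simplex n \<Longrightarrow> snd (shrink_simplex (n, \<sigma>)) t = shrink (\<sigma> t)"
  by (simp add: shrink_simplex_def)

lemma shrink_simplex_eq: "shrink_simplex (n, \<sigma>) = (n, snd (shrink_simplex (n, \<sigma>)))"
  by (simp add: shrink_simplex_def)

lemma cell_shrink_simplex:
  assumes "s \<subseteq> {..n}" "s \<noteq> {}"
  shows "cell s (snd (shrink_simplex (n, \<sigma>))) = shrink_simplex (cell s \<sigma>)"
  using push_simplex[OF assms]
  by (auto simp: cell_def shrink_simplex_def restrict_def fun_eq_iff)

lemma shrink_simplex_kept:
  assumes "(n, \<sigma>) \<in> T - upper_cells"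
  shows "shrink_simplex (n, \<sigma>) = (n, \<sigma>)"
proof -
  have "shrink (\<sigma> t) = \<sigma> t" if "t \<in> standard_simplex n" for t
    using shrink_fixed kept_not_int[OF assms that] tri_maps(2)[OF T] assms that by blast
  then show ?thesis
    using tri_maps(1)[OF T, of n \<sigma>] assms
    by (auto simp: shrink_simplex_def restrict_def fun_eq_iff extensional_def)
qed

lemma shrink_lower_cell:
  assumes "s \<subseteq> {..3}" "s \<noteq> {}" "\<not> L \<subseteq> s"
  shows "shrink_simplex (cell s G) = cell s \<tau>"
proof -
  have "\<tau> (push s x) = shrink (G (push s x))" if x: "x \<in> standard_simplex (card s - 1)" for x
    using \<tau>_lower[OF push_simplex[OF assms(1,2) x]] low_zero_iff(2)[OF push_simplex[OF assms(1,2) x]]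
      push_supp(1)[OF assms(1,2) x] assms(3) by blast
  then show ?thesis by (auto simp: cell_def shrink_simplex_def restrict_def)
qed

lemma \<tau>_upper_cell:
  assumes "s \<subseteq> {..3}" "s \<noteq> {}" "\<not> U \<subseteq> s"
  shows "cell s \<tau> = cell s g"
proof (rule cell_cong[OF assms(1,2)])
  fix t assume "t \<in> standard_simplex 3" "supp t \<subseteq> s"
  then have "t \<in> upper" using assms(3) by (auto simp: upper_supp)
  then show "\<tau> t = g t" by (rule \<tau>_upper)
qed

lemma \<tau>_cell_point:
  assumes "s \<subseteq> {..3}" "s \<noteq> {}" "L \<subseteq> s" "x \<in> open_simplex (card s - 1)"
  shows "push s x \<in> standard_simplex 3" "supp (push s x) = s" "snd (cell s \<tau>) x = \<tau> (push s x)" "0 < low L (push s x)"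
proof -
  have x: "x \<in> standard_simplex (card s - 1)" using assms(4) open_simplex_sub by blast
  show ps: "push s x \<in> standard_simplex 3" by (rule push_simplex[OF assms(1,2) x])
  show sp: "supp (push s x) = s" using push_open[OF assms(1,2) x] assms(4) by blast
  show "snd (cell s \<tau>) x = \<tau> (push s x)" by (rule snd_cell[OF x])
  show "0 < low L (push s x)" using low_pos_iff(2)[of "push s x"] sp assms(3) by simp
qed

lemma vertices_switched:
  assumes "v \<in> vertices switched" shows "v \<in> vertices T" "v \<notin> Q_int"
proof -
  obtain \<sigma> where \<sigma>: "(0, \<sigma>) \<in> switched" "v = \<sigma> (simplex_vertex 0)" using assms by (auto simp: vertices_def)
  have "(0, \<sigma>) \<notin> lower_cells"
  proof
    assume "(0, \<sigma>) \<in> lower_cells"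
    then obtain s where s: "U \<subseteq> s" "(0::nat) = card s - 1" "finite s" by (metis lower_cellE)
    then have "card s \<ge> 2" using two card_mono[of s U] by linarith
    then show False using s by simp
  qed
  then have k: "(0, \<sigma>) \<in> T - upper_cells" using \<sigma>(1) by (auto simp: switched_def)
  then show "v \<in> vertices T" using \<sigma>(2) vertexI by blast
  show "v \<notin> Q_int" using kept_not_int[OF k] \<sigma>(2) vertex_simplex[of 0 0] by simp
qed

context
  fixes K :: "'a simplices"
  assumes K: "tri (cball 0 1) K" and indK: "induced_triangulation (sphere 0 1) K = switched"
    and vK: "vertices K \<subseteq> vertices switched"
begin

text \<open>Cells of the tetrahedron that omit a vertex of \<open>L\<close> are left out of the
  second set because they are present already: by \<open>shrink_lower_cell\<close> each is the
  shrunken image of a simplex of \<open>switched\<close>, hence of \<open>K\<close>.\<close>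

definition filled :: "'a simplices" where
  "filled = shrink_simplex ` K \<union> {cell s \<tau> |s. s \<subseteq> {..3} \<and> L \<subseteq> s}"

lemma switched_K: "switched \<subseteq> K"
  unfolding indK[symmetric] by (auto simp: induced_triangulation_def)

lemma shrunkE:
  assumes "(n, \<sigma>') \<in> shrink_simplex ` K"
  obtains \<sigma> where "(n, \<sigma>) \<in> K" "\<sigma>' = snd (shrink_simplex (n, \<sigma>))" "\<forall>t\<in>standard_simplex n. \<sigma>' t = shrink (\<sigma> t)"
    "\<sigma>' = restrict (shrink \<circ> \<sigma>) (standard_simplex n)"
proof -
  obtain m \<sigma> where "(m, \<sigma>) \<in> K" "(n, \<sigma>') = shrink_simplex (m, \<sigma>)" using assms by force
  then show ?thesis using that[of \<sigma>] by (auto simp: shrink_simplex_def)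
qed

lemma gapE:
  assumes "(n, \<sigma>) \<in> {cell s \<tau> |s. s \<subseteq> {..3} \<and> L \<subseteq> s}"
  obtains s where "s \<subseteq> {..3}" "s \<noteq> {}" "L \<subseteq> s" "\<sigma> = snd (cell s \<tau>)" "n = card s - 1" "finite s" "(n, \<sigma>) = cell s \<tau>"
proof -
  obtain s where s: "s \<subseteq> {..3}" "L \<subseteq> s" "(n, \<sigma>) = cell s \<tau>" using assms by blast
  moreover have "s \<noteq> {}" using s UL by blast
  moreover have "\<sigma> = snd (cell s \<tau>)" "n = card s - 1" using s(3) by (simp_all add: cell_def)
  moreover have "finite s" using s(1) finite_subset by blast
  ultimately show ?thesis using that by blast
qed

lemma filled_cell:
  assumes "s \<subseteq> {..3}" "s \<noteq> {}" shows "cell s \<tau> \<in> filled"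
proof (cases "L \<subseteq> s")
  case True
  then show ?thesis using assms unfolding filled_def by blast
next
  case False
  then have "cell s G \<in> K" using switched_cell[OF assms] switched_K by blast
  then have "cell s \<tau> \<in> shrink_simplex ` K" 
    using shrink_lower_cell[OF assms False] image_eqI[of "cell s \<tau>" shrink_simplex "cell s G" K] by simp
  then show ?thesis unfolding filled_def by (rule UnI1)
qed

lemma K_norm: "(n, \<sigma>) \<in> K \<Longrightarrow> t \<in> standard_simplex n \<Longrightarrow> norm (\<sigma> t) \<le> 1"
  using tri_maps(2)[OF K] by (fastforce simp: cball_def)

text \<open>By \<open>gap_cases\<close> and \<open>\<tau>_not_shrink\<close>, the unit ball is the
  disjoint union of the shrunken ball and of the points \<open>\<tau> t\<close> with
  \<open>0 < low L t\<close>; each piece comes with its own decomposition into open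
  simplices.\<close>

lemma tri_filled: "tri (cball 0 1) filled"
proof (rule triI)
  have "finite {cell s \<tau> |s. s \<subseteq> {..3} \<and> L \<subseteq> s}"
    by (rule finite_subset[OF _ finite_imageI[of "Pow {..3}" "\<lambda>s. cell s \<tau>"]]) auto
  then show "finite filled" using tri_finite[OF K] by (simp add: filled_def)
next
  fix n \<sigma>' assume "(n, \<sigma>') \<in> filled"
  then consider "(n, \<sigma>') \<in> shrink_simplex ` K" | "(n, \<sigma>') \<in> {cell s \<tau> |s. s \<subseteq> {..3} \<and> L \<subseteq> s}"
    unfolding filled_def by blast
  then have "\<sigma>' \<in> extensional (standard_simplex n) \<and> \<sigma>' ` standard_simplex n \<subseteq> cball 0 1 \<and>
      continuous_on (standard_simplex n) \<sigma>' \<and> inj_on \<sigma>' (open_simplex n)"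
  proof cases
    case 1
    then obtain \<sigma> where \<sigma>: "(n, \<sigma>) \<in> K" "\<sigma>' = snd (shrink_simplex (n, \<sigma>))"
      "\<forall>t\<in>standard_simplex n. \<sigma>' t = shrink (\<sigma> t)" "\<sigma>' = restrict (shrink \<circ> \<sigma>) (standard_simplex n)"
      by (rule shrunkE)
    have "\<sigma>' ` standard_simplex n \<subseteq> cball 0 1"
      using \<sigma>(3) K_norm[OF \<sigma>(1)] shrink_le by (force simp: cball_def intro: order_trans)
    moreover have "continuous_on (standard_simplex n) \<sigma>'"
      by (rule continuous_on_eq[OF continuous_on_compose2[OF continuous_on_shrink[of UNIV] tri_cont[OF K \<sigma>(1)]]])
        (use \<sigma>(3) in auto)
    moreover have "inj_on \<sigma>' (open_simplex n)"
    proof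
      fix x y assume x: "x \<in> open_simplex n" and y: "y \<in> open_simplex n" and e: "\<sigma>' x = \<sigma>' y"
      have "\<sigma> x = \<sigma> y" using \<sigma>(3) x y e open_simplex_sub shrink_inj by (metis subsetD)
      then show "x = y" using tri_maps(3)[OF K \<sigma>(1)] x y by (auto dest: inj_onD)
    qed
    ultimately show ?thesis unfolding \<sigma>(4) by simp
  next
    case 2
    then obtain s where s: "s \<subseteq> {..3}" "s \<noteq> {}" "L \<subseteq> s" "\<sigma>' = snd (cell s \<tau>)" "n = card s - 1" "finite s"
      "(n, \<sigma>') = cell s \<tau>" by (rule gapE)
    have "\<tau> ` standard_simplex 3 \<subseteq> cball 0 1"
      using norm_\<tau> slope_low_bounds by (force simp: cball_def)
    then have "\<sigma>' ` standard_simplex n \<subseteq> cball 0 1"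
      using cell_image[OF s(1,2), of \<tau>] unfolding s(4,5) by blast
    moreover have "continuous_on (standard_simplex n) \<sigma>'"
      using continuous_on_cell[OF s(1,2) continuous_on_\<tau>] unfolding s(4,5) .
    moreover have "inj_on \<sigma>' (open_simplex n)"
    proof
      fix x y assume x: "x \<in> open_simplex n" and y: "y \<in> open_simplex n" and e: "\<sigma>' x = \<sigma>' y"
      note px = \<tau>_cell_point[OF s(1-3) x[unfolded s(5)]] and py = \<tau>_cell_point[OF s(1-3) y[unfolded s(5)]]
      have "push s x = push s y" using \<tau>_inj px py e unfolding s(4) by (metis inj_onD)
      then show "x = y" using push_inj[OF s(6,2)] x y s(5) open_simplex_sub by (meson inj_onD subsetD)
    qed
    moreover have "\<sigma>' \<in> extensional (standard_simplex n)" unfolding s(4,5) by (simp add: cell_def)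
    ultimately show ?thesis by blast
  qed
  then show "\<sigma>' \<in> extensional (standard_simplex n)" "\<sigma>' ` standard_simplex n \<subseteq> cball 0 1"
      "continuous_on (standard_simplex n) \<sigma>'" "inj_on \<sigma>' (open_simplex n)" by blast+
next
  fix z :: 'a assume "z \<in> cball 0 1"
  then have z: "norm z \<le> 1" by simp
  then show "\<exists>n \<sigma>. (n, \<sigma>) \<in> filled \<and> z \<in> \<sigma> ` open_simplex n"
  proof (cases rule: gap_cases)
    case (1 y)
    then obtain n \<sigma> t where nt: "(n, \<sigma>) \<in> K" "t \<in> open_simplex n" "\<sigma> t = y"
      using tri_point[OF K, of y] by auto
    then have "snd (shrink_simplex (n, \<sigma>)) t = z"
      using shrink_simplex_snd[of t n \<sigma>] open_simplex_sub 1(2) by auto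
    moreover have "(n, snd (shrink_simplex (n, \<sigma>))) \<in> filled"
      using imageI[OF nt(1), of shrink_simplex] shrink_simplex_eq[of n \<sigma>] unfolding filled_def by simp
    ultimately show ?thesis using nt(2) by blast
  next
    case (2 t)
    obtain x where x: "x \<in> open_simplex (card (supp t) - 1)" "snd (cell (supp t) \<tau>) x = \<tau> t"
      using open_cell[OF 2(1)] by metis
    have "(card (supp t) - 1, snd (cell (supp t) \<tau>)) \<in> filled"
      using filled_cell[OF supp_sub[OF 2(1)] supp_ne[OF 2(1)]] by (simp only: cell_is)
    moreover have "z \<in> snd (cell (supp t) \<tau>) ` open_simplex (card (supp t) - 1)"
      using x 2(3) by (metis image_eqI)
    ultimately show ?thesis by blast
  qed
next
  fix n \<sigma>' m \<tau>' t t'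
  assume f: "(n, \<sigma>') \<in> filled" "(m, \<tau>') \<in> filled" and t: "t \<in> open_simplex n" "t' \<in> open_simplex m"
    and eq: "\<sigma>' t = \<tau>' t'"
  have mixed: False if A: "(n, \<sigma>') \<in> shrink_simplex ` K" "(m, \<tau>') \<in> {cell s \<tau> |s. s \<subseteq> {..3} \<and> L \<subseteq> s}"
    "t \<in> open_simplex n" "t' \<in> open_simplex m" "\<sigma>' t = \<tau>' t'" for n \<sigma>' m \<tau>' t t'
  proof -
    obtain \<sigma> where \<sigma>: "(n, \<sigma>) \<in> K" "\<forall>t\<in>standard_simplex n. \<sigma>' t = shrink (\<sigma> t)"
      using shrunkE[OF A(1)] by metis
    obtain s where s: "s \<subseteq> {..3}" "s \<noteq> {}" "L \<subseteq> s" "\<tau>' = snd (cell s \<tau>)" "m = card s - 1"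
      "finite s" "(m, \<tau>') = cell s \<tau>" using A(2) by (rule gapE)
    note p = \<tau>_cell_point[OF s(1-3) A(4)[unfolded s(5)]]
    have ts: "t \<in> standard_simplex n" using A(3) open_simplex_sub by blast
    show False using \<tau>_not_shrink[OF p(1,4) K_norm[OF \<sigma>(1) ts]] p(3) s(4) \<sigma>(2) ts A(5) by simp
  qed
  consider "(n, \<sigma>') \<in> shrink_simplex ` K" "(m, \<tau>') \<in> shrink_simplex ` K"
    | "(n, \<sigma>') \<in> shrink_simplex ` K" "(m, \<tau>') \<in> {cell s \<tau> |s. s \<subseteq> {..3} \<and> L \<subseteq> s}"
    | "(n, \<sigma>') \<in> {cell s \<tau> |s. s \<subseteq> {..3} \<and> L \<subseteq> s}" "(m, \<tau>') \<in> shrink_simplex ` K"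
    | "(n, \<sigma>') \<in> {cell s \<tau> |s. s \<subseteq> {..3} \<and> L \<subseteq> s}" "(m, \<tau>') \<in> {cell s \<tau> |s. s \<subseteq> {..3} \<and> L \<subseteq> s}"
    using f unfolding filled_def by blast
  then show "n = m \<and> \<sigma>' = \<tau>'"
  proof cases
    case 1
    obtain \<sigma> where \<sigma>: "(n, \<sigma>) \<in> K" "\<sigma>' = snd (shrink_simplex (n, \<sigma>))" "\<forall>t\<in>standard_simplex n. \<sigma>' t = shrink (\<sigma> t)"
      using shrunkE[OF 1(1)] by metis
    obtain \<rho> where \<rho>: "(m, \<rho>) \<in> K" "\<tau>' = snd (shrink_simplex (m, \<rho>))" "\<forall>t\<in>standard_simplex m. \<tau>' t = shrink (\<rho> t)"
      using shrunkE[OF 1(2)] by metis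
    have "\<sigma> t = \<rho> t'" using shrink_inj \<sigma>(3) \<rho>(3) t eq open_simplex_sub by (metis subsetD)
    then show ?thesis using tri_unique(1,2)[OF K \<sigma>(1) \<rho>(1) t] \<sigma>(2) \<rho>(2) by simp
  next
    case 2
    then show ?thesis using mixed t eq by blast
  next
    case 3
    then show ?thesis using mixed[OF 3(2,1) t(2,1)] eq by simp
  next
    case 4
    obtain s where s: "s \<subseteq> {..3}" "s \<noteq> {}" "L \<subseteq> s" "\<sigma>' = snd (cell s \<tau>)" "n = card s - 1"
      "finite s" "(n, \<sigma>') = cell s \<tau>" using 4(1) by (rule gapE)
    obtain r where r: "r \<subseteq> {..3}" "r \<noteq> {}" "L \<subseteq> r" "\<tau>' = snd (cell r \<tau>)" "m = card r - 1"
      "finite r" "(m, \<tau>') = cell r \<tau>" using 4(2) by (rule gapE)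
    note ps = \<tau>_cell_point[OF s(1-3) t(1)[unfolded s(5)]] and pr = \<tau>_cell_point[OF r(1-3) t(2)[unfolded r(5)]]
    have "push s t = push r t'" using \<tau>_inj ps pr eq unfolding s(4) r(4) by (metis inj_onD)
    then have "s = r" using ps(2) pr(2) by simp
    then show ?thesis using s r by simp
  qed
next
  fix n \<sigma>' s assume f: "(n, \<sigma>') \<in> filled" and s: "s \<subset> {..n}" "s \<noteq> {}"
  then consider "(n, \<sigma>') \<in> shrink_simplex ` K" | "(n, \<sigma>') \<in> {cell s \<tau> |s. s \<subseteq> {..3} \<and> L \<subseteq> s}"
    unfolding filled_def by blast
  then show "cell s \<sigma>' \<in> filled"
  proof cases
    case 1
    obtain \<sigma> where \<sigma>: "(n, \<sigma>) \<in> K" "\<sigma>' = snd (shrink_simplex (n, \<sigma>))"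
      using shrunkE[OF 1] by metis
    have sn: "s \<subseteq> {..n}" using s by blast
    have "cell s \<sigma>' = shrink_simplex (cell s \<sigma>)" using cell_shrink_simplex[OF sn s(2)] \<sigma>(2) by simp
    then show ?thesis using tri_cell[OF K \<sigma>(1) sn s(2)] unfolding filled_def by blast
  next
    case 2
    then obtain q where q: "q \<subseteq> {..3}" "q \<noteq> {}" "L \<subseteq> q" "\<sigma>' = snd (cell q \<tau>)" "n = card q - 1" "finite q"
      "(n, \<sigma>') = cell q \<tau>" by (rule gapE)
    obtain r where r: "r \<subseteq> q" "s = vrank q ` r" using rank_preimage[OF q(6,2), of s] s q(5) by blast
    have rne: "r \<noteq> {}" using r s by blast
    have "cell s \<sigma>' = cell r \<tau>" using cell_cell[OF q(6) r(1) rne, of \<tau>] r(2) q(4) by simp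
    then show ?thesis using filled_cell[of r] r(1) q rne by auto
  qed
qed

text \<open>A shrunken simplex lies in the sphere only if it did so before and avoids
  \<open>Q_int\<close>, which leaves the kept simplices of \<open>T\<close>; these are fixed by
  \<open>shrink\<close> as maps. A cell of the tetrahedron lies in the sphere only if it omits a
  vertex of \<open>U\<close>, and there \<open>\<tau>\<close> equals \<open>g\<close>.\<close>

lemma induced_filled: "induced_triangulation (sphere 0 1) filled = T"
proof
  show "T \<subseteq> induced_triangulation (sphere 0 1) filled"
  proof
    fix y assume y: "y \<in> T"
    obtain n \<sigma> where n\<sigma>: "y = (n, \<sigma>)" by fastforce
    have "y \<in> filled"
    proof (cases "y \<in> upper_cells")
      case True
      then obtain s where s: "y = cell s g" "s \<subseteq> {..3}" "L \<subseteq> s" "\<not> U \<subseteq> s" unfolding upper_cells_def by blast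
      then have "s \<noteq> {}" using UL by blast
      then show ?thesis using filled_cell[of s] \<tau>_upper_cell[of s] s by simp
    next
      case False
      then have "shrink_simplex y = y" using shrink_simplex_kept y n\<sigma> by blast
      moreover have "y \<in> K" using y False switched_K unfolding switched_def by blast
      ultimately have "y \<in> shrink_simplex ` K" using image_eqI[of y shrink_simplex y K] by simp
      then show ?thesis unfolding filled_def by (rule UnI1)
    qed
    then show "y \<in> induced_triangulation (sphere 0 1) filled"
      using tri_maps(2)[OF T, of n \<sigma>] y n\<sigma> by (simp add: induced_triangulation_def)
  qed
  show "induced_triangulation (sphere 0 1) filled \<subseteq> T"
  proof
    fix y assume "y \<in> induced_triangulation (sphere 0 1) filled"
    then obtain n \<sigma>' where y: "y = (n, \<sigma>')" "(n, \<sigma>') \<in> filled" "\<sigma>' ` standard_simplex n \<subseteq> sphere 0 1"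
      unfolding induced_triangulation_def by blast
    have un: "norm (\<sigma>' t) = 1" if "t \<in> standard_simplex n" for t using y(3) that by force
    from y(2) consider "(n, \<sigma>') \<in> shrink_simplex ` K" | "(n, \<sigma>') \<in> {cell s \<tau> |s. s \<subseteq> {..3} \<and> L \<subseteq> s}"
      unfolding filled_def by blast
    then show "y \<in> T"
    proof cases
      case 1
      then obtain \<sigma> where \<sigma>: "(n, \<sigma>) \<in> K" "\<sigma>' = snd (shrink_simplex (n, \<sigma>))"
        "\<forall>t\<in>standard_simplex n. \<sigma>' t = shrink (\<sigma> t)" using shrunkE by metis
      have D: "norm (\<sigma> t) = 1 \<and> \<sigma> t \<notin> Q_int" if "t \<in> standard_simplex n" for t
        using shrink_sphereD[OF K_norm[OF \<sigma>(1) that]] un[OF that] \<sigma>(3) that by simp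
      then have "\<sigma> ` standard_simplex n \<subseteq> sphere 0 1" by auto
      then have sw: "(n, \<sigma>) \<in> switched" using \<sigma>(1) indK by (auto simp: induced_triangulation_def)
      have "(n, \<sigma>) \<notin> lower_cells"
      proof
        assume "(n, \<sigma>) \<in> lower_cells"
        then obtain s where s: "(n, \<sigma>) = cell s G" "s \<subseteq> {..3}" "U \<subseteq> s" "\<not> L \<subseteq> s" "s \<noteq> {}"
          using lower_cellE by metis
        obtain x where x: "x \<in> open_simplex n" using open_simplex_nonempty by blast
        have "\<sigma> x \<in> Q_int" using lower_cell_point[OF s x] G_lower_int by metis
        then show False using D x open_simplex_sub by blast
      qed
      then have k: "(n, \<sigma>) \<in> T - upper_cells" using sw by (auto simp: switched_def)
      then show ?thesis using shrink_simplex_kept[OF k] \<sigma>(2) y(1) by simp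
    next
      case 2
      then obtain s where s: "s \<subseteq> {..3}" "s \<noteq> {}" "L \<subseteq> s" "\<sigma>' = snd (cell s \<tau>)" "n = card s - 1" "finite s" "(n, \<sigma>') = cell s \<tau>"
        by (rule gapE)
      have "\<not> U \<subseteq> s"
      proof
        assume Us: "U \<subseteq> s"
        obtain x where x: "x \<in> open_simplex n" using open_simplex_nonempty by blast
        note p = \<tau>_cell_point[OF s(1-3) x[unfolded s(5)]]
        have "0 < low U (push s x)" using low_pos_iff(1)[of "push s x"] p(2) Us by simp
        then have "norm (\<tau> (push s x)) < 1" using norm_\<tau>[OF p(1)] slope_pos by simp
        moreover have "norm (\<tau> (push s x)) = 1" using un[of x] x open_simplex_sub p(3) s(4) by auto
        ultimately show False by simp
      qed
      then show ?thesis using \<tau>_upper_cell[OF s(1,2)] cell_upper_in_T[OF s(1,2)] s(7) y(1) by simp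
    qed
  qed
qed

lemma shrink_vertex: "v \<in> vertices K \<Longrightarrow> shrink v = v \<and> v \<in> vertices T"
proof -
  assume "v \<in> vertices K"
  then have v: "v \<in> vertices T" "v \<notin> Q_int" using vK vertices_switched by blast+
  obtain \<sigma> where "(0, \<sigma>) \<in> T" "v = \<sigma> (simplex_vertex 0)" using v(1) by (auto simp: vertices_def)
  then have "v \<in> sphere 0 1" using tri_maps(2)[OF T] vertex_simplex[of 0 0] by blast
  then show ?thesis using v shrink_fixed by blast
qed

text \<open>A cell that contains \<open>L\<close> and has fewer than four vertices omits a vertex of
  \<open>U\<close>. So the gap brings no vertices or edges beyond those of \<open>T\<close>.\<close>

lemma small_gap_cell:
  assumes "(n, \<sigma>) \<in> {cell s \<tau> |s. s \<subseteq> {..3} \<and> L \<subseteq> s}" "n < 3"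
  shows "(n, \<sigma>) \<in> T"
proof -
  obtain s where s: "s \<subseteq> {..3}" "s \<noteq> {}" "L \<subseteq> s" "n = card s - 1" "(n, \<sigma>) = cell s \<tau>"
    using gapE[OF assms(1)] by metis
  have "s \<noteq> {..3}" using s(4) assms(2) by auto
  then have "\<not> U \<subseteq> s" using UL(1) s(1,3) by blast
  then show ?thesis using \<tau>_upper_cell[OF s(1,2)] cell_upper_in_T[OF s(1,2)] s(5) by simp
qed

lemma vertices_filled: "vertices filled \<subseteq> vertices T"
proof
  fix v assume "v \<in> vertices filled"
  then obtain \<sigma>' where \<sigma>': "(0, \<sigma>') \<in> filled" "v = \<sigma>' (simplex_vertex 0)" by (auto simp: vertices_def)
  then consider "(0, \<sigma>') \<in> shrink_simplex ` K" | "(0, \<sigma>') \<in> {cell s \<tau> |s. s \<subseteq> {..3} \<and> L \<subseteq> s}"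
    unfolding filled_def by blast
  then show "v \<in> vertices T"
  proof cases
    case 1
    then obtain \<sigma> where \<sigma>: "(0, \<sigma>) \<in> K" "\<forall>t\<in>standard_simplex 0. \<sigma>' t = shrink (\<sigma> t)"
      using shrunkE by metis
    then show ?thesis using shrink_vertex[OF vertexI[OF \<sigma>(1)]] \<sigma>'(2) vertex_simplex[of 0 0] by simp
  next
    case 2
    then show ?thesis using small_gap_cell[OF 2] \<sigma>'(2) vertexI[of \<sigma>' T] by simp
  qed
qed

lemma proper_filled:
  assumes "proper_coloring K \<psi>" "proper_coloring T \<psi>" shows "proper_coloring filled \<psi>"
  unfolding proper_coloring_def
proof (intro allI impI)
  fix \<sigma>' assume "(1, \<sigma>') \<in> filled"
  then consider "(1, \<sigma>') \<in> shrink_simplex ` K" | "(1, \<sigma>') \<in> {cell s \<tau> |s. s \<subseteq> {..3} \<and> L \<subseteq> s}"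
    unfolding filled_def by blast
  then show "\<psi> (\<sigma>' (simplex_vertex 0)) \<noteq> \<psi> (\<sigma>' (simplex_vertex 1))"
  proof cases
    case 1
    then obtain \<sigma> where \<sigma>: "(1, \<sigma>) \<in> K" "\<forall>t\<in>standard_simplex 1. \<sigma>' t = shrink (\<sigma> t)"
      using shrunkE by metis
    have "\<sigma>' (simplex_vertex i) = \<sigma> (simplex_vertex i)" if "i \<le> 1" for i
      using shrink_vertex[OF corner_vertex[OF K \<sigma>(1) that]] \<sigma>(2) that by (simp add: vertex_simplex)
    then show ?thesis using assms(1) \<sigma>(1) unfolding proper_coloring_def by simp
  next
    case 2
    then show ?thesis using small_gap_cell[OF 2] assms(2) unfolding proper_coloring_def by simp
  qed
qed

end

theorem fillable_switched:
  assumes "fillable switched \<psi>" "proper_coloring T \<psi>"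
  shows "fillable T \<psi>"
proof -
  obtain K where K: "tri (cball 0 1) K" "induced_triangulation (sphere 0 1) K = switched"
    "vertices K \<subseteq> vertices switched" "proper_coloring K \<psi>"
    using assms(1) unfolding fillable_def by blast
  show ?thesis unfolding fillable_def
    using tri_filled[OF K(1-3)] induced_filled[OF K(1-3)] vertices_filled[OF K(1-3)] proper_filled[OF K(1-4) assms(2)]
    by blast
qed

end

section \<open>Filling the boundary of a tetrahedron\<close>

lemma continuous_on_opens_and_point:
  fixes f :: "(nat \<Rightarrow> real) \<Rightarrow> 'b::metric_space"
  assumes W: "openin (top_of_set S) W" "S - W \<subseteq> {b}" and f: "continuous_on W f"
    and b: "b \<in> S \<Longrightarrow> continuous (at b within S) f"
  shows "continuous_on S f"
  unfolding continuous_on_eq_continuous_within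
proof
  fix x assume x: "x \<in> S"
  show "continuous (at x within S) f"
  proof (cases "x \<in> W")
    case True
    obtain O' where O': "open O'" "W = S \<inter> O'" using W(1) by (auto simp: openin_open)
    have "at x within S = at x within W"
      by (rule at_within_nhd[of x O']) (use True O' in auto)
    then show ?thesis using f True by (simp add: continuous_on_eq_continuous_within)
  qed (use W(2) x b in blast)
qed

text \<open>With all four facets given, \<open>upper_of {..3}\<close> is the whole boundary of the
  tetrahedron, and \<open>all_faces\<close> says that \<open>T\<close> has no other simplices than
  its faces.\<close>

locale tetra_boundary = facet_family "{..3}" T A p for T :: "('a::euclidean_space) simplices" and A p +
  assumes all_faces: "T \<subseteq> {cell s g |s. s \<subset> {..3} \<and> s \<noteq> {}}"
begin

abbreviation bd :: "(nat \<Rightarrow> real) set" where "bd \<equiv> upper_of {..3}"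

definition mn :: "(nat \<Rightarrow> real) \<Rightarrow> real" where "mn t = low {..3} t"

text \<open>Central projection from the barycenter: \<open>t\<close> is the convex combination of
  \<open>center\<close> and \<open>radial t\<close> with weights \<open>4 * mn t\<close> and
  \<open>1 - 4 * mn t\<close>, where 4 counts the vertices.\<close>

definition radial :: "(nat \<Rightarrow> real) \<Rightarrow> nat \<Rightarrow> real" where
  "radial t = (\<lambda>i. if i \<le> 3 then (t i - mn t) / (1 - 4 * mn t) else 0)"

text \<open>The cone over \<open>g\<close> with apex at the origin. At \<open>center\<close> the
  scalar factor is 0, so the division by zero in \<open>radial\<close> does no harm.\<close>

definition \<tau> :: "(nat \<Rightarrow> real) \<Rightarrow> 'a" where
  "\<tau> t = (1 - 4 * mn t) *\<^sub>R g (radial t)"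

definition center :: "nat \<Rightarrow> real" where
  "center = (\<lambda>i. if i \<le> 3 then 1 / 4 else 0)"

lemma mn_le: "i \<le> 3 \<Longrightarrow> mn t \<le> t i"
  unfolding mn_def by (rule low_lower_bound) auto

lemma mn_att: "\<exists>i\<le>3. t i = mn t"
  unfolding mn_def using low_is_coord[of "{..3}" t] by auto

lemma mn_nonneg: "t \<in> standard_simplex 3 \<Longrightarrow> 0 \<le> mn t"
  unfolding mn_def by (rule low_simplex_bounds) auto

lemma mn_le4: 
  assumes "t \<in> standard_simplex 3" shows "mn t \<le> 1 / 4" "mn t = 1 / 4 \<Longrightarrow> t = center"
proof -
  have "(\<Sum>i\<in>{..3::nat}. mn t) \<le> (\<Sum>i\<le>3. t i)" by (intro sum_mono mn_le) auto
  then show "mn t \<le> 1 / 4" using simplex_sum[OF assms] by simp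
  assume m: "mn t = 1 / 4"
  have "(\<Sum>i\<le>3. t i - mn t) = 0" using simplex_sum[OF assms] m by (simp add: sum_subtractf)
  then have "\<forall>i\<in>{..3}. t i - mn t = 0"
    using sum_nonneg_eq_0_iff[of "{..3}" "\<lambda>i. t i - mn t"] mn_le by auto
  then show "t = center" using m simplex_beyond[OF assms] by (auto simp: center_def fun_eq_iff)
qed

lemma center_simplex: "center \<in> standard_simplex 3" and mn_center: "mn center = 1 / 4"
proof -
  show "center \<in> standard_simplex 3" by (rule in_simplexI) (auto simp: center_def)
  show "mn center = 1 / 4" using mn_att[of center] by (auto simp: center_def)
qed

lemma radial_bd:
  assumes t: "t \<in> standard_simplex 3" and m: "mn t < 1 / 4" shows "radial t \<in> bd"
proof -
  have pos: "0 < 1 - 4 * mn t" using m by simp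
  have "radial t \<in> standard_simplex 3"
  proof (rule in_simplexI)
    have "(\<Sum>i\<le>3. radial t i) = (\<Sum>i\<le>3. t i - mn t) / (1 - 4 * mn t)"
      by (simp add: radial_def sum_divide_distrib)
    also have "\<dots> = 1" using simplex_sum[OF t] pos by (simp add: sum_subtractf)
    finally show "(\<Sum>i\<le>3. radial t i) = 1" .
    show "0 \<le> radial t i" if "i \<le> 3" for i using mn_le[OF that, of t] pos by (simp add: radial_def)
  qed (auto simp: radial_def)
  moreover obtain i where "i \<le> 3" "t i = mn t" using mn_att by blast
  then have "i \<le> 3 \<and> radial t i = 0" by (simp add: radial_def)
  then have "\<not> {..3} \<subseteq> supp (radial t)" by (auto simp: supp_def)
  ultimately show ?thesis by (simp add: upper_supp)
qed

lemma bd_mn: "t \<in> bd \<longleftrightarrow> t \<in> standard_simplex 3 \<and> mn t = 0"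
  by (simp add: upper_of_def mn_def)

lemma radial_id: "t \<in> bd \<Longrightarrow> radial t = t"
  using simplex_beyond[of t 3] by (auto simp: radial_def bd_mn fun_eq_iff)

lemma norm_\<tau>: "t \<in> standard_simplex 3 \<Longrightarrow> norm (\<tau> t) = 1 - 4 * mn t"
proof -
  assume t: "t \<in> standard_simplex 3"
  show ?thesis
  proof (cases "mn t = 1 / 4")
    case False
    then have m: "mn t < 1 / 4" using mn_le4(1)[OF t] by simp
    then show ?thesis using g_sphere[OF radial_bd[OF t m]] by (simp add: \<tau>_def)
  qed (simp add: \<tau>_def)
qed

lemma \<tau>_bd: "t \<in> bd \<Longrightarrow> \<tau> t = g t"
  by (simp add: \<tau>_def radial_id) (simp add: bd_mn)

lemma \<tau>_inj: "inj_on \<tau> (standard_simplex 3)"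
proof
  fix t t' assume t: "t \<in> standard_simplex 3" and t': "t' \<in> standard_simplex 3" and e: "\<tau> t = \<tau> t'"
  have m: "mn t = mn t'" using norm_\<tau>[OF t] norm_\<tau>[OF t'] e by simp
  show "t = t'"
  proof (cases "mn t = 1 / 4")
    case True
    then show ?thesis using mn_le4(2)[OF t] mn_le4(2)[OF t'] m by simp
  next
    case False
    then have lt: "mn t < 1 / 4" "mn t' < 1 / 4" using mn_le4(1)[OF t] m by simp_all
    have "g (radial t) = g (radial t')" using e lt m by (simp add: \<tau>_def)
    then have r: "radial t = radial t'" using inj_onD[OF g_inj] radial_bd t t' lt by blast
    show ?thesis
    proof
      fix i
      show "t i = t' i"
      proof (cases "i \<le> 3")
        case True
        then show ?thesis using fun_cong[OF r, of i] m lt by (simp add: radial_def)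
      next
        case False
        then show ?thesis using simplex_beyond[OF t] simplex_beyond[OF t'] by simp
      qed
    qed
  qed
qed

lemma continuous_on_mn: "continuous_on S mn"
  unfolding mn_def low_def by (rule continuous_on_Min_coord) auto

lemma continuous_on_\<tau>: "continuous_on (standard_simplex 3) \<tau>"
proof (rule continuous_on_opens_and_point[where b=center])
  let ?W = "standard_simplex 3 \<inter> mn -` {..<1/4}"
  show "openin (top_of_set (standard_simplex 3)) ?W"
    by (rule continuous_openin_preimage_gen[OF continuous_on_mn]) simp
  show "standard_simplex 3 - ?W \<subseteq> {center}" using mn_le4 by fastforce
  have "continuous_on ?W radial"
  proof (rule continuous_on_coordinatewise_then_product)
    fix i
    show "continuous_on ?W (\<lambda>t. radial t i)"
      unfolding radial_def by (cases "i \<le> 3") (auto intro!: continuous_intros continuous_on_coord continuous_on_mn)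
  qed
  then have "continuous_on ?W (\<lambda>t. g (radial t))"
    by (rule continuous_on_compose2[OF continuous_on_g]) (use radial_bd in auto)
  then show "continuous_on ?W \<tau>"
    unfolding \<tau>_def by (intro continuous_intros continuous_on_mn)
  \<comment> \<open>Continuity of \<open>\<tau>\<close> at the barycenter cannot come from
    \<open>radial\<close>; it follows from the norm of \<open>\<tau>\<close> tending to 0.\<close>
  have "((\<lambda>t. 1 - 4 * mn t) \<longlongrightarrow> 1 - 4 * mn center) (at center within standard_simplex 3)"
    using continuous_on_mn[of "standard_simplex 3"] center_simplex
    by (intro tendsto_intros) (simp add: continuous_on_def)
  then have "((\<lambda>t. 1 - 4 * mn t) \<longlongrightarrow> 0) (at center within standard_simplex 3)" by (simp add: mn_center)
  then have "(\<tau> \<longlongrightarrow> 0) (at center within standard_simplex 3)"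
    by (rule Lim_null_comparison[rotated]) (auto simp: eventually_at_filter norm_\<tau>)
  then show "continuous (at center within standard_simplex 3) \<tau>"
    by (simp add: continuous_within \<tau>_def mn_center)
qed

lemma cell_in_T: "s \<subset> {..3} \<Longrightarrow> s \<noteq> {} \<Longrightarrow> cell s g \<in> T"
  by (rule cell_upper_in_T) auto

lemma cell_\<tau>: "s \<subset> {..3} \<Longrightarrow> s \<noteq> {} \<Longrightarrow> cell s \<tau> = cell s g"
proof (rule cell_cong)
  fix t assume "s \<subset> {..3}" "t \<in> standard_simplex 3" "supp t \<subseteq> s"
  then have "t \<in> bd" by (auto simp: upper_supp)
  then show "\<tau> t = g t" by (rule \<tau>_bd)
qed auto

definition solid :: "nat \<times> ((nat \<Rightarrow> real) \<Rightarrow> 'a)" where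
  "solid = (3, restrict \<tau> (standard_simplex 3))"

lemma sphere_onto: assumes "x \<in> sphere 0 1" obtains y where "y \<in> bd" "g y = x"
proof -
  obtain n \<sigma> t where nt: "(n, \<sigma>) \<in> T" "t \<in> open_simplex n" "\<sigma> t = x" using tri_point[OF T assms] .
  then obtain s where s: "(n, \<sigma>) = cell s g" "s \<subset> {..3}" "s \<noteq> {}" using all_faces by blast
  have n: "n = card s - 1" "\<sigma> = snd (cell s g)" using s(1) by (simp_all add: cell_def)
  have "s \<subseteq> {..3}" using s(2) by blast
  then have "x \<in> g ` {t \<in> standard_simplex 3. supp t \<subseteq> s}"
    using cell_image[of s 3 g] s(3) nt(2,3) n open_simplex_sub by blast
  moreover have "\<not> {..3} \<subseteq> supp t" if "supp t \<subseteq> s" for t using that s(2) by blast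
  then have "{t \<in> standard_simplex 3. supp t \<subseteq> s} \<subseteq> bd" by (auto simp: upper_supp)
  ultimately show ?thesis using that by blast
qed

lemma ball_onto:
  assumes "norm z < 1" obtains t where "t \<in> open_simplex 3" "\<tau> t = z"
proof -
  have o: "t \<in> open_simplex 3" if "t \<in> standard_simplex 3" "0 < mn t" for t
    using that mn_le[of _ t] by (force simp: open_simplex_def)
  show ?thesis
  proof (cases "z = 0")
    case True
    have "\<tau> center = z" using True by (simp add: \<tau>_def mn_center)
    then show ?thesis using that o[OF center_simplex] mn_center by simp
  next
    case False
    have "sgn z \<in> sphere 0 1" using False by (simp add: norm_sgn)
    then obtain y where y: "y \<in> bd" "g y = sgn z" by (rule sphere_onto)
    then have y3: "y \<in> standard_simplex 3" "mn y = 0" by (auto simp: bd_mn)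
    define r where "r = norm z"
    have r: "0 < r" "r < 1" using False assms by (auto simp: r_def)
    \<comment> \<open>The point on the segment from \<open>center\<close> to \<open>y\<close> at
      which the cone has norm \<open>r\<close>.\<close>
    define t where "t = (\<lambda>i. (1 - r) * center i + r * y i)"
    have t3: "t \<in> standard_simplex 3"
      using convex_standard_simplex[OF center_simplex y3(1)] r by (simp add: t_def)
    have ti: "t i = (1 - r) / 4 + r * y i" if "i \<le> 3" for i using that by (simp add: t_def center_def)
    have mt: "mn t = (1 - r) / 4"
    proof -
      obtain i where i: "i \<le> 3" "t i = mn t" using mn_att by blast
      obtain j where j: "j \<le> 3" "y j = 0" using mn_att[of y] y3(2) by auto
      have "(1 - r) / 4 \<le> mn t" using ti[OF i(1)] i(2) r simplex_nonneg[OF y3(1), of i] by simp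
      moreover have "mn t \<le> (1 - r) / 4" using mn_le[OF j(1), of t] ti[OF j(1)] j(2) by simp
      ultimately show ?thesis by simp
    qed
    have a: "1 - 4 * mn t = r" using mt by simp
    have "t i - mn t = r * y i" if "i \<le> 3" for i using ti[OF that] mt by simp
    then have "radial t = y"
      using a r simplex_beyond[OF y3(1)] by (auto simp: radial_def fun_eq_iff)
    then have "\<tau> t = r *\<^sub>R sgn z" using mt y(2) by (simp add: \<tau>_def)
    then have "\<tau> t = z" using False by (simp add: r_def sgn_div_norm)
    then show ?thesis using that o[OF t3] mt r by simp
  qed
qed

lemma solid_open:
  assumes "t \<in> open_simplex 3" shows "norm (\<tau> t) < 1"
proof -
  have "0 < mn t" using mn_att[of t] assms by (auto simp: open_simplex_def)
  then show ?thesis using norm_\<tau> assms open_simplex_sub by force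
qed

theorem fillable_boundary:
  assumes "proper_coloring T \<psi>" shows "fillable T \<psi>"
proof -
  let ?K = "insert solid T"
  have sT: "norm (\<sigma> t) = 1" if "(n, \<sigma>) \<in> T" "t \<in> standard_simplex n" for n \<sigma> t
    using tri_maps(2)[OF T that(1)] that(2) by auto
  have tri: "tri (cball 0 1) ?K"
  proof (rule triI)
    show "finite ?K" using tri_finite[OF T] by simp
  next
    fix n \<sigma> assume "(n, \<sigma>) \<in> ?K"
    then consider "(n, \<sigma>) \<in> T" | "n = 3" "\<sigma> = restrict \<tau> (standard_simplex 3)" by (auto simp: solid_def)
    then have "\<sigma> \<in> extensional (standard_simplex n) \<and> \<sigma> ` standard_simplex n \<subseteq> cball 0 1 \<and>
      continuous_on (standard_simplex n) \<sigma> \<and> inj_on \<sigma> (open_simplex n)"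
    proof cases
      case 1
      then show ?thesis using tri_maps[OF T 1] tri_cont[OF T 1] sT[OF 1] by (auto simp: cball_def)
    next
      case 2
      have "norm (\<tau> t) \<le> 1" if "t \<in> standard_simplex 3" for t using norm_\<tau>[OF that] mn_nonneg[OF that] by simp
      moreover have "inj_on \<sigma> (open_simplex 3)"
        using inj_on_subset[OF \<tau>_inj open_simplex_sub] open_simplex_sub[of 3] unfolding 2
        by (auto simp: inj_on_def subset_iff)
      ultimately show ?thesis using continuous_on_\<tau> unfolding 2 by (auto simp: cball_def cong: continuous_on_cong)
    qed
    then show "\<sigma> \<in> extensional (standard_simplex n)" "\<sigma> ` standard_simplex n \<subseteq> cball 0 1"
      "continuous_on (standard_simplex n) \<sigma>" "inj_on \<sigma> (open_simplex n)" by blast+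
  next
    fix z :: 'a assume "z \<in> cball 0 1"
    then consider "z \<in> sphere 0 1" | "norm z < 1" by fastforce
    then show "\<exists>n \<sigma>. (n, \<sigma>) \<in> ?K \<and> z \<in> \<sigma> ` open_simplex n"
    proof cases
      case 1
      then obtain n \<sigma> t where "(n, \<sigma>) \<in> T" "t \<in> open_simplex n" "\<sigma> t = z" by (rule tri_point[OF T])
      then show ?thesis by blast
    next
      case 2
      then obtain t where t: "t \<in> open_simplex 3" "\<tau> t = z" by (rule ball_onto)
      then have "z = restrict \<tau> (standard_simplex 3) t" using open_simplex_sub by auto
      then show ?thesis using t(1) unfolding solid_def by blast
    qed
  next
    fix n \<sigma> m \<rho> t t' assume a: "(n, \<sigma>) \<in> ?K" "(m, \<rho>) \<in> ?K" "t \<in> open_simplex n" "t' \<in> open_simplex m" "\<sigma> t = \<rho> t'"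
    have mixed: False if m: "(n, \<sigma>) \<in> T" "(m, \<rho>) = solid" "t \<in> open_simplex n" "t' \<in> open_simplex m" "\<sigma> t = \<rho> t'" for n \<sigma> m \<rho> t t'
    proof -
      have "norm (\<rho> t') < 1" using m(2,4) solid_open[of t'] open_simplex_sub[of 3] by (auto simp: solid_def)
      moreover have "norm (\<sigma> t) = 1" using sT[OF m(1)] m(3) open_simplex_sub by blast
      ultimately show False using m(5) by simp
    qed
    consider "(n, \<sigma>) \<in> T" "(m, \<rho>) \<in> T" | "(n, \<sigma>) \<in> T" "(m, \<rho>) = solid" | "(n, \<sigma>) = solid" "(m, \<rho>) \<in> T"
      | "(n, \<sigma>) = solid" "(m, \<rho>) = solid" using a(1,2) by blast
    then show "n = m \<and> \<sigma> = \<rho>"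
    proof cases
      case 1
      then show ?thesis using tri_unique(1,2)[OF T 1 a(3-5)] by simp
    next
      case 2
      then show ?thesis using mixed a(3-5) by blast
    next
      case 3
      then show ?thesis using mixed[OF 3(2,1) a(4,3)] a(5) by simp
    next
      case 4
      then have "(n, \<sigma>) = (m, \<rho>)" by simp
      then show ?thesis by simp
    qed
  next
    fix n \<sigma> s assume a: "(n, \<sigma>) \<in> ?K" "s \<subset> {..n}" "s \<noteq> {}"
    then consider "(n, \<sigma>) \<in> T" | "n = 3" "\<sigma> = restrict \<tau> (standard_simplex 3)" by (auto simp: solid_def)
    then show "cell s \<sigma> \<in> ?K"
    proof cases
      case 1
      then show ?thesis using tri_cell[OF T 1, of s] a(2,3) by blast
    next
      case 2
      have "cell s \<sigma> = cell s \<tau>"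
        by (rule cell_cong[of s 3]) (use a 2 in auto)
      then show ?thesis using cell_\<tau>[of s] cell_in_T[of s] a(2,3) 2(1) by simp
    qed
  qed
  have solid_not: "\<not> snd solid ` standard_simplex 3 \<subseteq> sphere 0 1"
  proof
    assume a: "snd solid ` standard_simplex 3 \<subseteq> sphere 0 1"
    obtain t :: "nat \<Rightarrow> real" where t: "t \<in> open_simplex 3" using open_simplex_nonempty by blast
    then have "snd solid t \<in> sphere 0 1" using a open_simplex_sub by blast
    then show False using solid_open[OF t] t open_simplex_sub[of 3] by (auto simp: solid_def)
  qed
  have "induced_triangulation (sphere 0 1) ?K = T"
  proof
    show "T \<subseteq> induced_triangulation (sphere 0 1) ?K"
      using tri_maps(2)[OF T] by (auto simp: induced_triangulation_def)
    show "induced_triangulation (sphere 0 1) ?K \<subseteq> T"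
      using solid_not by (auto simp: induced_triangulation_def solid_def)
  qed
  moreover have "vertices ?K \<subseteq> vertices T" by (auto simp: vertices_def solid_def)
  moreover have "proper_coloring ?K \<psi>" using assms by (auto simp: proper_coloring_def solid_def)
  ultimately show ?thesis unfolding fillable_def using tri by blast
qed

end

section \<open>Local structure of triangulated spheres\<close>

abbreviation S2 :: "(real^3) set" where "S2 \<equiv> sphere 0 1"

text \<open>Stereographic projection. The plane is taken as the complex numbers because the Jordan
  curve theorem will be applied there.\<close>

lemma sphere_chart:
  assumes "p \<in> S2"
  obtains h k where "homeomorphism (S2 - {p}) (UNIV::complex set) h k"
proof -
  let ?H = "{x::real^3. axis 1 1 \<bullet> x = 0}"
  have a: "axis 1 (1::real) \<noteq> (0::real^3)" by (simp add: axis_eq_0_iff)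
  have "(S2 - {p}) homeomorphic ?H"
    by (rule homeomorphic_punctured_sphere_hyperplane) (use assms a in auto)
  moreover have "?H homeomorphic (UNIV::complex set)"
    by (rule homeomorphic_subspaces) (auto simp: subspace_hyperplane dim_hyperplane a)
  ultimately show ?thesis
    using that unfolding homeomorphic_def by (meson homeomorphic_def homeomorphic_trans)
qed

lemma sphere_other_point: obtains q where "q \<in> S2" "q \<noteq> p"
proof -
  have "axis 1 1 \<in> S2" "- axis 1 1 \<in> S2" by (simp_all add: norm_axis_1)
  moreover have "axis 1 (1::real) \<noteq> (- axis 1 1 :: real^3)"
  proof
    assume "axis 1 (1::real) = (- axis 1 1 :: real^3)"
    then have "(axis 1 1 :: real^3) $ 1 = (- axis 1 1 :: real^3) $ 1" by (rule arg_cong)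
    then show False by (simp add: axis_def)
  qed
  ultimately show ?thesis using that by metis
qed

text \<open>Invariance of domain, in a chart that omits a point outside the image; if there is no
  such point, the image is the whole sphere.\<close>

lemma openin_sphere_image:
  assumes V: "open (V::complex set)" and f: "continuous_on V f" "inj_on f V" "f ` V \<subseteq> S2"
  shows "openin (top_of_set S2) (f ` V)"
proof (cases "f ` V = S2")
  case False
  then obtain p where p: "p \<in> S2" "p \<notin> f ` V" using f(3) by blast
  obtain h k where hk: "homeomorphism (S2 - {p}) (UNIV::complex set) h k" using sphere_chart[OF p(1)] .
  have sub: "f ` V \<subseteq> S2 - {p}" using f(3) p(2) by blast
  have e: "k (h (f x)) = f x" if "x \<in> V" for x
    by (rule homeomorphism_apply1[OF hk]) (use sub that in blast)
  have "continuous_on V (h \<circ> f)"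
    by (rule continuous_on_compose[OF f(1) continuous_on_subset[OF homeomorphism_cont1[OF hk] sub]])
  moreover have "inj_on (h \<circ> f) V"
    by (rule inj_on_inverseI[where g="the_inv_into V f \<circ> k"])
      (use e the_inv_into_f_f[OF f(2)] in simp)
  ultimately have "open ((h \<circ> f) ` V)" using invariance_of_domain V by blast
  then have "openin (top_of_set (S2 - {p})) ((S2 - {p}) \<inter> h -` ((h \<circ> f) ` V))"
    by (intro continuous_openin_preimage_gen[OF homeomorphism_cont1[OF hk]])
  moreover have "(S2 - {p}) \<inter> h -` ((h \<circ> f) ` V) = f ` V"
  proof
    show "(S2 - {p}) \<inter> h -` ((h \<circ> f) ` V) \<subseteq> f ` V"
    proof
      fix y assume "y \<in> (S2 - {p}) \<inter> h -` ((h \<circ> f) ` V)"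
      then obtain x where x: "y \<in> S2 - {p}" "x \<in> V" "h y = h (f x)" by auto
      then have "y = f x" using e[OF x(2)] homeomorphism_apply1[OF hk x(1)] by metis
      then show "y \<in> f ` V" using x(2) by blast
    qed
    show "f ` V \<subseteq> (S2 - {p}) \<inter> h -` ((h \<circ> f) ` V)" using sub by auto
  qed
  ultimately have "openin (top_of_set (S2 - {p})) (f ` V)" by simp
  moreover have "openin (top_of_set S2) (S2 - {p})"
    by (metis Diff_eq openin_open_Int open_Compl closed_singleton)
  ultimately show ?thesis using openin_trans by blast
qed simp

lemma open_from_sphere:
  assumes O: "openin (top_of_set S2) O'" and k: "continuous_on O' k" "inj_on k O'"
  shows "open (k ` O' :: complex set)"
proof -
  have *: "open (k ` (O' - {p}))" if p: "p \<in> S2" for p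
  proof -
    obtain h l where hl: "homeomorphism (S2 - {p}) (UNIV::complex set) h l" using sphere_chart[OF p] .
    have sub: "O' - {p} \<subseteq> S2 - {p}" using openin_imp_subset[OF O] by blast
    have "openin (top_of_set (S2 - {p})) (O' - {p})"
      using O unfolding openin_open by blast
    then have "openin (top_of_set (UNIV::complex set)) (h ` (O' - {p}))"
      using homeomorphism_imp_open_map[OF hl] by blast
    then have op: "open (h ` (O' - {p}))" by simp
    have lh: "l ` h ` (O' - {p}) = O' - {p}" using homeomorphism_apply1[OF hl] sub by (force simp: image_image)
    have "continuous_on (h ` (O' - {p})) (k \<circ> l)"
      by (rule continuous_on_compose[OF continuous_on_subset[OF homeomorphism_cont2[OF hl]]])
        (use lh in \<open>auto intro: continuous_on_subset[OF k(1)]\<close>)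
    moreover have "inj_on (k \<circ> l) (h ` (O' - {p}))"
    proof (rule comp_inj_on)
      show "inj_on l (h ` (O' - {p}))"
        by (rule inj_on_inverseI[where g=h]) (use homeomorphism_apply2[OF hl] in auto)
      show "inj_on k (l ` h ` (O' - {p}))" unfolding lh using k(2) inj_on_subset by blast
    qed
    ultimately have "open ((k \<circ> l) ` h ` (O' - {p}))" using invariance_of_domain op by blast
    moreover have "(k \<circ> l) ` h ` (O' - {p}) = k ` (O' - {p})" by (metis image_comp lh)
    ultimately show ?thesis by simp
  qed
  \<comment> \<open>A chart omits a point, so the set is covered by its parts in two charts that
    omit different points.\<close>
  obtain p where p: "p \<in> S2" using sphere_other_point by blast
  obtain q where q: "q \<in> S2" "q \<noteq> p" using sphere_other_point by blast
  have "k ` O' = k ` (O' - {p}) \<union> k ` (O' - {q})" using q(2) by blast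
  then show ?thesis using *[OF p] *[OF q(1)] by (metis open_Un)
qed

text \<open>The sphere has no boundary: the image is open in the plane, so it would contain points
  below \<open>k p\<close>. This will exclude edges with fewer than two triangles and isolated
  vertices.\<close>

lemma no_half_plane_chart:
  assumes O: "openin (top_of_set S2) O'" and k: "continuous_on O' k" "inj_on k O'"
    and p: "p \<in> O'" "Im (k p) = 0" and pos: "\<And>y. y \<in> O' \<Longrightarrow> 0 \<le> Im (k y)"
  shows False
proof -
  have "open (k ` O')" by (rule open_from_sphere[OF O k])
  then obtain \<epsilon> where \<epsilon>: "0 < \<epsilon>" "ball (k p) \<epsilon> \<subseteq> k ` O'" using p(1) open_contains_ball by blast
  let ?z = "k p - Complex 0 (\<epsilon> / 2)"
  have "?z \<in> ball (k p) \<epsilon>" using \<epsilon>(1) by (simp add: dist_norm norm_complex_def)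
  then obtain y where "y \<in> O'" "k y = ?z" using \<epsilon>(2) by (metis imageE subsetD)
  then have "0 \<le> Im ?z" using pos by metis
  then show False using p(2) \<epsilon>(1) by simp
qed

lemma no_solid_in_sphere:
  fixes f :: "real \<times> real \<times> real \<Rightarrow> real^3"
  assumes "open V" "V \<noteq> {}" "continuous_on V f" "inj_on f V" "f ` V \<subseteq> S2"
  shows False
proof -
  obtain x where x: "x \<in> V" using assms(2) by blast
  obtain p where p: "p \<in> S2" "p \<noteq> f x" using sphere_other_point by blast
  obtain h k where hk: "homeomorphism (S2 - {p}) (UNIV::complex set) h k" using sphere_chart[OF p(1)] .
  let ?W = "V \<inter> f -` (- {p})"
  have W: "open ?W" by (rule continuous_open_preimage[OF assms(3,1)]) (simp add: open_Compl)
  have sub: "f ` ?W \<subseteq> S2 - {p}" using assms(5) by blast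
  have e: "k (h (f x)) = f x" if "x \<in> ?W" for x
    by (rule homeomorphism_apply1[OF hk]) (use sub that in blast)
  have c: "continuous_on ?W (h \<circ> f)"
    by (rule continuous_on_compose[OF continuous_on_subset[OF assms(3)] continuous_on_subset[OF homeomorphism_cont1[OF hk] sub]]) auto
  have "inj_on (h \<circ> f) ?W"
    by (rule inj_on_inverseI[where g="the_inv_into V f \<circ> k"])
      (use e the_inv_into_f_f[OF assms(4)] in simp)
  from invariance_of_dimension[OF c W this] show False using x p(2) by auto
qed

text \<open>One of the points serves as the omitted point of a chart, and the remaining ones cannot
  separate the plane because they are countable.\<close>

lemma connected_sphere_diff:
  assumes "finite V" "p \<in> V" "V \<subseteq> S2"
  shows "connected (S2 - V)"
proof -
  obtain h k where hk: "homeomorphism (S2 - {p}) (UNIV::complex set) h k" using sphere_chart assms by blast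
  have "connected (- (h ` (V - {p})))"
    by (intro path_connected_imp_connected path_connected_complement_countable)
      (use assms(1) in \<open>auto intro: countable_finite\<close>)
  then have "connected (k ` (- (h ` (V - {p}))))"
    by (rule connected_continuous_image[rotated]) (rule continuous_on_subset[OF homeomorphism_cont2[OF hk]], simp)
  moreover have "k ` (- (h ` (V - {p}))) = S2 - V"
  proof
    show "k ` (- (h ` (V - {p}))) \<subseteq> S2 - V"
    proof
      fix y assume "y \<in> k ` (- (h ` (V - {p})))"
      then obtain z where z: "z \<notin> h ` (V - {p})" "y = k z" by blast
      have "y \<in> S2 - {p}" using homeomorphism_image2[OF hk] z(2) by blast
      moreover have "h y = z" using homeomorphism_apply2[OF hk] z(2) by simp
      ultimately show "y \<in> S2 - V" using z(1) by auto
    qed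
    show "S2 - V \<subseteq> k ` (- (h ` (V - {p})))"
    proof
      fix y assume y: "y \<in> S2 - V"
      have "y \<in> S2 - {p}" using y assms(2) by blast
      then have ky: "k (h y) = y" by (rule homeomorphism_apply1[OF hk])
      have "h y \<notin> h ` (V - {p})"
      proof
        assume "h y \<in> h ` (V - {p})"
        then obtain v where v: "v \<in> V - {p}" "h y = h v" by blast
        then have "k (h v) = v" using homeomorphism_apply1[OF hk, of v] assms(3) by blast
        then have "v = y" using ky v(2) by metis
        then show False using v y by blast
      qed
      then show "y \<in> k ` (- (h ` (V - {p})))" using ky by (metis ComplI image_eqI)
    qed
  qed
  ultimately show ?thesis by simp
qed

text \<open>The neighborhood is a round disc in a chart; a punctured disc in the plane is
  connected.\<close>

lemma connected_punctured_nhd: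
  assumes O: "openin (top_of_set S2) O'" and p: "p \<in> O'"
  obtains B where "openin (top_of_set S2) B" "p \<in> B" "B \<subseteq> O'" "connected (B - {p})"
proof -
  have pS: "p \<in> S2" using openin_imp_subset[OF O] p by blast
  obtain q where q: "q \<in> S2" "q \<noteq> p" using sphere_other_point by blast
  obtain h k where hk: "homeomorphism (S2 - {q}) (UNIV::complex set) h k" using sphere_chart[OF q(1)] .
  have "openin (top_of_set (S2 - {q})) (O' - {q})"
    using O unfolding openin_open by blast
  then have "openin (top_of_set (UNIV::complex set)) (h ` (O' - {q}))"
    using homeomorphism_imp_open_map[OF hk] by blast
  then have "open (h ` (O' - {q}))" by simp
  moreover have "h p \<in> h ` (O' - {q})" using p q by blast
  ultimately obtain \<epsilon> where \<epsilon>: "0 < \<epsilon>" "ball (h p) \<epsilon> \<subseteq> h ` (O' - {q})" using open_contains_ball by blast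
  have kh: "k (h y) = y" if "y \<in> O' - {q}" for y
    using homeomorphism_apply1[OF hk] that openin_imp_subset[OF O] by blast
  have hk': "h (k z) = z" for z using homeomorphism_apply2[OF hk] by simp
  let ?B = "k ` ball (h p) \<epsilon>"
  have "?B \<subseteq> O' - {q}" using \<epsilon>(2) kh by (force simp: subset_iff image_iff)
  moreover have "openin (top_of_set S2) ?B"
  proof (rule openin_sphere_image)
    show "continuous_on (ball (h p) \<epsilon>) k" using continuous_on_subset[OF homeomorphism_cont2[OF hk]] by simp
    show "inj_on k (ball (h p) \<epsilon>)" by (rule inj_on_inverseI[where g=h]) (simp add: hk')
    show "k ` ball (h p) \<epsilon> \<subseteq> S2" using homeomorphism_image2[OF hk] by blast
  qed simp
  moreover have "k (h p) = p" using kh p q by blast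
  moreover from this have "p \<in> ?B" using \<epsilon>(1) by (metis centre_in_ball image_eqI)
  moreover have "connected (?B - {p})"
  proof -
    have "connected (ball (h p) \<epsilon> - {h p})"
      by (rule connected_punctured_ball) simp
    then have "connected (k ` (ball (h p) \<epsilon> - {h p}))"
      by (rule connected_continuous_image[rotated]) (rule continuous_on_subset[OF homeomorphism_cont2[OF hk]], simp)
    moreover have "k ` (ball (h p) \<epsilon> - {h p}) = ?B - {p}"
      using \<open>k (h p) = p\<close> hk' by (auto simp: image_iff)
    ultimately show ?thesis by simp
  qed
  ultimately show ?thesis using that by blast
qed

lemma simplex_segment:
  assumes "t0 \<in> standard_simplex n" "t1 \<in> standard_simplex n"
    and W: "openin (top_of_set (standard_simplex n)) W" "t0 \<in> W"
  obtains l where "0 < l" "l \<le> 1" "(\<lambda>i. (1 - l) * t0 i + l * t1 i) \<in> W"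
proof -
  define c where "c = (\<lambda>l::real. \<lambda>i. (1 - l) * t0 i + l * t1 i)"
  have "continuous_on {0..1} c"
    unfolding c_def by (intro continuous_on_coordinatewise_then_product continuous_intros)
  moreover have "c \<in> {0..1} \<rightarrow> standard_simplex n"
    using convex_standard_simplex[OF assms(1,2)] by (auto simp: c_def)
  ultimately have "openin (top_of_set {0..1}) ({0..1} \<inter> c -` W)"
    using W(1) continuous_on_open_gen[of c "{0..1}" "standard_simplex n"] by blast
  moreover have "c 0 = t0" by (simp add: c_def)
  then have "0 \<in> {0..1} \<inter> c -` W" using W(2) by simp
  ultimately obtain \<epsilon> where \<epsilon>: "0 < \<epsilon>" "ball 0 \<epsilon> \<inter> {0..1} \<subseteq> {0..1} \<inter> c -` W"
    unfolding openin_contains_ball by meson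
  define l where "l = min (\<epsilon> / 2) 1"
  have "0 < l" "l \<le> 1" "l \<in> ball 0 \<epsilon> \<inter> {0..1}" using \<epsilon>(1) by (auto simp: l_def)
  moreover from this have "c l \<in> W" using \<epsilon>(2) by blast
  ultimately show ?thesis using that by (simp add: c_def)
qed

lemma vrank_pair: "i < j \<Longrightarrow> vrank {i, j} i = 0 \<and> vrank {i, j} j = 1"
proof -
  assume "i < j"
  then have "{k \<in> {i, j}. k < i} = {}" "{k \<in> {i, j}. k < j} = {i}" by auto
  then show ?thesis unfolding vrank_def by simp
qed

lemma card_omit3: "i \<le> 2 \<Longrightarrow> card ({..2} - {i::nat}) = 2"
  by simp

section \<open>Simplices of a triangulated sphere without loops\<close>

locale colored_sphere =
  fixes T :: "(real^3) simplices"
  assumes T: "tri S2 T"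
    and no_loop: "(1, e) \<in> T \<Longrightarrow> e (simplex_vertex 0) \<noteq> e (simplex_vertex 1)"
begin

lemma vert_inj:
  assumes "(n, \<sigma>) \<in> T" shows "inj_on (\<lambda>i. \<sigma> (simplex_vertex i)) {..n}"
proof -
  have *: "\<sigma> (simplex_vertex i) \<noteq> \<sigma> (simplex_vertex j)" if ij: "i < j" "j \<le> n" for i j
  proof -
    have c: "card {i, j} - 1 = 1" using ij by simp
    have "(1, snd (cell {i, j} \<sigma>)) \<in> T" using tri_cell'[OF T assms, of "{i, j}"] ij c by simp
    from no_loop[OF this] show ?thesis
      using cell_vertex[of "{i, j}" i \<sigma>] cell_vertex[of "{i, j}" j \<sigma>] vrank_pair[OF ij(1)] by simp
  qed
  show ?thesis
    by (rule inj_onI) (metis * atMost_iff linorder_neqE_nat)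
qed

lemma cell_inj:
  assumes "(n, \<sigma>) \<in> T" and s: "s \<subseteq> {..n}" "s \<noteq> {}" and r: "r \<subseteq> {..n}" "r \<noteq> {}" and eq: "cell s \<sigma> = cell r \<sigma>"
  shows "s = r"
proof -
  have f: "finite s" "finite r" using s r finite_subset by blast+
  have "(\<lambda>i. \<sigma> (simplex_vertex i)) ` s = (\<lambda>i. \<sigma> (simplex_vertex i)) ` r"
    using cell_vertices[OF f(1) s(2), of \<sigma>] cell_vertices[OF f(2) r(2), of \<sigma>] eq
    by (metis fst_cell)
  then show ?thesis using inj_on_image_eq_iff[OF vert_inj[OF assms(1)] s(1) r(1)] by simp
qed

text \<open>Identified points are interior points of equal faces, and without loops a face
  determines its vertex set, because all corners of a simplex are distinct.\<close>

lemma embedded: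
  assumes \<sigma>: "(n, \<sigma>) \<in> T" shows "inj_on \<sigma> (standard_simplex n)"
proof
  fix t t' assume t: "t \<in> standard_simplex n" "t' \<in> standard_simplex n" and e: "\<sigma> t = \<sigma> t'"
  note c = tri_coincidence[OF T \<sigma> \<sigma> t e]
  have "supp t = supp t'"
    by (rule cell_inj[OF \<sigma> supp_sub[OF t(1)] supp_ne[OF t(1)] supp_sub[OF t(2)] supp_ne[OF t(2)] c(1)])
  then show "t = t'" using c(2) by metis
qed

lemma image_S2: "(n, \<sigma>) \<in> T \<Longrightarrow> t \<in> standard_simplex n \<Longrightarrow> \<sigma> t \<in> S2"
  using tri_maps(2)[OF T] by blast

lemma dim2:
  assumes "(n, \<sigma>) \<in> T" shows "n \<le> 2"
proof (rule ccontr)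
  assume "\<not> n \<le> 2"
  then have "{..3} \<subseteq> {..n}" by auto
  then have "(3, snd (cell {..3} \<sigma>)) \<in> T" using tri_cell'[OF T assms, of "{..3}"] by simp
  then obtain \<rho> where \<rho>: "(3, \<rho>) \<in> T" by blast
  \<comment> \<open>Parametrizes the interior of the 3-simplex by its last three coordinates, which
    range over an open set of 3-space; invariance of dimension forbids this in a sphere.\<close>
  define f :: "real \<times> real \<times> real \<Rightarrow> nat \<Rightarrow> real" where
    "f = (\<lambda>x i. if i = 0 then 1 - fst x - fst (snd x) - snd (snd x) else if i = 1 then fst x else if i = 2 then fst (snd x)
      else if i = 3 then snd (snd x) else 0)"
  define V where "V = {x :: real \<times> real \<times> real. 0 < fst x \<and> 0 < fst (snd x) \<and> 0 < snd (snd x)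
      \<and> fst x + fst (snd x) + snd (snd x) < 1}"
  have "open V" unfolding V_def by (intro open_Collect_conj open_Collect_less continuous_intros)
  moreover have "(1/4, 1/4, 1/4) \<in> V" by (simp add: V_def)
  moreover have fV: "f x \<in> standard_simplex 3" if "x \<in> V" for x
    by (rule in_simplexI) (use that in \<open>auto simp: f_def V_def numeral_3_eq_3 atMost_Suc\<close>)
  moreover have cf: "continuous_on V f"
  proof (rule continuous_on_coordinatewise_then_product)
    fix i :: nat
    consider "i = 0" | "i = 1" | "i = 2" | "i = 3" | "3 < i" by linarith
    then show "continuous_on V (\<lambda>x. f x i)"
      by cases (auto simp: f_def intro!: continuous_intros)
  qed
  moreover have "continuous_on V (\<lambda>x. \<rho> (f x))"
    using continuous_on_compose2[OF tri_cont[OF T \<rho>] cf] fV by blast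
  moreover have "inj_on (\<lambda>x. \<rho> (f x)) V"
  proof
    fix x y assume x: "x \<in> V" and y: "y \<in> V" and e: "\<rho> (f x) = \<rho> (f y)"
    have eq: "f x = f y" using inj_onD[OF embedded[OF \<rho>], of "f x" "f y"] e fV x y by blast
    have "f x 1 = f y 1" "f x 2 = f y 2" "f x 3 = f y 3" using eq by auto
    then show "x = y" by (simp add: f_def prod_eq_iff)
  qed
  moreover have "(\<lambda>x. \<rho> (f x)) ` V \<subseteq> S2" using fV image_S2[OF \<rho>] by blast
  ultimately show False using no_solid_in_sphere[of V "\<lambda>x. \<rho> (f x)"] by blast
qed

lemma compact_image: "(n, \<sigma>) \<in> T \<Longrightarrow> compact (\<sigma> ` standard_simplex n)"
  using compact_continuous_image[OF tri_cont[OF T] compact_simplex] by blast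

text \<open>The simplices that miss \<open>p\<close> form a finite union of compact sets; the
  neighborhood is its complement.\<close>

lemma star_nhd:
  assumes p: "p \<in> S2"
  obtains N where "openin (top_of_set S2) N" "p \<in> N"
    "\<And>m \<tau>. (m, \<tau>) \<in> T \<Longrightarrow> N \<inter> \<tau> ` standard_simplex m \<noteq> {} \<Longrightarrow> p \<in> \<tau> ` standard_simplex m"
proof
  let ?C = "\<Union>(m, \<tau>)\<in>{(m, \<tau>)\<in>T. p \<notin> \<tau> ` standard_simplex m}. \<tau> ` standard_simplex m"
  have "finite {(m, \<tau>)\<in>T. p \<notin> \<tau> ` standard_simplex m}" using tri_finite[OF T] by (rule rev_finite_subset) auto
  then have "closed ?C" using compact_image by (intro compact_imp_closed compact_UN) auto
  then have "openin (top_of_set S2) (S2 \<inter> - ?C)" by (intro openin_open_Int open_Compl)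
  then show "openin (top_of_set S2) (S2 - ?C)" by (simp only: Diff_eq)
  show "p \<in> S2 - ?C" using p by blast
qed blast

text \<open>On a segment from \<open>t0\<close> towards an interior point of the simplex, every
  point other than \<open>t0\<close> is interior.\<close>

lemma open_point_near:
  assumes \<sigma>: "(n, \<sigma>) \<in> T" and t0: "t0 \<in> standard_simplex n" and N: "openin (top_of_set S2) N" "\<sigma> t0 \<in> N"
  obtains t where "t \<in> open_simplex n" "\<sigma> t \<in> N"
proof -
  obtain t1 where t1: "t1 \<in> open_simplex n" using open_simplex_nonempty by blast
  have "\<sigma> \<in> standard_simplex n \<rightarrow> S2" using image_S2[OF \<sigma>] by blast
  then have W: "openin (top_of_set (standard_simplex n)) (standard_simplex n \<inter> \<sigma> -` N)"
    using tri_cont[OF T \<sigma>] N(1) continuous_on_open_gen by blast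
  have t1': "t1 \<in> standard_simplex n" using t1 open_simplex_sub by blast
  have "t0 \<in> standard_simplex n \<inter> \<sigma> -` N" using t0 N(2) by blast
  from simplex_segment[OF t0 t1' W this] obtain l where l: "0 < l" "l \<le> 1"
    "(\<lambda>i. (1 - l) * t0 i + l * t1 i) \<in> standard_simplex n \<inter> \<sigma> -` N" .
  have "(\<lambda>i. (1 - l) * t0 i + l * t1 i) \<in> open_simplex n"
    using l t1 simplex_nonneg[OF t0] by (auto simp: open_simplex_def intro!: add_nonneg_pos mult_nonneg_nonneg)
  then show ?thesis using that l(3) by blast
qed

text \<open>If one simplex covers an open set, \<open>\<kappa>\<close> composed with its inverse is
  a chart into the closed half-plane. A map \<open>\<kappa>\<close> with values on the real axis
  makes this applicable to edges and vertices too.\<close>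

lemma not_locally_bounded_by:
  assumes N: "openin (top_of_set S2) N" and \<sigma>: "(n, \<sigma>) \<in> T" and cov: "N \<subseteq> \<sigma> ` standard_simplex n"
    and \<kappa>: "continuous_on (standard_simplex n) \<kappa>" "inj_on \<kappa> (standard_simplex n)"
      "\<And>t. t \<in> standard_simplex n \<Longrightarrow> 0 \<le> Im (\<kappa> t)"
    and t: "t \<in> standard_simplex n" "\<sigma> t \<in> N" "Im (\<kappa> t) = 0"
  shows False
proof -
  let ?k = "\<kappa> \<circ> the_inv_into (standard_simplex n) \<sigma>"
  have img: "the_inv_into (standard_simplex n) \<sigma> y \<in> standard_simplex n" if "y \<in> N" for y
    using the_inv_into_into[OF embedded[OF \<sigma>]] cov that by blast
  have "continuous_on (\<sigma> ` standard_simplex n) (the_inv_into (standard_simplex n) \<sigma>)"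
    by (rule continuous_on_inv_into[OF tri_cont[OF T \<sigma>] compact_simplex embedded[OF \<sigma>]])
  then have "continuous_on N (the_inv_into (standard_simplex n) \<sigma>)" using cov continuous_on_subset by blast
  then have c: "continuous_on N ?k"
    by (rule continuous_on_compose) (use img in \<open>auto intro: continuous_on_subset[OF \<kappa>(1)]\<close>)
  have i: "inj_on ?k N"
  proof (rule comp_inj_on)
    show "inj_on (the_inv_into (standard_simplex n) \<sigma>) N"
      by (rule inj_on_subset[OF inj_on_the_inv_into[OF embedded[OF \<sigma>]] cov])
    show "inj_on \<kappa> (the_inv_into (standard_simplex n) \<sigma> ` N)"
      by (rule inj_on_subset[OF \<kappa>(2)]) (use img in blast)
  qed
  show False
    by (rule no_half_plane_chart[OF N c i t(2)])
      (use t(3) the_inv_into_f_f[OF embedded[OF \<sigma>] t(1)] \<kappa>(3) img in auto)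
qed

end

text \<open>Coordinates on a triangle near the midpoint of the edge opposite to \<open>i\<close>:
  the imaginary part is the barycentric coordinate of \<open>i\<close>, and the real part moves
  along the edge. Two triangles at an edge can then be glued along the real axis.\<close>

definition half :: "nat \<Rightarrow> complex \<Rightarrow> nat \<Rightarrow> real" where
  "half i z = (\<lambda>k. push ({..2} - {i}) (\<lambda>m. if m = 0 then 1/2 - Re z - Im z / 2 else if m = 1 then 1/2 + Re z - Im z / 2 else 0) k
      + (if k = i then Im z else 0))"

text \<open>With the bound 1/4 the other two barycentric coordinates
  \<open>1/2 \<plusminus> Re z - Im z / 2\<close> stay above 1/8.\<close>

definition square :: "complex set" where
  "square = {z. - 1/4 < Re z \<and> Re z < 1/4 \<and> - 1/4 < Im z \<and> Im z < 1/4}"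

lemma vrank_omit3: "i \<le> 2 \<Longrightarrow> k \<le> 2 \<Longrightarrow> k \<noteq> i \<Longrightarrow> vrank ({..2} - {i}) k < 2"
  using rank_lt_card[of "{..2} - {i}" k] card_omit3[of i] by simp

lemma half_simplex:
  assumes "i \<le> 2" "z \<in> square" "0 \<le> Im z"
  shows "half i z \<in> standard_simplex 2" "0 < Im z \<Longrightarrow> half i z \<in> open_simplex 2"
proof -
  let ?w = "\<lambda>m::nat. if m = 0 then 1/2 - Re z - Im z / 2 else if m = 1 then 1/2 + Re z - Im z / 2 else 0"
  have "(\<Sum>k\<le>2. half i z k) = (\<Sum>k\<le>2. push ({..2} - {i}) ?w k) + (\<Sum>k\<le>2. if k = i then Im z else 0)"
    by (simp add: half_def sum.distrib)
  also have "(\<Sum>k\<le>2. push ({..2} - {i}) ?w k) = (\<Sum>m<2. ?w m)"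
    using push_sum[of "{..2} - {i}" "{..2}" ?w] card_omit3[OF assms(1)] by simp
  also have "\<dots> = 1 - Im z" by (simp add: numeral_2_eq_2)
  also have "(\<Sum>k\<le>2. if k = i then Im z else 0) = Im z" using assms(1) by simp
  finally have s: "(\<Sum>k\<le>2. half i z k) = 1" by simp
  have w: "0 < ?w m" if "m < 2" for m using that assms(2,3) by (auto simp: square_def less_2_cases_iff)
  have pos: "0 < half i z k" if "k \<le> 2" "k \<noteq> i" for k
    using w[OF vrank_omit3[OF assms(1) that]] that by (simp add: half_def push_def)
  have i: "half i z i = Im z" by (simp add: half_def push_def)
  show *: "half i z \<in> standard_simplex 2"
  proof (rule in_simplexI[OF _ _ s])
    show "0 \<le> half i z k" if "k \<le> 2" for k using pos[OF that] i assms(3) by (cases "k = i") auto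
    show "half i z k = 0" if "2 < k" for k using that assms(1) by (simp add: half_def push_def)
  qed
  show "half i z \<in> open_simplex 2" if z: "0 < Im z"
  proof -
    have "0 < half i z k" if "k \<le> 2" for k using pos[OF that] i z by (cases "k = i") auto
    then show ?thesis unfolding open_simplex_def using * by blast
  qed
qed

definition edge_point :: "real \<Rightarrow> nat \<Rightarrow> real" where
  "edge_point x = (\<lambda>m. if m = 0 then 1/2 - x else if m = 1 then 1/2 + x else 0)"

lemma half_real:
  assumes "i \<le> 2" "z \<in> square" "Im z = 0"
  shows "edge_point (Re z) \<in> open_simplex 1" "half i z = push ({..2} - {i}) (edge_point (Re z))"
proof -
  have "edge_point (Re z) \<in> standard_simplex 1"
    by (rule in_simplexI) (use assms(2) in \<open>auto simp: square_def edge_point_def\<close>)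
  then show "edge_point (Re z) \<in> open_simplex 1"
    using assms(2) by (auto simp: open_simplex_def square_def edge_point_def)
  show "half i z = push ({..2} - {i}) (edge_point (Re z))"
    using assms(3) by (auto simp: half_def push_def edge_point_def fun_eq_iff)
qed

lemma half_inj:
  assumes "i \<le> 2" "half i z = half i z'" shows "z = z'"
proof -
  have im: "Im z = Im z'" using fun_cong[OF assms(2), of i] by (simp add: half_def push_def)
  have "0 \<in> vrank ({..2} - {i}) ` ({..2} - {i})"
    using rank_image[of "{..2} - {i}"] card_omit3[OF assms(1)] by simp
  then obtain k where k: "0 = vrank ({..2} - {i}) k" "k \<in> {..2} - {i}" by (rule imageE)
  have "Re z = Re z'" using fun_cong[OF assms(2), of k] k im by (simp add: half_def push_def)
  then show ?thesis using im by (simp add: complex_eq_iff)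
qed

lemma continuous_on_half: "continuous_on S (half i)"
proof (rule continuous_on_coordinatewise_then_product)
  fix k
  show "continuous_on S (\<lambda>z. half i z k)"
    unfolding half_def push_def
    by (cases "k = i"; cases "k \<in> {..2} - {i}"; cases "vrank ({..2} - {i}) k = 0"; cases "vrank ({..2} - {i}) k = 1")
      (auto intro!: continuous_intros)
qed

lemma open_square: "open square"
  unfolding square_def by (intro open_Collect_conj open_Collect_less continuous_intros)

definition incident :: "'a simplices \<Rightarrow> ((nat \<Rightarrow> real) \<Rightarrow> 'a) \<Rightarrow> ((nat \<Rightarrow> real) \<Rightarrow> 'a) set" where
  "incident T e = {\<sigma>. (2, \<sigma>) \<in> T \<and> (\<exists>i\<le>2. cell ({..2} - {i}) \<sigma> = (1, e))}"

section \<open>An edge lies in at most two triangles\<close>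

context colored_sphere
begin

lemma finite_incident: "finite (incident T e)"
proof -
  have "incident T e \<subseteq> snd ` T" unfolding incident_def by force
  then show ?thesis using tri_finite[OF T] finite_surj by blast
qed

lemma edge_point_of:
  assumes \<sigma>: "(2, \<sigma>) \<in> T" and i: "i \<le> 2" "cell ({..2} - {i}) \<sigma> = (1, e)" and z: "z \<in> square" "Im z = 0"
  shows "\<sigma> (half i z) = e (edge_point (Re z))"
proof -
  have "e (edge_point (Re z)) = snd (cell ({..2} - {i}) \<sigma>) (edge_point (Re z))" using i(2) by simp
  also have "\<dots> = \<sigma> (push ({..2} - {i}) (edge_point (Re z)))"
    using snd_cell[of "edge_point (Re z)" "{..2} - {i}" \<sigma>] half_real(1)[OF i(1) z] card_omit3[OF i(1)] open_simplex_sub by auto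
  finally show ?thesis using half_real(2)[OF i(1) z] by simp
qed

text \<open>By invariance of domain, two triangles glued along \<open>e\<close> already cover an
  open neighborhood of an inner point of \<open>e\<close>. A third triangle would have interior
  points in this neighborhood, which are then points of the first two triangles or of
  \<open>e\<close>.\<close>

lemma incident_le2:
  assumes e: "(1, e) \<in> T" and "\<sigma> \<in> incident T e" "\<sigma>' \<in> incident T e" "\<sigma>'' \<in> incident T e"
    and ne: "\<sigma> \<noteq> \<sigma>'" "\<sigma>'' \<noteq> \<sigma>" "\<sigma>'' \<noteq> \<sigma>'"
  shows False
proof -
  obtain i where \<sigma>: "(2, \<sigma>) \<in> T" "i \<le> 2" "cell ({..2} - {i}) \<sigma> = (1, e)" using assms(2) unfolding incident_def by blast
  obtain i' where \<sigma>': "(2, \<sigma>') \<in> T" "i' \<le> 2" "cell ({..2} - {i'}) \<sigma>' = (1, e)" using assms(3) unfolding incident_def by blast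
  obtain j where \<sigma>'': "(2, \<sigma>'') \<in> T" "j \<le> 2" "cell ({..2} - {j}) \<sigma>'' = (1, e)" using assms(4) unfolding incident_def by blast
  \<comment> \<open>Conjugation folds the lower half of the square onto the upper one, where
    \<open>half i'\<close> takes values in the simplex.\<close>
  define f where "f = (\<lambda>z. if Im z \<le> 0 then \<sigma>' (half i' (cnj z)) else \<sigma> (half i z))"
  have cnj: "cnj z \<in> square \<longleftrightarrow> z \<in> square" for z by (auto simp: square_def)
  note hu = half_simplex[OF \<sigma>(2)] and hl = half_simplex[OF \<sigma>'(2)]
  have agree: "\<sigma>' (half i' (cnj z)) = \<sigma> (half i z)" if "z \<in> square" "Im z = 0" for z
    using edge_point_of[OF \<sigma> that] edge_point_of[OF \<sigma>', of "cnj z"] that cnj by simp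
  have edge: "\<exists>w \<in> open_simplex 1. f z = e w" if "z \<in> square" "Im z = 0" for z
    using edge_point_of[OF \<sigma>', of "cnj z"] half_real(1)[OF \<sigma>(2) that] that cnj by (auto simp: f_def)
  have up: "f z = \<sigma> (half i z) \<and> half i z \<in> open_simplex 2" if "z \<in> square" "0 < Im z" for z
    using hu(2)[OF that(1)] that by (simp add: f_def)
  have lo: "f z = \<sigma>' (half i' (cnj z)) \<and> half i' (cnj z) \<in> open_simplex 2" if "z \<in> square" "Im z < 0" for z
    using hl(2)[of "cnj z"] that cnj by (simp add: f_def)
  have "continuous_on square f"
    unfolding f_def
  proof (rule continuous_on_cases_le)
    show "continuous_on {z \<in> square. Im z \<le> 0} (\<lambda>z. \<sigma>' (half i' (cnj z)))"
    proof (rule continuous_on_compose2[OF tri_cont[OF T \<sigma>'(1)]])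
      show "continuous_on {z \<in> square. Im z \<le> 0} (\<lambda>z. half i' (cnj z))"
        by (rule continuous_on_compose2[OF continuous_on_half[of UNIV]]) (auto intro: continuous_intros)
      show "(\<lambda>z. half i' (cnj z)) ` {z \<in> square. Im z \<le> 0} \<subseteq> standard_simplex 2"
        using hl(1) cnj by auto
    qed
    show "continuous_on {z \<in> square. 0 \<le> Im z} (\<lambda>z. \<sigma> (half i z))"
      by (rule continuous_on_compose2[OF tri_cont[OF T \<sigma>(1)] continuous_on_half]) (use hu(1) in auto)
    show "\<sigma>' (half i' (cnj z)) = \<sigma> (half i z)" if "z \<in> square" "Im z = 0" for z by (rule agree[OF that])
  qed (intro continuous_intros)
  moreover have "f ` square \<subseteq> S2"
    using hu(1) hl(1) cnj image_S2[OF \<sigma>(1)] image_S2[OF \<sigma>'(1)] by (auto simp: f_def)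
  moreover have "inj_on f square"
  proof
    fix z z' assume z: "z \<in> square" "z' \<in> square" and eq: "f z = f z'"
    have A: False if "z \<in> square" "z' \<in> square" "f z = f z'" "0 < Im z" "Im z' < 0" for z z'
      using tri_unique(2)[OF T \<sigma>(1) \<sigma>'(1)] up[OF that(1,4)] lo[OF that(2,5)] that(3) ne(1) by metis
    have B: False if C: "z \<in> square" "z' \<in> square" "f z = f z'" "Im z \<noteq> 0" "Im z' = 0" for z z'
    proof -
      obtain w where w: "w \<in> open_simplex 1" "f z' = e w" using edge[OF C(2,5)] by blast
      show False
      proof (cases "0 < Im z")
        case True
        then show ?thesis using tri_unique(1)[OF T \<sigma>(1) e _ w(1)] up[OF C(1) True] w(2) C(3) by auto
      next
        case False
        then have "Im z < 0" using C(4) by simp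
        then show ?thesis using tri_unique(1)[OF T \<sigma>'(1) e _ w(1)] lo[OF C(1)] w(2) C(3) by auto
      qed
    qed
    consider "0 \<le> Im z \<and> 0 \<le> Im z'" | "Im z \<le> 0 \<and> Im z' \<le> 0"
      | "0 < Im z \<and> Im z' < 0" | "0 < Im z' \<and> Im z < 0" by linarith
    then show "z = z'"
    proof cases
      case 1
      then have "f z = \<sigma> (half i z)" "f z' = \<sigma> (half i z')" using agree z by (auto simp: f_def)
      then have "half i z = half i z'"
        using inj_onD[OF embedded[OF \<sigma>(1)]] hu(1) z 1 eq by metis
      then show ?thesis by (rule half_inj[OF \<sigma>(2)])
    next
      case 2
      then have "half i' (cnj z) = half i' (cnj z')"
        using inj_onD[OF embedded[OF \<sigma>'(1)], of "half i' (cnj z)" "half i' (cnj z')"] hl(1) z cnj eq by (simp add: f_def)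
      then have "cnj z = cnj z'" by (rule half_inj[OF \<sigma>'(2)])
      then show ?thesis by simp
    next
      case 3
      then show ?thesis using A[OF z eq] by blast
    next
      case 4
      then show ?thesis using A[OF z(2,1) eq[symmetric]] by blast
    qed
  qed
  ultimately have N: "openin (top_of_set S2) (f ` square)" by (intro openin_sphere_image open_square)
  have z0: "0 \<in> square" by (simp add: square_def)
  have "f 0 = \<sigma>'' (half j 0)"
    using edge_point_of[OF \<sigma>'', of 0] edge_point_of[OF \<sigma>', of 0] z0 by (simp add: f_def)
  then have "\<sigma>'' (half j 0) \<in> f ` square" using z0 by (metis image_eqI)
  moreover have "half j 0 \<in> standard_simplex 2" using half_simplex(1)[OF \<sigma>''(2) z0] by simp
  ultimately obtain t where t: "t \<in> open_simplex 2" "\<sigma>'' t \<in> f ` square"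
    using open_point_near[OF \<sigma>''(1) _ N] by blast
  then obtain z where z: "z \<in> square" "\<sigma>'' t = f z" by blast
  consider "0 < Im z" | "Im z < 0" | "Im z = 0" by linarith
  then show False
  proof cases
    case 1
    then show ?thesis using tri_unique(2)[OF T \<sigma>''(1) \<sigma>(1) t(1)] up[OF z(1)] z(2) ne by auto
  next
    case 2
    then show ?thesis using tri_unique(2)[OF T \<sigma>''(1) \<sigma>'(1) t(1)] lo[OF z(1)] z(2) ne by auto
  next
    case 3
    then obtain w where "w \<in> open_simplex 1" "f z = e w" using edge[OF z(1)] by blast
    then show ?thesis using tri_unique(1)[OF T \<sigma>''(1) e t(1)] z(2) by auto
  qed
qed

end

abbreviation tris :: "'a simplices \<Rightarrow> ((nat \<Rightarrow> real) \<Rightarrow> 'a) set" where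
  "tris T \<equiv> {\<sigma>. (2, \<sigma>) \<in> T}"

definition share_edge :: "((nat \<Rightarrow> real) \<Rightarrow> 'a) \<Rightarrow> ((nat \<Rightarrow> real) \<Rightarrow> 'a) \<Rightarrow> ((nat \<Rightarrow> real) \<Rightarrow> 'a) \<Rightarrow> bool" where
  "share_edge e \<sigma> \<tau> \<longleftrightarrow> (\<exists>i\<le>2. cell ({..2} - {i}) \<sigma> = (1, e)) \<and> (\<exists>j\<le>2. cell ({..2} - {j}) \<tau> = (1, e))"

lemma two_subset: 
  assumes "s \<subseteq> {..2::nat}" "card s = 2"
  obtains i where "i \<le> 2" "s = {..2} - {i}"
proof -
  have "card ({..2} - s) = 1" using card_Diff_subset[of s "{..2}"] assms finite_subset[OF assms(1)] by simp
  then obtain i where i: "{..2} - s = {i}" using card_1_singletonE by blast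
  then have "i \<le> 2" "s = {..2} - {i}" using assms(1) by blast+
  then show ?thesis using that by blast
qed

section \<open>Exactly two triangles at an edge; purity; connectedness of the dual graph and of
  stars\<close>

context colored_sphere
begin

lemma finite_tris: "finite (tris T)"
proof -
  have "tris T \<subseteq> snd ` T" by force
  then show ?thesis using tri_finite[OF T] finite_surj by blast
qed

lemma cell_top:
  assumes "(n, \<sigma>) \<in> T" "s \<subseteq> {..n}" "cell s \<sigma> = (n, \<rho>)" "s \<noteq> {}"
  shows "\<rho> = \<sigma>"
proof -
  have "card s - 1 = n" using assms(3) by (simp add: cell_def)
  moreover have "card s > 0" using assms(2,4) finite_subset by (auto simp: card_gt_0_iff)
  ultimately have "card s = card {..n}" by simp
  then have "s = {..n}" using card_subset_eq[of "{..n}" s] assms(2) by simp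
  then show ?thesis using cell_full[OF tri_maps(1)[OF T assms(1)]] assms(3) by simp
qed

lemma cell_pair: "cell s \<sigma> = (card s - 1, snd (cell s \<sigma>))"
  by (simp add: cell_def)

text \<open>Otherwise \<open>e\<close> and at most one triangle would cover a neighborhood of an
  inner point of \<open>e\<close>, which would be a boundary point. An arbitrary
  \<open>\<sigma>0\<close> treats the case of no triangle and that of a single triangle
  together.\<close>

lemma incident_not_sub:
  assumes e: "(1, e) \<in> T"
  shows "\<not> incident T e \<subseteq> {\<sigma>0}"
proof
  assume sub: "incident T e \<subseteq> {\<sigma>0}"
  obtain w where w: "w \<in> open_simplex 1" using open_simplex_nonempty by blast
  have ws: "w \<in> standard_simplex 1" using w open_simplex_sub by blast
  have sw: "supp w = {..1}" using w open_simplex_iff by blast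
  define p where "p = e w"
  obtain N where N: "openin (top_of_set S2) N" "p \<in> N"
    "\<And>m \<tau>. (m, \<tau>) \<in> T \<Longrightarrow> N \<inter> \<tau> ` standard_simplex m \<noteq> {} \<Longrightarrow> p \<in> \<tau> ` standard_simplex m"
    using star_nhd[of p] image_S2[OF e ws] p_def by blast
  have cases: "(m = 1 \<and> \<tau> = e) \<or> (m = 2 \<and> \<tau> \<in> incident T e)"
    if \<tau>: "(m, \<tau>) \<in> T" and t: "t \<in> standard_simplex m" "\<tau> t \<in> N" for m \<tau> t
  proof -
    have "e w \<in> \<tau> ` standard_simplex m" using N(3)[OF \<tau>] t unfolding p_def by blast
    then obtain t' where t': "t' \<in> standard_simplex m" "\<tau> t' = e w" by (metis imageE)
    have c: "cell (supp t') \<tau> = (1, e)" "card (supp t') = 2"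
      using tri_coincidence(1,3)[OF T \<tau> e t'(1) ws t'(2)] cell_full[OF tri_maps(1)[OF T e]] sw by auto
    have "2 \<le> Suc m" using c(2) card_mono[OF _ supp_sub[OF t'(1)]] by simp
    then consider "m = 1" | "m = 2" using dim2[OF \<tau>] by linarith
    then show ?thesis
    proof cases
      case 1
      then have "(1, \<tau>) \<in> T" using \<tau> by simp
      from cell_top[OF this _ c(1)] have "e = \<tau>" using supp_sub[OF t'(1)] supp_ne[OF t'(1)] 1 by simp
      then show ?thesis using 1 by simp
    next
      case 2
      have "supp t' \<subseteq> {..2}" using supp_sub[OF t'(1)] 2 by simp
      then obtain i where "i \<le> 2" "supp t' = {..2} - {i}" using two_subset c(2) by blast
      then have "\<tau> \<in> incident T e" using c(1) \<tau> 2 unfolding incident_def by auto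
      then show ?thesis using 2 by blast
    qed
  qed
  have Nsub: "N \<subseteq> S2" using openin_imp_subset[OF N(1)] .
  show False
  proof (cases "\<sigma>0 \<in> incident T e")
    case True
    then obtain i where i: "(2, \<sigma>0) \<in> T" "i \<le> 2" "cell ({..2} - {i}) \<sigma>0 = (1, e)" unfolding incident_def by blast
    have ce: "e u = \<sigma>0 (push ({..2} - {i}) u) \<and> push ({..2} - {i}) u \<in> standard_simplex 2"
      if "u \<in> standard_simplex 1" for u
      using that snd_cell[of u "{..2} - {i}" \<sigma>0] i card_omit3[OF i(2)]
        push_simplex[of "{..2} - {i}" 2 u] by (metis Diff_subset One_nat_def card.empty diff_Suc_1 numeral_2_eq_2 snd_conv zero_neq_numeral)
    have cov: "N \<subseteq> \<sigma>0 ` standard_simplex 2"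
    proof
      fix y assume y: "y \<in> N"
      then obtain m \<tau> t where t: "(m, \<tau>) \<in> T" "t \<in> open_simplex m" "\<tau> t = y" using tri_point[OF T] Nsub by blast
      then have ts: "t \<in> standard_simplex m" using open_simplex_sub by blast
      from cases[OF t(1) ts] t(3) y sub have "(m = 1 \<and> \<tau> = e) \<or> (m = 2 \<and> \<tau> = \<sigma>0)" by auto
      then show "y \<in> \<sigma>0 ` standard_simplex 2"
      proof
        assume "m = 1 \<and> \<tau> = e"
        then show ?thesis using ce[of t] ts t(3) by auto
      qed (use ts t(3) in auto)
    qed
    obtain b where b: "b \<le> 2" "b \<noteq> i" using that[of "if i = 0 then 1 else 0"] by (metis le_numeral_extra(3) one_le_numeral zero_le zero_neq_one)
    \<comment> \<open>Two barycentric coordinates embed the triangle into the closed half-plane, and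
      the one that vanishes on \<open>e\<close> is the imaginary part.\<close>
    define \<kappa> where "\<kappa> = (\<lambda>t::nat \<Rightarrow> real. Complex (t b) (t i))"
    have "continuous_on (standard_simplex 2) \<kappa>"
      unfolding \<kappa>_def Complex_eq by (intro continuous_intros continuous_on_coord)
    moreover have "inj_on \<kappa> (standard_simplex 2)"
    proof
      fix s t assume s: "s \<in> standard_simplex 2" and t: "t \<in> standard_simplex 2" and eq: "\<kappa> s = \<kappa> t"
      have bi: "s b = t b" "s i = t i" using eq by (auto simp: \<kappa>_def)
      have sums: "s 0 + s 1 + s 2 = 1" "t 0 + t 1 + t 2 = 1"
        using simplex_sum[OF s] simplex_sum[OF t] by (simp_all add: numeral_2_eq_2)
      show "s = t"
      proof
        fix k
        consider "k = b" | "k = i" | "2 < k" | "k \<le> 2" "k \<noteq> b" "k \<noteq> i" by linarith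
        then show "s k = t k"
        proof cases
          case 4
          then show ?thesis using b i(2) bi sums by (auto simp: le_Suc_eq numeral_2_eq_2)
        qed (use bi simplex_beyond[OF s] simplex_beyond[OF t] in auto)
      qed
    qed
    moreover have "0 \<le> Im (\<kappa> t)" if "t \<in> standard_simplex 2" for t
      using simplex_nonneg[OF that] by (simp add: \<kappa>_def)
    moreover have "Im (\<kappa> (push ({..2} - {i}) w)) = 0" by (simp add: \<kappa>_def push_def)
    ultimately show False
      using not_locally_bounded_by[OF N(1) i(1) cov, of \<kappa> "push ({..2} - {i}) w"] ce[OF ws] N(2) p_def by auto
  next
    case False
    have cov: "N \<subseteq> e ` standard_simplex 1"
    proof
      fix y assume y: "y \<in> N"
      then obtain m \<tau> t where t: "(m, \<tau>) \<in> T" "t \<in> open_simplex m" "\<tau> t = y" using tri_point[OF T] Nsub by blast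
      then have ts: "t \<in> standard_simplex m" using open_simplex_sub by blast
      from cases[OF t(1) ts] t(3) y sub False have "m = 1 \<and> \<tau> = e" by auto
      then show "y \<in> e ` standard_simplex 1" using ts t(3) by auto
    qed
    define \<kappa> where "\<kappa> = (\<lambda>t::nat \<Rightarrow> real. Complex (t 0) 0)"
    have "continuous_on (standard_simplex 1) \<kappa>"
      unfolding \<kappa>_def Complex_eq by (intro continuous_intros continuous_on_coord)
    moreover have "inj_on \<kappa> (standard_simplex 1)"
    proof
      fix s t assume s: "s \<in> standard_simplex 1" and t: "t \<in> standard_simplex 1" and eq: "\<kappa> s = \<kappa> t"
      have bi: "s 0 = t 0" using eq by (auto simp: \<kappa>_def)
      have sums: "s 0 + s 1 = 1" "t 0 + t 1 = 1"
        using simplex_sum[OF s] simplex_sum[OF t] by simp_all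
      show "s = t"
      proof
        fix k :: nat
        consider "k = 0" | "k = 1" | "1 < k" by linarith
        then show "s k = t k"
          by cases (use bi sums simplex_beyond[OF s] simplex_beyond[OF t] in auto)
      qed
    qed
    ultimately show False
      using not_locally_bounded_by[OF N(1) e cov, of \<kappa> w] ws N(2) p_def by (auto simp: \<kappa>_def)
  qed
qed

theorem card_incident:
  assumes e: "(1, e) \<in> T" shows "card (incident T e) = 2"
proof -
  have "incident T e \<noteq> {}" using incident_not_sub[OF e, of undefined] by blast
  then obtain a where a: "a \<in> incident T e" by blast
  then obtain b where b: "b \<in> incident T e" "a \<noteq> b" using incident_not_sub[OF e, of a] by blast
  have "incident T e = {a, b}" using incident_le2[OF e a b(1) _ b(2)] a b by blast
  then show ?thesis using b(2) by simp
qed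

lemma edge_in_tri:
  assumes "(1, e) \<in> T" obtains \<sigma> i where "(2, \<sigma>) \<in> T" "i \<le> 2" "cell ({..2} - {i}) \<sigma> = (1, e)"
proof -
  have "incident T e \<noteq> {}" using incident_not_sub[OF assms, of undefined] by blast
  then show ?thesis using that unfolding incident_def by blast
qed

text \<open>An isolated vertex would have a neighborhood consisting of one point, which
  \<open>not_locally_bounded_by\<close> excludes with a constant \<open>\<kappa>\<close>.\<close>

lemma vertex_in_edge:
  assumes \<nu>: "(0, \<nu>) \<in> T"
  obtains e where "(1, e) \<in> T" "\<nu> (simplex_vertex 0) \<in> e ` standard_simplex 1"
proof -
  define p where "p = \<nu> (simplex_vertex 0)"
  have v0: "simplex_vertex 0 \<in> standard_simplex 0" by (simp add: vertex_simplex)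
  have single: "standard_simplex 0 = {simplex_vertex 0}" unfolding simplex_vertex_def by (rule standard_simplex_0)
  obtain N where N: "openin (top_of_set S2) N" "p \<in> N"
    "\<And>m \<tau>. (m, \<tau>) \<in> T \<Longrightarrow> N \<inter> \<tau> ` standard_simplex m \<noteq> {} \<Longrightarrow> p \<in> \<tau> ` standard_simplex m"
    using star_nhd[of p] image_S2[OF \<nu> v0] p_def by blast
  have "\<exists>m \<tau>. (m, \<tau>) \<in> T \<and> m \<noteq> 0 \<and> p \<in> \<tau> ` standard_simplex m"
  proof (rule ccontr)
    assume no: "\<not> ?thesis"
    have cov: "N \<subseteq> \<nu> ` standard_simplex 0"
    proof
      fix y assume y: "y \<in> N"
      then have "y \<in> S2" using openin_imp_subset[OF N(1)] by blast
      then obtain m \<tau> t where t: "(m, \<tau>) \<in> T" "t \<in> open_simplex m" "\<tau> t = y" using tri_point[OF T] by blast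
      then have ts: "t \<in> standard_simplex m" using open_simplex_sub by blast
      have "p \<in> \<tau> ` standard_simplex m" using N(3)[OF t(1)] y ts t(3) by blast
      then have m0: "m = 0" using no t(1) by blast
      then have "t = simplex_vertex 0" using ts single by simp
      moreover have "p \<in> \<tau> ` {simplex_vertex 0}" using \<open>p \<in> \<tau> ` standard_simplex m\<close> m0 single by simp
      ultimately have "y = p" using t(3) by simp
      then show "y \<in> \<nu> ` standard_simplex 0" using v0 p_def by blast
    qed
    show False
      by (rule not_locally_bounded_by[OF N(1) \<nu> cov, of "\<lambda>_. 0" "simplex_vertex 0"])
        (use v0 N(2) p_def single in auto)
  qed
  then obtain m \<tau> t where t: "(m, \<tau>) \<in> T" "m \<noteq> 0" "t \<in> standard_simplex m" "\<tau> t = p" by blast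
  have "card (supp t) = card (supp (simplex_vertex 0))"
    by (rule tri_coincidence(3)[OF T t(1) \<nu> t(3) v0]) (simp add: t(4) p_def)
  then have "card (supp t) = 1" by (simp add: supp_vertex)
  then obtain i where i: "supp t = {i}" using card_1_singletonE by blast
  have im: "i \<le> m" using i supp_sub[OF t(3)] by blast
  obtain j where j: "j \<le> m" "j \<noteq> i" using t(2) that[of "if i = 0 then 1 else 0"]
    by (metis One_nat_def Suc_leI gr0I zero_le zero_neq_one)
  let ?s = "{i, j}"
  have c: "card ?s - 1 = 1" using j by simp
  have "(1, snd (cell ?s \<tau>)) \<in> T" using tri_cell'[OF T t(1), of ?s] c im j by simp
  moreover have "p \<in> \<tau> ` {t \<in> standard_simplex m. supp t \<subseteq> ?s}" using t i by auto
  then have "p \<in> snd (cell ?s \<tau>) ` standard_simplex 1"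
    using cell_image[of ?s m \<tau>] im j c by simp
  ultimately show ?thesis using that[of "snd (cell ?s \<tau>)"] p_def by simp
qed

lemma covered_by_tris:
  assumes "(m, \<tau>) \<in> T"
  obtains \<sigma> where "(2, \<sigma>) \<in> T" "\<tau> ` standard_simplex m \<subseteq> \<sigma> ` standard_simplex 2"
proof -
  have edge: "\<exists>\<sigma>. (2, \<sigma>) \<in> T \<and> e ` standard_simplex 1 \<subseteq> \<sigma> ` standard_simplex 2" if e: "(1, e) \<in> T" for e
  proof -
    obtain \<sigma> i where s: "(2, \<sigma>) \<in> T" "i \<le> 2" "cell ({..2} - {i}) \<sigma> = (1, e)" using edge_in_tri[OF e] .
    have c: "card ({..2} - {i}) - 1 = 1" using card_omit3[OF s(2)] by simp
    have c2: "{..2} - {i} \<noteq> {}" using card_omit3[OF s(2)] by (metis card.empty zero_neq_numeral)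
    have "e ` standard_simplex 1 = \<sigma> ` {t \<in> standard_simplex 2. supp t \<subseteq> {..2} - {i}}"
      using cell_image[OF Diff_subset c2, of \<sigma>] s(3) c by simp
    then show ?thesis using s(1) by blast
  qed
  consider "m = 0" | "m = 1" | "m = 2" using dim2[OF assms] by linarith
  then show ?thesis
  proof cases
    case 1
    have "(0, \<tau>) \<in> T" using assms 1 by simp
    then obtain e where e: "(1, e) \<in> T" "\<tau> (simplex_vertex 0) \<in> e ` standard_simplex 1"
      by (rule vertex_in_edge)
    have "\<tau> ` standard_simplex m = {\<tau> (simplex_vertex 0)}"
      using standard_simplex_0 1 by (simp add: simplex_vertex_def)
    then have "\<tau> ` standard_simplex m \<subseteq> e ` standard_simplex 1" using e(2) by simp
    moreover obtain \<sigma> where "(2, \<sigma>) \<in> T" "e ` standard_simplex 1 \<subseteq> \<sigma> ` standard_simplex 2"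
      using edge[OF e(1)] by blast
    ultimately show ?thesis using that[of \<sigma>] by (meson order_trans)
  next
    case 2
    then obtain \<sigma> where "(2, \<sigma>) \<in> T" "\<tau> ` standard_simplex 1 \<subseteq> \<sigma> ` standard_simplex 2"
      using edge[of \<tau>] assms by blast
    then show ?thesis using that[of \<sigma>] 2 by simp
  next
    case 3
    then show ?thesis using assms that by blast
  qed
qed

text \<open>The three alternatives are the sizes 3, 2 and 1 of the smallest face containing the
  common point.\<close>

lemma tris_common_point:
  assumes \<sigma>: "(2, \<sigma>) \<in> T" and \<tau>: "(2, \<tau>) \<in> T" and t: "t \<in> standard_simplex 2" "t' \<in> standard_simplex 2" "\<sigma> t = \<tau> t'"
  shows "\<sigma> = \<tau> \<or> (\<exists>e w. (1, e) \<in> T \<and> share_edge e \<sigma> \<tau> \<and> w \<in> open_simplex 1 \<and> \<sigma> t = e w) \<or> \<sigma> t \<in> vertices T"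
proof -
  note c = tri_coincidence[OF T \<sigma> \<tau> t]
  note s = supp_sub[OF t(1)] supp_ne[OF t(1)] and s' = supp_sub[OF t(2)] supp_ne[OF t(2)]
  have le: "card (supp t) \<le> 3" using card_mono[OF _ s(1)] by simp
  have pos: "card (supp t) > 0" using s finite_subset[OF s(1)] by (simp add: card_gt_0_iff)
  obtain x where x: "x \<in> open_simplex (card (supp t) - 1)" "push (supp t) x = t" using c(2) by blast
  have val: "\<sigma> t = snd (cell (supp t) \<sigma>) x" using snd_cell[of x "supp t" \<sigma>] x open_simplex_sub by (metis subsetD)
  consider "card (supp t) = 3" | "card (supp t) = 2" | "card (supp t) = 1" using le pos by linarith
  then show ?thesis
  proof cases
    case 1
    have "supp t = {..2}" "supp t' = {..2}"
      using card_subset_eq[OF _ s(1)] card_subset_eq[OF _ s'(1)] 1 c(3) by auto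
    then show ?thesis using c(1) cell_full[OF tri_maps(1)[OF T \<sigma>]] cell_full[OF tri_maps(1)[OF T \<tau>]] by simp
  next
    case 2
    obtain i where i: "i \<le> 2" "supp t = {..2} - {i}" using two_subset[OF s(1) 2] .
    obtain j where j: "j \<le> 2" "supp t' = {..2} - {j}" using two_subset[OF s'(1)] c(3) 2 by metis
    define e where "e = snd (cell (supp t) \<sigma>)"
    have ce: "cell (supp t) \<sigma> = (1, e)" using 2 cell_pair[of "supp t" \<sigma>] by (simp add: e_def)
    then have "(1, e) \<in> T" using tri_cell[OF T \<sigma> s] by simp
    moreover have "share_edge e \<sigma> \<tau>" unfolding share_edge_def using ce c(1) i j by auto
    ultimately show ?thesis using x(1) val 2 unfolding e_def by auto
  next
    case 3
    then obtain i where i: "supp t = {i}" using card_1_singletonE by blast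
    have "x = simplex_vertex 0" using x(1) 3 standard_simplex_0 open_simplex_sub by (auto simp: simplex_vertex_def)
    moreover have "(0, snd (cell (supp t) \<sigma>)) \<in> T" using tri_cell'[OF T \<sigma> s] 3 by simp
    ultimately show ?thesis using val vertexI by metis
  qed
qed

lemma finite_vertices: "finite (vertices T)"
proof -
  have "vertices T \<subseteq> (\<lambda>s. snd s (simplex_vertex 0)) ` T" unfolding vertices_def by force
  then show ?thesis using tri_finite[OF T] finite_surj by blast
qed

lemma vertices_sphere: "vertices T \<subseteq> S2"
  using image_S2 vertex_simplex[of 0 0] unfolding vertices_def by auto

lemma compact_tris: "F \<subseteq> tris T \<Longrightarrow> compact (\<Union>\<sigma>\<in>F. \<sigma> ` standard_simplex 2)"
  using compact_image finite_subset[OF _ finite_tris] by (intro compact_UN) auto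

text \<open>The sphere stays connected after deletion of its finitely many vertices. Away from the
  vertices, a triangle in \<open>S\<close> and one outside \<open>S\<close> could meet only on a
  shared edge, so otherwise the two families would separate the deleted sphere into closed
  pieces.\<close>

theorem dual_connected:
  assumes S: "S \<subseteq> tris T" "S \<noteq> {}"
    and closed: "\<And>\<sigma> \<tau> e. \<sigma> \<in> S \<Longrightarrow> \<tau> \<in> tris T \<Longrightarrow> (1, e) \<in> T \<Longrightarrow> share_edge e \<sigma> \<tau> \<Longrightarrow> \<tau> \<in> S"
  shows "S = tris T"
proof (rule ccontr)
  assume ne: "S \<noteq> tris T"
  let ?V = "vertices T"
  define F where "F = (\<Union>\<sigma>\<in>S. \<sigma> ` standard_simplex 2)"
  define F' where "F' = (\<Union>\<sigma>\<in>tris T - S. \<sigma> ` standard_simplex 2)"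
  have cl: "closed F" "closed F'" unfolding F_def F'_def
    by (rule compact_imp_closed[OF compact_tris], use S(1) in blast)+
  obtain \<sigma>0 where \<sigma>0: "\<sigma>0 \<in> S" using S(2) by blast
  have "\<sigma>0 (simplex_vertex 0) \<in> ?V" using corner_vertex[OF T, of 2 \<sigma>0 0] \<sigma>0 S(1) by auto
  then have conn: "connected (S2 - ?V)" using connected_sphere_diff[OF finite_vertices _ vertices_sphere] by blast
  have "S2 - ?V \<subseteq> F \<union> F'"
  proof
    fix y assume "y \<in> S2 - ?V"
    then obtain m \<tau> t where t: "(m, \<tau>) \<in> T" "t \<in> open_simplex m" "\<tau> t = y" using tri_point[OF T] by blast
    obtain \<sigma> where "(2, \<sigma>) \<in> T" "\<tau> ` standard_simplex m \<subseteq> \<sigma> ` standard_simplex 2" using covered_by_tris[OF t(1)] .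
    then have "\<sigma> \<in> tris T" "y \<in> \<sigma> ` standard_simplex 2" using t open_simplex_sub by blast+
    then show "y \<in> F \<union> F'" unfolding F_def F'_def by (cases "\<sigma> \<in> S") (auto intro: UN_I)
  qed
  moreover have "F \<inter> F' \<inter> (S2 - ?V) = {}"
  proof -
    have False if y: "y \<in> F" "y \<in> F'" "y \<notin> ?V" for y
    proof -
      obtain \<sigma> t where \<sigma>: "\<sigma> \<in> S" "t \<in> standard_simplex 2" "\<sigma> t = y" using y(1) unfolding F_def by blast
      obtain \<tau> t' where \<tau>: "\<tau> \<in> tris T - S" "t' \<in> standard_simplex 2" "\<tau> t' = y" using \<open>y \<in> F'\<close> unfolding F'_def by blast
      have e: "\<sigma> t = \<tau> t'" using \<sigma> \<tau> by simp
      have "(2, \<sigma>) \<in> T" "(2, \<tau>) \<in> T" using \<sigma> \<tau> S(1) by auto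
      from tris_common_point[OF this \<sigma>(2) \<tau>(2) e] closed[OF \<sigma>(1)] \<sigma> \<tau> \<open>y \<notin> ?V\<close> show False by blast
    qed
    then show ?thesis by blast
  qed
  ultimately have "F \<inter> (S2 - ?V) = {} \<or> F' \<inter> (S2 - ?V) = {}"
    using conn cl unfolding connected_closed by blast
  moreover have "\<sigma> ` standard_simplex 2 \<inter> (S2 - ?V) \<noteq> {}" if \<sigma>: "(2, \<sigma>) \<in> T" for \<sigma>
  proof -
    obtain t where t: "t \<in> open_simplex 2" using open_simplex_nonempty by blast
    have "\<sigma> t \<notin> ?V"
    proof
      assume "\<sigma> t \<in> ?V"
      then obtain \<nu> where \<nu>: "(0, \<nu>) \<in> T" "\<sigma> t = \<nu> (simplex_vertex 0)" unfolding vertices_def by blast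
      have "simplex_vertex 0 \<in> open_simplex 0" by (simp add: open_simplex_iff vertex_simplex supp_vertex)
      then show False using tri_unique(1)[OF T \<sigma> \<nu>(1) t] \<nu>(2) by auto
    qed
    then show ?thesis using t open_simplex_sub image_S2[OF \<sigma>] by blast
  qed
  moreover obtain \<sigma>1 where "\<sigma>1 \<in> tris T - S" using S(1) ne by blast
  moreover have "\<sigma> ` standard_simplex 2 \<subseteq> F" if "\<sigma> \<in> S" for \<sigma> unfolding F_def using that by (rule UN_upper)
  moreover have "\<sigma> ` standard_simplex 2 \<subseteq> F'" if "\<sigma> \<in> tris T - S" for \<sigma> unfolding F'_def using that by (rule UN_upper)
  ultimately show False using \<sigma>0 S(1) by (smt (verit) DiffD1 disjoint_iff mem_Collect_eq subsetD)
qed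

text \<open>The same argument in a small punctured neighborhood of \<open>v\<close> that meets only
  simplices containing \<open>v\<close>: there two triangles can meet only on an edge through
  \<open>v\<close>.\<close>

theorem star_connected:
  assumes v: "v \<in> vertices T"
    and S: "S \<subseteq> {\<sigma> \<in> tris T. v \<in> \<sigma> ` standard_simplex 2}" "S \<noteq> {}"
    and closed: "\<And>\<sigma> \<tau> e. \<sigma> \<in> S \<Longrightarrow> \<tau> \<in> tris T \<Longrightarrow> (1, e) \<in> T \<Longrightarrow> share_edge e \<sigma> \<tau> \<Longrightarrow> v \<in> e ` standard_simplex 1 \<Longrightarrow> \<tau> \<in> S"
  shows "S = {\<sigma> \<in> tris T. v \<in> \<sigma> ` standard_simplex 2}" (is "_ = ?Star")
proof (rule ccontr)
  assume ne: "S \<noteq> ?Star"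
  define F where "F = (\<Union>\<sigma>\<in>S. \<sigma> ` standard_simplex 2)"
  define F' where "F' = (\<Union>\<sigma>\<in>?Star - S. \<sigma> ` standard_simplex 2)"
  have "S \<subseteq> tris T" "?Star - S \<subseteq> tris T" using S(1) by blast+
  then have cl: "closed F" "closed F'" unfolding F_def F'_def
    using compact_imp_closed[OF compact_tris[of S]] compact_imp_closed[OF compact_tris[of "?Star - S"]] by simp_all
  have vS: "v \<in> S2" using v vertices_sphere by blast
  obtain \<nu> where \<nu>: "(0, \<nu>) \<in> T" "v = \<nu> (simplex_vertex 0)" using v unfolding vertices_def by blast
  obtain N where N: "openin (top_of_set S2) N" "v \<in> N"
    "\<And>m \<tau>. (m, \<tau>) \<in> T \<Longrightarrow> N \<inter> \<tau> ` standard_simplex m \<noteq> {} \<Longrightarrow> v \<in> \<tau> ` standard_simplex m"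
    using star_nhd[OF vS] by blast
  obtain B where B: "openin (top_of_set S2) B" "v \<in> B" "B \<subseteq> N" "connected (B - {v})"
    using connected_punctured_nhd[OF N(1,2)] .
  have BS: "B \<subseteq> S2" using openin_imp_subset[OF B(1)] .
  have "B - {v} \<subseteq> F \<union> F'"
  proof
    fix y assume y: "y \<in> B - {v}"
    then obtain m \<tau> t where t: "(m, \<tau>) \<in> T" "t \<in> open_simplex m" "\<tau> t = y" using tri_point[OF T] BS by blast
    obtain \<sigma> where \<sigma>: "(2, \<sigma>) \<in> T" "\<tau> ` standard_simplex m \<subseteq> \<sigma> ` standard_simplex 2" using covered_by_tris[OF t(1)] .
    have yt: "y \<in> \<tau> ` standard_simplex m" using t open_simplex_sub by blast
    then have "v \<in> \<tau> ` standard_simplex m" using N(3)[OF t(1)] y B(3) by blast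
    then have "\<sigma> \<in> ?Star" using \<sigma> by blast
    moreover have "y \<in> \<sigma> ` standard_simplex 2" using \<sigma>(2) yt by blast
    ultimately show "y \<in> F \<union> F'" unfolding F_def F'_def by (cases "\<sigma> \<in> S") (auto intro: UN_I)
  qed
  moreover have "F \<inter> F' \<inter> (B - {v}) = {}"
  proof -
    have False if y: "y \<in> F" "y \<in> F'" "y \<in> B" "y \<noteq> v" for y
    proof -
      obtain \<sigma> t where \<sigma>: "\<sigma> \<in> S" "t \<in> standard_simplex 2" "\<sigma> t = y" using y(1) unfolding F_def by blast
      obtain \<tau> t' where \<tau>: "\<tau> \<in> ?Star - S" "t' \<in> standard_simplex 2" "\<tau> t' = y" using y(2) unfolding F'_def by blast
      have e: "\<sigma> t = \<tau> t'" using \<sigma> \<tau> by simp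
      have st: "(2, \<sigma>) \<in> T" "(2, \<tau>) \<in> T" using \<sigma> \<tau> S(1) by auto
      consider "\<sigma> = \<tau>" | e w where "(1, e) \<in> T" "share_edge e \<sigma> \<tau>" "w \<in> open_simplex 1" "y = e w" | "y \<in> vertices T"
        using tris_common_point[OF st \<sigma>(2) \<tau>(2) e] \<sigma>(3) by blast
      then show False
      proof cases
        case 1
        then show ?thesis using \<sigma> \<tau> by blast
      next
        case 2
        have "y \<in> e ` standard_simplex 1" using 2(3,4) open_simplex_sub by blast
        then have "v \<in> e ` standard_simplex 1" using N(3)[OF 2(1)] y(3) B(3) by blast
        then show ?thesis using closed[OF \<sigma>(1) _ 2(1,2)] \<tau> by blast
      next
        case 3
        then obtain \<mu> where \<mu>: "(0, \<mu>) \<in> T" "y = \<mu> (simplex_vertex 0)" unfolding vertices_def by blast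
        have img: "\<mu> ` standard_simplex 0 = {y}"
          using standard_simplex_0 \<mu>(2) by (simp add: simplex_vertex_def)
        then have "v \<in> {y}" using N(3)[OF \<mu>(1)] y(3) B(3) by blast
        then show ?thesis using y(4) by simp
      qed
    qed
    then show ?thesis by blast
  qed
  ultimately have "F \<inter> (B - {v}) = {} \<or> F' \<inter> (B - {v}) = {}"
    using B(4) cl unfolding connected_closed by blast
  moreover have "\<sigma> ` standard_simplex 2 \<inter> (B - {v}) \<noteq> {}" if \<sigma>: "(2, \<sigma>) \<in> T" "v \<in> \<sigma> ` standard_simplex 2" for \<sigma>
  proof -
    obtain t0 where t0: "t0 \<in> standard_simplex 2" "\<sigma> t0 = v" using \<sigma>(2) by blast
    then obtain t where t: "t \<in> open_simplex 2" "\<sigma> t \<in> B" using open_point_near[OF \<sigma>(1) t0(1) B(1)] B(2) by metis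
    have "simplex_vertex 0 \<in> open_simplex 0" by (simp add: open_simplex_iff vertex_simplex supp_vertex)
    then have "\<sigma> t \<noteq> v" using tri_unique(1)[OF T \<sigma>(1) \<nu>(1) t(1)] \<nu>(2) by auto
    then show ?thesis using t open_simplex_sub by blast
  qed
  moreover obtain \<sigma>0 where "\<sigma>0 \<in> S" using S(2) by blast
  moreover obtain \<sigma>1 where "\<sigma>1 \<in> ?Star - S" using S(1) ne by blast
  moreover have "\<sigma> ` standard_simplex 2 \<subseteq> F" if "\<sigma> \<in> S" for \<sigma> unfolding F_def using that by (rule UN_upper)
  moreover have "\<sigma> ` standard_simplex 2 \<subseteq> F'" if "\<sigma> \<in> ?Star - S" for \<sigma> unfolding F'_def using that by (rule UN_upper)
  ultimately show False using S(1) by (smt (verit) DiffD1 disjoint_iff mem_Collect_eq subsetD)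
qed

end

section \<open>Exclusion of parallel edges by the Jordan curve theorem\<close>

lemma connected_sphere_delete:
  assumes X: "openin (top_of_set S2) X" "connected X"
  shows "connected (X - {p})"
proof (cases "p \<in> X")
  case True
  obtain B where B: "openin (top_of_set S2) B" "p \<in> B" "B \<subseteq> X" "connected (B - {p})"
    using connected_punctured_nhd[OF X(1) True] .
  show ?thesis
  proof (rule ccontr)
    assume "\<not> connected (X - {p})"
    then obtain E F where EF: "open E" "open F" "X - {p} \<subseteq> E \<union> F" "E \<inter> F \<inter> (X - {p}) = {}"
      "E \<inter> (X - {p}) \<noteq> {}" "F \<inter> (X - {p}) \<noteq> {}"
      unfolding connected_def by blast
    \<comment> \<open>If one side misses the punctured neighborhood of \<open>p\<close>, the whole
      neighborhood can be added to the other side, and then \<open>X\<close> itself is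
      disconnected.\<close>
    have *: False if "open E" "open F" "X - {p} \<subseteq> E \<union> F" "E \<inter> F \<inter> (X - {p}) = {}"
      "E \<inter> (X - {p}) \<noteq> {}" "F \<inter> (X - {p}) \<noteq> {}" and BF: "F \<inter> (B - {p}) = {}" for E F
    proof -
      obtain B' where B': "open B'" "B = S2 \<inter> B'" using B(1) by (auto simp: openin_open)
      obtain X' where X': "open X'" "X = S2 \<inter> X'" using X(1) by (auto simp: openin_open)
      let ?E = "E - {p} \<union> B'" and ?F = "F - {p}"
      have "open ?E" "open ?F" using that(1,2) B'(1) by (auto simp: open_delete)
      moreover have "X \<subseteq> ?E \<union> ?F" using that(3) B(2) B'(2) by blast
      moreover have "?E \<inter> ?F \<inter> X = {}" using that(4) BF B'(2) X'(2) by blast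
      moreover have "?E \<inter> X \<noteq> {}" "?F \<inter> X \<noteq> {}" using that(5,6) by blast+
      ultimately show False using X(2) unfolding connected_def by blast
    qed
    have "E \<inter> (B - {p}) = {} \<or> F \<inter> (B - {p}) = {}"
    proof (rule connectedD[OF B(4) EF(1,2)])
      show "E \<inter> F \<inter> (B - {p}) = {}" using EF(4) B(3) by auto
      show "B - {p} \<subseteq> E \<union> F" using EF(3) B(3) by auto
    qed
    then show False
    proof
      assume "E \<inter> (B - {p}) = {}"
      then show False using *[of F E] EF by (simp add: Un_commute Int_commute)
    next
      assume "F \<inter> (B - {p}) = {}"
      then show False by (rule *[OF EF])
    qed
  qed
qed (use X in simp)

definition corners :: "nat \<Rightarrow> ((nat \<Rightarrow> real) \<Rightarrow> 'a) \<Rightarrow> 'a set" where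
  "corners n \<sigma> = (\<lambda>i. \<sigma> (simplex_vertex i)) ` {..n}"

lemma corners_cell: 
  assumes "finite s" "s \<noteq> {}"
  shows "corners (card s - 1) (snd (cell s \<sigma>)) = (\<lambda>i. \<sigma> (simplex_vertex i)) ` s"
  unfolding corners_def by (rule cell_vertices[OF assms])

definition edge_path :: "((nat \<Rightarrow> real) \<Rightarrow> 'a) \<Rightarrow> real \<Rightarrow> 'a" where
  "edge_path e x = e (\<lambda>m. if m = 0 then 1 - x else if m = 1 then x else 0)"

lemma simplex1_param:
  "standard_simplex 1 = (\<lambda>x. \<lambda>m. if m = 0 then 1 - x else if m = 1 then x else 0) ` {0..1::real}" (is "_ = ?f ` _")
proof
  show "?f ` {0..1} \<subseteq> standard_simplex 1"
    by (auto intro!: in_simplexI)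
  show "standard_simplex 1 \<subseteq> ?f ` {0..1}"
  proof
    fix t :: "nat \<Rightarrow> real" assume t: "t \<in> standard_simplex 1"
    have "t 0 + t 1 = 1" using simplex_sum[OF t] by simp
    then have "t = ?f (t 1)" using simplex_beyond[OF t] by (auto simp: fun_eq_iff)
    moreover have "t 1 \<in> {0..1}" using simplex_nonneg[OF t] simplex_le1[OF t] by simp
    ultimately show "t \<in> ?f ` {0..1}" by blast
  qed
qed

context colored_sphere
begin

lemma common_corner:
  assumes "(n, \<sigma>) \<in> T" "(m, \<tau>) \<in> T" "t \<in> standard_simplex n" "t' \<in> standard_simplex m" "\<sigma> t = \<tau> t'" "i \<in> supp t"
  shows "\<sigma> (simplex_vertex i) \<in> corners m \<tau>"
proof -
  note c = tri_coincidence(1)[OF T assms(1-5)]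
  have f: "finite (supp t)" "finite (supp t')" using supp_finite assms(3,4) by blast+
  have ne: "supp t \<noteq> {}" "supp t' \<noteq> {}" using supp_ne assms(3,4) by blast+
  have "(\<lambda>i. \<sigma> (simplex_vertex i)) ` supp t = (\<lambda>i. \<tau> (simplex_vertex i)) ` supp t'"
    using corners_cell[OF f(1) ne(1), of \<sigma>] corners_cell[OF f(2) ne(2), of \<tau>] c by (metis fst_cell)
  then have "\<sigma> (simplex_vertex i) \<in> (\<lambda>i. \<tau> (simplex_vertex i)) ` supp t'" using assms(6) by blast
  then show ?thesis using supp_sub[OF assms(4)] unfolding corners_def by blast
qed

lemma vertex_in_image:
  assumes "(n, \<sigma>) \<in> T" "v \<in> vertices T"
  shows "v \<in> \<sigma> ` standard_simplex n \<longleftrightarrow> v \<in> corners n \<sigma>"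
proof
  assume "v \<in> \<sigma> ` standard_simplex n"
  then obtain t where t: "t \<in> standard_simplex n" "\<sigma> t = v" by blast
  obtain \<nu> where \<nu>: "(0, \<nu>) \<in> T" "v = \<nu> (simplex_vertex 0)" using assms(2) by (auto simp: vertices_def)
  have "\<nu> (simplex_vertex 0) \<in> corners n \<sigma>"
    by (rule common_corner[OF \<nu>(1) assms(1) _ t(1)]) (use t(2) \<nu>(2) in \<open>auto simp: vertex_simplex supp_vertex\<close>)
  then show "v \<in> corners n \<sigma>" using \<nu>(2) by simp
next
  assume "v \<in> corners n \<sigma>"
  then show "v \<in> \<sigma> ` standard_simplex n" unfolding corners_def using vertex_simplex by auto
qed

lemma corners_vertices: "(n, \<sigma>) \<in> T \<Longrightarrow> corners n \<sigma> \<subseteq> vertices T"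
  unfolding corners_def using corner_vertex[OF T] by auto

lemma card_corners: "(n, \<sigma>) \<in> T \<Longrightarrow> card (corners n \<sigma>) = Suc n"
  unfolding corners_def using card_image[OF vert_inj] by force

lemma edge_corners: "corners 1 e = {e (simplex_vertex 0), e (simplex_vertex 1)}"
  by (simp add: corners_def atMost_Suc numeral_2_eq_2 insert_commute)

lemma edge_path_image: "path_image (edge_path e) = e ` standard_simplex 1"
  unfolding simplex1_param path_image_def edge_path_def by (simp add: image_image)

lemma edge_path_ends: "pathstart (edge_path e) = e (simplex_vertex 0)" "pathfinish (edge_path e) = e (simplex_vertex 1)"
proof -
  have "(\<lambda>m::nat. if m = 0 then 1 - 0 else if m = 1 then 0 else 0) = (simplex_vertex 0 :: nat \<Rightarrow> real)"
    "(\<lambda>m::nat. if m = 0 then 1 - 1 else if m = 1 then 1 else 0) = (simplex_vertex 1 :: nat \<Rightarrow> real)"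
    by (auto simp: simplex_vertex_def fun_eq_iff)
  then show "pathstart (edge_path e) = e (simplex_vertex 0)" "pathfinish (edge_path e) = e (simplex_vertex 1)"
    by (simp_all only: pathstart_def pathfinish_def edge_path_def)
qed

lemma arc_edge_path:
  assumes "(1, e) \<in> T" shows "arc (edge_path e)"
proof -
  let ?f = "\<lambda>x. \<lambda>m::nat. if m = 0 then 1 - x else if m = 1 then x else (0::real)"
  have "continuous_on {0..1} ?f"
  proof (rule continuous_on_coordinatewise_then_product)
    fix i :: nat
    show "continuous_on {0..1} (\<lambda>x. ?f x i)" by (cases "i = 0"; cases "i = 1") (auto intro!: continuous_intros)
  qed
  then have "continuous_on {0..1} (\<lambda>x. e (?f x))"
    by (rule continuous_on_compose2[OF tri_cont[OF T assms]]) (simp only: simplex1_param)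
  then have "path (edge_path e)" unfolding path_def edge_path_def .
  moreover have "inj_on (edge_path e) {0..1}"
  proof
    fix x y :: real assume x: "x \<in> {0..1}" and y: "y \<in> {0..1}" and "edge_path e x = edge_path e y"
    then have eq: "e (?f x) = e (?f y)" by (simp only: edge_path_def)
    have "?f x \<in> standard_simplex 1" "?f y \<in> standard_simplex 1" using x y unfolding simplex1_param by blast+
    then have "?f x = ?f y" using inj_onD[OF embedded[OF assms], of "?f x" "?f y"] eq by blast
    then have "?f x 1 = ?f y 1" by (rule fun_cong)
    then show "x = y" by simp
  qed
  ultimately show ?thesis unfolding arc_def by blast
qed

lemma edges_meet_in_corners:
  assumes "(1, e) \<in> T" "(1, f) \<in> T" "e \<noteq> f"
  shows "e ` standard_simplex 1 \<inter> f ` standard_simplex 1 \<subseteq> corners 1 e"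
proof
  fix y assume "y \<in> e ` standard_simplex 1 \<inter> f ` standard_simplex 1"
  then obtain t t' where t: "t \<in> standard_simplex 1" "e t = y" "t' \<in> standard_simplex 1" "f t' = y"
    by (metis IntE imageE)
  have eq: "e t = f t'" using t by simp
  note c = tri_coincidence[OF T assms(1,2) t(1,3) eq]
  have "card (supp t) \<noteq> 2"
  proof
    assume two: "card (supp t) = 2"
    then have "supp t = {..1}" "supp t' = {..1}"
      using card_subset_eq[OF _ supp_sub[OF t(1)]] card_subset_eq[OF _ supp_sub[OF t(3)]] c(3) by auto
    then have "(1, e) = (1, f)"
      using c(1) cell_full[OF tri_maps(1)[OF T assms(1)]] cell_full[OF tri_maps(1)[OF T assms(2)]] by simp
    then show False using assms(3) by simp
  qed
  moreover have "card (supp t) \<le> 2" using card_mono[OF _ supp_sub[OF t(1)]] by simp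
  moreover have "card (supp t) > 0" using supp_ne[OF t(1)] supp_finite[OF t(1)] by (simp add: card_gt_0_iff)
  ultimately have "card (supp t) = 1" by linarith
  then obtain i where i: "supp t = {i}" using card_1_singletonE by blast
  then have i1: "i \<le> 1" using supp_sub[OF t(1)] by blast
  have "t = simplex_vertex i"
  proof -
    have z: "t j = 0" if "j \<noteq> i" for j using supp_zero[OF t(1), of j] i that by simp
    have "(\<Sum>j\<le>1. t j) = t i" using z i1 by (subst sum.remove[of _ i]) auto
    then show ?thesis using simplex_sum[OF t(1)] z by (auto simp: simplex_vertex_def fun_eq_iff)
  qed
  then show "y \<in> corners 1 e" using t(2) i1 unfolding corners_def by blast
qed

text \<open>The set is star-shaped about the corner \<open>i\<close>. On a segment towards it the
  coordinate at \<open>i\<close> becomes positive at once, and a point with positive coordinate at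
  \<open>i\<close> lies on no edge that avoids this corner.\<close>

lemma connected_triangle_diff:
  assumes \<sigma>: "(2, \<sigma>) \<in> T" and i: "i \<le> 2" and E: "E \<subseteq> {e. (1, e) \<in> T}"
    and c: "\<And>e. e \<in> E \<Longrightarrow> \<sigma> (simplex_vertex i) \<notin> corners 1 e"
  shows "connected (\<sigma> ` standard_simplex 2 - (\<Union>e\<in>E. e ` standard_simplex 1))"
    "\<sigma> (simplex_vertex i) \<in> \<sigma> ` standard_simplex 2 - (\<Union>e\<in>E. e ` standard_simplex 1)"
proof -
  let ?J = "\<Union>e\<in>E. e ` standard_simplex 1" and ?v = "simplex_vertex i :: nat \<Rightarrow> real"
  have v: "?v \<in> standard_simplex 2" using i by (simp add: vertex_simplex)
  have off: "\<sigma> t \<notin> ?J" if t: "t \<in> standard_simplex 2" "i \<in> supp t" for t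
  proof
    assume "\<sigma> t \<in> ?J"
    then obtain e t' where e: "e \<in> E" "t' \<in> standard_simplex 1" "\<sigma> t = e t'" by blast
    have "\<sigma> ?v \<in> corners 1 e" using common_corner[OF \<sigma>, of 1 e t t' i] t e E by blast
    then show False using c[OF e(1)] by blast
  qed
  show vin: "\<sigma> ?v \<in> \<sigma> ` standard_simplex 2 - ?J" using off[OF v] v by (simp add: supp_vertex)
  define seg where "seg = (\<lambda>t. (\<lambda>l j. (1 - l) * t j + l * ?v j) ` {0..1::real})"
  have segsub: "seg t \<subseteq> standard_simplex 2" if "t \<in> standard_simplex 2" for t
    using convex_standard_simplex[OF that v] by (auto simp: seg_def)
  have segJ: "\<sigma> ` seg t \<inter> ?J = {}" if t: "t \<in> standard_simplex 2" "\<sigma> t \<notin> ?J" for t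
  proof -
    have "\<sigma> (\<lambda>j. (1 - l) * t j + l * ?v j) \<notin> ?J" if l: "l \<in> {0..1}" for l
    proof (cases "l = 0")
      case True
      then show ?thesis using t(2) by simp
    next
      case False
      let ?t = "\<lambda>j. (1 - l) * t j + l * ?v j"
      have "?t \<in> standard_simplex 2" using segsub[OF t(1)] l by (auto simp: seg_def)
      moreover have "0 < ?t i" using False l simplex_nonneg[OF t(1), of i]
        by (auto simp: simplex_vertex_def intro!: add_nonneg_pos)
      then have "i \<in> supp ?t" by (simp add: supp_def)
      ultimately show ?thesis using off by blast
    qed
    then have "\<forall>u\<in>seg t. \<sigma> u \<notin> ?J" unfolding seg_def by blast
    then show ?thesis by blast
  qed
  have "continuous_on {0..1} (\<lambda>l j. (1 - l) * t j + l * ?v j)" for t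
    by (intro continuous_on_coordinatewise_then_product continuous_intros)
  then have "connected (seg t)" for t
    unfolding seg_def by (rule connected_continuous_image) simp
  then have cs: "connected (\<sigma> ` seg t)" if "t \<in> standard_simplex 2" for t
    using connected_continuous_image continuous_on_subset[OF tri_cont[OF T \<sigma>] segsub[OF that]] by blast
  have ends: "t \<in> seg t" "?v \<in> seg t" for t
  proof -
    have "(\<lambda>j. (1 - 0) * t j + 0 * ?v j) \<in> seg t" "(\<lambda>j. (1 - 1) * t j + 1 * ?v j) \<in> seg t"
      unfolding seg_def by (rule image_eqI[where x=0], simp, simp) (rule image_eqI[where x=1], simp, simp)
    then show "t \<in> seg t" "?v \<in> seg t" by simp_all
  qed
  let ?F = "(\<lambda>t. \<sigma> ` seg t) ` {t \<in> standard_simplex 2. \<sigma> t \<notin> ?J}"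
  have "connected (\<Union>?F)"
  proof (rule connected_Union)
    have "\<sigma> ?v \<in> \<Inter>?F" using ends(2) by blast
    then show "\<Inter>?F \<noteq> {}" by blast
    fix C assume "C \<in> ?F"
    then show "connected C" using cs by (auto simp del: UN_iff)
  qed
  moreover have "\<Union>?F = \<sigma> ` standard_simplex 2 - ?J"
  proof
    have "\<sigma> ` seg t \<subseteq> \<sigma> ` standard_simplex 2 - ?J" if "t \<in> standard_simplex 2" "\<sigma> t \<notin> ?J" for t
      using segJ[OF that] image_mono[OF segsub[OF that(1)], of \<sigma>] by blast
    then show "\<Union>?F \<subseteq> \<sigma> ` standard_simplex 2 - ?J" by (intro UN_least) simp
    show "\<sigma> ` standard_simplex 2 - ?J \<subseteq> \<Union>?F"
    proof
      fix y assume "y \<in> \<sigma> ` standard_simplex 2 - ?J"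
      then obtain t where "t \<in> standard_simplex 2" "y = \<sigma> t" "\<sigma> t \<notin> ?J" by (metis DiffE imageE)
      then show "y \<in> \<Union>?F" using ends(1)[of t] by (intro UN_I[of t]) simp_all
    qed
  qed
  ultimately show "connected (\<sigma> ` standard_simplex 2 - ?J)" by simp
qed

text \<open>The two edges form a Jordan curve. Every triangle has \<open>c\<close> or
  \<open>d\<close> among its corners, so the rest of the sphere is the union of two connected stars
  around \<open>c\<close> and \<open>d\<close>; these overlap in a triangle at \<open>f\<close>.
  Hence the complement of the curve would be connected.\<close>

theorem no_parallel_edges:
  assumes V: "vertices T = {a, b, c, d}" and dist: "c \<noteq> a" "c \<noteq> b" "d \<noteq> a" "d \<noteq> b" "a \<noteq> b"
    and e: "(1, e) \<in> T" "corners 1 e = {a, b}" and e': "(1, e') \<in> T" "corners 1 e' = {a, b}" and ne: "e \<noteq> e'"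
    and f: "(1, f) \<in> T" "corners 1 f = {c, d}"
  shows False
proof -
  let ?J = "\<Union>e\<in>{e, e'}. e ` standard_simplex 1"
  have Jc: "closed ?J" using compact_image[OF e(1)] compact_image[OF e'(1)] by (auto intro: compact_imp_closed)
  have star: "connected (\<sigma> ` standard_simplex 2 - ?J) \<and> x \<in> \<sigma> ` standard_simplex 2 - ?J"
    if \<sigma>: "(2, \<sigma>) \<in> T" "x \<in> corners 2 \<sigma>" and x: "x \<in> {c, d}" for \<sigma> x
  proof -
    obtain i where i: "i \<le> 2" "x = \<sigma> (simplex_vertex i)" using \<sigma>(2) unfolding corners_def by blast
    show ?thesis using connected_triangle_diff[OF \<sigma>(1) i(1), of "{e, e'}"] e e' dist x i(2) by auto
  qed
  define X where "X = (\<lambda>x. \<Union>\<sigma>\<in>{\<sigma> \<in> tris T. x \<in> corners 2 \<sigma>}. \<sigma> ` standard_simplex 2 - ?J)"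
  have cX: "connected (X x)" if "x \<in> {c, d}" for x
    unfolding X_def by (rule connected_Union) (use star that in blast)+
  obtain \<sigma> i where \<sigma>: "(2, \<sigma>) \<in> T" "i \<le> 2" "cell ({..2} - {i}) \<sigma> = (1, f)" using edge_in_tri[OF f(1)] .
  have "corners 1 f \<subseteq> corners 2 \<sigma>"
    using corners_cell[of "{..2} - {i}" \<sigma>] \<sigma>(3) card_omit3[OF \<sigma>(2)] unfolding corners_def by (metis Diff_subset One_nat_def card.empty diff_Suc_1 finite_Diff finite_atMost image_mono numeral_2_eq_2 snd_conv zero_neq_numeral)
  then have cd: "c \<in> corners 2 \<sigma>" "d \<in> corners 2 \<sigma>" using f(2) by auto
  have c: "c \<in> \<sigma> ` standard_simplex 2 - ?J" using star[OF \<sigma>(1) cd(1)] by simp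
  have "c \<in> X x" if "x \<in> corners 2 \<sigma>" for x
    unfolding X_def by (rule UN_I[of \<sigma>]) (use \<sigma>(1) c that in auto)
  then have "X c \<inter> X d \<noteq> {}" using cd by blast
  then have conn: "connected (X c \<union> X d)" using connected_Un[of "X c" "X d"] cX by blast
  have "X c \<union> X d = S2 - ?J"
  proof
    show "X c \<union> X d \<subseteq> S2 - ?J" unfolding X_def using image_S2 by auto
    show "S2 - ?J \<subseteq> X c \<union> X d"
    proof
      fix y assume y: "y \<in> S2 - ?J"
      then have "y \<in> S2" by (rule DiffD1)
      then obtain m \<tau> t where t: "(m, \<tau>) \<in> T" "t \<in> open_simplex m" "\<tau> t = y" by (rule tri_point[OF T])
      obtain \<rho> where \<rho>: "(2, \<rho>) \<in> T" "\<tau> ` standard_simplex m \<subseteq> \<rho> ` standard_simplex 2" using covered_by_tris[OF t(1)] .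
      have "y \<in> \<tau> ` standard_simplex m" using t(2,3) open_simplex_sub by blast
      then have y\<rho>: "y \<in> \<rho> ` standard_simplex 2" using \<rho>(2) by blast
      have notin: "\<not> corners 2 \<rho> \<subseteq> {a, b}"
        using card_corners[OF \<rho>(1)] card_mono[of "{a, b}" "corners 2 \<rho>"] dist(5) by auto
      have "corners 2 \<rho> \<subseteq> {a, b, c, d}" using corners_vertices[OF \<rho>(1)] V by simp
      then have "c \<in> corners 2 \<rho> \<or> d \<in> corners 2 \<rho>" using notin by blast
      moreover have "y \<in> X x" if "x \<in> corners 2 \<rho>" for x
        unfolding X_def by (rule UN_I[of \<rho>]) (use y\<rho> y \<rho>(1) that in auto)
      ultimately show "y \<in> X c \<union> X d" by blast
    qed
  qed
  then have cJ: "connected (S2 - ?J)" using conn by simp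
  have "openin (top_of_set S2) (S2 \<inter> - ?J)" using Jc by (intro openin_open_Int open_Compl)
  then have oJ: "openin (top_of_set S2) (S2 - ?J)" by (simp only: Diff_eq)
  have p: "c \<in> S2 - ?J" using c image_S2[OF \<sigma>(1)] by auto
  \<comment> \<open>The planar theorem is applied in the chart that omits \<open>c\<close>, which
    lies off the curve; deleting this point keeps the complement connected.\<close>
  define p where "p = c"
  have p: "p \<in> S2 - ?J" "p \<in> S2" using p by (simp_all add: p_def)
  have cp: "connected (S2 - ?J - {p})" by (rule connected_sphere_delete[OF oJ cJ])
  obtain h k where hk: "homeomorphism (S2 - {p}) (UNIV::complex set) h k" using p(2) by (rule sphere_chart)
  have ends: "{pathstart (edge_path e), pathfinish (edge_path e)} = {a, b}"
    "{pathstart (edge_path e'), pathfinish (edge_path e')} = {a, b}"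
    using e(2) e'(2) unfolding edge_path_ends edge_corners by simp_all
  \<comment> \<open>Reversed if necessary, so that the two arcs close up to a loop.\<close>
  define q where "q = (if pathstart (edge_path e') = pathstart (edge_path e) then reversepath (edge_path e') else edge_path e')"
  have q: "arc q" "path_image q = e' ` standard_simplex 1"
    using arc_edge_path[OF e'(1)] by (auto simp: q_def arc_reversepath edge_path_image)
  have qe: "pathfinish (edge_path e) = pathstart q" "pathfinish q = pathstart (edge_path e)"
    using ends dist(5) unfolding q_def by (auto simp: doubleton_eq_iff)
  have meet: "e ` standard_simplex 1 \<inter> e' ` standard_simplex 1 \<subseteq> {a, b}"
    using edges_meet_in_corners[OF e(1) e'(1) ne] e(2) by simp
  define \<gamma> where "\<gamma> = edge_path e +++ q"
  have "simple_path \<gamma>"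
    unfolding \<gamma>_def
  proof (rule simple_path_join_loop[OF arc_edge_path[OF e(1)] q(1) qe])
    have "{pathstart (edge_path e), pathstart q} = {a, b}" using ends(1) qe(1) by simp
    then show "path_image (edge_path e) \<inter> path_image q \<subseteq> {pathstart (edge_path e), pathstart q}"
      using meet by (simp add: edge_path_image q(2))
  qed
  moreover have img: "path_image \<gamma> = ?J" unfolding \<gamma>_def using qe(1) by (simp add: path_image_join edge_path_image q(2))
  have sub: "?J \<subseteq> S2 - {p}" using p(1) image_S2[OF e(1)] image_S2[OF e'(1)] by auto
  have inj: "inj_on h (S2 - {p})" by (rule inj_on_inverseI[where g=k]) (rule homeomorphism_apply1[OF hk])
  ultimately have "simple_path (h \<circ> \<gamma>)"
    using simple_path_continuous_image[of \<gamma> h] img sub continuous_on_subset[OF homeomorphism_cont1[OF hk] sub] inj_on_subset[OF inj sub]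
    by simp
  moreover have "pathfinish (h \<circ> \<gamma>) = pathstart (h \<circ> \<gamma>)"
    unfolding \<gamma>_def using qe(2) by (simp add: pathfinish_compose pathstart_compose)
  ultimately have "\<not> connected (- path_image (h \<circ> \<gamma>))" by (rule Jordan_disconnected)
  moreover have "connected (h ` (S2 - ?J - {p}))"
    by (rule connected_continuous_image[OF _ cp]) (rule continuous_on_subset[OF homeomorphism_cont1[OF hk]], blast)
  moreover have "h ` (S2 - ?J - {p}) = - path_image (h \<circ> \<gamma>)"
  proof -
    have "h ` (S2 - {p}) = UNIV" using homeomorphism_image1[OF hk] .
    moreover have "h ` (S2 - {p} - ?J) = h ` (S2 - {p}) - h ` ?J"
      by (rule inj_on_image_set_diff[OF inj]) (use sub in auto)
    moreover have "S2 - ?J - {p} = S2 - {p} - ?J" by blast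
    ultimately show ?thesis unfolding path_image_compose img by (metis Compl_eq_Diff_UNIV)
  qed
  ultimately show False by simp
qed

end

section \<open>Combinatorics of colored triangulated surfaces\<close>

text \<open>The combinatorial content of the geometry: a closed connected surface. Edges are objects
  of their own, so parallel edges stay distinct. By \<open>shape\<close> the edges of a triangle
  order its corners linearly; \<open>two\<close> and \<open>star_conn\<close> make every vertex link
  a single cycle. That the surface is a sphere enters again only through
  \<open>no_parallel_edges\<close>.\<close>

locale csurf =
  fixes S :: "'t set" and E :: "'t \<Rightarrow> 'e set" and src tgt :: "'e \<Rightarrow> 'v" and col :: "'v \<Rightarrow> 'c"
  assumes fin: "finite S"
    and shape: "\<sigma> \<in> S \<Longrightarrow> \<exists>x y z e f g. E \<sigma> = {e, f, g} \<and> src e = x \<and> tgt e = y \<and> src f = y \<and> tgt f = z \<and>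
      src g = x \<and> tgt g = z \<and> col x \<noteq> col y \<and> col y \<noteq> col z \<and> col x \<noteq> col z"
    and two: "\<sigma> \<in> S \<Longrightarrow> e \<in> E \<sigma> \<Longrightarrow> card {\<tau> \<in> S. e \<in> E \<tau>} = 2"
    and star_conn: "R \<subseteq> {\<sigma> \<in> S. v \<in> (\<Union>e\<in>E \<sigma>. {src e, tgt e})} \<Longrightarrow> R \<noteq> {} \<Longrightarrow>
      (\<And>\<sigma> \<tau> e. \<sigma> \<in> R \<Longrightarrow> \<tau> \<in> S \<Longrightarrow> e \<in> E \<sigma> \<Longrightarrow> e \<in> E \<tau> \<Longrightarrow> v \<in> {src e, tgt e} \<Longrightarrow> \<tau> \<in> R) \<Longrightarrow>
      R = {\<sigma> \<in> S. v \<in> (\<Union>e\<in>E \<sigma>. {src e, tgt e})}"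
    and dual_conn: "R \<subseteq> S \<Longrightarrow> R \<noteq> {} \<Longrightarrow>
      (\<And>\<sigma> \<tau> e. \<sigma> \<in> R \<Longrightarrow> \<tau> \<in> S \<Longrightarrow> e \<in> E \<sigma> \<Longrightarrow> e \<in> E \<tau> \<Longrightarrow> \<tau> \<in> R) \<Longrightarrow> R = S"

section \<open>From geometric simplices to the combinatorial surface\<close>

definition src :: "((nat \<Rightarrow> real) \<Rightarrow> 'a) \<Rightarrow> 'a" where
  "src e = e (simplex_vertex 0)"

definition tgt :: "((nat \<Rightarrow> real) \<Rightarrow> 'a) \<Rightarrow> 'a" where
  "tgt e = e (simplex_vertex 1)"

definition eds :: "((nat \<Rightarrow> real) \<Rightarrow> 'a) \<Rightarrow> ((nat \<Rightarrow> real) \<Rightarrow> 'a) set" where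
  "eds \<sigma> = (\<lambda>i. snd (cell ({..2} - {i}) \<sigma>)) ` {..2}"

lemma omit_cell: "i \<le> 2 \<Longrightarrow> cell ({..2} - {i}) \<sigma> = (1, snd (cell ({..2} - {i}) \<sigma>))"
  using card_omit3[of i] by (simp add: cell_def)

lemma eds_iff: "e \<in> eds \<sigma> \<longleftrightarrow> (\<exists>i\<le>2. cell ({..2} - {i}) \<sigma> = (1, e))"
proof
  assume "e \<in> eds \<sigma>"
  then obtain i where "i \<le> 2" "e = snd (cell ({..2} - {i}) \<sigma>)" unfolding eds_def by auto
  then show "\<exists>i\<le>2. cell ({..2} - {i}) \<sigma> = (1, e)" using omit_cell[of i \<sigma>] by auto
next
  assume "\<exists>i\<le>2. cell ({..2} - {i}) \<sigma> = (1, e)"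
  then obtain i where i: "i \<le> 2" "cell ({..2} - {i}) \<sigma> = (1, e)" by blast
  then have "e = snd (cell ({..2} - {i}) \<sigma>)" by simp
  then show "e \<in> eds \<sigma>" unfolding eds_def using i(1) by blast
qed

lemma atMost2: "{..2::nat} = {0, 1, 2}"
  by auto

lemma omit3_sets: "{..2} - {0::nat} = {1, 2}" "{..2} - {1::nat} = {0, 2}" "{..2} - {2::nat} = {0, 1}"
  by auto

lemma eds3: "eds \<sigma> = {snd (cell {1, 2} \<sigma>), snd (cell {0, 2} \<sigma>), snd (cell {0, 1} \<sigma>)}"
proof -
  have "eds \<sigma> = (\<lambda>i. snd (cell ({..2} - {i}) \<sigma>)) ` {0, 1, 2}"
    unfolding eds_def by (rule arg_cong[OF atMost2])
  then show ?thesis by (simp only: image_insert image_empty omit3_sets)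
qed

lemma pair_ends:
  assumes "i < j"
  shows "src (snd (cell {i, j} \<sigma>)) = \<sigma> (simplex_vertex i)" "tgt (snd (cell {i, j} \<sigma>)) = \<sigma> (simplex_vertex j)"
  using cell_vertex[of "{i, j}" i \<sigma>] cell_vertex[of "{i, j}" j \<sigma>] vrank_pair[OF assms]
  by (simp_all add: src_def tgt_def)

definition good :: "(real^3 \<Rightarrow> 'c) \<Rightarrow> (real^3) simplices \<Rightarrow> bool" where
  "good \<psi> T \<longleftrightarrow> tri S2 T \<and> proper_coloring T \<psi>"

lemma good_colored: "good \<psi> T \<Longrightarrow> colored_sphere T"
  unfolding good_def proper_coloring_def by unfold_locales auto

lemma verts_corners: "(\<Union>e\<in>eds \<sigma>. {src e, tgt e}) = corners 2 \<sigma>"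
  unfolding eds3 corners_def atMost2 by (auto simp: pair_ends)

context colored_sphere
begin

lemma ends_corners: "{src e, tgt e} = corners 1 e"
  unfolding src_def tgt_def edge_corners ..

lemma eds_in_T: "\<sigma> \<in> tris T \<Longrightarrow> e \<in> eds \<sigma> \<Longrightarrow> (1, e) \<in> T"
proof -
  assume "\<sigma> \<in> tris T" "e \<in> eds \<sigma>"
  then obtain i where i: "i \<le> 2" "cell ({..2} - {i}) \<sigma> = (1, e)" "(2, \<sigma>) \<in> T" using eds_iff by auto
  have "{..2} - {i} \<noteq> {}" using card_omit3[OF i(1)] by (metis card.empty zero_neq_numeral)
  then show ?thesis using tri_cell[OF T i(3), of "{..2} - {i}"] i(2) by simp
qed

lemma share_iff: "share_edge e \<sigma> \<tau> \<longleftrightarrow> e \<in> eds \<sigma> \<and> e \<in> eds \<tau>"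
  unfolding share_edge_def eds_iff ..

lemma incident_iff: "incident T e = {\<tau> \<in> tris T. e \<in> eds \<tau>}"
  unfolding incident_def eds_iff by blast

end

lemma csurf_good:
  assumes "good \<psi> T"
  shows "csurf (tris T) eds src tgt \<psi>"
proof -
  interpret colored_sphere T by (rule good_colored[OF assms])
  have pc: "\<psi> (src e) \<noteq> \<psi> (tgt e)" if "(1, e) \<in> T" for e
    using assms that unfolding good_def proper_coloring_def src_def tgt_def by blast
  show ?thesis
  proof
    show "finite (tris T)" by (rule finite_tris)
  next
    fix \<sigma> assume \<sigma>: "\<sigma> \<in> tris T"
    let ?e = "snd (cell {0, 1} \<sigma>)" and ?f = "snd (cell {1, 2} \<sigma>)" and ?g = "snd (cell {0, 2} \<sigma>)"
    have *: "?e \<in> eds \<sigma>" "?f \<in> eds \<sigma>" "?g \<in> eds \<sigma>" unfolding eds3 by blast+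
    have "\<psi> (src ?e) \<noteq> \<psi> (tgt ?e)" "\<psi> (src ?f) \<noteq> \<psi> (tgt ?f)" "\<psi> (src ?g) \<noteq> \<psi> (tgt ?g)"
      using pc eds_in_T[OF \<sigma>] * by blast+
    moreover have "eds \<sigma> = {?e, ?f, ?g}" unfolding eds3 by blast
    ultimately show "\<exists>x y z e f g. eds \<sigma> = {e, f, g} \<and> src e = x \<and> tgt e = y \<and> src f = y \<and> tgt f = z \<and>
      src g = x \<and> tgt g = z \<and> \<psi> x \<noteq> \<psi> y \<and> \<psi> y \<noteq> \<psi> z \<and> \<psi> x \<noteq> \<psi> z"
      by (intro exI[of _ "\<sigma> (simplex_vertex 0)"] exI[of _ "\<sigma> (simplex_vertex 1)"] exI[of _ "\<sigma> (simplex_vertex 2)"]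
          exI[of _ ?e] exI[of _ ?f] exI[of _ ?g]) (simp add: pair_ends)
  next
    fix \<sigma> e assume "\<sigma> \<in> tris T" "e \<in> eds \<sigma>"
    then show "card {\<tau> \<in> tris T. e \<in> eds \<tau>} = 2" using card_incident[OF eds_in_T] incident_iff by simp
  next
    fix R v assume R: "R \<subseteq> {\<sigma> \<in> tris T. v \<in> (\<Union>e\<in>eds \<sigma>. {src e, tgt e})}" "R \<noteq> {}"
      and cl: "\<And>\<sigma> \<tau> e. \<sigma> \<in> R \<Longrightarrow> \<tau> \<in> tris T \<Longrightarrow> e \<in> eds \<sigma> \<Longrightarrow> e \<in> eds \<tau> \<Longrightarrow> v \<in> {src e, tgt e} \<Longrightarrow> \<tau> \<in> R"
    have eq: "{\<sigma> \<in> tris T. v \<in> (\<Union>e\<in>eds \<sigma>. {src e, tgt e})} = {\<sigma> \<in> tris T. v \<in> \<sigma> ` standard_simplex 2}" if "v \<in> vertices T"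
      using vertex_in_image that unfolding verts_corners by blast
    obtain \<sigma> where \<sigma>: "\<sigma> \<in> R" "\<sigma> \<in> tris T" "v \<in> corners 2 \<sigma>" using R unfolding verts_corners by blast
    then have v: "v \<in> vertices T" using corners_vertices by blast
    show "R = {\<sigma> \<in> tris T. v \<in> (\<Union>e\<in>eds \<sigma>. {src e, tgt e})}"
      unfolding eq[OF v]
    proof (rule star_connected[OF v R(1)[unfolded eq[OF v]] R(2)])
      fix \<sigma> \<tau> e assume "\<sigma> \<in> R" "\<tau> \<in> tris T" "(1, e) \<in> T" "share_edge e \<sigma> \<tau>" "v \<in> e ` standard_simplex 1"
      then show "\<tau> \<in> R" using cl[of \<sigma> \<tau> e] vertex_in_image[of 1 e v] v unfolding share_iff ends_corners by blast
    qed
  next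
    fix R assume R: "R \<subseteq> tris T" "R \<noteq> {}"
      and cl: "\<And>\<sigma> \<tau> e. \<sigma> \<in> R \<Longrightarrow> \<tau> \<in> tris T \<Longrightarrow> e \<in> eds \<sigma> \<Longrightarrow> e \<in> eds \<tau> \<Longrightarrow> \<tau> \<in> R"
    show "R = tris T"
      by (rule dual_connected[OF R]) (use cl share_iff in blast)
  qed
qed

text \<open>The record of a flip of the edge \<open>e\<close> between \<open>A\<close> and
  \<open>B\<close>, whose opposite vertices are \<open>c\<close> and \<open>d\<close>. By convention
  \<open>C\<close> is the new triangle at the source of \<open>e\<close> and \<open>D\<close> the
  one at its target.\<close>

definition flipped ::
    "('t \<Rightarrow> 'e set) \<Rightarrow> ('e \<Rightarrow> 'v) \<Rightarrow> ('e \<Rightarrow> 'v) \<Rightarrow> 't set \<Rightarrow> 't set \<Rightarrow> 't \<Rightarrow> 't \<Rightarrow> 'e \<Rightarrow> 'v \<Rightarrow> 'v \<Rightarrow> 't \<Rightarrow> 't \<Rightarrow> 'e \<Rightarrow> bool" where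
  "flipped E s t S S' A B e c d C D f \<longleftrightarrow>
     S' = S - {A, B} \<union> {C, D} \<and> C \<notin> S \<and> D \<notin> S \<and> C \<noteq> D \<and> {s f, t f} = {c, d} \<and> (\<forall>\<sigma>\<in>S. f \<notin> E \<sigma>) \<and>
     E C = insert f {x \<in> E A \<union> E B. s e \<in> {s x, t x} \<and> x \<noteq> e} \<and>
     E D = insert f {x \<in> E A \<union> E B. t e \<in> {s x, t x} \<and> x \<noteq> e}"

context csurf
begin

definition ends :: "'e \<Rightarrow> 'v set" where "ends e = {src e, tgt e}"

definition verts :: "'t \<Rightarrow> 'v set" where "verts \<sigma> = (\<Union>e\<in>E \<sigma>. ends e)"

definition Star :: "'v \<Rightarrow> 't set" where "Star v = {\<sigma> \<in> S. v \<in> verts \<sigma>}"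

definition arrow :: "'t \<Rightarrow> 'v \<Rightarrow> 'v \<Rightarrow> bool" where "arrow \<sigma> x y \<longleftrightarrow> (\<exists>e\<in>E \<sigma>. src e = x \<and> tgt e = y)"

lemma tri_at:
  assumes "\<sigma> \<in> S" "v \<in> verts \<sigma>"
  obtains x y p q l where "E \<sigma> = {p, q, l}" "ends p = {v, x}" "ends q = {v, y}" "ends l = {x, y}"
    "verts \<sigma> = {v, x, y}" "v \<noteq> x" "v \<noteq> y" "x \<noteq> y" "col v \<noteq> col x" "col v \<noteq> col y" "col x \<noteq> col y" "p \<noteq> q" "p \<noteq> l" "q \<noteq> l"
proof -
  obtain x y z e f g where s: "E \<sigma> = {e, f, g}" "src e = x" "tgt e = y" "src f = y" "tgt f = z"
      "src g = x" "tgt g = z" "col x \<noteq> col y" "col y \<noteq> col z" "col x \<noteq> col z"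
    using shape[OF assms(1)] by blast
  have v: "verts \<sigma> = {x, y, z}" unfolding verts_def ends_def s(1) using s by auto
  have d: "x \<noteq> y" "y \<noteq> z" "x \<noteq> z" using s by auto
  from assms(2) v consider "v = x" | "v = y" | "v = z" by blast
  then show ?thesis
  proof cases
    case 1
    show ?thesis by (rule that[of e g f y z]) (use s v d 1 in \<open>auto simp: ends_def doubleton_eq_iff\<close>)
  next
    case 2
    show ?thesis by (rule that[of e f g x z]) (use s v d 2 in \<open>auto simp: ends_def doubleton_eq_iff\<close>)
  next
    case 3
    show ?thesis by (rule that[of f g e y x]) (use s v d 3 in \<open>auto simp: ends_def doubleton_eq_iff\<close>)
  qed
qed

lemma arrow_linear:
  assumes "\<sigma> \<in> S"
  shows "x \<in> verts \<sigma> \<Longrightarrow> y \<in> verts \<sigma> \<Longrightarrow> x \<noteq> y \<Longrightarrow> arrow \<sigma> x y \<or> arrow \<sigma> y x"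
    "arrow \<sigma> x y \<Longrightarrow> \<not> arrow \<sigma> y x" "arrow \<sigma> x y \<Longrightarrow> arrow \<sigma> y z \<Longrightarrow> arrow \<sigma> x z"
    "arrow \<sigma> x y \<Longrightarrow> x \<in> verts \<sigma> \<and> y \<in> verts \<sigma> \<and> x \<noteq> y"
proof -
  obtain x0 y0 z0 e f g where s: "E \<sigma> = {e, f, g}" "src e = x0" "tgt e = y0" "src f = y0" "tgt f = z0"
      "src g = x0" "tgt g = z0" "col x0 \<noteq> col y0" "col y0 \<noteq> col z0" "col x0 \<noteq> col z0"
    using shape[OF assms(1)] by blast
  have v: "verts \<sigma> = {x0, y0, z0}" unfolding verts_def ends_def s(1) using s by auto
  have a: "arrow \<sigma> a b \<longleftrightarrow> (a = x0 \<and> b = y0) \<or> (a = y0 \<and> b = z0) \<or> (a = x0 \<and> b = z0)" for a b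
    unfolding arrow_def s(1) using s by auto
  have d: "x0 \<noteq> y0" "y0 \<noteq> z0" "x0 \<noteq> z0" using s by auto
  show "x \<in> verts \<sigma> \<Longrightarrow> y \<in> verts \<sigma> \<Longrightarrow> x \<noteq> y \<Longrightarrow> arrow \<sigma> x y \<or> arrow \<sigma> y x"
    "arrow \<sigma> x y \<Longrightarrow> \<not> arrow \<sigma> y x" "arrow \<sigma> x y \<Longrightarrow> arrow \<sigma> y z \<Longrightarrow> arrow \<sigma> x z"
    "arrow \<sigma> x y \<Longrightarrow> x \<in> verts \<sigma> \<and> y \<in> verts \<sigma> \<and> x \<noteq> y"
    unfolding a v using d by auto
qed

lemma arrow_edge:
  assumes "\<sigma> \<in> S" "e \<in> E \<sigma>" "ends e = {x, y}"
  shows "arrow \<sigma> x y \<longleftrightarrow> src e = x" 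
proof -
  obtain x0 y0 z0 e0 f g where s: "E \<sigma> = {e0, f, g}" "src e0 = x0" "tgt e0 = y0" "src f = y0" "tgt f = z0"
      "src g = x0" "tgt g = z0" "col x0 \<noteq> col y0" "col y0 \<noteq> col z0" "col x0 \<noteq> col z0"
    using shape[OF assms(1)] by blast
  have d: "x0 \<noteq> y0" "y0 \<noteq> z0" "x0 \<noteq> z0" using s by auto
  have a: "arrow \<sigma> a b \<longleftrightarrow> (a = x0 \<and> b = y0) \<or> (a = y0 \<and> b = z0) \<or> (a = x0 \<and> b = z0)" for a b
    unfolding arrow_def s(1) using s by auto
  have en: "ends e0 = {x0, y0}" "ends f = {y0, z0}" "ends g = {x0, z0}" using s by (simp_all add: ends_def)
  from assms(2) s(1) consider "e = e0" | "e = f" | "e = g" by blast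
  then show ?thesis
    by cases (use assms(3) en d s(2-7) a in \<open>auto simp: doubleton_eq_iff\<close>)
qed

end

lemma card3_subset:
  assumes "s \<subseteq> {..3::nat}" "card s = 3"
  obtains k where "k \<le> 3" "s = {..3} - {k}"
proof -
  have "card ({..3} - s) = 1" using card_Diff_subset[of s "{..3}"] assms finite_subset[OF assms(1)] by simp
  then obtain k where k: "{..3} - s = {k}" using card_1_singletonE by blast
  then have "k \<le> 3" "s = {..3} - {k}" using assms(1) by blast+
  then show ?thesis using that by blast
qed

lemma eds_cell:
  assumes "finite s" "card s = 3"
  shows "eds (snd (cell s F)) = {snd (cell r F) |r. r \<subseteq> s \<and> card r = 2}"
proof
  have ne: "s \<noteq> {}" using assms by auto
  have c2: "card s - 1 = 2" using assms by simp
  show "eds (snd (cell s F)) \<subseteq> {snd (cell r F) |r. r \<subseteq> s \<and> card r = 2}"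
  proof
    fix e assume "e \<in> eds (snd (cell s F))"
    then obtain i where i: "i \<le> 2" "e = snd (cell ({..2} - {i}) (snd (cell s F)))" unfolding eds_def by auto
    obtain r where r: "r \<subseteq> s" "{..2} - {i} = vrank s ` r"
      using rank_preimage[OF assms(1) ne, of "{..2} - {i}"] c2 by auto
    have c: "card r = 2" using card_rank_image[OF assms(1) r(1)] card_omit3[OF i(1)] r(2) by simp
    then have "r \<noteq> {}" by auto
    then have "e = snd (cell r F)" using i(2) cell_cell[OF assms(1) r(1), of F] r(2) by simp
    then show "e \<in> {snd (cell r F) |r. r \<subseteq> s \<and> card r = 2}" using r(1) c by blast
  qed
  show "{snd (cell r F) |r. r \<subseteq> s \<and> card r = 2} \<subseteq> eds (snd (cell s F))"
  proof
    fix e assume "e \<in> {snd (cell r F) |r. r \<subseteq> s \<and> card r = 2}"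
    then obtain r where r: "r \<subseteq> s" "card r = 2" "e = snd (cell r F)" by blast
    have "vrank s ` r \<subseteq> {..2}" "card (vrank s ` r) = 2"
      using rank_image_sub[OF assms(1) ne r(1)] card_rank_image[OF assms(1) r(1)] r(2) c2 by auto
    then obtain i where i: "i \<le> 2" "vrank s ` r = {..2} - {i}" using two_subset by blast
    have "r \<noteq> {}" using r(2) by auto
    then have "e = snd (cell ({..2} - {i}) (snd (cell s F)))" using cell_cell[OF assms(1) r(1), of F] i(2) r(3) by simp
    then show "e \<in> eds (snd (cell s F))" unfolding eds_def using i(1) by blast
  qed
qed

lemma card2_pair:
  assumes "card (r::nat set) = 2"
  obtains x y where "x < y" "r = {x, y}"
proof -
  obtain x y where "r = {x, y}" "x \<noteq> y" using assms by (auto simp: card_2_iff)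
  then show ?thesis using that[of x y] that[of y x] by (cases "x < y") (auto simp: insert_commute)
qed

lemma ends_cell:
  assumes "card r = 2"
  shows "{src (snd (cell r F)), tgt (snd (cell r F))} = (\<lambda>k. F (simplex_vertex k)) ` r"
proof -
  obtain x y where "x < y" "r = {x, y}" using card2_pair[OF assms] .
  then show ?thesis using pair_ends[of x y F] by simp
qed

section \<open>The effect of an exchange on vertices, edges and colors\<close>

context disc_switch
begin

lemma G_vertex: "k \<le> 3 \<Longrightarrow> G (simplex_vertex k) = p k"
proof -
  assume k: "k \<le> 3"
  have "\<not> U \<subseteq> {k}" using two card_mono[of "{k}" U] by auto
  then have "simplex_vertex k \<in> upper" using k by (simp add: upper_supp vertex_simplex supp_vertex)
  then show ?thesis using G_upper g_vertex[OF k] by simp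
qed

lemma G_vertices: "s \<subseteq> {..3} \<Longrightarrow> (\<lambda>k. G (simplex_vertex k)) ` s = p ` s"
  using G_vertex by (intro image_cong) auto

lemma cell_G_inj:
  assumes s: "s \<subseteq> {..3}" "s \<noteq> {}" and r: "r \<subseteq> {..3}" "r \<noteq> {}" and eq: "cell s G = cell r G"
  shows "s = r"
proof -
  have f: "finite s" "finite r" using s r finite_subset by blast+
  have "(\<lambda>i. G (simplex_vertex i)) ` s = (\<lambda>i. G (simplex_vertex i)) ` r"
    using cell_vertices[OF f(1) s(2), of G] cell_vertices[OF f(2) r(2), of G] eq by (metis fst_cell)
  then show ?thesis using inj_on_image_eq_iff[OF p_inj s(1) r(1)] G_vertices s(1) r(1) by simp
qed

text \<open>A lower cell has interior points in \<open>Q_int\<close>. A simplex of \<open>T\<close>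
  with such points is an upper cell, and upper and lower cells have different vertex sets.\<close>

lemma lower_cells_new: "lower_cells \<inter> T = {}"
proof -
  have False if a: "(n, \<sigma>) \<in> lower_cells" "(n, \<sigma>) \<in> T" for n \<sigma>
  proof -
    obtain s where s: "(n, \<sigma>) = cell s G" "s \<subseteq> {..3}" "U \<subseteq> s" "\<not> L \<subseteq> s" "s \<noteq> {}"
      using lower_cellE[OF a(1)] by metis
    obtain x where x: "x \<in> open_simplex n" using open_simplex_nonempty by blast
    have "\<sigma> x \<in> Q_int" using lower_cell_point[OF s x] G_lower_int by metis
    then have "(n, \<sigma>) \<in> upper_cells" using kept_not_int[of n \<sigma> x] a(2) x open_simplex_sub by blast
    then obtain r where r: "(n, \<sigma>) = cell r g" "r \<subseteq> {..3}" "L \<subseteq> r" "\<not> U \<subseteq> r" unfolding upper_cells_def by blast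
    have rne: "r \<noteq> {}" using r(3) UL by blast
    have "cell s G = cell r G" using s(1) r(1) G_boundary[OF r(2) rne r(4)] by simp
    then have "s = r" by (rule cell_G_inj[OF s(2,5) r(2) rne])
    then show False using s(4) r(3) by blast
  qed
  then show ?thesis by fastforce
qed

text \<open>New edges join corners of the tetrahedron, and these have four different colors.\<close>

lemma proper_switched:
  assumes "proper_coloring T \<psi>" "inj_on (\<psi> \<circ> p) {..3}"
  shows "proper_coloring switched \<psi>"
  unfolding proper_coloring_def
proof (intro allI impI)
  fix \<sigma> assume "(1, \<sigma>) \<in> switched"
  then consider "(1, \<sigma>) \<in> T" | "(1, \<sigma>) \<in> lower_cells" by (auto simp: switched_def)
  then show "\<psi> (\<sigma> (simplex_vertex 0)) \<noteq> \<psi> (\<sigma> (simplex_vertex 1))"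
  proof cases
    case 1
    then show ?thesis using assms(1) unfolding proper_coloring_def by blast
  next
    case 2
    then obtain s where s: "(1, \<sigma>) = cell s G" "s \<subseteq> {..3}" "1 = card s - 1" using lower_cellE by metis
    then have "card s = 2" by simp
    then obtain x y where xy: "x < y" "s = {x, y}" by (rule card2_pair)
    have "\<sigma> = snd (cell {x, y} G)" using s(1) xy(2) by (metis snd_conv)
    then have "\<sigma> (simplex_vertex 0) = p x" "\<sigma> (simplex_vertex 1) = p y"
      using pair_ends[OF xy(1), of G] G_vertex xy(2) s(2) by (simp_all add: src_def tgt_def)
    then show ?thesis using inj_onD[OF assms(2), of x y] xy s(2) by auto
  qed
qed

lemma vertices_switchedI:
  assumes "v \<in> vertices T" "\<And>l. L = {l} \<Longrightarrow> v \<noteq> p l" shows "v \<in> vertices switched"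
proof -
  obtain \<nu> where \<nu>: "(0, \<nu>) \<in> T" "v = \<nu> (simplex_vertex 0)" using assms(1) by (auto simp: vertices_def)
  have "(0, \<nu>) \<notin> upper_cells"
  proof
    assume "(0, \<nu>) \<in> upper_cells"
    then obtain s where s: "(0, \<nu>) = cell s g" "s \<subseteq> {..3}" "L \<subseteq> s" "\<not> U \<subseteq> s" unfolding upper_cells_def by blast
    have fs: "finite s" using s(2) finite_subset by blast
    have ne: "s \<noteq> {}" using s UL by blast
    have "card s - 1 = 0" using s(1) by (metis fst_cell fst_conv)
    then have "card s = 1" using ne fs by (metis One_nat_def Suc_pred card_gt_0_iff)
    then obtain l where l: "s = {l}" using card_1_singletonE by blast
    then have L: "L = {l}" using s(3) UL(4) by blast
    have "\<nu> = snd (cell {l} g)" using s(1) l by (metis snd_conv)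
    moreover have "vrank {l} l = 0" using rank_lt_card[of "{l}" l] by simp
    ultimately have "v = p l" using cell_vertex[of "{l}" l g] \<nu>(2) g_vertex s(2) l by simp
    then show False using assms(2)[OF L] by simp
  qed
  then have "(0, \<nu>) \<in> switched" using \<nu>(1) by (simp add: switched_def)
  then show ?thesis using \<nu>(2) vertexI by blast
qed

text \<open>A single vertex in \<open>L\<close> is an interior vertex of the upper disc, which
  consists of the three facets around it.\<close>

lemma removed_vertex:
  assumes "L = {l}" shows "vertices switched = vertices T - {p l}"
proof
  have l3: "l \<le> 3" using assms UL(1) by auto
  have "simplex_vertex l \<in> standard_simplex 3 \<and> \<not> U \<subseteq> supp (simplex_vertex l) \<and> L \<subseteq> supp (simplex_vertex l)"
    using assms UL(2,3) l3 by (auto simp: vertex_simplex supp_vertex)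
  then have "simplex_vertex l \<in> upper_int" unfolding upper_int_supp .
  then have "p l \<in> Q_int" using g_vertex[OF l3] unfolding Q_int_def by (metis image_eqI)
  then show "vertices switched \<subseteq> vertices T - {p l}" using vertices_switched by blast
  show "vertices T - {p l} \<subseteq> vertices switched" using vertices_switchedI assms by blast
qed

lemma edge_of_triangle: "\<sigma> \<in> tris T \<Longrightarrow> e \<in> eds \<sigma> \<Longrightarrow> (1, e) \<in> T"
proof -
  assume "\<sigma> \<in> tris T" "e \<in> eds \<sigma>"
  then obtain i where i: "i \<le> 2" "cell ({..2} - {i}) \<sigma> = (1, e)" "(2, \<sigma>) \<in> T" using eds_iff by auto
  have "{..2} - {i} \<noteq> {}" using card_omit3[OF i(1)] by (metis card.empty zero_neq_numeral)
  then show ?thesis using tri_cell[OF T i(3), of "{..2} - {i}"] i(2) by simp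
qed

text \<open>Cells of the tetrahedron correspond to vertex sets, so the edges of all four triangles
  are the pairs of their vertices. Passing to the lower disc exchanges the pair \<open>L\<close> for
  the pair \<open>U\<close> and keeps the other four.\<close>

lemma flipped_switched:
  assumes U: "U = {u1, u2}" "u1 < u2" and L: "L = {l1, l2}" "l1 < l2"
  shows "flipped eds src tgt (tris T) (tris switched) (A u2) (A u1) (snd (cell {l1, l2} G)) (p u1) (p u2)
      (snd (cell ({..3} - {l2}) G)) (snd (cell ({..3} - {l1}) G)) (snd (cell U G))"
    and "src (snd (cell U G)) = p u1" "tgt (snd (cell U G)) = p u2" "vertices switched = vertices T"
proof -
  have mem: "u1 \<le> 3" "u2 \<le> 3" "l1 \<le> 3" "l2 \<le> 3" using UL(1) U L by auto
  have dist: "u1 \<noteq> l1" "u1 \<noteq> l2" "u2 \<noteq> l1" "u2 \<noteq> l2" using UL(2) U L by auto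
  have all: "{..3} = {u1, u2, l1, l2}" using UL(1) U L by auto
  have subs: "k \<le> 3 \<Longrightarrow> {..3} - {k} \<subseteq> {..3} \<and> finite ({..3} - {k}) \<and> card ({..3} - {k}) = 3 \<and> {..3} - {k} \<noteq> {}" for k :: nat
  proof -
    assume "k \<le> 3"
    then have "card ({..3} - {k}) = 3" by simp
    moreover from this have "{..3} - {k} \<noteq> {}" by (metis card.empty zero_neq_numeral)
    ultimately show ?thesis by blast
  qed
  have facets: "A u = snd (cell ({..3} - {u}) G)" if u: "u \<in> U" for u
  proof -
    have "cell ({..3} - {u}) G = cell ({..3} - {u}) g"
      by (rule G_boundary) (use subs U3[OF u] u in auto)
    then show ?thesis using cell_facet[OF u] by simp
  qed
  have triangle: "(2, snd (cell ({..3} - {k}) G)) = cell ({..3} - {k}) G" if "k \<le> 3" for k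
    using subs[OF that] by (simp add: cell_def)
  have lower: "(2, \<sigma>) \<in> lower_cells \<longleftrightarrow> \<sigma> = snd (cell ({..3} - {l2}) G) \<or> \<sigma> = snd (cell ({..3} - {l1}) G)" for \<sigma>
  proof
    assume "(2, \<sigma>) \<in> lower_cells"
    then obtain s where s: "(2, \<sigma>) = cell s G" "s \<subseteq> {..3}" "U \<subseteq> s" "\<not> L \<subseteq> s" "2 = card s - 1" using lower_cellE by metis
    then have "card s = 3" by simp
    then obtain k where k: "k \<le> 3" "s = {..3} - {k}" using card3_subset s(2) by blast
    have "k \<in> {l1, l2}" using k s(3) U all by auto
    then show "\<sigma> = snd (cell ({..3} - {l2}) G) \<or> \<sigma> = snd (cell ({..3} - {l1}) G)"
      using s(1) k(2) by (metis empty_iff insert_iff snd_conv)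
  next
    have "(2, snd (cell ({..3} - {l}) G)) \<in> lower_cells" if "l \<in> {l1, l2}" for l
      using triangle[of l] that mem dist U L unfolding lower_cells_def by auto
    then show "\<sigma> = snd (cell ({..3} - {l2}) G) \<or> \<sigma> = snd (cell ({..3} - {l1}) G) \<Longrightarrow> (2, \<sigma>) \<in> lower_cells" by blast
  qed
  have upper: "(2, \<sigma>) \<in> upper_cells \<longleftrightarrow> \<sigma> = A u1 \<or> \<sigma> = A u2" for \<sigma>
  proof
    assume "(2, \<sigma>) \<in> upper_cells"
    then obtain s where s: "(2, \<sigma>) = cell s g" "s \<subseteq> {..3}" "L \<subseteq> s" "\<not> U \<subseteq> s" unfolding upper_cells_def by blast
    then have "2 = card s - 1" by (metis fst_cell fst_conv)
    then have "card s = 3" by simp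
    then obtain k where k: "k \<le> 3" "s = {..3} - {k}" using card3_subset s(2) by blast
    have kU: "k \<in> U" using k s(3) L U all by auto
    then have "\<sigma> = A k" using cell_facet[OF kU] s(1) k(2) by simp
    then show "\<sigma> = A u1 \<or> \<sigma> = A u2" using kU U by blast
  next
    have "(2, A u) \<in> upper_cells" if "u \<in> U" for u
      using cell_facet[OF that] that dist U L mem unfolding upper_cells_def
      by (auto intro!: exI[of _ "{..3} - {u}"])
    then show "\<sigma> = A u1 \<or> \<sigma> = A u2 \<Longrightarrow> (2, \<sigma>) \<in> upper_cells" using U by blast
  qed
  let ?C = "snd (cell ({..3} - {l2}) G)" and ?D = "snd (cell ({..3} - {l1}) G)" and ?f = "snd (cell U G)"
    and ?e = "snd (cell {l1, l2} G)"
  show f: "src ?f = p u1" "tgt ?f = p u2"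
    using pair_ends[OF U(2), of G] G_vertex mem U(1) by simp_all
  have fl: "(1, ?f) \<in> lower_cells"
  proof -
    have "(1, ?f) = cell U G" using U by (simp add: cell_def)
    moreover have "\<not> L \<subseteq> U" using L dist U by blast
    ultimately show ?thesis unfolding lower_cells_def using U_sub by blast
  qed
  have CT: "?C \<notin> tris T" "?D \<notin> tris T" using lower lower_cells_new by blast+
  have "?C \<noteq> ?D"
  proof
    assume "?C = ?D"
    then have "cell ({..3} - {l2}) G = cell ({..3} - {l1}) G" using triangle mem by metis
    from cell_G_inj[OF _ _ _ _ this] have "{..3} - {l2} = {..3} - {l1}" using subs mem by blast
    then show False using mem L(2) by auto
  qed
  moreover have "\<forall>\<sigma>\<in>tris T. ?f \<notin> eds \<sigma>"
    using edge_of_triangle fl lower_cells_new by blast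
  moreover have "tris switched = tris T - {A u2, A u1} \<union> {?C, ?D}"
    unfolding switched_def using upper lower by auto
  moreover have edC: "eds (snd (cell ({..3} - {k}) G)) = {snd (cell r G) |r. r \<subseteq> {..3} - {k} \<and> card r = 2}" if "k \<le> 3" for k
    using eds_cell subs[OF that] by blast
  have en: "{src (snd (cell r G)), tgt (snd (cell r G))} = p ` r" if "card r = 2" "r \<subseteq> {..3}" for r
    using ends_cell[OF that(1), of G] G_vertices[OF that(2)] by simp
  have pe: "src ?e = p l1" "tgt ?e = p l2" using pair_ends[OF L(2), of G] G_vertex mem by simp_all
  have in_p: "p l \<in> p ` r \<longleftrightarrow> l \<in> r" if "l \<le> 3" "r \<subseteq> {..3}" for l r
    using inj_on_image_mem_iff[OF p_inj] that by auto
  have ce: "snd (cell r G) = ?e \<longleftrightarrow> r = {l1, l2}" if "card r = 2" "r \<subseteq> {..3}" for r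
  proof
    assume "snd (cell r G) = ?e"
    moreover have "fst (cell r G) = fst (cell {l1, l2} G)" using that(1) L(2) by simp
    ultimately have "cell r G = cell {l1, l2} G" by (simp add: prod_eq_iff)
    then show "r = {l1, l2}" using cell_G_inj[of r "{l1, l2}"] that mem by force
  qed simp
  \<comment> \<open>Both new triangles at once: \<open>l\<close> is the end of the old edge that is
    kept, \<open>l'\<close> the one that is omitted.\<close>
  have ed: "eds (snd (cell ({..3} - {l'}) G)) = insert ?f {x \<in> eds (A u2) \<union> eds (A u1). p l \<in> {src x, tgt x} \<and> x \<noteq> ?e}"
    if ll: "{l, l'} = {l1, l2}" for l l'
  proof -
    have l: "l \<le> 3" "l' \<le> 3" "l \<noteq> l'" "{..3} = {u1, u2, l, l'}" "{l, l'} \<inter> {u1, u2} = {}"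
      using ll mem L(2) all dist by (auto simp: doubleton_eq_iff)
    have e2: "\<exists>a b. r = {a, b} \<and> a \<noteq> b" if "card r = 2" for r :: "nat set" using that by (auto simp: card_2_iff)
    have R: "{x \<in> eds (A u2) \<union> eds (A u1). p l \<in> {src x, tgt x} \<and> x \<noteq> ?e}
        = {snd (cell r G) |r. (r \<subseteq> {..3} - {u2} \<or> r \<subseteq> {..3} - {u1}) \<and> card r = 2 \<and> l \<in> r \<and> r \<noteq> {l, l'}}"
      (is "?L = ?R")
    proof
      show "?L \<subseteq> ?R"
      proof
        fix x assume x: "x \<in> ?L"
        then have "x \<in> eds (snd (cell ({..3} - {u2}) G)) \<or> x \<in> eds (snd (cell ({..3} - {u1}) G))"
          using facets U(1) by auto
        then obtain r where r: "r \<subseteq> {..3} - {u2} \<or> r \<subseteq> {..3} - {u1}" "card r = 2" "x = snd (cell r G)"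
          using edC mem by auto
        then have r3: "r \<subseteq> {..3}" by blast
        have "l \<in> r" using x r(3) en[OF r(2) r3] in_p[OF l(1) r3] by auto
        moreover have "r \<noteq> {l, l'}" using x r(3) ll by auto
        ultimately show "x \<in> ?R" using r by blast
      qed
      show "?R \<subseteq> ?L"
      proof
        fix x assume "x \<in> ?R"
        then obtain r where r: "r \<subseteq> {..3} - {u2} \<or> r \<subseteq> {..3} - {u1}" "card r = 2" "l \<in> r" "r \<noteq> {l, l'}" "x = snd (cell r G)" by blast
        then have r3: "r \<subseteq> {..3}" by blast
        have "x \<in> eds (A u2) \<union> eds (A u1)" using r(1,2,5) edC[OF mem(1)] edC[OF mem(2)] facets U(1) by auto
        moreover have "p l \<in> {src x, tgt x}" using en[OF r(2) r3] r(3,5) in_p[OF l(1) r3] by simp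
        moreover have "x \<noteq> ?e" using ce[OF r(2) r3] r(4,5) ll by simp
        ultimately show "x \<in> ?L" by blast
      qed
    qed
    show ?thesis unfolding R edC[OF l(2)]
    proof
      show "{snd (cell r G) |r. r \<subseteq> {..3} - {l'} \<and> card r = 2}
        \<subseteq> insert ?f {snd (cell r G) |r. (r \<subseteq> {..3} - {u2} \<or> r \<subseteq> {..3} - {u1}) \<and> card r = 2 \<and> l \<in> r \<and> r \<noteq> {l, l'}}"
      proof
        fix x assume "x \<in> {snd (cell r G) |r. r \<subseteq> {..3} - {l'} \<and> card r = 2}"
        then obtain r where r: "r \<subseteq> {..3} - {l'}" "card r = 2" "x = snd (cell r G)" by blast
        show "x \<in> insert ?f {snd (cell r G) |r. (r \<subseteq> {..3} - {u2} \<or> r \<subseteq> {..3} - {u1}) \<and> card r = 2 \<and> l \<in> r \<and> r \<noteq> {l, l'}}"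
        proof (cases "l \<in> r")
          case False
          then have "r \<subseteq> {u1, u2}" using r(1) l(4) by blast
          then have "r = U" using card_subset_eq[of "{u1, u2}" r] r(2) U by simp
          then show ?thesis using r(3) by simp
        next
          case True
          have "\<not> (u1 \<in> r \<and> u2 \<in> r)"
          proof
            assume "u1 \<in> r \<and> u2 \<in> r"
            then have "{l, u1, u2} \<subseteq> r" using True by simp
            moreover have "card {l, u1, u2} = 3" using l(5) U(2) by auto
            ultimately show False using card_mono[of r "{l, u1, u2}"] r(1,2) finite_subset[OF r(1)] by simp
          qed
          moreover have "r \<subseteq> {..3}" using r(1) by auto
          ultimately have "r \<subseteq> {..3} - {u2} \<or> r \<subseteq> {..3} - {u1}" by auto
          moreover have "r \<noteq> {l, l'}" using r(1) by blast
          ultimately show ?thesis using r True by blast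
        qed
      qed
      have "U \<subseteq> {..3} - {l'}" "card U = 2" using U l(5) mem by auto
      have "r \<subseteq> {..3} - {l'}" if r: "r \<subseteq> {..3} - {u2} \<or> r \<subseteq> {..3} - {u1}" "card r = 2" "l \<in> r" "r \<noteq> {l, l'}" for r
      proof -
        obtain a b where ab: "r = {a, b}" "a \<noteq> b" using e2[OF r(2)] by blast
        then have "l' \<notin> r" using r(3,4) l(3) by auto
        then show ?thesis using r(1) by blast
      qed
      then have "{snd (cell r G) |r. (r \<subseteq> {..3} - {u2} \<or> r \<subseteq> {..3} - {u1}) \<and> card r = 2 \<and> l \<in> r \<and> r \<noteq> {l, l'}}
        \<subseteq> {snd (cell r G) |r. r \<subseteq> {..3} - {l'} \<and> card r = 2}" by (intro Collect_mono) metis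
      moreover have "?f \<in> {snd (cell r G) |r. r \<subseteq> {..3} - {l'} \<and> card r = 2}"
        using \<open>U \<subseteq> {..3} - {l'}\<close> \<open>card U = 2\<close> by (intro CollectI exI[of _ U]) simp
      ultimately show "insert ?f {snd (cell r G) |r. (r \<subseteq> {..3} - {u2} \<or> r \<subseteq> {..3} - {u1}) \<and> card r = 2 \<and> l \<in> r \<and> r \<noteq> {l, l'}}
        \<subseteq> {snd (cell r G) |r. r \<subseteq> {..3} - {l'} \<and> card r = 2}" by (rule insert_subsetI[rotated])
    qed
  qed
  have "eds ?C = insert ?f {x \<in> eds (A u2) \<union> eds (A u1). src ?e \<in> {src x, tgt x} \<and> x \<noteq> ?e}"
    "eds ?D = insert ?f {x \<in> eds (A u2) \<union> eds (A u1). tgt ?e \<in> {src x, tgt x} \<and> x \<noteq> ?e}"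
    unfolding pe using ed[of l1 l2] ed[of l2 l1] by (simp_all add: insert_commute)
  ultimately show "flipped eds src tgt (tris T) (tris switched) (A u2) (A u1) ?e (p u1) (p u2) ?C ?D ?f"
    unfolding flipped_def using CT f by simp
  have "\<And>l. L \<noteq> {l}" using L by auto
  then show "vertices switched = vertices T" using vertices_switched(1) vertices_switchedI by blast
qed

end

text \<open>What later steps need to know about a sequence of flips. Fillability passes backwards,
  from the result to the original.\<close>

definition reaches :: "(real^3 \<Rightarrow> 'c) \<Rightarrow> (real^3) simplices \<Rightarrow> (real^3) simplices \<Rightarrow> bool" where
  "reaches \<psi> T T' \<longleftrightarrow> good \<psi> T' \<and> vertices T' = vertices T \<and> (fillable T' \<psi> \<longrightarrow> fillable T \<psi>)"

lemma reaches_refl: "good \<psi> T \<Longrightarrow> reaches \<psi> T T"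
  by (simp add: reaches_def)

lemma reaches_trans: "reaches \<psi> T T' \<Longrightarrow> reaches \<psi> T' T'' \<Longrightarrow> reaches \<psi> T T''"
  by (simp add: reaches_def)

lemma triangle_colors:
  assumes "good \<psi> T" "(2, \<sigma>) \<in> T"
  shows "inj_on (\<lambda>i. \<psi> (\<sigma> (simplex_vertex i))) {..2}"
proof -
  have T: "tri S2 T" and pc: "proper_coloring T \<psi>" using assms(1) by (auto simp: good_def)
  have *: "\<psi> (\<sigma> (simplex_vertex i)) \<noteq> \<psi> (\<sigma> (simplex_vertex j))" if ij: "i < j" "j \<le> 2" for i j
  proof -
    have c: "card {i, j} - 1 = 1" using ij by simp
    have "(1, snd (cell {i, j} \<sigma>)) \<in> T" using tri_cell'[OF T assms(2), of "{i, j}"] ij c by simp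
    then show ?thesis using pc pair_ends[OF ij(1), of \<sigma>] unfolding proper_coloring_def src_def tgt_def by metis
  qed
  show ?thesis by (rule inj_onI) (metis * atMost_iff linorder_neqE_nat)
qed

text \<open>
  The four vertices \<open>a, b, c, d\<close> of the two triangles admit a common order. Here \<open>c\<close> is put at
  position \<open>i\<close> and \<open>d\<close> at position \<open>j + 1\<close>, which is why \<open>i \<le> j\<close> is needed.
\<close>

lemma geometric_flip:
  assumes gd: "good \<psi> T" and A: "(2, A) \<in> T" and B: "(2, B) \<in> T" and AB: "A \<noteq> B"
    and ij: "i \<le> j" "j \<le> 2" and e: "cell ({..2} - {i}) A = (1, e)" "cell ({..2} - {j}) B = (1, e)"
    and col: "\<psi> (A (simplex_vertex i)) \<noteq> \<psi> (B (simplex_vertex j))"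
  shows "\<exists>T' C D f. reaches \<psi> T T' \<and>
    flipped eds src tgt (tris T) (tris T') A B e (A (simplex_vertex i)) (B (simplex_vertex j)) C D f \<and>
    src f = A (simplex_vertex i) \<and> tgt f = B (simplex_vertex j)"
proof -
  interpret colored_sphere T by (rule good_colored[OF gd])
  have pc: "proper_coloring T \<psi>" using gd by (simp add: good_def)
  let ?q = "Suc j"
  define U where "U = {i, ?q}"
  define L where "L = {..3} - U"
  have lt: "i < ?q" and q3: "?q \<le> 3" using ij by auto
  have U3: "U \<subseteq> {..3}" "card U = 2" using lt q3 by (auto simp: U_def)
  have "card L = 2" unfolding L_def using card_Diff_subset[of U "{..3}"] U3 finite_subset[OF U3(1)] by simp
  then obtain l1 l2 where L: "l1 < l2" "L = {l1, l2}" by (rule card2_pair)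
  \<comment> \<open>In the common numbering \<open>A\<close> is the facet that omits
    \<open>d\<close>, at position \<open>j + 1\<close>, and \<open>B\<close> the one that omits
    \<open>c\<close>, at position \<open>i\<close>.\<close>
  define Af where "Af = (\<lambda>k. if k = ?q then A else B)"
  define pf where "pf = (\<lambda>k. if k = ?q then B (simplex_vertex j) else A (simplex_vertex (if k < ?q then k else k - 1)))"
  have match: "B (simplex_vertex (if k < i then k else k - 1)) = A (simplex_vertex (if k < ?q then k else k - 1))"
    if k: "k \<le> 3" "k \<noteq> i" "k \<noteq> ?q" for k
  proof -
    let ?a = "if k < ?q then k else k - 1" and ?b = "if k < i then k else k - 1"
    have ab: "?a \<le> 2" "?a \<noteq> i" "?b \<le> 2" "?b \<noteq> j" using k ij by auto
    have rk: "vrank ({..2} - {i}) ?a = vrank ({..2} - {j}) ?b"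
      unfolding vrank_omit[OF ab(1,2)] vrank_omit[OF ab(3,4)] using k ij by auto
    have "A (simplex_vertex ?a) = snd (cell ({..2} - {i}) A) (simplex_vertex (vrank ({..2} - {i}) ?a))"
      by (rule cell_vertex[symmetric]) (use ab in auto)
    also have "\<dots> = snd (cell ({..2} - {j}) B) (simplex_vertex (vrank ({..2} - {j}) ?b))"
      using e rk by simp
    also have "\<dots> = B (simplex_vertex ?b)"
      by (rule cell_vertex) (use ab in auto)
    finally show ?thesis by simp
  qed
  have corner: "Af u (simplex_vertex (if k < u then k else k - 1)) = pf k" if u: "u \<in> U" "k \<le> 3" "k \<noteq> u" for u k
  proof (cases "u = ?q")
    case True
    then show ?thesis using u(3) by (simp add: Af_def pf_def)
  next
    case False
    then have ui: "u = i" using u(1) by (simp add: U_def)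
    show ?thesis
    proof (cases "k = ?q")
      case True
      then show ?thesis using ui lt by (simp add: Af_def pf_def)
    next
      case False
      then show ?thesis using match[of k] u ui lt by (simp add: Af_def pf_def)
    qed
  qed
  have ci: "inj_on (\<psi> \<circ> pf) {..3}"
  proof -
    have "\<psi> (pf k) \<noteq> \<psi> (pf k')" if k: "k < k'" "k' \<le> 3" for k k'
    proof -
      have A': "\<psi> (pf k) \<noteq> \<psi> (pf k')" if n: "k \<noteq> ?q" "k' \<noteq> ?q"
      proof -
        let ?m = "\<lambda>k. if k < ?q then k else k - 1"
        have "?m k \<noteq> ?m k'" "?m k \<le> 2" "?m k' \<le> 2" using n k ij by auto
        then show ?thesis using inj_onD[OF triangle_colors[OF gd A], of "?m k" "?m k'"] n by (auto simp: pf_def)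
      qed
      have B': "\<psi> (pf h) \<noteq> \<psi> (pf ?q)" if h: "h \<le> 3" "h \<noteq> ?q" for h
      proof (cases "h = i")
        case True
        then show ?thesis using col lt by (simp add: pf_def)
      next
        case False
        let ?b = "if h < i then h else h - 1"
        have "?b \<noteq> j" "?b \<le> 2" using h False ij by auto
        then have "\<psi> (B (simplex_vertex ?b)) \<noteq> \<psi> (B (simplex_vertex j))"
          using inj_onD[OF triangle_colors[OF gd B], of ?b j] ij by auto
        then show ?thesis using match[OF h(1) False h(2)] h by (simp add: pf_def)
      qed
      show ?thesis using A' B'[of k] B'[of k'] k by (cases "k = ?q"; cases "k' = ?q") auto
    qed
    then show ?thesis by (intro inj_onI) (metis atMost_iff comp_apply linorder_neqE_nat)
  qed
  interpret disc_pair U L T Af pf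
  proof
    show "U \<union> L = {..3}" "U \<inter> L = {}" using U3(1) by (auto simp: L_def)
    show "U \<noteq> {}" "L \<noteq> {}" using U3(2) L by auto
    show "tri S2 T" by (rule T)
    show "U \<subseteq> {..3}" "2 \<le> card U" using U3 by auto
    show "(2, Af u) \<in> T" if "u \<in> U" for u using A B by (simp add: Af_def)
    show "cell ({..2} - {v - 1}) (Af u) = cell ({..2} - {u}) (Af v)" if "u \<in> U" "v \<in> U" "u < v" for u v
    proof -
      have "u = i" "v = ?q" using that lt by (auto simp: U_def)
      then show ?thesis using e lt by (simp add: Af_def)
    qed
    show "Af u (simplex_vertex (if k < u then k else k - 1)) = pf k" if "u \<in> U" "k \<le> 3" "k \<noteq> u" for u k
      using corner that by blast
    show "inj_on pf {..3}" using ci inj_on_imageI2 by blast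
  qed
  have mem: "i \<in> U" "?q \<in> U" by (auto simp: U_def)
  have gA: "cell ({..3} - {?q}) g = (2, A)" "cell ({..3} - {i}) g = (2, B)"
    using cell_facet[OF mem(1)] cell_facet[OF mem(2)] lt by (simp_all add: Af_def)
  have l3: "l1 \<le> 3" "l2 \<le> 3" "l1 \<notin> U" "l2 \<notin> U" using L(2) UL by auto
  have eL: "cell L g = (1, e)"
  proof -
    have sub: "L \<subseteq> {..3} - {?q}" using mem UL by auto
    have "cell L g = cell (vrank ({..3} - {?q}) ` L) A"
      using cell_cell[OF _ sub, of g] gA(1) UL(4) by simp
    moreover have "vrank ({..3} - {?q}) ` L = {..2} - {i}"
    proof -
      have m: "i \<in> {..3} - {?q}" using lt q3 by auto
      have d: "{..3} - {?q} = insert i L" using sub m UL mem unfolding U_def by auto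
      have "vrank ({..3} - {?q}) ` ({..3} - {?q}) = {..2}"
        using rank_image[of "{..3} - {?q}"] q3 by (simp add: lessThan_Suc_atMost[symmetric] numeral_3_eq_3 numeral_2_eq_2)
      moreover have "vrank ({..3} - {?q}) i = i" using vrank_omit[of i 3 ?q] lt q3 by simp
      moreover have "vrank ({..3} - {?q}) ` ({..3} - {?q}) = insert (vrank ({..3} - {?q}) i) (vrank ({..3} - {?q}) ` L)"
        using d by (metis image_insert)
      moreover have "vrank ({..3} - {?q}) i \<notin> vrank ({..3} - {?q}) ` L"
      proof
        assume "vrank ({..3} - {?q}) i \<in> vrank ({..3} - {?q}) ` L"
        then obtain l where "l \<in> L" "vrank ({..3} - {?q}) i = vrank ({..3} - {?q}) l" by blast
        then have "i = l" using inj_onD[OF rank_inj[of "{..3} - {?q}"]] m sub by blast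
        then show False using \<open>l \<in> L\<close> UL(2) mem by blast
      qed
      ultimately show ?thesis by auto
    qed
    ultimately show ?thesis using e(1) by simp
  qed
  have upper: "x \<in> upper_cells \<longleftrightarrow> x = (1, e) \<or> x = (2, A) \<or> x = (2, B)" for x
  proof
    assume "x \<in> upper_cells"
    then obtain s where s: "x = cell s g" "s \<subseteq> {..3}" "L \<subseteq> s" "\<not> U \<subseteq> s" unfolding upper_cells_def by blast
    have all: "{..3} = insert i (insert ?q L)" using UL(1) unfolding U_def by simp
    have nL: "i \<notin> L" "?q \<notin> L" using UL(2) mem by blast+
    have "s = L \<or> s = {..3} - {?q} \<or> s = {..3} - {i}"
    proof (cases "i \<in> s")
      case True
      then have "?q \<notin> s" using s(4) unfolding U_def by simp
      then have "s = insert i L" using True s(2,3) unfolding all by blast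
      then show ?thesis unfolding all using nL lt by auto
    next
      case False
      then have "s = L \<or> s = insert ?q L" using s(2,3) unfolding all by blast
      then show ?thesis unfolding all using nL lt by auto
    qed
    then show "x = (1, e) \<or> x = (2, A) \<or> x = (2, B)" using s(1) eL gA by auto
  next
    have "(1, e) \<in> upper_cells"
      unfolding upper_cells_def using eL UL U_sub by (auto intro!: exI[of _ L])
    moreover have "(2, A) \<in> upper_cells"
      unfolding upper_cells_def using gA(1) UL mem by (auto intro!: exI[of _ "{..3} - {?q}"])
    moreover have "(2, B) \<in> upper_cells"
      unfolding upper_cells_def using gA(2) UL mem by (auto intro!: exI[of _ "{..3} - {i}"])
    ultimately show "x = (1, e) \<or> x = (2, A) \<or> x = (2, B) \<Longrightarrow> x \<in> upper_cells" by blast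
  qed
  have i2: "i \<le> 2" using ij by simp
  have eT: "(1, e) \<in> T"
    using eds_in_T[of A e] A e(1) i2 eds_iff by blast
  \<comment> \<open>No third triangle contains \<open>e\<close>, which yields \<open>star\<close>
    for the disc formed by \<open>A\<close>, \<open>B\<close> and \<open>e\<close>.\<close>
  have inc: "incident T e = {A, B}"
  proof -
    have "A \<in> incident T e" unfolding incident_def using A e(1) i2 by blast
    moreover have "B \<in> incident T e" unfolding incident_def using B e(2) ij(2) by blast
    ultimately have "{A, B} \<subseteq> incident T e" by simp
    then show ?thesis using card_subset_eq[OF finite_incident, of "{A, B}" e] card_incident[OF eT] AB by simp
  qed
  interpret disc_switch U L T Af pf
  proof
    fix n \<sigma> s assume \<sigma>: "(n, \<sigma>) \<in> T" and s: "s \<subseteq> {..n}" "s \<noteq> {}" and up: "cell s \<sigma> \<in> upper_cells"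
    have fs: "finite s" using s(1) finite_subset by blast
    have cs: "card s \<le> Suc n" using card_mono[OF _ s(1)] by simp
    from up upper consider "cell s \<sigma> = (1, e)" | X where "X \<in> {A, B}" "cell s \<sigma> = (2, X)" by blast
    then show "(n, \<sigma>) \<in> upper_cells"
    proof cases
      case 1
      then have "card s - 1 = 1" by (metis fst_cell fst_conv)
      then have c2: "card s = 2" by simp
      then consider "n = 1" | "n = 2" using dim2[OF \<sigma>] cs by linarith
      then show ?thesis
      proof cases
        case 1
        then have "e = \<sigma>" using cell_top[of 1 \<sigma> s e] \<sigma> s \<open>cell s \<sigma> = (1, e)\<close> by simp
        then show ?thesis using 1 upper by simp
      next
        case 2
        then obtain k where "k \<le> 2" "s = {..2} - {k}" using two_subset[of s] s(1) c2 by blast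
        then have "\<sigma> \<in> incident T e" unfolding incident_def using \<sigma> 2 \<open>cell s \<sigma> = (1, e)\<close> by auto
        then show ?thesis using inc upper 2 by auto
      qed
    next
      case 2
      then have "card s - 1 = 2" by (metis fst_cell fst_conv)
      then have "n = 2" using dim2[OF \<sigma>] cs by linarith
      then have "X = \<sigma>" using cell_top[of 2 \<sigma> s X] \<sigma> s 2(2) by simp
      then show ?thesis using 2(1) \<open>n = 2\<close> upper by auto
    qed
  qed
  have U': "U = {i, ?q}" by (simp add: U_def)
  note fl = flipped_switched[OF U' lt L(2,1)]
  have eq: "Af ?q = A" "Af i = B" "pf i = A (simplex_vertex i)" "pf ?q = B (simplex_vertex j)"
    using lt by (simp_all add: Af_def pf_def)
  have eL': "snd (cell {l1, l2} G) = e"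
  proof -
    have "cell L G = cell L g" by (rule G_boundary) (use UL U_sub in auto)
    then show ?thesis using eL L(2) by simp
  qed
  have "good \<psi> switched" unfolding good_def using tri_switched proper_switched[OF pc ci] by blast
  then have "reaches \<psi> T switched"
    unfolding reaches_def using fl(4) fillable_switched[OF _ pc] by blast
  then show ?thesis using fl(1-3) unfolding eq eL' by blast
qed

section \<open>Removing a vertex or filling the sphere, given facets with compatible edges\<close>

context colored_sphere
begin

text \<open>An interior point of the simplex lies in some triangle, and its smallest face there must
  be the given simplex.\<close>

lemma face_of_triangle:
  assumes \<tau>: "(m, \<tau>) \<in> T"
  obtains \<sigma> s where "(2, \<sigma>) \<in> T" "s \<subseteq> {..2}" "s \<noteq> {}" "cell s \<sigma> = (m, \<tau>)"
proof -
  obtain \<sigma> where \<sigma>: "(2, \<sigma>) \<in> T" "\<tau> ` standard_simplex m \<subseteq> \<sigma> ` standard_simplex 2" using covered_by_tris[OF \<tau>] .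
  obtain t :: "nat \<Rightarrow> real" where t: "t \<in> open_simplex m" using open_simplex_nonempty by blast
  then have ts: "t \<in> standard_simplex m" "supp t = {..m}" using open_simplex_iff by blast+
  obtain t' where t': "t' \<in> standard_simplex 2" "\<sigma> t' = \<tau> t" using \<sigma>(2) ts(1) by (metis image_iff image_subset_iff)
  have "cell (supp t') \<sigma> = cell {..m} \<tau>"
    using tri_coincidence(1)[OF T \<sigma>(1) \<tau> t'(1) ts(1) t'(2)] ts(2) by simp
  then have "cell (supp t') \<sigma> = (m, \<tau>)" using cell_full[OF tri_maps(1)[OF T \<tau>]] by simp
  then show ?thesis using that[OF \<sigma>(1) supp_sub[OF t'(1)] supp_ne[OF t'(1)]] by blast
qed

end

context facet_family
begin

lemma face_of_facet:
  assumes i: "i \<in> U" and s: "s \<subseteq> {..2}" "s \<noteq> {}"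
  obtains r where "r \<subseteq> {..3} - {i}" "r \<noteq> {}" "cell s (A i) = cell r g" "finite r"
proof -
  have c: "card ({..3} - {i}) - 1 = 2" using U3[OF i] by simp
  have ne: "{..3} - {i} \<noteq> {}" using c by (metis card.empty diff_0_eq_0 zero_neq_numeral)
  obtain r where r: "r \<subseteq> {..3} - {i}" "s = vrank ({..3} - {i}) ` r"
    using rank_preimage[of "{..3} - {i}" s] ne s(1) c by auto
  have rne: "r \<noteq> {}" using r(2) s(2) by blast
  have "cell s (A i) = cell r g" using cell_cell[OF _ r(1) rne, of g] r(2) cell_facet[OF i] by simp
  moreover have "finite r" using r(1) finite_subset by blast
  ultimately show ?thesis using that r(1) rne by blast
qed

lemma corners_face:
  assumes "r \<subseteq> {..3}" "r \<noteq> {}" "cell r g = (n, \<sigma>)"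
  shows "corners n \<sigma> = p ` r"
proof -
  have "finite r" using assms(1) finite_subset by blast
  moreover have "n = card r - 1" "\<sigma> = snd (cell r g)" using assms(3) by (metis fst_cell fst_conv, metis snd_conv)
  ultimately have "corners n \<sigma> = (\<lambda>k. g (simplex_vertex k)) ` r"
    using corners_cell[of r g] assms(2) by simp
  also have "\<dots> = p ` r" by (rule image_cong) (use g_vertex assms(1) in auto)
  finally show ?thesis .
qed

end

text \<open>Every simplex at the removed vertex is a face of a triangle at this vertex, hence of one
  of the three facets; this gives the condition \<open>star\<close> of the exchange.\<close>

lemma geometric_removal:
  assumes gd: "good \<psi> T" and U: "U \<union> {l} = {..3}" "l \<notin> U"
    and facet: "\<And>i. i \<in> U \<Longrightarrow> (2, A i) \<in> T"
    and glued: "\<And>i j. i \<in> U \<Longrightarrow> j \<in> U \<Longrightarrow> i < j \<Longrightarrow> cell ({..2} - {j - 1}) (A i) = cell ({..2} - {i}) (A j)"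
    and corner: "\<And>i k. i \<in> U \<Longrightarrow> k \<le> 3 \<Longrightarrow> k \<noteq> i \<Longrightarrow> A i (simplex_vertex (if k < i then k else k - 1)) = p k"
    and col: "inj_on (\<psi> \<circ> p) {..3}"
    and star: "\<And>\<sigma>. \<sigma> \<in> tris T \<Longrightarrow> p l \<in> corners 2 \<sigma> \<Longrightarrow> \<sigma> \<in> A ` U"
  shows "\<exists>T'. good \<psi> T' \<and> vertices T' = vertices T - {p l} \<and> (fillable T' \<psi> \<longrightarrow> fillable T \<psi>)"
proof -
  interpret colored_sphere T by (rule good_colored[OF gd])
  have pc: "proper_coloring T \<psi>" using gd by (simp add: good_def)
  have l3: "l \<le> 3" using U by auto
  have fU: "finite U" using U by (metis finite_Un finite_atMost)
  have "card (insert l U) = 4" using U(1) by (metis Un_insert_right card_atMost sup_bot.right_neutral Suc_numeral numeral_3_eq_3 eval_nat_numeral(3) eval_nat_numeral(2) semiring_norm(28) semiring_norm(27) semiring_norm(26))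
  then have cU: "card U = 3" using U(2) fU by simp
  interpret disc_pair U "{l}" T A p
  proof
    show "U \<noteq> {}" "2 \<le> card U" using cU by auto
    show "inj_on p {..3}" using col inj_on_imageI2 by blast
  qed (use U T facet glued corner in auto)
  interpret disc_switch U "{l}" T A p
  proof
    fix n \<sigma> s assume \<sigma>: "(n, \<sigma>) \<in> T" and s: "s \<subseteq> {..n}" "s \<noteq> {}" and up: "cell s \<sigma> \<in> upper_cells"
    obtain r where r: "cell s \<sigma> = cell r g" "r \<subseteq> {..3}" "{l} \<subseteq> r" using up unfolding upper_cells_def by blast
    have rne: "r \<noteq> {}" using r(3) by blast
    have "cell r g = (card s - 1, snd (cell s \<sigma>))" using r(1) cell_is[of s \<sigma>] by metis
    from corners_face[OF r(2) rne this] have "p l \<in> corners (card s - 1) (snd (cell s \<sigma>))"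
      using r(3) by simp
    moreover have "corners (card s - 1) (snd (cell s \<sigma>)) \<subseteq> corners n \<sigma>"
      using corners_cell[OF finite_subset[OF s(1)] s(2), of \<sigma>] s(1) unfolding corners_def by auto
    ultimately have pl: "p l \<in> corners n \<sigma>" by blast
    obtain \<rho> q where \<rho>: "(2, \<rho>) \<in> T" "q \<subseteq> {..2}" "q \<noteq> {}" "cell q \<rho> = (n, \<sigma>)" using face_of_triangle[OF \<sigma>] .
    have "n = card q - 1" "\<sigma> = snd (cell q \<rho>)" using \<rho>(4) by (metis fst_cell fst_conv, metis snd_conv)
    then have "corners n \<sigma> = (\<lambda>i. \<rho> (simplex_vertex i)) ` q"
      using corners_cell[OF finite_subset[OF \<rho>(2)] \<rho>(3), of \<rho>] by simp
    then have "corners n \<sigma> \<subseteq> corners 2 \<rho>" using \<rho>(2) unfolding corners_def by auto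
    then have "\<rho> \<in> A ` U" using star \<rho>(1) pl by blast
    then obtain i where i: "i \<in> U" "\<rho> = A i" by blast
    obtain r' where r': "r' \<subseteq> {..3} - {i}" "r' \<noteq> {}" "cell q (A i) = cell r' g" using face_of_facet[OF i(1) \<rho>(2,3)] by metis
    have r3: "r' \<subseteq> {..3}" using r'(1) by blast
    have c: "cell r' g = (n, \<sigma>)" using r'(3) \<rho>(4) i(2) by simp
    have "p l \<in> p ` r'" using pl corners_face[OF r3 r'(2) c] by simp
    then have "l \<in> r'" using inj_on_image_mem_iff[OF p_inj] l3 r3 by blast
    moreover have "\<not> U \<subseteq> r'" using i(1) r'(1) by blast
    ultimately show "(n, \<sigma>) \<in> upper_cells" unfolding upper_cells_def using c r3 by (metis (mono_tags, lifting) empty_subsetI insert_subset mem_Collect_eq)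
  qed
  have "good \<psi> switched" unfolding good_def using tri_switched proper_switched[OF pc col] by blast
  then show ?thesis using removed_vertex[OF refl] fillable_switched[OF _ pc] by blast
qed

lemma geometric_fill:
  assumes gd: "good \<psi> T"
    and facet: "\<And>i. i \<le> 3 \<Longrightarrow> (2, A i) \<in> T"
    and glued: "\<And>i j. i < j \<Longrightarrow> j \<le> 3 \<Longrightarrow> cell ({..2} - {j - 1}) (A i) = cell ({..2} - {i}) (A j)"
    and corner: "\<And>i k. i \<le> 3 \<Longrightarrow> k \<le> 3 \<Longrightarrow> k \<noteq> i \<Longrightarrow> A i (simplex_vertex (if k < i then k else k - 1)) = p k"
    and p: "inj_on p {..3}"
    and all: "tris T \<subseteq> A ` {..3}"
  shows "fillable T \<psi>"
proof -
  interpret colored_sphere T by (rule good_colored[OF gd])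
  interpret facet_family "{..3}" T A p
    by unfold_locales (use T facet glued corner p in auto)
  have "T \<subseteq> {cell s g |s. s \<subset> {..3} \<and> s \<noteq> {}}"
  proof
    fix x assume x: "x \<in> T"
    obtain n \<sigma> where n: "x = (n, \<sigma>)" by fastforce
    obtain \<rho> q where \<rho>: "(2, \<rho>) \<in> T" "q \<subseteq> {..2}" "q \<noteq> {}" "cell q \<rho> = (n, \<sigma>)" using face_of_triangle x n by blast
    then obtain i where i: "i \<in> {..3}" "\<rho> = A i" using all by blast
    obtain r where r: "r \<subseteq> {..3} - {i}" "r \<noteq> {}" "cell q (A i) = cell r g" using face_of_facet[OF i(1) \<rho>(2,3)] by metis
    moreover from this have "r \<subset> {..3}" using i(1) by blast
    moreover have "x = cell r g" using r(3) \<rho>(4) i(2) n by simp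
    ultimately show "x \<in> {cell s g |s. s \<subset> {..3} \<and> s \<noteq> {}}" using r(2) by blast
  qed
  then interpret tetra_boundary T A p by unfold_locales
  show ?thesis by (rule fillable_boundary) (use gd in \<open>simp add: good_def\<close>)
qed

text \<open>Three linearly ordered vertices have only one increasing numbering, so the arrows
  determine which corner is which.\<close>

lemma corner_of_order:
  assumes gd: "good \<psi> T" and \<sigma>: "(2, \<sigma>) \<in> T" and i: "i \<le> 3"
    and arrows: "\<And>k k'. k < k' \<Longrightarrow> k' \<le> 3 \<Longrightarrow> k \<noteq> i \<Longrightarrow> k' \<noteq> i \<Longrightarrow> \<exists>e\<in>eds \<sigma>. src e = p k \<and> tgt e = p k'"
    and k: "k \<le> 3" "k \<noteq> i"
  shows "\<sigma> (simplex_vertex (if k < i then k else k - 1)) = p k"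
proof -
  interpret colored_sphere T by (rule good_colored[OF gd])
  let ?v = "\<lambda>m. \<sigma> (simplex_vertex m)"
  have d: "?v 0 \<noteq> ?v 1" "?v 1 \<noteq> ?v 2" "?v 0 \<noteq> ?v 2"
    using inj_onD[OF vert_inj[OF \<sigma>], of 0 1] inj_onD[OF vert_inj[OF \<sigma>], of 1 2] inj_onD[OF vert_inj[OF \<sigma>], of 0 2] by auto
  have ar: "(\<exists>e\<in>eds \<sigma>. src e = a \<and> tgt e = b) \<longleftrightarrow>
      (a = ?v 0 \<and> b = ?v 1) \<or> (a = ?v 1 \<and> b = ?v 2) \<or> (a = ?v 0 \<and> b = ?v 2)" for a b
    unfolding eds3 by (auto simp: pair_ends)
  have order: "p k0 = ?v 0 \<and> p k1 = ?v 1 \<and> p k2 = ?v 2"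
    if "k0 < k1" "k1 < k2" "k2 \<le> 3" "k0 \<noteq> i" "k1 \<noteq> i" "k2 \<noteq> i" for k0 k1 k2
    using arrows[of k0 k1] arrows[of k1 k2] arrows[of k0 k2] that d unfolding ar by auto
  have kc: "k = 0 \<or> k = 1 \<or> k = 2 \<or> k = 3" using k by linarith
  consider "i = 0" | "i = 1" | "i = 2" | "i = 3" using i by linarith
  then show ?thesis
  proof cases
    case 1
    then show ?thesis using order[of 1 2 3] k kc by (elim disjE) simp_all
  next
    case 2
    then show ?thesis using order[of 0 2 3] k kc by (elim disjE) simp_all
  next
    case 3
    then show ?thesis using order[of 0 1 3] k kc by (elim disjE) simp_all
  next
    case 4
    then show ?thesis using order[of 0 1 2] k kc by (elim disjE) simp_all
  qed
qed

text \<open>An edge of a triangle is identified by the corner that it omits, so knowing the omitted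
  corners of the shared edge suffices.\<close>

lemma glued_of_shared:
  assumes gd: "good \<psi> T" and \<sigma>: "(2, \<sigma>) \<in> T" and \<tau>: "(2, \<tau>) \<in> T" and ij: "i < j" "j \<le> 3"
    and v: "\<sigma> (simplex_vertex (j - 1)) = w" "\<tau> (simplex_vertex i) = u"
    and e: "e \<in> eds \<sigma>" "e \<in> eds \<tau>" "w \<notin> {src e, tgt e}" "u \<notin> {src e, tgt e}"
  shows "cell ({..2} - {j - 1}) \<sigma> = cell ({..2} - {i}) \<tau>"
proof -
  interpret colored_sphere T by (rule good_colored[OF gd])
  have *: "cell ({..2} - {m}) \<rho> = (1, e)" if \<rho>: "(2, \<rho>) \<in> T" "m \<le> 2" "e \<in> eds \<rho>" "\<rho> (simplex_vertex m) \<notin> {src e, tgt e}" for \<rho> m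
  proof -
    obtain k where k: "k \<le> 2" "cell ({..2} - {k}) \<rho> = (1, e)" using \<rho>(3) eds_iff by blast
    have c2: "card ({..2} - {k}) = 2" by (rule card_omit3[OF k(1)])
    have "{src e, tgt e} = (\<lambda>k. \<rho> (simplex_vertex k)) ` ({..2} - {k})" using ends_cell[OF c2, of \<rho>] k(2) by simp
    then have "m = k" using \<rho>(2,4) by auto
    then show ?thesis using k(2) by simp
  qed
  have "j - 1 \<le> 2" "i \<le> 2" using ij by auto
  then show ?thesis using *[OF \<sigma>, of "j - 1"] *[OF \<tau>, of i] v e by simp
qed

section \<open>Orientation of vertex links\<close>

context csurf
begin

text \<open>The parameter \<open>k\<close> allows all edges to be reversed, so that one argument
  treats both sources and sinks.\<close>

definition arr :: "bool \<Rightarrow> 't \<Rightarrow> 'v \<Rightarrow> 'v \<Rightarrow> bool" where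
  "arr k \<sigma> x y = (if k then arrow \<sigma> x y else arrow \<sigma> y x)"

text \<open>
  Of the two edges of \<open>\<sigma>\<close> at \<open>v\<close>, the one whose other end is the source (for \<open>k = True\<close>) or the
  target (for \<open>k = False\<close>) of the edge of \<open>\<sigma>\<close> opposite to \<open>v\<close>.
\<close>

definition spoke :: "bool \<Rightarrow> 'v \<Rightarrow> 't \<Rightarrow> 'e" where
  "spoke k v \<sigma> = (THE g. g \<in> E \<sigma> \<and> v \<in> ends g \<and> (\<exists>u x. u \<in> ends g \<and> u \<noteq> v \<and> x \<noteq> v \<and> arr k \<sigma> u x))"

definition Sp :: "'v \<Rightarrow> 'e set" where
  "Sp v = {g. (\<exists>\<sigma>\<in>S. g \<in> E \<sigma>) \<and> v \<in> ends g}"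

text \<open>The link of \<open>v\<close> is not a directed cycle.\<close>

definition W :: "'v \<Rightarrow> bool" where
  "W v \<longleftrightarrow> (\<exists>k. \<exists>g\<in>Sp v. \<forall>\<sigma>\<in>S. g \<in> E \<sigma> \<longrightarrow> spoke k v \<sigma> = g)"

lemma arr_linear:
  assumes "\<sigma> \<in> S"
  shows "x \<in> verts \<sigma> \<Longrightarrow> y \<in> verts \<sigma> \<Longrightarrow> x \<noteq> y \<Longrightarrow> arr k \<sigma> x y \<or> arr k \<sigma> y x"
    "arr k \<sigma> x y \<Longrightarrow> \<not> arr k \<sigma> y x" "arr k \<sigma> x y \<Longrightarrow> arr k \<sigma> y z \<Longrightarrow> arr k \<sigma> x z"
    "arr k \<sigma> x y \<Longrightarrow> x \<in> verts \<sigma> \<and> y \<in> verts \<sigma> \<and> x \<noteq> y"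
proof -
  show "x \<in> verts \<sigma> \<Longrightarrow> y \<in> verts \<sigma> \<Longrightarrow> x \<noteq> y \<Longrightarrow> arr k \<sigma> x y \<or> arr k \<sigma> y x"
    using arrow_linear(1)[OF assms, of x y] by (cases k) (auto simp: arr_def)
  show "arr k \<sigma> x y \<Longrightarrow> \<not> arr k \<sigma> y x"
    using arrow_linear(2)[OF assms] by (cases k) (auto simp: arr_def)
  show "arr k \<sigma> x y \<Longrightarrow> arr k \<sigma> y z \<Longrightarrow> arr k \<sigma> x z"
    using arrow_linear(3)[OF assms, of x y z] arrow_linear(3)[OF assms, of z y x] by (cases k) (auto simp: arr_def)
  show "arr k \<sigma> x y \<Longrightarrow> x \<in> verts \<sigma> \<and> y \<in> verts \<sigma> \<and> x \<noteq> y"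
    using arrow_linear(4)[OF assms, of x y] arrow_linear(4)[OF assms, of y x] by (cases k) (auto simp: arr_def)
qed

lemma ends_verts: "g \<in> E \<sigma> \<Longrightarrow> ends g \<subseteq> verts \<sigma>"
  unfolding verts_def by blast

lemma edge_ends:
  assumes "\<sigma> \<in> S" "g \<in> E \<sigma>"
  shows "src g \<noteq> tgt g" "col (src g) \<noteq> col (tgt g)"
proof -
  obtain x y z e f h where s: "E \<sigma> = {e, f, h}" "src e = x" "tgt e = y" "src f = y" "tgt f = z"
      "src h = x" "tgt h = z" "col x \<noteq> col y" "col y \<noteq> col z" "col x \<noteq> col z"
    using shape[OF assms(1)] by blast
  then show "col (src g) \<noteq> col (tgt g)" using assms(2) by auto
  then show "src g \<noteq> tgt g" by auto
qed

lemma edge_unique: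
  assumes "\<sigma> \<in> S" "g \<in> E \<sigma>" "h \<in> E \<sigma>" "ends g = ends h" shows "g = h"
proof -
  obtain x where x: "x \<in> ends g" by (auto simp: ends_def)
  have "x \<in> verts \<sigma>" using x ends_verts assms(2) by blast
  from tri_at[OF assms(1) this] show ?thesis using assms(2-4)
    by (smt (verit) doubleton_eq_iff insert_iff singletonD)
qed

lemma spoke_iff:
  assumes \<sigma>: "\<sigma> \<in> S" and v: "verts \<sigma> = {v, u, x}" "u \<noteq> v" "x \<noteq> v" "u \<noteq> x"
    and g: "g \<in> E \<sigma>" "ends g = {v, u}"
  shows "spoke k v \<sigma> = g \<longleftrightarrow> arr k \<sigma> u x"
proof -
  have vv: "v \<in> verts \<sigma>" using v by blast
  obtain u' x' p q l where t: "E \<sigma> = {p, q, l}" "ends p = {v, u'}" "ends q = {v, x'}" "ends l = {u', x'}"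
    "verts \<sigma> = {v, u', x'}" "v \<noteq> u'" "v \<noteq> x'" "u' \<noteq> x'" "p \<noteq> q" "p \<noteq> l" "q \<noteq> l"
    by (rule tri_at[OF \<sigma> vv])
  obtain h where h: "h \<in> E \<sigma>" "ends h = {v, x}" "h \<noteq> g" "\<And>m. m \<in> E \<sigma> \<Longrightarrow> v \<in> ends m \<Longrightarrow> m = g \<or> m = h"
  proof (cases "u = u'")
    case True
    then have "x = x'" using t(5,6,7,8) v by (auto simp: doubleton_eq_iff)
    moreover have "g = p" using edge_unique[OF \<sigma> g(1), of p] t g True by simp
    ultimately show ?thesis using that[of q] t True by (auto simp: doubleton_eq_iff)
  next
    case False
    then have ux: "u = x'" "x = u'" using t(5,6,7,8) v by (auto simp: doubleton_eq_iff)
    moreover have "g = q" using edge_unique[OF \<sigma> g(1), of q] t g ux by simp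
    ultimately show ?thesis using that[of p] t by (auto simp: doubleton_eq_iff)
  qed
  let ?P = "\<lambda>m. m \<in> E \<sigma> \<and> v \<in> ends m \<and> (\<exists>u x. u \<in> ends m \<and> u \<noteq> v \<and> x \<noteq> v \<and> arr k \<sigma> u x)"
  have Pg: "?P g \<longleftrightarrow> arr k \<sigma> u x"
  proof
    assume "?P g"
    then obtain a b where ab: "a \<in> ends g" "a \<noteq> v" "b \<noteq> v" "arr k \<sigma> a b" by blast
    then have "a = u" using g by blast
    moreover have "b = x" using arr_linear(4)[OF \<sigma> ab(4)] ab v \<open>a = u\<close> by auto
    ultimately show "arr k \<sigma> u x" using ab by simp
  next
    assume "arr k \<sigma> u x"
    then show "?P g" using g v by blast
  qed
  have Ph: "?P h \<longleftrightarrow> arr k \<sigma> x u"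
  proof
    assume "?P h"
    then obtain a b where ab: "a \<in> ends h" "a \<noteq> v" "b \<noteq> v" "arr k \<sigma> a b" by blast
    then have "a = x" using h by blast
    moreover have "b = u" using arr_linear(4)[OF \<sigma> ab(4)] ab v \<open>a = x\<close> by auto
    ultimately show "arr k \<sigma> x u" using ab by simp
  next
    assume "arr k \<sigma> x u"
    then show "?P h" using h v by blast
  qed
  have "u \<in> verts \<sigma>" "x \<in> verts \<sigma>" using v by auto
  then consider "arr k \<sigma> u x" "\<not> arr k \<sigma> x u" | "arr k \<sigma> x u" "\<not> arr k \<sigma> u x"
    using arr_linear(1,2)[OF \<sigma>] v(4) by blast
  then show ?thesis
  proof cases
    case 1
    have "spoke k v \<sigma> = g" unfolding spoke_def
      by (rule the_equality) (use Pg Ph 1 h(4) in blast)+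
    then show ?thesis using 1 by simp
  next
    case 2
    have "spoke k v \<sigma> = h" unfolding spoke_def
      by (rule the_equality) (use Pg Ph 2 h(4) in blast)+
    then show ?thesis using 2 h(3) by simp
  qed
qed

lemma spokes_at:
  assumes "\<sigma> \<in> Star v"
  obtains u x where "verts \<sigma> = {v, u, x}" "u \<noteq> v" "x \<noteq> v" "u \<noteq> x" "col u \<noteq> col x" "col v \<noteq> col u" "col v \<noteq> col x"
    "spoke True v \<sigma> \<in> E \<sigma>" "ends (spoke True v \<sigma>) = {v, u}"
    "spoke False v \<sigma> \<in> E \<sigma>" "ends (spoke False v \<sigma>) = {v, x}" "arrow \<sigma> u x" "spoke True v \<sigma> \<noteq> spoke False v \<sigma>"
    "\<And>g. g \<in> E \<sigma> \<Longrightarrow> v \<in> ends g \<Longrightarrow> g = spoke True v \<sigma> \<or> g = spoke False v \<sigma>"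
proof -
  have \<sigma>: "\<sigma> \<in> S" "v \<in> verts \<sigma>" using assms by (auto simp: Star_def)
  obtain u x p q l where t: "E \<sigma> = {p, q, l}" "ends p = {v, u}" "ends q = {v, x}" "ends l = {u, x}"
    "verts \<sigma> = {v, u, x}" "v \<noteq> u" "v \<noteq> x" "u \<noteq> x" "col v \<noteq> col u" "col v \<noteq> col x" "col u \<noteq> col x" "p \<noteq> q" "p \<noteq> l" "q \<noteq> l"
    by (rule tri_at[OF \<sigma>])
  have v2: "verts \<sigma> = {v, x, u}" using t(5) by auto
  have P: "spoke k v \<sigma> = p \<longleftrightarrow> arr k \<sigma> u x" for k by (rule spoke_iff[OF \<sigma>(1) t(5)]) (use t in auto)
  have Q: "spoke k v \<sigma> = q \<longleftrightarrow> arr k \<sigma> x u" for k by (rule spoke_iff[OF \<sigma>(1) v2]) (use t in auto)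
  have "arrow \<sigma> u x \<or> arrow \<sigma> x u" using arrow_linear(1)[OF \<sigma>(1), of u x] t by auto
  then show ?thesis
  proof
    assume a: "arrow \<sigma> u x"
    then have "spoke True v \<sigma> = p" "spoke False v \<sigma> = q" using P Q by (simp_all add: arr_def)
    then show ?thesis using that[of u x] t a by auto
  next
    assume a: "arrow \<sigma> x u"
    then have "spoke True v \<sigma> = q" "spoke False v \<sigma> = p" using P Q by (simp_all add: arr_def)
    then show ?thesis using that[of x u] t a v2 by auto
  qed
qed

lemma spoke_in: "\<sigma> \<in> Star v \<Longrightarrow> spoke k v \<sigma> \<in> E \<sigma> \<and> v \<in> ends (spoke k v \<sigma>)"
  by (cases k) (metis (full_types) insertI1 spokes_at)+

lemma spoke_cases: "\<sigma> \<in> Star v \<Longrightarrow> g \<in> E \<sigma> \<Longrightarrow> v \<in> ends g \<Longrightarrow> g = spoke k v \<sigma> \<or> g = spoke (\<not> k) v \<sigma>"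
  by (cases k) (metis (full_types) spokes_at)+

lemma spoke_ne: "\<sigma> \<in> Star v \<Longrightarrow> spoke k v \<sigma> \<noteq> spoke (\<not> k) v \<sigma>"
  by (cases k) (metis (full_types) spokes_at)+

lemma in_Star: "\<sigma> \<in> S \<Longrightarrow> g \<in> E \<sigma> \<Longrightarrow> v \<in> ends g \<Longrightarrow> \<sigma> \<in> Star v"
  using ends_verts unfolding Star_def by blast

lemma finite_Star: "finite (Star v)"
  using fin by (simp add: Star_def)

lemma finite_E: "\<sigma> \<in> S \<Longrightarrow> finite (E \<sigma>)"
  using shape[of \<sigma>] by (metis finite.emptyI finite.insertI)

lemma finite_Sp: "finite (Sp v)"
proof -
  have "Sp v \<subseteq> (\<Union>\<sigma>\<in>S. E \<sigma>)" by (auto simp: Sp_def)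
  then show ?thesis using fin finite_E by (meson finite_UN finite_subset)
qed

lemma spoke_Sp: "\<sigma> \<in> Star v \<Longrightarrow> spoke k v \<sigma> \<in> Sp v"
  using spoke_in unfolding Sp_def Star_def by blast

lemma incident_pair:
  assumes "g \<in> E \<sigma>" "\<sigma> \<in> S"
  obtains \<tau> where "\<tau> \<in> S" "g \<in> E \<tau>" "\<tau> \<noteq> \<sigma>" "{\<rho> \<in> S. g \<in> E \<rho>} = {\<sigma>, \<tau>}"
proof -
  obtain a b where ab: "{\<rho> \<in> S. g \<in> E \<rho>} = {a, b}" "a \<noteq> b" using two[OF assms(2,1)] by (auto simp: card_2_iff)
  moreover have "\<sigma> \<in> {a, b}" using ab(1) assms by blast
  ultimately show ?thesis using that[of a] that[of b] by (metis doubleton_eq_iff insert_iff mem_Collect_eq singletonD)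
qed

text \<open>Double counting: each spoke lies in two triangles, and each triangle at \<open>v\<close>
  has two spokes.\<close>

lemma card_Sp: "card (Sp v) = card (Star v)"
proof -
  have 1: "card {\<sigma> \<in> Star v. g \<in> E \<sigma>} = 2" if g: "g \<in> Sp v" for g
  proof -
    obtain \<sigma> where \<sigma>: "\<sigma> \<in> S" "g \<in> E \<sigma>" "v \<in> ends g" using g by (auto simp: Sp_def)
    have "{\<sigma> \<in> Star v. g \<in> E \<sigma>} = {\<sigma> \<in> S. g \<in> E \<sigma>}" using in_Star[OF _ _ \<sigma>(3)] by (auto simp: Star_def)
    then show ?thesis using two[OF \<sigma>(1,2)] by simp
  qed
  have 2: "card {g \<in> Sp v. g \<in> E \<sigma>} = 2" if \<sigma>: "\<sigma> \<in> Star v" for \<sigma>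
  proof -
    have "{g \<in> Sp v. g \<in> E \<sigma>} = {spoke True v \<sigma>, spoke False v \<sigma>}"
      using spoke_cases[OF \<sigma>, of _ True] spoke_Sp[OF \<sigma>] spoke_in[OF \<sigma>] by (auto simp: Sp_def)
    then show ?thesis using spoke_ne[OF \<sigma>, of True] by simp
  qed
  have "(\<Sum>g\<in>Sp v. card {\<sigma> \<in> Star v. g \<in> E \<sigma>}) = (\<Sum>\<sigma>\<in>Star v. 2)"
    by (rule sum_multicount_gen) (use finite_Sp finite_Star 2 in auto)
  then show ?thesis using 1 by simp
qed

lemma spoke_image_full: "spoke k v ` Star v = Sp v \<longleftrightarrow> inj_on (spoke k v) (Star v)"
proof
  assume "spoke k v ` Star v = Sp v"
  then show "inj_on (spoke k v) (Star v)" using card_Sp[of v] finite_Star by (metis eq_card_imp_inj_on)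
next
  assume "inj_on (spoke k v) (Star v)"
  then have "card (spoke k v ` Star v) = card (Sp v)" using card_Sp card_image by metis
  then show "spoke k v ` Star v = Sp v" using spoke_Sp by (intro card_subset_eq finite_Sp) auto
qed

text \<open>
  Each edge of the link has one source and one target, and there are as many edges as vertices in
  the link, so the existence of a local source and that of a local sink are equivalent.
\<close>

lemma W_opposite:
  assumes g: "g \<in> Sp v" "\<forall>\<sigma>\<in>S. g \<in> E \<sigma> \<longrightarrow> spoke k v \<sigma> = g"
  shows "\<exists>h\<in>Sp v. \<forall>\<sigma>\<in>S. h \<in> E \<sigma> \<longrightarrow> spoke (\<not> k) v \<sigma> = h"
proof -
  obtain \<sigma> where \<sigma>: "\<sigma> \<in> S" "g \<in> E \<sigma>" "v \<in> ends g" using g(1) by (auto simp: Sp_def)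
  obtain \<tau> where \<tau>: "\<tau> \<in> S" "g \<in> E \<tau>" "\<tau> \<noteq> \<sigma>" using incident_pair[OF \<sigma>(2,1)] by metis
  have "\<sigma> \<in> Star v" "\<tau> \<in> Star v" "spoke k v \<sigma> = spoke k v \<tau>" using in_Star \<sigma> \<tau> g(2) by auto
  then have "\<not> inj_on (spoke k v) (Star v)" using \<tau>(3) by (auto simp: inj_on_def)
  then have "spoke k v ` Star v \<noteq> Sp v" using spoke_image_full by blast
  then obtain h where h: "h \<in> Sp v" "h \<notin> spoke k v ` Star v" using spoke_Sp by blast
  have "spoke (\<not> k) v \<rho> = h" if "\<rho> \<in> S" "h \<in> E \<rho>" for \<rho>
  proof -
    have vh: "v \<in> ends h" using h(1) by (simp add: Sp_def)
    have "\<rho> \<in> Star v" using in_Star that vh by blast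
    then show ?thesis using spoke_cases[OF _ that(2) vh, of k] h(2) by blast
  qed
  then show ?thesis using h(1) by blast
qed

text \<open>A link that is not a directed cycle has both a local source and a local sink. They are
  different, so one of them avoids the spoke \<open>g\<close>; this is used when \<open>g\<close> is
  about to be flipped away.\<close>

lemma W_avoid:
  assumes "W v"
  shows "\<exists>k. \<exists>h\<in>Sp v. h \<noteq> g \<and> (\<forall>\<sigma>\<in>S. h \<in> E \<sigma> \<longrightarrow> spoke k v \<sigma> = h)"
proof -
  obtain k h where h: "h \<in> Sp v" "\<forall>\<sigma>\<in>S. h \<in> E \<sigma> \<longrightarrow> spoke k v \<sigma> = h" using assms unfolding W_def by blast
  obtain h' where h': "h' \<in> Sp v" "\<forall>\<sigma>\<in>S. h' \<in> E \<sigma> \<longrightarrow> spoke (\<not> k) v \<sigma> = h'" using W_opposite[OF h] by blast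
  obtain \<sigma> where \<sigma>: "\<sigma> \<in> S" "h \<in> E \<sigma>" "v \<in> ends h" using h(1) by (auto simp: Sp_def)
  have "h \<noteq> h'"
    using spoke_ne[OF in_Star[OF \<sigma>], of k] h(2) h'(2) \<sigma> by metis
  then show ?thesis using h h' by metis
qed

text \<open>
  If some edge leaves \<open>v\<close> and some edge enters it and the link were a directed cycle, then in this
  cycle the out-neighbors would be closed under successors, hence under predecessors.
\<close>

lemma mixed_W:
  assumes o: "o' \<in> Sp v" "src o' = v" and i: "i \<in> Sp v" "tgt i = v"
  shows "W v"
proof (rule ccontr)
  assume nW: "\<not> W v"
  have inj: "inj_on (spoke k v) (Star v)" for k
  proof (rule ccontr)
    assume "\<not> inj_on (spoke k v) (Star v)"
    then have "spoke k v ` Star v \<noteq> Sp v" using spoke_image_full by blast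
    then obtain h where h: "h \<in> Sp v" "h \<notin> spoke k v ` Star v" using spoke_Sp by blast
    have vh: "v \<in> ends h" using h(1) by (simp add: Sp_def)
    have "spoke (\<not> k) v \<rho> = h" if "\<rho> \<in> S" "h \<in> E \<rho>" for \<rho>
      using spoke_cases[OF in_Star[OF that vh] that(2) vh, of k] h(2) in_Star[OF that vh] by blast
    then show False using nW h(1) unfolding W_def by blast
  qed
  define Out where "Out = {g \<in> Sp v. src g = v}"
  define R where "R = {\<sigma> \<in> Star v. spoke True v \<sigma> \<in> Out}"
  \<comment> \<open>If \<open>v\<close> precedes the source of a link edge, it also precedes the
    target, by transitivity in the triangle.\<close>
  have step: "spoke False v \<sigma> \<in> Out" if \<sigma>: "\<sigma> \<in> R" for \<sigma>
  proof -
    have s: "\<sigma> \<in> Star v" "\<sigma> \<in> S" "spoke True v \<sigma> \<in> Out" using \<sigma> by (auto simp: R_def Star_def)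
    obtain u x where ux: "verts \<sigma> = {v, u, x}" "u \<noteq> v" "x \<noteq> v" "u \<noteq> x"
      "spoke True v \<sigma> \<in> E \<sigma>" "ends (spoke True v \<sigma>) = {v, u}"
      "spoke False v \<sigma> \<in> E \<sigma>" "ends (spoke False v \<sigma>) = {v, x}" "arrow \<sigma> u x"
      by (rule spokes_at[OF s(1)])
    have "arrow \<sigma> v u" using arrow_edge[OF s(2) ux(5,6)] s(3) by (simp add: Out_def)
    then have "arrow \<sigma> v x" using arrow_linear(3)[OF s(2)] ux(9) by blast
    then have "src (spoke False v \<sigma>) = v" using arrow_edge[OF s(2) ux(7,8)] by simp
    then show ?thesis using spoke_Sp[OF s(1)] by (simp add: Out_def)
  qed
  have fO: "finite Out" using finite_Sp by (simp add: Out_def)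
  have full: "spoke True v ` Star v = Sp v" using inj[of True] spoke_image_full[of True v] by simp
  have "spoke True v ` R = Out"
  proof
    show "Out \<subseteq> spoke True v ` R"
    proof
      fix g assume g: "g \<in> Out"
      then have "g \<in> spoke True v ` Star v" unfolding full by (simp add: Out_def)
      then obtain \<sigma> where "\<sigma> \<in> Star v" "g = spoke True v \<sigma>" by (rule imageE)
      then show "g \<in> spoke True v ` R" using g by (simp add: R_def)
    qed
  qed (auto simp: R_def)
  then have cR: "card R = card Out" using card_image[OF inj_on_subset[OF inj[of True]], of R] by (simp add: R_def)
  \<comment> \<open>An injection from \<open>R\<close> into \<open>Out\<close> between sets of equal
    size is onto; this turns closure under successors into closure under predecessors.\<close>
  have "spoke False v ` R = Out"
    by (rule card_subset_eq[OF fO]) (use step cR card_image[OF inj_on_subset[OF inj[of False]], of R] in \<open>auto simp: R_def\<close>)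
  then have pre: "\<sigma> \<in> R" if "\<sigma> \<in> Star v" "spoke False v \<sigma> \<in> Out" for \<sigma>
    using inj_onD[OF inj[of False]] that unfolding R_def by (smt (verit) imageE mem_Collect_eq)
  have touch: "\<sigma> \<in> R" if "\<sigma> \<in> Star v" "g \<in> E \<sigma>" "g \<in> Out" for \<sigma> g
  proof -
    have "v \<in> ends g" using that(3) by (auto simp: Out_def ends_def)
    then show ?thesis using spoke_cases[OF that(1,2), of True] pre[OF that(1)] that by (auto simp: R_def)
  qed
  have Rg: "g \<in> Out" if "\<sigma> \<in> R" "g \<in> E \<sigma>" "v \<in> ends g" for \<sigma> g
    using spoke_cases[of \<sigma> v g True] that step[OF that(1)] by (auto simp: R_def)
  have "R = {\<sigma> \<in> S. v \<in> (\<Union>e\<in>E \<sigma>. {src e, tgt e})}"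
  proof (rule star_conn)
    show "R \<subseteq> {\<sigma> \<in> S. v \<in> (\<Union>e\<in>E \<sigma>. {src e, tgt e})}"
      unfolding R_def Star_def verts_def ends_def by blast
    obtain \<sigma> where \<sigma>: "\<sigma> \<in> S" "o' \<in> E \<sigma>" using o(1) by (auto simp: Sp_def)
    have "\<sigma> \<in> Star v" using in_Star[OF \<sigma>] o(2) by (simp add: ends_def)
    then show "R \<noteq> {}" using touch[of \<sigma> o'] \<sigma>(2) o by (auto simp: Out_def)
    fix \<sigma> \<tau> e assume a: "\<sigma> \<in> R" "\<tau> \<in> S" "e \<in> E \<sigma>" "e \<in> E \<tau>" "v \<in> {src e, tgt e}"
    then have "e \<in> Out" using Rg[of \<sigma> e] by (simp add: ends_def)
    moreover have "\<tau> \<in> Star v" using in_Star[OF a(2,4)] a(5) by (simp add: ends_def)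
    ultimately show "\<tau> \<in> R" using touch a(4) by blast
  qed
  then have "R = Star v" unfolding Star_def verts_def ends_def .
  moreover obtain \<sigma> where \<sigma>: "\<sigma> \<in> S" "i \<in> E \<sigma>" using i(1) by (auto simp: Sp_def)
  have vi: "v \<in> ends i" using i(2) by (simp add: ends_def)
  ultimately have "i \<in> Out" using Rg[OF _ \<sigma>(2) vi] in_Star[OF \<sigma> vi] by blast
  then show False using edge_ends(1)[OF \<sigma>] i(2) by (simp add: Out_def)
qed

end

context csurf
begin

text \<open>In this form the property depends on the star of \<open>v\<close> only, which allows it
  to be compared between two surfaces.\<close>

lemma W_Star:
  "W v \<longleftrightarrow> (\<exists>k g. (\<exists>\<sigma>\<in>Star v. g \<in> E \<sigma> \<and> v \<in> ends g) \<and> (\<forall>\<sigma>\<in>Star v. g \<in> E \<sigma> \<longrightarrow> spoke k v \<sigma> = g))"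
proof
  assume "W v"
  then obtain k g where g: "g \<in> Sp v" "\<forall>\<sigma>\<in>S. g \<in> E \<sigma> \<longrightarrow> spoke k v \<sigma> = g" unfolding W_def by blast
  obtain \<sigma> where "\<sigma> \<in> S" "g \<in> E \<sigma>" "v \<in> ends g" using g(1) unfolding Sp_def by blast
  then show "\<exists>k g. (\<exists>\<sigma>\<in>Star v. g \<in> E \<sigma> \<and> v \<in> ends g) \<and> (\<forall>\<sigma>\<in>Star v. g \<in> E \<sigma> \<longrightarrow> spoke k v \<sigma> = g)"
    using in_Star g(2) unfolding Star_def by blast
next
  assume "\<exists>k g. (\<exists>\<sigma>\<in>Star v. g \<in> E \<sigma> \<and> v \<in> ends g) \<and> (\<forall>\<sigma>\<in>Star v. g \<in> E \<sigma> \<longrightarrow> spoke k v \<sigma> = g)"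
  then obtain k g \<sigma> where g: "\<sigma> \<in> Star v" "g \<in> E \<sigma>" "v \<in> ends g" "\<forall>\<sigma>\<in>Star v. g \<in> E \<sigma> \<longrightarrow> spoke k v \<sigma> = g" by blast
  then have "g \<in> Sp v" unfolding Sp_def Star_def by blast
  moreover have "\<forall>\<sigma>\<in>S. g \<in> E \<sigma> \<longrightarrow> spoke k v \<sigma> = g" using in_Star g(3,4) by blast
  ultimately show "W v" unfolding W_def by blast
qed

lemma arr_edge:
  assumes "\<sigma> \<in> S" "g \<in> E \<sigma>" "ends g = {x, y}"
  shows "arr k \<sigma> x y \<longleftrightarrow> src g = (if k then x else y)"
proof -
  have "ends g = {y, x}" using assms(3) by (simp add: insert_commute)
  then show ?thesis using arrow_edge[OF assms] arrow_edge[OF assms(1,2), of y x] by (simp add: arr_def)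
qed

lemma tri_edges:
  assumes "\<sigma> \<in> S" "verts \<sigma> = {x, y, z}" "x \<noteq> y" "y \<noteq> z" "x \<noteq> z"
  obtains xy xz yz where "E \<sigma> = {xy, xz, yz}" "ends xy = {x, y}" "ends xz = {x, z}" "ends yz = {y, z}"
proof -
  have xv: "x \<in> verts \<sigma>" using assms(2) by blast
  obtain y' z' p q l where t: "E \<sigma> = {p, q, l}" "ends p = {x, y'}" "ends q = {x, z'}" "ends l = {y', z'}"
    "verts \<sigma> = {x, y', z'}" "x \<noteq> y'" "x \<noteq> z'" "y' \<noteq> z'"
    by (rule tri_at[OF assms(1) xv])
  have "{y', z'} = {y, z}" using t(5-8) assms(2-5) by auto
  then consider "y' = y" "z' = z" | "y' = z" "z' = y" by (auto simp: doubleton_eq_iff)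
  then show ?thesis
  proof cases
    case 1
    then show ?thesis using that[of p q l] t by simp
  next
    case 2
    then show ?thesis using that[of q p l] t by (simp add: insert_commute)
  qed
qed

lemma third_vertex:
  assumes "\<sigma> \<in> S" "g \<in> E \<sigma>" "ends g = {x, y}"
  obtains z where "verts \<sigma> = {x, y, z}" "z \<noteq> x" "z \<noteq> y" "x \<noteq> y"
proof -
  have xv: "x \<in> verts \<sigma>" using ends_verts[OF assms(2)] assms(3) by blast
  obtain y' z' p q l where t: "E \<sigma> = {p, q, l}" "ends p = {x, y'}" "ends q = {x, z'}" "ends l = {y', z'}"
    "verts \<sigma> = {x, y', z'}" "x \<noteq> y'" "x \<noteq> z'" "y' \<noteq> z'"
    by (rule tri_at[OF assms(1) xv])
  from assms(2) t(1) consider "g = p" | "g = q" | "g = l" by blast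
  then show ?thesis
  proof cases
    case 1
    then have "y = y'" using assms(3) t(2,6) by (auto simp: doubleton_eq_iff)
    then show ?thesis using that[of z'] t by auto
  next
    case 2
    then have "y = z'" using assms(3) t(3,7) by (auto simp: doubleton_eq_iff)
    then show ?thesis using that[of y'] t by auto
  next
    case 3
    then show ?thesis using assms(3) t(4,6,7) by (auto simp: doubleton_eq_iff)
  qed
qed

lemma vert_colors:
  assumes "\<sigma> \<in> S" "x \<in> verts \<sigma>" "y \<in> verts \<sigma>" "x \<noteq> y" shows "col x \<noteq> col y"
proof -
  obtain y' z' p q l where t: "E \<sigma> = {p, q, l}"
    "verts \<sigma> = {x, y', z'}" "col x \<noteq> col y'" "col x \<noteq> col z'"
    by (rule tri_at[OF assms(1,2)])
  then show ?thesis using assms(3,4) by auto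
qed

end

section \<open>Vertex links before and after a flip\<close>

locale csurf_flip = csurf S E src tgt col + S': csurf S' E src tgt col
  for S S' :: "'t set" and E :: "'t \<Rightarrow> 'e set" and src tgt :: "'e \<Rightarrow> 'v" and col :: "'v \<Rightarrow> 'c" +
  fixes A B C D :: 't and e f :: 'e and a b c d :: 'v
  assumes AB: "A \<in> S" "B \<in> S" "A \<noteq> B" "e \<in> E A" "e \<in> E B" "ends e = {a, b}"
    and vA: "verts A = {a, b, c}" and vB: "verts B = {a, b, d}"
    and dist: "a \<noteq> b" "c \<noteq> a" "c \<noteq> b" "d \<noteq> a" "d \<noteq> b" "c \<noteq> d"
    and S'_eq: "S' = S - {A, B} \<union> {C, D}" and new: "C \<notin> S" "D \<notin> S" "C \<noteq> D"
    and f: "ends f = {c, d}" "\<And>\<sigma>. \<sigma> \<in> S \<Longrightarrow> f \<notin> E \<sigma>"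
    and EC: "E C = insert f {x \<in> E A \<union> E B. a \<in> ends x \<and> x \<noteq> e}"
    and ED: "E D = insert f {x \<in> E A \<union> E B. b \<in> ends x \<and> x \<noteq> e}"
begin

text \<open>With \<open>swap_ends\<close> this gives the symmetries of a flip: results about
  \<open>a\<close> and \<open>c\<close> transfer to \<open>b\<close> and \<open>d\<close>.\<close>

lemma swap_triangles: "csurf_flip S S' E src tgt col B A C D e f a b d c"
  by unfold_locales (use AB vA vB dist S'_eq new f EC ED in auto)

lemma swap_ends: "csurf_flip S S' E src tgt col A B D C e f b a c d"
  by unfold_locales (use AB vA vB dist S'_eq new f EC ED in auto)

lemma inc_e: "\<sigma> \<in> S \<Longrightarrow> e \<in> E \<sigma> \<Longrightarrow> \<sigma> = A \<or> \<sigma> = B"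
proof -
  assume a: "\<sigma> \<in> S" "e \<in> E \<sigma>"
  have "card {\<rho> \<in> S. e \<in> E \<rho>} = 2" using two AB(1,4) by blast
  moreover have "{A, B} \<subseteq> {\<rho> \<in> S. e \<in> E \<rho>}" using AB by blast
  ultimately have "{A, B} = {\<rho> \<in> S. e \<in> E \<rho>}"
    using AB(3) by (intro card_subset_eq) (use fin in auto)
  then show ?thesis using a by blast
qed

lemma CD_in: "C \<in> S'" "D \<in> S'" by (auto simp: S'_eq)

lemma edges:
  obtains ac bc ad bd where "E A = {e, ac, bc}" "E B = {e, ad, bd}" "E C = {f, ac, ad}" "E D = {f, bc, bd}"
    "ends ac = {a, c}" "ends bc = {b, c}" "ends ad = {a, d}" "ends bd = {b, d}"
proof -
  obtain ab ac bc where A: "E A = {ab, ac, bc}" "ends ab = {a, b}" "ends ac = {a, c}" "ends bc = {b, c}"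
    by (rule tri_edges[OF AB(1) vA]) (use dist in auto)
  have "ab = e" using edge_unique[OF AB(1), of ab e] A AB by simp
  obtain ab' ad bd where B: "E B = {ab', ad, bd}" "ends ab' = {a, b}" "ends ad = {a, d}" "ends bd = {b, d}"
    by (rule tri_edges[OF AB(2) vB]) (use dist in auto)
  have "ab' = e" using edge_unique[OF AB(2), of ab' e] B AB by simp
  have ne: "ac \<noteq> e" "bc \<noteq> e" "ad \<noteq> e" "bd \<noteq> e" using A B AB(6) dist by (auto simp: doubleton_eq_iff)
  have "E C = {f, ac, ad}" unfolding EC A(1) B(1) \<open>ab = e\<close> \<open>ab' = e\<close> using ne A B dist by auto
  moreover have "E D = {f, bc, bd}" unfolding ED A(1) B(1) \<open>ab = e\<close> \<open>ab' = e\<close> using ne A B dist by auto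
  ultimately show ?thesis using that A B \<open>ab = e\<close> \<open>ab' = e\<close> by blast
qed

lemma vC: "verts C = {a, c, d}" and vD: "verts D = {b, c, d}"
proof -
  obtain ac bc ad bd where "E C = {f, ac, ad}" "E D = {f, bc, bd}"
    "ends ac = {a, c}" "ends bc = {b, c}" "ends ad = {a, d}" "ends bd = {b, d}" by (rule edges)
  then show "verts C = {a, c, d}" "verts D = {b, c, d}" unfolding verts_def using f(1) by auto
qed

lemma arr_C: "arr k C a c \<longleftrightarrow> arr k A a c" "arr k C a d \<longleftrightarrow> arr k B a d"
proof -
  obtain ac bc ad bd where x: "E A = {e, ac, bc}" "E B = {e, ad, bd}" "E C = {f, ac, ad}"
    "ends ac = {a, c}" "ends ad = {a, d}" by (rule edges)
  show "arr k C a c \<longleftrightarrow> arr k A a c" using S'.arr_edge[OF CD_in(1), of ac a c k] arr_edge[OF AB(1), of ac a c k] x by simp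
  show "arr k C a d \<longleftrightarrow> arr k B a d" using S'.arr_edge[OF CD_in(1), of ad a d k] arr_edge[OF AB(2), of ad a d k] x by simp
qed

lemma arr_e: "arr k A a b \<longleftrightarrow> arr k B a b"
  using arr_edge[OF AB(1,4,6)] arr_edge[OF AB(2,5,6)] by simp

lemma arr_f: "arr k C c d \<longleftrightarrow> src f = (if k then c else d)" "arr k D c d \<longleftrightarrow> src f = (if k then c else d)"
  using S'.arr_edge[OF CD_in(1) _ f(1)] S'.arr_edge[OF CD_in(2) _ f(1)] EC ED by auto

lemma arr_flip: "\<sigma> \<in> S \<Longrightarrow> x \<in> verts \<sigma> \<Longrightarrow> y \<in> verts \<sigma> \<Longrightarrow> x \<noteq> y \<Longrightarrow> arr k \<sigma> y x \<longleftrightarrow> \<not> arr k \<sigma> x y"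
  using arr_linear(1,2) by blast

lemma in_S': "\<sigma> \<in> S' \<longleftrightarrow> (\<sigma> \<in> S \<and> \<sigma> \<noteq> A \<and> \<sigma> \<noteq> B) \<or> \<sigma> = C \<or> \<sigma> = D"
  unfolding S'_eq by blast

lemma Star'_iff: "\<sigma> \<in> S'.Star v \<longleftrightarrow>
    (\<sigma> \<in> Star v \<and> \<sigma> \<noteq> A \<and> \<sigma> \<noteq> B) \<or> (\<sigma> = C \<and> v \<in> {a, c, d}) \<or> (\<sigma> = D \<and> v \<in> {b, c, d})"
  using vC vD unfolding S'.Star_def Star_def mem_Collect_eq in_S' by metis

lemma AB_Star: "A \<in> Star v \<longleftrightarrow> v \<in> {a, b, c}" "B \<in> Star v \<longleftrightarrow> v \<in> {a, b, d}"
  using AB vA vB by (simp_all add: Star_def)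

lemma Star_other:
  assumes "v \<notin> {a, b, c, d}" shows "S'.Star v = Star v"
proof (rule Set.set_eqI)
  fix \<sigma> show "\<sigma> \<in> S'.Star v \<longleftrightarrow> \<sigma> \<in> Star v"
    using Star'_iff[of \<sigma> v] AB_Star[of v] assms by blast
qed

lemma Star_a: "S'.Star a = Star a - {A, B} \<union> {C}"
proof (rule Set.set_eqI)
  fix \<sigma> show "\<sigma> \<in> S'.Star a \<longleftrightarrow> \<sigma> \<in> Star a - {A, B} \<union> {C}"
    using Star'_iff[of \<sigma> a] dist by auto
qed

lemma Star_c: "S'.Star c = Star c - {A} \<union> {C, D}"
proof (rule Set.set_eqI)
  fix \<sigma> show "\<sigma> \<in> S'.Star c \<longleftrightarrow> \<sigma> \<in> Star c - {A} \<union> {C, D}"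
    using Star'_iff[of \<sigma> c] AB_Star[of c] dist by auto
qed

text \<open>In the link of \<open>c\<close> the flip inserts \<open>d\<close> into the edge
  \<open>a b\<close>. A local source at an end of this edge remains one if it precedes
  \<open>d\<close>. Otherwise \<open>d\<close> precedes it, hence also the other end, and
  \<open>d\<close> is a local source.\<close>

lemma W_c:
  assumes "W c" shows "S'.W c"
proof -
  obtain ac bc ad bd where x: "E A = {e, ac, bc}" "E B = {e, ad, bd}" "E C = {f, ac, ad}" "E D = {f, bc, bd}"
    "ends ac = {a, c}" "ends bc = {b, c}" "ends ad = {a, d}" "ends bd = {b, d}" by (rule edges)
  obtain k g where g: "\<exists>\<sigma>\<in>Star c. g \<in> E \<sigma> \<and> c \<in> ends g" "\<forall>\<sigma>\<in>Star c. g \<in> E \<sigma> \<longrightarrow> spoke k c \<sigma> = g"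
    using assms unfolding W_Star by blast
  then obtain \<sigma>0 where \<sigma>0: "\<sigma>0 \<in> Star c" "g \<in> E \<sigma>0" "c \<in> ends g" by blast
  have gf: "g \<noteq> f" using \<sigma>0 f(2) by (auto simp: Star_def)
  have As: "A \<in> Star c" using AB(1) vA by (simp add: Star_def)
  show ?thesis
  proof (cases "g \<in> E A")
    case False
    have gCD: "g \<notin> E C" "g \<notin> E D" using False gf x \<sigma>0(3) dist by auto
    have "\<sigma>0 \<noteq> A" using False \<sigma>0(2) by blast
    then have "\<sigma>0 \<in> S'.Star c" using \<sigma>0(1) Star_c by blast
    moreover have "\<forall>\<sigma>\<in>S'.Star c. g \<in> E \<sigma> \<longrightarrow> spoke k c \<sigma> = g" using g(2) gCD Star_c by blast
    ultimately show ?thesis unfolding S'.W_Star using \<sigma>0(2,3) by blast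
  next
    case True
    have main: "S'.W c"
      if F: "csurf_flip S S' E src tgt col A B C0 D0 e f x0 y0 c d" and gx: "ends g = {x0, c}" for C0 D0 x0 y0
    proof -
      interpret F: csurf_flip S S' E src tgt col A B C0 D0 e f x0 y0 c d by (rule F)
      obtain xc yc xd yd where z: "E A = {e, xc, yc}" "E B = {e, xd, yd}" "E C0 = {f, xc, xd}" "E D0 = {f, yc, yd}"
        "ends xc = {x0, c}" "ends yc = {y0, c}" "ends xd = {x0, d}" "ends yd = {y0, d}" by (rule F.edges)
      have gxc: "g = xc" using edge_unique[OF AB(1) True, of xc] z gx by simp
      have sA: "spoke k c A = g" using g(2) As True by blast
      have xy: "arr k A x0 y0"
        using spoke_iff[OF AB(1), of c x0 y0 g k] F.vA F.dist True gx sA by (simp add: insert_commute)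
      show "S'.W c"
      proof (cases "arr k C0 x0 d")
        case xd: True
        have "spoke k c C0 = g"
          using S'.spoke_iff[OF F.CD_in(1), of c x0 d g k] F.vC F.dist gx z(3) gxc xd by (simp add: insert_commute)
        moreover have "g \<notin> E D0" using gf gx z F.dist gxc by (auto simp: doubleton_eq_iff)
        moreover have "C0 \<in> S'.Star c" using F.Star_c by blast
        moreover have "g \<in> E C0" using gxc z by blast
        ultimately show ?thesis unfolding S'.W_Star using g(2) F.Star_c \<sigma>0(3) by blast
      next
        case False
        have "arr k C0 d x0" using False S'.arr_linear(1)[OF F.CD_in(1), of x0 d k] F.vC F.dist by auto
        then have "arr k B d x0" using F.arr_C(2)[of k] arr_flip[OF AB(2), of x0 d k] F.vB F.dist
          S'.arr_linear(2)[OF F.CD_in(1)] by blast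
        moreover have "arr k B x0 y0" using F.arr_e xy by blast
        ultimately have "arr k B d y0" using arr_linear(3)[OF AB(2)] by blast
        then have "arr k D0 d y0"
          using csurf_flip.arr_C(2)[OF F.swap_ends, of k] arr_linear(2)[OF AB(2)] S'.arr_linear(1)[OF F.CD_in(2), of y0 d k] F.vD F.dist by auto
        then have "spoke k c D0 = f"
          using S'.spoke_iff[OF F.CD_in(2), of c d y0 f k] F.vD F.dist f z(4) by (auto simp: insert_commute)
        moreover have "spoke k c C0 = f"
          using S'.spoke_iff[OF F.CD_in(1), of c d x0 f k] F.vC F.dist f z(3) \<open>arr k C0 d x0\<close> by (auto simp: insert_commute)
        moreover have "C0 \<in> S'.Star c" "f \<in> E C0" "c \<in> ends f" using F.Star_c z(3) f(1) by blast+
        moreover have "f \<notin> E \<sigma>" if "\<sigma> \<in> Star c" for \<sigma> using f(2) that by (simp add: Star_def)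
        ultimately show ?thesis unfolding S'.W_Star using F.Star_c by blast
      qed
    qed
    have "ends g = {a, c} \<or> ends g = {b, c}" using True x \<sigma>0(3) AB(6) dist by auto
    then show ?thesis
      using main[OF csurf_flip_axioms] main[OF swap_ends] by blast
  qed
qed

lemma W_off_edge:
  assumes "W v" "v \<notin> {a, b}" shows "S'.W v"
proof -
  consider "v = c" | "v = d" | "v \<notin> {a, b, c, d}" using assms(2) by blast
  then show ?thesis
  proof cases
    case 1
    then show ?thesis using W_c assms(1) by simp
  next
    case 2
    then show ?thesis using csurf_flip.W_c[OF swap_triangles] assms(1) by simp
  next
    case 3
    then show ?thesis using assms(1) Star_other unfolding W_Star S'.W_Star by simp
  qed
qed

text \<open>The spokes to \<open>c\<close> and \<open>d\<close> survive the flip; one of them enters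
  \<open>a\<close> and the other leaves it, so \<open>mixed_W\<close> applies.\<close>

lemma W_a_mixed:
  assumes "arr k A c a" "arr k B a d" shows "S'.W a"
proof -
  obtain ac bc ad bd where x: "E A = {e, ac, bc}" "E B = {e, ad, bd}" "E C = {f, ac, ad}" "E D = {f, bc, bd}"
    "ends ac = {a, c}" "ends bc = {b, c}" "ends ad = {a, d}" "ends bd = {b, d}" by (rule edges)
  have sp: "ac \<in> S'.Sp a" "ad \<in> S'.Sp a" unfolding S'.Sp_def using x CD_in by auto
  have ac: "src ac = (if k then c else a)" using arr_edge[OF AB(1), of ac c a k] x assms(1) by (simp add: insert_commute)
  have ad: "src ad = (if k then a else d)" using arr_edge[OF AB(2), of ad a d k] x assms(2) by simp
  have t: "tgt ac = (if k then a else c)" "tgt ad = (if k then d else a)"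
    using ac ad x(5,7) dist unfolding ends_def by (auto simp: doubleton_eq_iff split: if_splits)
  show ?thesis
  proof (cases k)
    case True
    then show ?thesis using S'.mixed_W[OF sp(2) _ sp(1)] ac ad t by simp
  next
    case False
    then show ?thesis using S'.mixed_W[OF sp(1) _ sp(2)] ac ad t by simp
  qed
qed

lemma W_a_far:
  assumes g: "g \<in> Sp a" "\<forall>\<sigma>\<in>S. g \<in> E \<sigma> \<longrightarrow> spoke k a \<sigma> = g" and "g \<notin> E A" "g \<notin> E B"
  shows "S'.W a"
proof -
  obtain \<sigma> where \<sigma>: "\<sigma> \<in> S" "g \<in> E \<sigma>" "a \<in> ends g" using g(1) by (auto simp: Sp_def)
  have "g \<noteq> f" using \<sigma> f(2) by blast
  then have gn: "g \<notin> E C" "g \<notin> E D" using EC ED assms(3,4) by auto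
  have "\<sigma> \<in> S'" using \<sigma> assms(3,4) by (auto simp: S'_eq)
  then have "g \<in> S'.Sp a" unfolding S'.Sp_def using \<sigma> by blast
  moreover have "\<forall>\<sigma>\<in>S'. g \<in> E \<sigma> \<longrightarrow> spoke k a \<sigma> = g" using g(2) gn by (auto simp: S'_eq)
  ultimately show ?thesis unfolding S'.W_def by blast
qed

text \<open>In the link of \<open>a\<close>, the neighbor \<open>b\<close> of \<open>c\<close> is
  replaced by \<open>d\<close>. So \<open>c\<close> stays a local source in the sense of
  \<open>k\<close> when the new edge leaves it in this sense.\<close>

lemma W_a_near:
  assumes g: "g \<in> E A" "ends g = {a, c}" "\<forall>\<sigma>\<in>S. g \<in> E \<sigma> \<longrightarrow> spoke k a \<sigma> = g"
    and o: "arr k C c d"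
  shows "S'.W a"
proof -
  obtain ac bc ad bd where x: "E A = {e, ac, bc}" "E B = {e, ad, bd}" "E C = {f, ac, ad}" "E D = {f, bc, bd}"
    "ends ac = {a, c}" "ends bc = {b, c}" "ends ad = {a, d}" "ends bd = {b, d}" by (rule edges)
  have gac: "g = ac" using edge_unique[OF AB(1) g(1), of ac] x g(2) by simp
  have gC: "g \<in> E C" using gac x by simp
  have "g \<noteq> f" using g(1) f(2) AB(1) by blast
  then have gD: "g \<notin> E D" using x gac dist by (auto simp: doubleton_eq_iff)
  have "spoke k a C = g"
    using S'.spoke_iff[OF CD_in(1), of a c d g k] vC dist gC g(2) o by (simp add: insert_commute)
  then have "\<forall>\<sigma>\<in>S'. g \<in> E \<sigma> \<longrightarrow> spoke k a \<sigma> = g" using g(3) gD by (auto simp: S'_eq)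
  moreover have "g \<in> S'.Sp a" unfolding S'.Sp_def using CD_in(1) gC g(2) by blast
  ultimately show ?thesis unfolding S'.W_def by blast
qed

end

section \<open>Flips in a colored sphere\<close>

context csurf
begin

lemma card_verts: "\<sigma> \<in> S \<Longrightarrow> card (verts \<sigma>) = 3"
proof -
  assume \<sigma>: "\<sigma> \<in> S"
  obtain x y z e f g where "E \<sigma> = {e, f, g}" "src e = x" "tgt e = y" "src f = y" "tgt f = z"
      "src g = x" "tgt g = z" "col x \<noteq> col y" "col y \<noteq> col z" "col x \<noteq> col z"
    using shape[OF \<sigma>] by blast
  moreover from this have "x \<noteq> y" "y \<noteq> z" "x \<noteq> z" by auto
  ultimately have "verts \<sigma> = {x, y, z}" "card {x, y, z} = 3" by (auto simp: verts_def ends_def)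
  then show ?thesis by simp
qed

lemma three_distinct:
  assumes "\<sigma> \<in> S" "verts \<sigma> = {x, y, z}" shows "x \<noteq> y" "y \<noteq> z" "x \<noteq> z"
  using card_verts[OF assms(1)] assms(2) card_2_iff[of "{x, y}"]
  by (auto simp: card_insert_if split: if_splits)

lemma edge_between:
  assumes "\<sigma> \<in> S" "x \<in> verts \<sigma>" "y \<in> verts \<sigma>" "x \<noteq> y"
  obtains g where "g \<in> E \<sigma>" "ends g = {x, y}"
proof -
  obtain g where "g \<in> E \<sigma>" "(src g = x \<and> tgt g = y) \<or> (src g = y \<and> tgt g = x)"
    using arrow_linear(1)[OF assms] unfolding arrow_def by blast
  then show ?thesis using that[of g] by (auto simp: ends_def)
qed

definition hinge :: "'t \<Rightarrow> 't \<Rightarrow> 'e \<Rightarrow> 'v \<Rightarrow> 'v \<Rightarrow> 'v \<Rightarrow> 'v \<Rightarrow> bool" where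
  "hinge A B e a b c d \<longleftrightarrow> A \<in> S \<and> B \<in> S \<and> A \<noteq> B \<and> e \<in> E A \<and> e \<in> E B \<and> ends e = {a, b} \<and>
     verts A = {a, b, c} \<and> verts B = {a, b, d}"

lemma hinge_swap: "hinge A B e a b c d \<Longrightarrow> hinge B A e a b d c"
  "hinge A B e a b c d \<Longrightarrow> hinge A B e b a c d"
  by (auto simp: hinge_def insert_commute)

lemma hingeI:
  assumes "A \<in> S" "B \<in> S" "A \<noteq> B" "e \<in> E A" "e \<in> E B" "ends e = {a, b}"
  obtains c d where "hinge A B e a b c d"
proof -
  obtain c where "verts A = {a, b, c}" using third_vertex[OF assms(1,4,6)] by blast
  moreover obtain d where "verts B = {a, b, d}" using third_vertex[OF assms(2,5,6)] by blast
  ultimately show ?thesis using that assms unfolding hinge_def by blast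
qed

text \<open>The predecessors of \<open>c\<close> and of \<open>d\<close> among \<open>a, b\<close> are initial segments of the same order.\<close>

lemma hinge_orient:
  assumes h: "hinge A B e a b c d"
  shows "\<exists>k. \<forall>x\<in>{a, b}. arr k A x c \<longrightarrow> arr k B x d"
proof (rule ccontr)
  assume n: "\<not> ?thesis"
  have S: "A \<in> S" "B \<in> S" and v: "verts A = {a, b, c}" "verts B = {a, b, d}" using h by (auto simp: hinge_def)
  note dA = three_distinct[OF S(1) v(1)] and dB = three_distinct[OF S(2) v(2)]
  have A: "arr False A x c \<longleftrightarrow> \<not> arr True A x c" if "x \<in> {a, b}" for x
    using arrow_linear(1,2)[OF S(1), of x c] that dA v(1) unfolding arr_def by auto
  have B: "arr False B x d \<longleftrightarrow> \<not> arr True B x d" if "x \<in> {a, b}" for x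
    using arrow_linear(1,2)[OF S(2), of x d] that dB v(2) unfolding arr_def by auto
  obtain x where x: "x \<in> {a, b}" "arr True A x c" "\<not> arr True B x d" using n by blast
  obtain y where y: "y \<in> {a, b}" "\<not> arr True A y c" "arr True B y d" using n A B by blast
  have "x \<noteq> y" using x y by blast
  then have xy: "{x, y} = {a, b}" using x(1) y(1) by blast
  have "arr True A x y \<longleftrightarrow> arr True B x y"
    using arr_edge[of A e x y True] arr_edge[of B e x y True] h xy by (simp add: hinge_def)
  moreover have "\<not> arr True A y x" using x(2) y(2) arr_linear(3)[OF S(1)] by blast
  moreover have "\<not> arr True B x y" using x(3) y(3) arr_linear(3)[OF S(2)] by blast
  moreover have "arr True A x y \<or> arr True A y x" using arr_linear(1)[OF S(1), of x y] \<open>x \<noteq> y\<close> x(1) y(1) v by blast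
  ultimately show False by blast
qed

end

abbreviation "tverts \<equiv> csurf.verts eds src tgt"
abbreviation "star T \<equiv> csurf.Star (tris T) eds src tgt"
abbreviation "WT T \<equiv> csurf.W (tris T) eds src tgt"
abbreviation "flip \<psi> T T' \<equiv> csurf_flip (tris T) (tris T') eds src tgt \<psi>"
abbreviation "tarr \<equiv> csurf.arr eds src tgt"
abbreviation "thinge T \<equiv> csurf.hinge (tris T) eds src tgt"

lemma tverts_corners:
  fixes \<sigma> :: "(nat \<Rightarrow> real) \<Rightarrow> real^3"
  assumes "good \<psi> T" shows "tverts \<sigma> = corners 2 \<sigma>"
proof -
  interpret csurf "tris T" eds src tgt \<psi> by (rule csurf_good[OF assms])
  show ?thesis unfolding verts_def ends_def by (rule verts_corners)
qed

lemma vertices_tris: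
  assumes "good \<psi> T" shows "vertices T = (\<Union>\<sigma>\<in>tris T. tverts \<sigma>)"
proof
  interpret colored_sphere T by (rule good_colored[OF assms])
  show "(\<Union>\<sigma>\<in>tris T. tverts \<sigma>) \<subseteq> vertices T" unfolding tverts_corners[OF assms] using corners_vertices by blast
  show "vertices T \<subseteq> (\<Union>\<sigma>\<in>tris T. tverts \<sigma>)"
  proof
    fix v assume "v \<in> vertices T"
    then obtain \<tau> where \<tau>: "(0, \<tau>) \<in> T" "v = \<tau> (simplex_vertex 0)" unfolding vertices_def by blast
    obtain \<sigma> s where \<sigma>: "(2, \<sigma>) \<in> T" "s \<subseteq> {..2}" "s \<noteq> {}" "cell s \<sigma> = (0, \<tau>)" using face_of_triangle[OF \<tau>(1)] .
    have "\<tau> = snd (cell s \<sigma>)" "0 = card s - 1" using \<sigma>(4) by (metis snd_conv, metis fst_cell fst_conv)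
    then have "corners 0 \<tau> = (\<lambda>k. \<sigma> (simplex_vertex k)) ` s"
      using corners_cell[OF finite_subset[OF \<sigma>(2)] \<sigma>(3), of \<sigma>] by simp
    moreover have "v \<in> corners 0 \<tau>" unfolding corners_def \<tau>(2) by simp
    ultimately have "v \<in> corners 2 \<sigma>" using \<sigma>(2) unfolding corners_def by auto
    then show "v \<in> (\<Union>\<sigma>\<in>tris T. tverts \<sigma>)" unfolding tverts_corners[OF assms] using \<sigma>(1) by blast
  qed
qed

text \<open>By \<open>ok\<close> the vertex \<open>c\<close> has no predecessors in \<open>A\<close>
  that are not predecessors of \<open>d\<close> in \<open>B\<close>. Hence \<open>c\<close> has at
  most the position of \<open>d\<close>, which is the inequality \<open>i \<le> j\<close> required
  by \<open>geometric_flip\<close>.\<close>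

lemma flip_forward:
  assumes gd: "good \<psi> T" and h: "thinge T A B e a b c d" and col: "\<psi> c \<noteq> \<psi> d"
    and ok: "\<And>x. x \<in> {a, b} \<Longrightarrow> tarr True A x c \<Longrightarrow> tarr True B x d"
  shows "\<exists>T' C D f. reaches \<psi> T T' \<and> flip \<psi> T T' A B C D e f a b c d \<and> src f = c"
proof -
  interpret colored_sphere T by (rule good_colored[OF gd])
  interpret csurf "tris T" eds src tgt \<psi> by (rule csurf_good[OF gd])
  have S: "A \<in> tris T" "B \<in> tris T" "A \<noteq> B" "e \<in> eds A" "e \<in> eds B" "ends e = {a, b}"
    and v: "verts A = {a, b, c}" "verts B = {a, b, d}" using h by (auto simp: hinge_def)
  note dA = three_distinct[OF S(1) v(1)] and dB = three_distinct[OF S(2) v(2)]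
  have vx: "verts \<sigma> = {\<sigma> (simplex_vertex 0), \<sigma> (simplex_vertex 1), \<sigma> (simplex_vertex 2)}" for \<sigma>
    unfolding tverts_corners[OF gd] corners_def atMost2 by simp
  have ar: "arrow \<sigma> x y \<longleftrightarrow> (x = \<sigma> (simplex_vertex 0) \<and> y = \<sigma> (simplex_vertex 1)) \<or>
      (x = \<sigma> (simplex_vertex 1) \<and> y = \<sigma> (simplex_vertex 2)) \<or> (x = \<sigma> (simplex_vertex 0) \<and> y = \<sigma> (simplex_vertex 2))" for \<sigma> x y
    unfolding arrow_def eds3 by (auto simp: pair_ends)
  have opp: "\<sigma> (simplex_vertex i) = z" if "\<sigma> \<in> tris T" "i \<le> 2" "cell ({..2} - {i}) \<sigma> = (1, e)" "verts \<sigma> = {a, b, z}" for \<sigma> i z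
  proof -
    have "ends e = (\<lambda>k. \<sigma> (simplex_vertex k)) ` ({..2} - {i})"
      using ends_cell[OF card_omit3[OF that(2)], of \<sigma>] that(3) by (simp add: ends_def)
    moreover have "inj_on (\<lambda>k. \<sigma> (simplex_vertex k)) {..2}" using vert_inj that(1) by blast
    ultimately have "\<sigma> (simplex_vertex i) \<notin> ends e" using that(2) by (auto simp: inj_on_def)
    moreover have "\<sigma> (simplex_vertex i) \<in> verts \<sigma>" using that(2) unfolding tverts_corners[OF gd] corners_def by blast
    ultimately show ?thesis using S(6) that(4) by blast
  qed
  obtain i where i: "i \<le> 2" "cell ({..2} - {i}) A = (1, e)" using S(4) eds_iff by blast
  obtain j where j: "j \<le> 2" "cell ({..2} - {j}) B = (1, e)" using S(5) eds_iff by blast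
  have ci: "A (simplex_vertex i) = c" by (rule opp) (use S i v in auto)
  have dj: "B (simplex_vertex j) = d" by (rule opp) (use S j v in auto)
  have ok': "arrow A x c \<Longrightarrow> x \<noteq> c \<Longrightarrow> x \<in> verts A \<Longrightarrow> arrow B x d" for x using ok[of x] v by (auto simp: arr_def)
  have "i \<le> j"
  proof (rule ccontr)
    assume "\<not> i \<le> j"
    then consider "j = 0" "i = 1 \<or> i = 2" | "i = 2" "j = 1" using i(1) j(1) by linarith
    then show False
    proof cases
      case 1
      have "A (simplex_vertex 0) \<noteq> A (simplex_vertex 1)" "A (simplex_vertex 0) \<noteq> A (simplex_vertex 2)"
        using three_distinct[OF S(1) vx] by auto
      then have "arrow B (A (simplex_vertex 0)) d" using ok'[of "A (simplex_vertex 0)"] 1 ci by (auto simp: ar vx)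
      moreover have "d = B (simplex_vertex 0)" using dj 1 by simp
      ultimately show False using three_distinct[OF S(2) vx] by (simp add: ar)
    next
      case 2
      note dd = three_distinct[OF S(1) vx] three_distinct[OF S(2) vx]
      have "arrow B (A (simplex_vertex 0)) d" "arrow B (A (simplex_vertex 1)) d"
        using ok'[of "A (simplex_vertex 0)"] ok'[of "A (simplex_vertex 1)"] 2 ci dd by (auto simp: ar vx)
      then show False using dd 2 dj by (auto simp: ar)
    qed
  qed
  from geometric_flip[OF gd _ _ S(3) this j(1) i(2) j(2)] S(1,2) col
  obtain T' C D f where r: "reaches \<psi> T T'" "flipped eds src tgt (tris T) (tris T') A B e c d C D f" "src f = c"
    unfolding ci dj by auto
  have gd': "good \<psi> T'" using r(1) by (simp add: reaches_def)
  interpret S': csurf "tris T'" eds src tgt \<psi> by (rule csurf_good[OF gd'])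
  have ab: "(src e = a \<and> tgt e = b) \<or> (src e = b \<and> tgt e = a)" using S(6) by (auto simp: ends_def doubleton_eq_iff)
  have cd: "c \<noteq> d" using col by blast
  note fl = r(2)[unfolded flipped_def]
  \<comment> \<open>\<open>flipped\<close> names the new triangles after the source and target of
    \<open>e\<close>, so \<open>C\<close> and \<open>D\<close> trade places when \<open>e\<close>
    runs from \<open>b\<close> to \<open>a\<close>.\<close>
  from ab show ?thesis
  proof
    assume "src e = a \<and> tgt e = b"
    then have "flip \<psi> T T' A B C D e f a b c d"
      by unfold_locales (use fl S v dA dB cd in \<open>auto simp: ends_def\<close>)
    then show ?thesis using r by blast
  next
    assume "src e = b \<and> tgt e = a"
    then have "flip \<psi> T T' A B D C e f a b c d"
      by unfold_locales (use fl S v dA dB cd in \<open>auto simp: ends_def\<close>)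
    then show ?thesis using r by blast
  qed
qed

text \<open>For \<open>k = False\<close> the new edge has to run from \<open>d\<close> to
  \<open>c\<close>, which is the forward case with the two triangles exchanged.\<close>

lemma flip_directed:
  assumes gd: "good \<psi> T" and h: "thinge T A B e a b c d" and col: "\<psi> c \<noteq> \<psi> d"
    and ok: "\<And>x. x \<in> {a, b} \<Longrightarrow> tarr k A x c \<Longrightarrow> tarr k B x d"
  shows "\<exists>T' C D f. reaches \<psi> T T' \<and> flip \<psi> T T' A B C D e f a b c d \<and> tarr k C c d"
proof (cases k)
  case True
  have "\<exists>T' C D f. reaches \<psi> T T' \<and> flip \<psi> T T' A B C D e f a b c d \<and> src f = c"
    by (rule flip_forward[OF gd h col]) (use ok True in simp)
  then obtain T' C D f where x: "reaches \<psi> T T'" "flip \<psi> T T' A B C D e f a b c d" "src f = c"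
    by blast
  moreover have "tarr k C c d" using csurf_flip.arr_f(1)[OF x(2), of k] x(3) True by simp
  ultimately show ?thesis by blast
next
  case False
  interpret csurf "tris T" eds src tgt \<psi> by (rule csurf_good[OF gd])
  have S: "A \<in> tris T" "B \<in> tris T" and v: "verts A = {a, b, c}" "verts B = {a, b, d}"
    using h by (auto simp: hinge_def)
  note dA = three_distinct[OF S(1) v(1)] and dB = three_distinct[OF S(2) v(2)]
  have "arr True A x c" if x: "x \<in> {a, b}" "arr True B x d" for x
  proof (rule ccontr)
    assume "\<not> arr True A x c"
    then have "arr False A x c" using arr_linear(1)[OF S(1), of x c True] x(1) dA v(1) by (auto simp: arr_def)
    then have "arr False B x d" using ok x(1) False by simp
    then show False using x(2) arrow_linear(2)[OF S(2)] by (auto simp: arr_def)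
  qed
  then have "\<exists>T' C D f. reaches \<psi> T T' \<and> flip \<psi> T T' B A C D e f a b d c \<and> src f = d"
    by (intro flip_forward[OF gd hinge_swap(1)[OF h] not_sym[OF col]])
  then obtain T' C D f where x: "reaches \<psi> T T'" "flip \<psi> T T' B A C D e f a b d c" "src f = d"
    by blast
  have fl: "flip \<psi> T T' A B C D e f a b c d" by (rule csurf_flip.swap_triangles[OF x(2)])
  moreover have "tarr k C c d" using csurf_flip.arr_f(1)[OF fl, of k] x(3) False by simp
  ultimately show ?thesis using x(1) by blast
qed

lemma flip_exists:
  assumes gd: "good \<psi> T" and h: "thinge T A B e a b c d" and col: "\<psi> c \<noteq> \<psi> d"
  shows "\<exists>T' C D f. reaches \<psi> T T' \<and> flip \<psi> T T' A B C D e f a b c d"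
proof -
  interpret csurf "tris T" eds src tgt \<psi> by (rule csurf_good[OF gd])
  obtain k where "\<forall>x\<in>{a, b}. arr k A x c \<longrightarrow> arr k B x d" using hinge_orient[OF h] by blast
  then show ?thesis using flip_directed[OF gd h col, of k] by blast
qed

text \<open>Only an end \<open>a\<close> of the flipped edge is critical. If \<open>a\<close> lies
  between \<open>c\<close> and \<open>d\<close> in the orders, \<open>W_a_mixed\<close> applies.
  Otherwise \<open>W_avoid\<close> gives a local source or sink at a spoke other than
  \<open>e\<close>; if this spoke lies in \<open>A\<close> or \<open>B\<close>, the new edge can be
  directed so as to preserve it, and if not, the flip does not affect it.\<close>

lemma flip_keeping_W:
  assumes gd: "good \<psi> T" and h: "thinge T A B e a b c d" and col: "\<psi> c \<noteq> \<psi> d"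
  shows "\<exists>T' C D f. reaches \<psi> T T' \<and> flip \<psi> T T' A B C D e f a b c d \<and> (WT T v \<longrightarrow> WT T' v)"
proof -
  interpret csurf "tris T" eds src tgt \<psi> by (rule csurf_good[OF gd])
  have near: "\<exists>T' C D f. reaches \<psi> T T' \<and> flip \<psi> T T' A B C D e f a b c d \<and> WT T' a"
    if h: "hinge A B e a b c d" and col: "\<psi> c \<noteq> \<psi> d" and nm: "\<And>k. arr k A a c \<Longrightarrow> arr k B a d"
      and g: "g \<in> eds A" "a \<in> ends g" "g \<noteq> e" "\<forall>\<sigma>\<in>tris T. g \<in> eds \<sigma> \<longrightarrow> spoke k a \<sigma> = g" for E A B a b c d g k
  proof -
    have S: "A \<in> tris T" "B \<in> tris T" "e \<in> eds A" "ends e = {a, b}" and v: "verts A = {a, b, c}"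
      using h by (auto simp: hinge_def)
    note dA = three_distinct[OF S(1) v]
    obtain ab ac bc where x: "eds A = {ab, ac, bc}" "ends ab = {a, b}" "ends ac = {a, c}" "ends bc = {b, c}"
      by (rule tri_edges[OF S(1) v dA])
    have "ab = e" using edge_unique[OF S(1), of ab e] x S by simp
    then have gac: "g = ac" using g(1-3) x dA by auto
    have "spoke k a A = g" using g(1,4) S(1) by blast
    then have cb: "arr k A c b"
      using spoke_iff[OF S(1), of a c b g k] v dA g(1) gac x(3) by (simp add: insert_commute)
    \<comment> \<open>As \<open>c\<close> precedes \<open>b\<close>, only \<open>a\<close> can be a
      predecessor of \<open>c\<close>, and \<open>nm\<close> turns it into a predecessor of
      \<open>d\<close>.\<close>
    have ok: "arr k B x d" if "x \<in> {a, b}" "arr k A x c" for x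
      using that nm[of k] arr_linear(2)[OF S(1) cb] by auto
    obtain T' C D f where fl: "reaches \<psi> T T'" "flip \<psi> T T' A B C D e f a b c d" "arr k C c d"
      using flip_directed[OF gd h col ok] by blast
    have "WT T' a" using csurf_flip.W_a_near[OF fl(2) g(1) _ g(4) fl(3)] gac x(3) by simp
    then show ?thesis using fl by blast
  qed
  have main: "\<exists>T' C D f. reaches \<psi> T T' \<and> flip \<psi> T T' A B C D e f a b c d \<and> WT T' a"
    if h: "hinge A B e a b c d" and W: "WT T a" for a b
  proof -
    have S: "A \<in> tris T" "B \<in> tris T" and v: "verts A = {a, b, c}" "verts B = {a, b, d}"
      using h by (auto simp: hinge_def)
    note dA = three_distinct[OF S(1) v(1)] and dB = three_distinct[OF S(2) v(2)]
    have rev: "arr k A c a \<longleftrightarrow> \<not> arr k A a c" "arr k B d a \<longleftrightarrow> \<not> arr k B a d" for k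
      using arr_linear(1)[OF S(1), of a c k] arr_linear(2)[OF S(1), of k a c]
        arr_linear(1)[OF S(2), of a d k] arr_linear(2)[OF S(2), of k a d] v dA dB by auto
    obtain T1 C D f where fl: "reaches \<psi> T T1" "flip \<psi> T T1 A B C D e f a b c d"
      using flip_exists[OF gd h col] by blast
    show ?thesis
    proof (cases "\<exists>k. arr k A c a \<and> arr k B a d")
      case True
      then have "WT T1 a" using csurf_flip.W_a_mixed[OF fl(2)] by blast
      then show ?thesis using fl by blast
    next
      case False
      then have nm: "arr k A a c \<Longrightarrow> arr k B a d" "arr k B a d \<Longrightarrow> arr k A a c" for k
        using rev[of k] rev[of "\<not> k"] by (auto simp: arr_def)
      obtain k g where g: "g \<in> Sp a" "g \<noteq> e" "\<forall>\<sigma>\<in>tris T. g \<in> eds \<sigma> \<longrightarrow> spoke k a \<sigma> = g"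
        using W_avoid[OF W, of e] by blast
      have ag: "a \<in> ends g" using g(1) by (simp add: Sp_def)
      consider "g \<in> eds A" | "g \<in> eds B" | "g \<notin> eds A" "g \<notin> eds B" by blast
      then show ?thesis
      proof cases
        case 1
        then show ?thesis using near[OF h col nm(1) _ ag g(2,3)] by blast
      next
        case 2
        then obtain T' C D f where fl': "reaches \<psi> T T'" "flip \<psi> T T' B A C D e f a b d c" "WT T' a"
          using near[OF hinge_swap(1)[OF h] not_sym[OF col] nm(2) _ ag g(2,3)] by blast
        have "flip \<psi> T T' A B C D e f a b c d" by (rule csurf_flip.swap_triangles[OF fl'(2)])
        then show ?thesis using fl' by blast
      next
        case 3
        have "WT T1 a" using csurf_flip.W_a_far[OF fl(2) g(1), of k] g(3) 3 by blast
        then show ?thesis using fl by blast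
      qed
    qed
  qed
  obtain T1 C1 D1 f1 where fl: "reaches \<psi> T T1" "flip \<psi> T T1 A B C1 D1 e f1 a b c d"
    using flip_exists[OF gd h col] by blast
  consider "\<not> WT T v" | "WT T v" "v = a" | "WT T v" "v = b" | "WT T v" "v \<notin> {a, b}" by blast
  then show ?thesis
  proof cases
    case 1
    then show ?thesis using fl by blast
  next
    case 2
    then show ?thesis using main[OF h] by blast
  next
    case 3
    then obtain T' C D f where fl': "reaches \<psi> T T'" "flip \<psi> T T' A B C D e f b a c d" "WT T' b"
      using main[OF hinge_swap(2)[OF h]] by blast
    have "flip \<psi> T T' A B D C e f a b c d" by (rule csurf_flip.swap_ends[OF fl'(2)])
    then show ?thesis using fl' 3 by blast
  next
    case 4
    then have "WT T1 v" using csurf_flip.W_off_edge[OF fl(2)] by blast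
    then show ?thesis using fl by blast
  qed
qed

section \<open>Bringing a color close to a vertex\<close>

context csurf
begin

text \<open>Balls in the dual graph around the star of \<open>v\<close>; by \<open>dual_conn\<close>
  they exhaust the surface.\<close>

primrec near :: "'v \<Rightarrow> nat \<Rightarrow> 't set" where
  "near v 0 = Star v"
| "near v (Suc n) = {\<sigma> \<in> S. \<exists>\<tau>\<in>near v n. E \<sigma> \<inter> E \<tau> \<noteq> {}}"

lemma near_S: "near v n \<subseteq> S"
  by (cases n) (auto simp: Star_def)

lemma near_all:
  assumes "Star v \<noteq> {}" "\<sigma> \<in> S"
  obtains n where "\<sigma> \<in> near v n"
proof -
  have "(\<Union>n. near v n) = S"
  proof (rule dual_conn)
    show "(\<Union>n. near v n) \<subseteq> S" using near_S by blast
    have "near v 0 \<noteq> {}" using assms(1) by simp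
    then show "(\<Union>n. near v n) \<noteq> {}" by blast
    fix \<sigma> \<tau> e assume a: "\<sigma> \<in> (\<Union>n. near v n)" "\<tau> \<in> S" "e \<in> E \<sigma>" "e \<in> E \<tau>"
    then obtain n where "\<sigma> \<in> near v n" by blast
    then have "\<tau> \<in> near v (Suc n)" using a by auto
    then show "\<tau> \<in> (\<Union>n. near v n)" by blast
  qed
  then show ?thesis using that assms(2) by blast
qed

end

text \<open>Consider the first ball with a triangle \<open>\<sigma>\<close> that has a vertex of
  color \<open>q\<close> other than \<open>v\<close>, entered from \<open>A\<close> through
  \<open>e\<close>. If \<open>A\<close> is at \<open>v\<close>, the two triangles form the desired
  hinge. Otherwise the third vertex of \<open>A\<close> does not have color \<open>q\<close>, so
  \<open>e\<close> can be flipped. Both new triangles contain the vertex of color \<open>q\<close>,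
  and one of them shares an edge with the ball preceding \<open>A\<close>, so the distance
  drops.\<close>

lemma bring_step:
  assumes gd: "good \<psi> T"
    and noq: "\<forall>\<sigma>\<in>star T v. \<forall>w\<in>tverts \<sigma>. \<psi> w = q \<longrightarrow> w = v"
    and IH: "\<And>m T \<sigma> w. m < n \<Longrightarrow> good \<psi> T \<Longrightarrow> \<forall>\<sigma>\<in>star T v. \<forall>w\<in>tverts \<sigma>. \<psi> w = q \<longrightarrow> w = v \<Longrightarrow>
      \<sigma> \<in> csurf.near (tris T) eds src tgt v m \<Longrightarrow> w \<in> tverts \<sigma> \<Longrightarrow> \<psi> w = q \<Longrightarrow> w \<noteq> v \<Longrightarrow>
      \<exists>T' A B e a b w. reaches \<psi> T T' \<and> star T' v = star T v \<and> thinge T' A B e a b v w \<and> \<psi> w = q \<and> w \<noteq> v"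
    and \<sigma>: "\<sigma> \<in> csurf.near (tris T) eds src tgt v n" "w \<in> tverts \<sigma>" "\<psi> w = q" "w \<noteq> v"
  shows "\<exists>T' A B e a b w. reaches \<psi> T T' \<and> star T' v = star T v \<and> thinge T' A B e a b v w \<and> \<psi> w = q \<and> w \<noteq> v"
proof -
  interpret csurf "tris T" eds src tgt \<psi> by (rule csurf_good[OF gd])
  define Q where "Q \<rho> \<longleftrightarrow> (\<exists>w\<in>verts \<rho>. \<psi> w = q \<and> w \<noteq> v)" for \<rho>
  have Q\<sigma>: "Q \<sigma>" using \<sigma> unfolding Q_def by blast
  show ?thesis
  proof (cases "\<exists>j<n. \<exists>\<rho>\<in>near v j. Q \<rho>")
    case True
    then obtain j \<rho> w' where "j < n" "\<rho> \<in> near v j" "w' \<in> verts \<rho>" "\<psi> w' = q" "w' \<noteq> v" unfolding Q_def by blast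
    from IH[OF this(1) gd noq this(2-5)] show ?thesis .
  next
    case False
    then have min: "\<not> Q \<rho>" if "\<rho> \<in> near v j" "j < n" for \<rho> j using that by blast
    have notStar: "\<rho> \<notin> Star v" if "Q \<rho>" for \<rho> using that noq unfolding Q_def by blast
    have qS: "Q \<rho>" if "\<rho> \<in> tris T" "\<rho> \<notin> Star v" "x \<in> verts \<rho>" "\<psi> x = q" for \<rho> x
      using that unfolding Q_def Star_def by blast
    have "n \<noteq> 0" using notStar[OF Q\<sigma>] \<sigma>(1) by (metis near.simps(1))
    then obtain m where m: "n = Suc m" using not0_implies_Suc by blast
    obtain A e where A: "\<sigma> \<in> tris T" "A \<in> near v m" "e \<in> eds \<sigma>" "e \<in> eds A" using \<sigma>(1) unfolding m by auto
    have AT: "A \<in> tris T" using near_S A(2) by blast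
    have nQA: "\<not> Q A" using min A(2) m by blast
    then have A\<sigma>: "A \<noteq> \<sigma>" using Q\<sigma> by blast
    obtain c d where h: "hinge A \<sigma> e (src e) (tgt e) c d"
      by (rule hingeI[OF AT A(1) A\<sigma> A(4,3)]) (simp add: ends_def)
    let ?a = "src e" and ?b = "tgt e"
    have vA: "verts A = {?a, ?b, c}" and v\<sigma>: "verts \<sigma> = {?a, ?b, d}" using h by (auto simp: hinge_def)
    note dA = three_distinct[OF AT vA] and d\<sigma> = three_distinct[OF A(1) v\<sigma>]
    have wd: "w = d" using nQA \<sigma> vA v\<sigma> unfolding Q_def by blast
    show ?thesis
    proof (cases m)
      case 0
      then have "A \<in> Star v" using A(2) by simp
      then have "v \<in> verts A" by (simp add: Star_def)
      moreover have "v \<noteq> ?a" "v \<noteq> ?b" using notStar[OF Q\<sigma>] A(1) v\<sigma> unfolding Star_def by blast+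
      ultimately have "c = v" using vA by blast
      then show ?thesis using h reaches_refl[OF gd] wd \<sigma>(3,4) by blast
    next
      case (Suc l)
      have AS: "A \<notin> Star v"
      proof
        assume "A \<in> Star v"
        then have "\<sigma> \<in> near v (Suc 0)" using A by auto
        then show False using min[of \<sigma> "Suc 0"] Q\<sigma> m Suc by simp
      qed
      have cq: "\<psi> c \<noteq> \<psi> d" using qS[OF AT AS, of c] nQA vA wd \<sigma>(3) by blast
      obtain \<tau> g where \<tau>: "\<tau> \<in> near v l" "g \<in> eds A" "g \<in> eds \<tau>" using A(2) unfolding Suc by auto
      \<comment> \<open>Neither \<open>A\<close> nor \<open>\<sigma>\<close> lies in the smaller
        balls, since \<open>\<sigma>\<close> would then have been reached earlier. So these balls
        survive the flip.\<close>
      have avoid: "\<rho> \<noteq> A \<and> \<rho> \<noteq> \<sigma>" if "\<rho> \<in> near v j" "j \<le> l" for \<rho> j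
      proof
        show "\<rho> \<noteq> \<sigma>" using min[of \<rho> j] that m Suc Q\<sigma> by auto
        show "\<rho> \<noteq> A"
        proof
          assume "\<rho> = A"
          then have "\<sigma> \<in> near v (Suc j)" using A that(1) by auto
          then show False using min[of \<sigma> "Suc j"] Q\<sigma> that(2) m Suc by simp
        qed
      qed
      obtain T' C D f where fl: "reaches \<psi> T T'" "flip \<psi> T T' A \<sigma> C D e f ?a ?b c d"
        using flip_exists[OF gd h cq] by blast
      interpret F: csurf_flip "tris T" "tris T'" eds src tgt \<psi> A \<sigma> C D e f ?a ?b c d by (rule fl(2))
      have gd': "good \<psi> T'" using fl(1) by (simp add: reaches_def)
      have vn: "v \<notin> {?a, ?b, c, d}" using notStar[OF Q\<sigma>] AS A(1) AT vA v\<sigma> unfolding Star_def by blast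
      have St: "star T' v = star T v" by (rule F.Star_other[OF vn])
      have near': "\<rho> \<in> F.S'.near v j" if "\<rho> \<in> near v j" "j \<le> l" for \<rho> j
        using that
      proof (induction j arbitrary: \<rho>)
        case 0
        then show ?case using St by simp
      next
        case (Suc j)
        then obtain \<rho>' where \<rho>': "\<rho> \<in> tris T" "\<rho>' \<in> near v j" "eds \<rho> \<inter> eds \<rho>' \<noteq> {}" by auto
        have "\<rho>' \<in> F.S'.near v j" using Suc.IH[OF \<rho>'(2)] Suc.prems(2) by simp
        moreover have "\<rho> \<in> tris T'" using avoid[OF Suc.prems] \<rho>'(1) F.in_S' by blast
        ultimately show ?case using \<rho>'(3) by auto
      qed
      have "g \<noteq> e" using F.inc_e[of \<tau>] \<tau>(1,3) avoid[OF \<tau>(1)] near_S by blast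
      obtain ac bc ad bd where x: "eds A = {e, ac, bc}" "eds C = {f, ac, ad}" "eds D = {f, bc, bd}" by (rule F.edges) blast
      have "g \<in> eds C \<or> g \<in> eds D" using \<tau>(2) \<open>g \<noteq> e\<close> x by blast
      then obtain X where X: "X = C \<or> X = D" "g \<in> eds X" by blast
      have "\<tau> \<in> F.S'.near v l" using near'[OF \<tau>(1)] by simp
      then have Xn: "X \<in> F.S'.near v (Suc l)" using X F.CD_in \<tau>(3) by auto
      have Xd: "d \<in> verts X" using X(1) F.vC F.vD by blast
      have "\<exists>T'' A B e a b w. reaches \<psi> T' T'' \<and> star T'' v = star T' v \<and> thinge T'' A B e a b v w \<and> \<psi> w = q \<and> w \<noteq> v"
        by (rule IH[OF _ gd' _ Xn Xd]) (use m Suc St noq wd \<sigma>(3,4) in auto)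
      then show ?thesis using reaches_trans[OF fl(1)] St by metis
    qed
  qed
qed

text \<open>Flips along a shortest path in the dual graph bring a vertex of color \<open>q\<close> next to the star of \<open>v\<close>.\<close>

lemma bring_color:
  assumes "good \<psi> T"
    and "\<forall>\<sigma>\<in>star T v. \<forall>w\<in>tverts \<sigma>. \<psi> w = q \<longrightarrow> w = v"
    and "\<sigma> \<in> csurf.near (tris T) eds src tgt v n" "w \<in> tverts \<sigma>" "\<psi> w = q" "w \<noteq> v"
  shows "\<exists>T' A B e a b w. reaches \<psi> T T' \<and> star T' v = star T v \<and> thinge T' A B e a b v w \<and> \<psi> w = q \<and> w \<noteq> v"
proof -
  define goal where "goal T \<longleftrightarrow> (\<exists>T' A B e a b w. reaches \<psi> T T' \<and> star T' v = star T v \<and>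
    thinge T' A B e a b v w \<and> \<psi> w = q \<and> w \<noteq> v)" for T
  define apart where "apart T \<longleftrightarrow> (\<forall>\<sigma>\<in>star T v. \<forall>w\<in>tverts \<sigma>. \<psi> w = q \<longrightarrow> w = v)" for T
  define ball where "ball T = csurf.near (tris T) eds src tgt v" for T
  have "\<forall>T \<sigma> w. good \<psi> T \<longrightarrow> apart T \<longrightarrow> \<sigma> \<in> ball T n \<longrightarrow> w \<in> tverts \<sigma> \<longrightarrow> \<psi> w = q \<longrightarrow> w \<noteq> v \<longrightarrow> goal T"
  proof (induction n rule: less_induct)
    case (less n)
    have IH: "goal T" if "m < n" "good \<psi> T" "apart T" "\<sigma> \<in> ball T m" "w \<in> tverts \<sigma>" "\<psi> w = q" "w \<noteq> v" for m T \<sigma> w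
      using less that by blast
    show ?case
    proof (intro allI impI)
      fix T \<sigma> w assume gd: "good \<psi> T" and ap: "apart T" and \<sigma>: "\<sigma> \<in> ball T n" "w \<in> tverts \<sigma>" "\<psi> w = q" "w \<noteq> v"
      show "goal T" by (rule bring_step[OF gd ap[unfolded apart_def] IH[unfolded goal_def apart_def ball_def] \<sigma>[unfolded ball_def], folded goal_def])
    qed
  qed
  then show ?thesis using assms unfolding goal_def apart_def ball_def by blast
qed

section \<open>Colors seen from a vertex and its degree\<close>

context csurf
begin

definition scol :: "'v \<Rightarrow> 'c set" where
  "scol v = col ` (\<Union>\<sigma>\<in>Star v. verts \<sigma>)"

definition far :: "'v \<Rightarrow> 'e \<Rightarrow> 'v" where
  "far v g = (if src g = v then tgt g else src g)"

lemma far: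
  assumes "g \<in> Sp v"
  shows "ends g = {v, far v g}" "far v g \<noteq> v" "col (far v g) \<noteq> col v"
proof -
  obtain \<sigma> where "\<sigma> \<in> S" "g \<in> E \<sigma>" "v \<in> ends g" using assms by (auto simp: Sp_def)
  then show "ends g = {v, far v g}" "far v g \<noteq> v" "col (far v g) \<noteq> col v"
    using edge_ends[of \<sigma> g] by (auto simp: far_def ends_def)
qed

lemma far_eq: "g \<in> Sp v \<Longrightarrow> ends g = {v, u} \<Longrightarrow> far v g = u"
  using far[of g v] by (auto simp: doubleton_eq_iff)

lemma scol_far: "Star v \<noteq> {} \<Longrightarrow> scol v = insert (col v) ((\<lambda>g. col (far v g)) ` Sp v)"
proof
  show "scol v \<subseteq> insert (col v) ((\<lambda>g. col (far v g)) ` Sp v)"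
  proof
    fix x assume "x \<in> scol v"
    then obtain \<sigma> u where u: "\<sigma> \<in> S" "v \<in> verts \<sigma>" "u \<in> verts \<sigma>" "x = col u" unfolding scol_def Star_def by blast
    show "x \<in> insert (col v) ((\<lambda>g. col (far v g)) ` Sp v)"
    proof (cases "u = v")
      case False
      then obtain g where g: "g \<in> E \<sigma>" "ends g = {v, u}" using edge_between[OF u(1,2,3)] by blast
      then have "g \<in> Sp v" using u(1) by (auto simp: Sp_def)
      then show ?thesis using far_eq[of g v u] g u(4) by blast
    qed (use u in blast)
  qed
  assume "Star v \<noteq> {}"
  then show "insert (col v) ((\<lambda>g. col (far v g)) ` Sp v) \<subseteq> scol v"
  proof -
    have "col (far v g) \<in> scol v" if g: "g \<in> Sp v" for g
    proof -
      obtain \<sigma> where \<sigma>: "\<sigma> \<in> S" "g \<in> E \<sigma>" "v \<in> ends g" using g by (auto simp: Sp_def)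
      have "\<sigma> \<in> Star v" "far v g \<in> verts \<sigma>" using in_Star[OF \<sigma>] ends_verts[OF \<sigma>(2)] far(1)[OF g] by auto
      then show ?thesis unfolding scol_def by blast
    qed
    moreover have "col v \<in> scol v" using \<open>Star v \<noteq> {}\<close> unfolding scol_def Star_def by blast
    ultimately show ?thesis by blast
  qed
qed

lemma finite_scol: "finite (scol v)"
proof (cases "Star v = {}")
  case False
  then show ?thesis using scol_far finite_Sp by simp
qed (simp add: scol_def)

end

lemma bring:
  assumes gd: "good \<psi> T" and v: "v \<in> vertices T" and w: "w \<in> vertices T" "w \<noteq> v"
    and noq: "\<And>\<sigma> x. \<sigma> \<in> star T v \<Longrightarrow> x \<in> tverts \<sigma> \<Longrightarrow> \<psi> x = \<psi> w \<Longrightarrow> x = v"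
  obtains T' A B e a b w' where "reaches \<psi> T T'" "star T' v = star T v" "thinge T' A B e a b v w'"
    "\<psi> w' = \<psi> w" "w' \<noteq> v"
proof -
  interpret csurf "tris T" eds src tgt \<psi> by (rule csurf_good[OF gd])
  have "Star v \<noteq> {}" using v unfolding vertices_tris[OF gd] Star_def by blast
  moreover obtain \<sigma> where \<sigma>: "\<sigma> \<in> tris T" "w \<in> verts \<sigma>" using w(1) unfolding vertices_tris[OF gd] by blast
  ultimately obtain n where "\<sigma> \<in> near v n" using near_all by blast
  moreover have "\<forall>\<sigma>\<in>star T v. \<forall>x\<in>tverts \<sigma>. \<psi> x = \<psi> w \<longrightarrow> x = v" using noq by blast
  ultimately show ?thesis using bring_color[OF gd _ _ \<sigma>(2) refl w(2)] that by blast
qed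

lemma W_cong_Star:
  assumes "csurf S E src tgt col" "csurf S' E src tgt col" "csurf.Star S' E src tgt v = csurf.Star S E src tgt v"
  shows "csurf.W S' E src tgt v \<longleftrightarrow> csurf.W S E src tgt v"
  unfolding csurf.W_Star[OF assms(1)] csurf.W_Star[OF assms(2)] assms(3) ..

abbreviation "tscol T \<psi> \<equiv> csurf.scol (tris T) eds src tgt \<psi>"

lemma reaches_good: "reaches \<psi> T T' \<Longrightarrow> good \<psi> T'"
  by (simp add: reaches_def)

lemma scol_sub:
  assumes gd: "good \<psi> T" shows "tscol T \<psi> v \<subseteq> \<psi> ` vertices T"
proof -
  interpret csurf "tris T" eds src tgt \<psi> by (rule csurf_good[OF gd])
  show ?thesis unfolding scol_def vertices_tris[OF gd] Star_def by blast
qed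

text \<open>A triangle at \<open>v\<close> shows three colors, so at most one is missing. A vertex
  of this color is brought to the far side of a link edge \<open>a b\<close>, and flipping that edge
  joins it to \<open>v\<close>, while \<open>a\<close> and \<open>b\<close> remain neighbors of
  \<open>v\<close>.\<close>

lemma all_colors_at:
  assumes gd: "good \<psi> T" and C: "card C = 4" "\<psi> ` vertices T = C" and v: "v \<in> vertices T"
  obtains T' where "reaches \<psi> T T'" "WT T v \<longrightarrow> WT T' v" "tscol T' \<psi> v = C"
proof (cases "tscol T \<psi> v = C")
  case True
  then show ?thesis using that[OF reaches_refl[OF gd]] by blast
next
  case False
  interpret csurf "tris T" eds src tgt \<psi> by (rule csurf_good[OF gd])
  have "scol v \<subset> C" using scol_sub[OF gd, of v] C(2) False by blast
  then obtain w where w: "w \<in> vertices T" "\<psi> w \<notin> scol v" using C(2) by blast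
  have vs: "\<psi> v \<in> scol v" using v unfolding vertices_tris[OF gd] scol_def Star_def by blast
  have no: "x = v" if "\<sigma> \<in> star T v" "x \<in> tverts \<sigma>" "\<psi> x = \<psi> w" for \<sigma> x
  proof -
    have "\<psi> x \<in> scol v" unfolding scol_def using that(1,2) by blast
    then show ?thesis using w(2) that(3) by simp
  qed
  have "w \<noteq> v" using w(2) vs by blast
  then obtain T1 A B e a b w' where r: "reaches \<psi> T T1" "star T1 v = star T v" "thinge T1 A B e a b v w'"
    "\<psi> w' = \<psi> w" "w' \<noteq> v" by (rule bring[OF gd v w(1) _ no])
  have gd1: "good \<psi> T1" by (rule reaches_good[OF r(1)])
  interpret T1: csurf "tris T1" eds src tgt \<psi> by (rule csurf_good[OF gd1])
  have W1: "WT T1 v \<longleftrightarrow> WT T v" by (rule W_cong_Star[OF csurf_axioms T1.csurf_axioms r(2)])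
  have vw: "\<psi> v \<noteq> \<psi> w'" using r(4) w(2) vs by metis
  obtain T2 C' D f where fl: "reaches \<psi> T1 T2" "flip \<psi> T1 T2 A B C' D e f a b v w'" "WT T1 v \<longrightarrow> WT T2 v"
    using flip_keeping_W[OF gd1 r(3) vw] by blast
  interpret F: csurf_flip "tris T1" "tris T2" eds src tgt \<psi> A B C' D e f a b v w' by (rule fl(2))
  have gd2: "good \<psi> T2" by (rule reaches_good[OF fl(1)])
  have A: "A \<in> tris T1" "A \<in> star T v" using F.AB(1) F.vA r(2) unfolding T1.Star_def by auto
  have inC: "\<psi> ` {a, v, w', b} \<subseteq> F.S'.scol v"
    using F.Star_c F.vC F.vD unfolding F.S'.scol_def by auto
  have sc: "\<psi> a \<in> scol v" "\<psi> b \<in> scol v" using A(2) F.vA unfolding scol_def by blast+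
  have "\<psi> a \<noteq> \<psi> v" "\<psi> b \<noteq> \<psi> v" "\<psi> a \<noteq> \<psi> b"
    using T1.vert_colors[OF A(1)] F.vA F.dist by auto
  moreover have "\<psi> w' \<noteq> \<psi> a" "\<psi> w' \<noteq> \<psi> b" using sc w(2) r(4) by metis+
  ultimately have c4: "card (\<psi> ` {a, v, w', b}) = 4" using vw by simp
  have sC: "F.S'.scol v \<subseteq> C" using scol_sub[OF gd2, of v] C(2) fl(1) r(1) by (simp add: reaches_def)
  have "finite C" using C(1) by (metis card.infinite zero_neq_numeral)
  then have "\<psi> ` {a, v, w', b} = C" using card_subset_eq[OF _ subset_trans[OF inC sC]] c4 C(1) by simp
  then have "F.S'.scol v = C" using inC sC by blast
  then show ?thesis using that[OF reaches_trans[OF r(1) fl(1)]] W1 fl(3) by blast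
qed

context csurf
begin

lemma spoke_mem:
  assumes "A \<in> Star v" "x \<in> verts A" "x \<noteq> v"
  obtains g where "g \<in> Sp v" "g \<in> E A" "ends g = {v, x}" "far v g = x"
proof -
  have A: "A \<in> S" "v \<in> verts A" using assms(1) by (auto simp: Star_def)
  obtain g where g: "g \<in> E A" "ends g = {v, x}" using edge_between[OF A assms(2)] assms(3) by blast
  then have "g \<in> Sp v" using A by (auto simp: Sp_def)
  then show ?thesis using that[OF _ g] far_eq g by blast
qed

lemma spoke_hinge:
  assumes "g \<in> Sp v" "g \<in> E A" "A \<in> S"
  obtains B c d where "hinge A B g v (far v g) c d"
proof -
  obtain B where B: "B \<in> S" "g \<in> E B" "B \<noteq> A" using incident_pair[OF assms(2,3)] by metis
  show ?thesis using hingeI[OF assms(3) B(1) not_sym[OF B(3)] assms(2) B(2) far(1)[OF assms(1)]] that by blast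
qed

text \<open>
  Triangles at \<open>v\<close> whose common spoke joins them to vertices of different colors separate the types
  (pairs of colors) of link edges. If every such spoke had a color of its own, then following the
  link shows that all spokes do, so there are only three of them.
\<close>

lemma hinge_only:
  assumes h: "hinge A B e a b c d" and "\<sigma> \<in> S" "e \<in> E \<sigma>" shows "\<sigma> = A \<or> \<sigma> = B"
proof -
  have AB: "A \<in> S" "B \<in> S" "A \<noteq> B" "e \<in> E A" "e \<in> E B" using h by (auto simp: hinge_def)
  have "card {\<rho> \<in> S. e \<in> E \<rho>} = 2" using two AB(1,4) by blast
  moreover have "{A, B} \<subseteq> {\<rho> \<in> S. e \<in> E \<rho>}" using AB by blast
  ultimately have "{A, B} = {\<rho> \<in> S. e \<in> E \<rho>}"
    using AB(3) by (intro card_subset_eq) (use fin in auto)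
  then show ?thesis using assms by blast
qed

lemma rainbow_spoke:
  assumes c4: "card (scol v) = 4" and deg: "4 \<le> card (Star v)"
  shows "\<exists>g A B x z g'. hinge A B g v (far v g) x z \<and> col x \<noteq> col z \<and> g \<in> Sp v \<and>
    g' \<in> Sp v \<and> g' \<noteq> g \<and> col (far v g') = col (far v g)"
proof (rule ccontr)
  assume neg: "\<not> ?thesis"
  have uniq: "g' = g" if "hinge A B g v (far v g) x z" "col x \<noteq> col z" "g \<in> Sp v" "g' \<in> Sp v"
    "col (far v g') = col (far v g)" for g A B x z g'
    using neg that by blast
  have ne: "Star v \<noteq> {}" using deg by auto
  then obtain \<sigma>0 where \<sigma>0: "\<sigma>0 \<in> Star v" by blast
  \<comment> \<open>The triangles with the colors of \<open>\<sigma>0\<close>. As four colors occur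
    at \<open>v\<close>, they are not the whole star, so some spoke leads out of this class.\<close>
  define R where "R = {\<sigma> \<in> Star v. col ` verts \<sigma> = col ` verts \<sigma>0}"
  have "R \<noteq> Star v"
  proof
    assume "R = Star v"
    then have "scol v = col ` verts \<sigma>0" unfolding scol_def R_def using \<sigma>0 by blast
    moreover have "card (col ` verts \<sigma>0) \<le> 3"
      using card_image_le[of "verts \<sigma>0" col] card_verts[of \<sigma>0] \<sigma>0 by (simp add: Star_def card_ge_0_finite)
    ultimately show False using c4 by simp
  qed
  have RS: "R \<subseteq> {\<sigma> \<in> S. v \<in> (\<Union>e\<in>E \<sigma>. {src e, tgt e})}" unfolding R_def Star_def verts_def ends_def by blast
  have St: "Star v = {\<sigma> \<in> S. v \<in> (\<Union>e\<in>E \<sigma>. {src e, tgt e})}" unfolding Star_def verts_def ends_def ..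
  have "\<exists>A B e. A \<in> R \<and> B \<in> S \<and> e \<in> E A \<and> e \<in> E B \<and> v \<in> {src e, tgt e} \<and> B \<notin> R"
  proof (rule ccontr)
    assume "\<not> ?thesis"
    then have n: "B \<in> R" if "A \<in> R" "B \<in> S" "e \<in> E A" "e \<in> E B" "v \<in> {src e, tgt e}" for A B e using that by blast
    have "R = {\<sigma> \<in> S. v \<in> (\<Union>e\<in>E \<sigma>. {src e, tgt e})}"
    proof (intro star_conn[OF RS])
      show "R \<noteq> {}" using \<sigma>0 by (auto simp: R_def)
    qed (use n in blast)
    then show False using \<open>R \<noteq> Star v\<close> St by simp
  qed
  then obtain A B e where AB: "A \<in> R" "B \<in> S" "e \<in> E A" "e \<in> E B" "v \<in> ends e" "B \<notin> R"
    unfolding ends_def by blast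
  have S: "A \<in> S" "A \<in> Star v" "B \<in> Star v" "A \<noteq> B" "e \<in> Sp v"
    using AB in_Star[OF AB(2,4,5)] by (auto simp: R_def Star_def Sp_def)
  define y where "y = far v e"
  have "ends e = {v, y}" unfolding y_def by (rule far(1)[OF S(5)])
  from hingeI[OF S(1) AB(2) S(4) AB(3,4) this] obtain x z where h: "hinge A B e v y x z" .
  have vAB: "verts A = {v, y, x}" "verts B = {v, y, z}" using h by (auto simp: hinge_def)
  have xz: "col x \<noteq> col z"
  proof
    assume "col x = col z"
    then have "col ` verts A = col ` verts B" unfolding vAB by simp
    then show False using AB(1,6) S(3) by (simp add: R_def)
  qed
  have uy: "g' = e" if "g' \<in> Sp v" "col (far v g') = col y" for g'
    using uniq[of A B e x z g'] h xz S(5) that unfolding y_def by blast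
  \<comment> \<open>The spoke to \<open>x\<close> is again a hinge between different colors: if its
    next triangle had the color of \<open>y\<close>, it would contain \<open>e\<close>, the only
    spoke of that color, and would therefore be \<open>B\<close>, which does not contain
    \<open>x\<close>. So the color of \<open>x\<close> occurs on one spoke only.\<close>
  have side: "\<exists>h. \<forall>g'\<in>Sp v. col (far v g') = col x \<longrightarrow> g' = h"
    if h: "hinge A B e v y x z" and xz: "col x \<noteq> col z" for A B x z
  proof -
    have A: "A \<in> S" "B \<in> S" and v: "verts A = {v, y, x}" "verts B = {v, y, z}" using h by (auto simp: hinge_def)
    note dA = three_distinct[OF A(1) v(1)] and dB = three_distinct[OF A(2) v(2)]
    have As: "A \<in> Star v" using A v by (simp add: Star_def)
    obtain p where p: "p \<in> Sp v" "p \<in> E A" "ends p = {v, x}" "far v p = x"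
      by (rule spoke_mem[OF As, of x]) (use v dA in auto)
    obtain A2 c d where h2: "hinge A A2 p v (far v p) c d" by (rule spoke_hinge[OF p(1,2) A(1)])
    have v2: "verts A = {v, x, c}" "verts A2 = {v, x, d}" and A2: "A2 \<in> S" "A2 \<noteq> A"
      using h2 p(4) by (auto simp: hinge_def)
    have cy: "c = y" using v(1) v2(1) dA three_distinct[OF A(1) v2(1)] by auto
    have "col d \<noteq> col y"
    proof
      assume dy: "col d = col y"
      have "A2 \<in> Star v" using A2 v2 by (simp add: Star_def)
      then obtain g' where g': "g' \<in> Sp v" "g' \<in> E A2" "far v g' = d"
        using spoke_mem[of A2 v d] v2(2) three_distinct[OF A2(1) v2(2)] by blast
      then have "g' = e" using uy dy by simp
      then have "A2 = B" using hinge_only[OF h A2(1)] g'(2) A2(2) by blast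
      then have "x \<in> {v, y, z}" using v(2) v2(2) by blast
      then show False using dA xz by auto
    qed
    then have "\<forall>g'\<in>Sp v. col (far v g') = col x \<longrightarrow> g' = p"
      using uniq[OF h2 _ p(1)] cy p(4) by metis
    then show ?thesis by blast
  qed
  obtain hx where hx: "\<forall>g'\<in>Sp v. col (far v g') = col x \<longrightarrow> g' = hx" using side[OF h xz] by blast
  obtain hz where hz: "\<forall>g'\<in>Sp v. col (far v g') = col z \<longrightarrow> g' = hz"
    using side[OF hinge_swap(1)[OF h] not_sym[OF xz]] by blast
  have "col v \<noteq> col y" "col v \<noteq> col x" "col y \<noteq> col x" "col v \<noteq> col z" "col y \<noteq> col z"
    using vert_colors[OF S(1)] vert_colors[OF AB(2)] vAB three_distinct[OF S(1) vAB(1)] three_distinct[OF AB(2) vAB(2)] by auto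
  then have "card {col v, col y, col x, col z} = 4" using xz by simp
  moreover have "{col v, col y, col x, col z} \<subseteq> scol v" using S(2,3) vAB unfolding scol_def by blast
  ultimately have sc: "scol v = {col v, col y, col x, col z}" using c4 finite_scol by (metis card_subset_eq)
  \<comment> \<open>Every spoke leads to one of three colors, and each of these occurs on one spoke
    only.\<close>
  have "Sp v \<subseteq> {e, hx, hz}"
  proof
    fix g assume g: "g \<in> Sp v"
    then have "col (far v g) \<in> scol v" "col (far v g) \<noteq> col v" using scol_far[OF ne] far(3) by auto
    then show "g \<in> {e, hx, hz}" using sc uy hx hz g by auto
  qed
  then have "card (Sp v) \<le> card {e, hx, hz}" by (intro card_mono) auto
  also have "\<dots> \<le> 3" by (simp add: card_insert_if)
  finally show False using deg card_Sp[of v] by simp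
qed

end

text \<open>Flipping a spoke \<open>e\<close> replaces two triangles of the star by one. No color is
  lost, because the spoke \<open>g\<close> leads to the same color as \<open>e\<close>.\<close>

lemma lower_degree:
  assumes gd: "good \<psi> T" and c4: "card (tscol T \<psi> v) = 4" and deg: "4 \<le> card (star T v)"
  obtains T' where "reaches \<psi> T T'" "WT T v \<longrightarrow> WT T' v" "tscol T' \<psi> v = tscol T \<psi> v"
    "card (star T' v) < card (star T v)" "star T' v \<noteq> {}"
proof -
  interpret csurf "tris T" eds src tgt \<psi> by (rule csurf_good[OF gd])
  obtain e A B c d g where h: "hinge A B e v (far v e) c d" and cd: "\<psi> c \<noteq> \<psi> d" and e: "e \<in> Sp v"
    and g: "g \<in> Sp v" "g \<noteq> e" "\<psi> (far v g) = \<psi> (far v e)"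
    using rainbow_spoke[OF c4 deg] by blast
  obtain T' C D f where fl: "reaches \<psi> T T'" "flip \<psi> T T' A B C D e f v (far v e) c d" "WT T v \<longrightarrow> WT T' v"
    using flip_keeping_W[OF gd h cd] by blast
  interpret F: csurf_flip "tris T" "tris T'" eds src tgt \<psi> A B C D e f v "far v e" c d by (rule fl(2))
  have St: "star T' v = star T v - {A, B} \<union> {C}" by (rule F.Star_a)
  have AB: "A \<in> Star v" "B \<in> Star v" using F.AB_Star by auto
  have ne: "Star v \<noteq> {}" "star T' v \<noteq> {}" using AB St by auto
  have far_in: "far v p \<in> (\<Union>\<sigma>\<in>star T' v. verts \<sigma>)" if p: "p \<in> Sp v" "p \<noteq> e" for p
  proof -
    obtain \<sigma> where \<sigma>: "\<sigma> \<in> tris T" "p \<in> eds \<sigma>" "v \<in> ends p" using p by (auto simp: Sp_def)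
    have "far v p \<in> verts \<sigma>" using far(1)[OF p(1)] ends_verts[OF \<sigma>(2)] by blast
    show ?thesis
    proof (cases "\<sigma> = A \<or> \<sigma> = B")
      case False
      then have "\<sigma> \<in> star T' v" using St in_Star[OF \<sigma>] by blast
      then show ?thesis using \<open>far v p \<in> verts \<sigma>\<close> by blast
    next
      case True
      have "far v p \<noteq> far v e"
      proof
        assume "far v p = far v e"
        then have "ends p = ends e" using far(1)[OF p(1)] far(1)[OF e] by simp
        moreover have "e \<in> eds \<sigma>" using True F.AB by blast
        ultimately show False using edge_unique[OF \<sigma>(1,2)] p(2) by blast
      qed
      then have "far v p \<in> {c, d}" using True \<open>far v p \<in> verts \<sigma>\<close> F.vA F.vB far(2)[OF p(1)] by blast
      then show ?thesis using St F.vC by blast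
    qed
  qed
  have "scol v \<subseteq> F.S'.scol v"
  proof
    fix k assume "k \<in> scol v"
    then consider "k = \<psi> v" | p where "p \<in> Sp v" "k = \<psi> (far v p)" using scol_far[OF ne(1)] by auto
    then show "k \<in> F.S'.scol v"
    proof cases
      case 1
      then show ?thesis using F.S'.scol_far[OF ne(2)] by blast
    next
      case (2 p)
      then have "\<exists>p. p \<in> Sp v \<and> p \<noteq> e \<and> k = \<psi> (far v p)" using g by (cases "p = e") auto
      then show ?thesis using far_in unfolding F.S'.scol_def by blast
    qed
  qed
  moreover have "F.S'.scol v \<subseteq> scol v"
  proof
    fix k assume "k \<in> F.S'.scol v"
    then obtain \<sigma> x where x: "\<sigma> \<in> star T' v" "x \<in> verts \<sigma>" "k = \<psi> x" unfolding F.S'.scol_def by blast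
    show "k \<in> scol v"
    proof (cases "\<sigma> = C")
      case True
      then have "x \<in> verts A \<or> x \<in> verts B" using x(2) F.vA F.vB F.vC by blast
      then show ?thesis using x(3) AB unfolding scol_def by blast
    next
      case False
      then show ?thesis using x St unfolding scol_def by blast
    qed
  qed
  ultimately have sc: "F.S'.scol v = scol v" by blast
  have CS: "C \<notin> Star v - {A, B}" using F.new(1) by (simp add: Star_def)
  have "card (star T' v) = Suc (card (Star v - {A, B}))" unfolding St using CS finite_Star by simp
  also have "card (Star v - {A, B}) = card (Star v) - 2" using AB F.AB(3) by (simp add: card_Diff_subset)
  finally have "card (star T' v) < card (star T v)" using deg by simp
  then show ?thesis using that[OF fl(1) _ sc _ ne(2)] fl(3) by blast
qed

text \<open>The descent cannot pass below three: seeing three further colors takes at least three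
  spokes.\<close>

lemma degree_three:
  assumes "good \<psi> T" and C: "card C = 4" "\<psi> ` vertices T = C" and v: "v \<in> vertices T"
  obtains T' where "reaches \<psi> T T'" "WT T v \<longrightarrow> WT T' v" "tscol T' \<psi> v = C" "card (star T' v) = 3"
proof -
  have "\<exists>T'. reaches \<psi> T T' \<and> (WT T v \<longrightarrow> WT T' v) \<and> tscol T' \<psi> v = C \<and> card (star T' v) = 3"
    if "good \<psi> T" "tscol T \<psi> v = C" "star T v \<noteq> {}" for T
    using that
  proof (induction "card (star T v)" arbitrary: T rule: less_induct)
    case less
    interpret csurf "tris T" eds src tgt \<psi> by (rule csurf_good[OF less.prems(1)])
    show ?case
    proof (cases "4 \<le> card (star T v)")
      case True
      obtain T1 where T1: "reaches \<psi> T T1" "WT T v \<longrightarrow> WT T1 v" "tscol T1 \<psi> v = tscol T \<psi> v"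
        "card (star T1 v) < card (star T v)" "star T1 v \<noteq> {}"
        using lower_degree[OF less.prems(1) _ True] less.prems(2) C(1) by metis
      have "tscol T1 \<psi> v = C" using T1(3) less.prems(2) by simp
      from less.hyps[OF T1(4) reaches_good[OF T1(1)] this T1(5)] show ?thesis
        using reaches_trans[OF T1(1)] T1(2) by blast
    next
      case False
      have "C = insert (\<psi> v) ((\<lambda>g. \<psi> (far v g)) ` Sp v)" using scol_far[OF less.prems(3)] less.prems(2) by simp
      then have "4 \<le> Suc (card ((\<lambda>g. \<psi> (far v g)) ` Sp v))"
        using C(1) finite_Sp[of v] by (simp add: card_insert_if split: if_splits)
      also have "\<dots> \<le> Suc (card (Star v))" using card_image_le[OF finite_Sp] card_Sp by (metis Suc_le_mono)
      finally have "card (star T v) = 3" using False by simp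
      then show ?thesis using reaches_refl less.prems by blast
    qed
  qed
  moreover obtain T1 where T1: "reaches \<psi> T T1" "WT T v \<longrightarrow> WT T1 v" "tscol T1 \<psi> v = C"
    by (rule all_colors_at[OF assms])
  moreover have "star T1 v \<noteq> {}"
  proof
    assume "star T1 v = {}"
    then have "tscol T1 \<psi> v = {}" using csurf.scol_def[OF csurf_good[OF reaches_good[OF T1(1)]]] by simp
    then show False using T1(3) C(1) by simp
  qed
  ultimately obtain T' where T': "reaches \<psi> T1 T'" "WT T1 v \<longrightarrow> WT T' v" "tscol T' \<psi> v = C" "card (star T' v) = 3"
    using reaches_good by blast
  then show ?thesis using that[OF reaches_trans[OF T1(1) T'(1)]] T1(2) by blast
qed

section \<open>Reduction to the boundary of a tetrahedron\<close>

lemma linear_labels: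
  assumes V: "card V = 4"
    and irr: "\<And>x y. x \<in> V \<Longrightarrow> y \<in> V \<Longrightarrow> r x y \<Longrightarrow> \<not> r y x"
    and tot: "\<And>x y. x \<in> V \<Longrightarrow> y \<in> V \<Longrightarrow> x \<noteq> y \<Longrightarrow> r x y \<or> r y x"
    and trans: "\<And>x y z. x \<in> V \<Longrightarrow> y \<in> V \<Longrightarrow> z \<in> V \<Longrightarrow> r x y \<Longrightarrow> r y z \<Longrightarrow> r x z"
  obtains p :: "nat \<Rightarrow> 'a" where "bij_betw p {..3} V" "\<And>k k'. k < k' \<Longrightarrow> k' \<le> 3 \<Longrightarrow> r (p k) (p k')"
proof -
  have fV: "finite V" using V by (metis card.infinite zero_neq_numeral)
  define rk where "rk x = card {y \<in> V. r y x}" for x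
  have mono: "rk x < rk y" if "x \<in> V" "y \<in> V" "r x y" for x y
  proof -
    have "{z \<in> V. r z x} \<subset> {z \<in> V. r z y}" using that trans irr by blast
    then show ?thesis unfolding rk_def using fV by (simp add: psubset_card_mono)
  qed
  have inj: "inj_on rk V" using mono tot by (intro inj_onI) (metis less_irrefl)
  have "rk x \<le> 3" if "x \<in> V" for x
  proof -
    have "{y \<in> V. r y x} \<subset> V" using that irr by blast
    then have "rk x < 4" unfolding rk_def using psubset_card_mono[OF fV] V by metis
    then show ?thesis by simp
  qed
  then have "rk ` V \<subseteq> {..3}" by auto
  then have "rk ` V = {..3}" using card_image[OF inj] V by (intro card_subset_eq) auto
  then have b: "bij_betw rk V {..3}" using inj by (simp add: bij_betw_def)
  define p where "p = inv_into V rk"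
  have bp: "bij_betw p {..3} V" unfolding p_def by (rule bij_betw_inv_into[OF b])
  have rp: "rk (p k) = k" "p k \<in> V" if "k \<le> 3" for k
    using bij_betw_inv_into_right[OF b, of k] bij_betwE[OF bp] that unfolding p_def by auto
  have "r (p k) (p k')" if "k < k'" "k' \<le> 3" for k k'
  proof -
    have k: "k \<le> 3" using that by simp
    have "p k \<noteq> p k'" using rp(1)[OF k] rp(1)[OF that(2)] that(1) by auto
    then have "r (p k) (p k') \<or> r (p k') (p k)" using tot rp(2) k that(2) by blast
    moreover have "\<not> r (p k') (p k)" using mono[OF rp(2)[OF that(2)] rp(2)[OF k]] rp(1)[OF k] rp(1)[OF that(2)] that(1) by auto
    ultimately show ?thesis by blast
  qed
  then show ?thesis using that bp by blast
qed

text \<open>Triangles \<open>F x\<close> opposite to \<open>x\<close>, in a set of four vertices that is linearly ordered by the edges.\<close>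

locale ordered_tetra =
  fixes \<psi> :: "real^3 \<Rightarrow> 'c" and T :: "(real^3) simplices" and V M :: "(real^3) set"
    and F :: "real^3 \<Rightarrow> (nat \<Rightarrow> real) \<Rightarrow> real^3" and p :: "nat \<Rightarrow> real^3"
  assumes gd: "good \<psi> T" and p: "bij_betw p {..3} V" and M: "M \<subseteq> V"
    and tri: "x \<in> M \<Longrightarrow> F x \<in> tris T"
    and arrows: "x \<in> M \<Longrightarrow> k < k' \<Longrightarrow> k' \<le> 3 \<Longrightarrow> p k \<noteq> x \<Longrightarrow> p k' \<noteq> x \<Longrightarrow> \<exists>e\<in>eds (F x). src e = p k \<and> tgt e = p k'"
    and shared: "x \<in> M \<Longrightarrow> y \<in> M \<Longrightarrow> x \<noteq> y \<Longrightarrow> \<exists>e\<in>eds (F x) \<inter> eds (F y). x \<notin> {src e, tgt e} \<and> y \<notin> {src e, tgt e}"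
begin

lemma p_inj: "inj_on p {..3}" using p by (simp add: bij_betw_def)

lemma p_eq: "i \<le> 3 \<Longrightarrow> k \<le> 3 \<Longrightarrow> p k = p i \<longleftrightarrow> k = i"
  using inj_on_eq_iff[OF p_inj, of k i] by simp

lemma facets: "p i \<in> M \<Longrightarrow> (2, F (p i)) \<in> T"
  using tri by simp

lemma corner: "p i \<in> M \<Longrightarrow> i \<le> 3 \<Longrightarrow> k \<le> 3 \<Longrightarrow> k \<noteq> i \<Longrightarrow> F (p i) (simplex_vertex (if k < i then k else k - 1)) = p k"
  by (rule corner_of_order[OF gd facets]) (use arrows p_eq in auto)

lemma glue:
  assumes "p i \<in> M" "p j \<in> M" "i < j" "j \<le> 3"
  shows "cell ({..2} - {j - 1}) (F (p i)) = cell ({..2} - {i}) (F (p j))"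
proof -
  have "p i \<noteq> p j" using p_eq assms(3,4) by auto
  then obtain e where e: "e \<in> eds (F (p i))" "e \<in> eds (F (p j))" "p i \<notin> {src e, tgt e}" "p j \<notin> {src e, tgt e}"
    using shared[OF assms(1,2)] by blast
  show ?thesis
    by (rule glued_of_shared[OF gd facets[OF assms(1)] facets[OF assms(2)] assms(3,4) _ _ e(1,2,4,3)])
      (use corner[OF assms(1), of j] corner[OF assms(2), of i] assms(3,4) in auto)
qed

lemma remove:
  assumes l: "M = V - {l}" "l \<in> V" and col: "inj_on \<psi> V" and st: "\<And>\<sigma>. \<sigma> \<in> star T l \<Longrightarrow> \<sigma> \<in> F ` M"
  shows "\<exists>T'. good \<psi> T' \<and> vertices T' = vertices T - {l} \<and> (fillable T' \<psi> \<longrightarrow> fillable T \<psi>)"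
proof -
  have im: "p ` {..3} = V" using p by (simp add: bij_betw_def)
  then obtain i where i: "i \<le> 3" "p i = l" using l(2) by (metis (no_types, lifting) atMost_iff imageE)
  have pM: "p k \<in> M \<longleftrightarrow> k \<noteq> i" if "k \<le> 3" for k using that im i p_eq[OF i(1) that] l(1) by auto
  have M': "(\<lambda>k. F (p k)) ` ({..3} - {i}) = F ` M"
  proof -
    have "p ` ({..3} - {i}) = M" using inj_on_image_set_diff[OF p_inj, of "{..3}" "{i}"] i im l(1) by simp
    then show ?thesis by (metis image_image)
  qed
  have *: "\<exists>T'. good \<psi> T' \<and> vertices T' = vertices T - {p i} \<and> (fillable T' \<psi> \<longrightarrow> fillable T \<psi>)"
  proof (rule geometric_removal[OF gd, of "{..3} - {i}" i "\<lambda>k. F (p k)" p])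
    show "{..3} - {i} \<union> {i} = {..3}" using i by auto
    show "(2, F (p k)) \<in> T" if "k \<in> {..3} - {i}" for k using facets pM that by auto
    show "cell ({..2} - {j - 1}) (F (p k)) = cell ({..2} - {k}) (F (p j))"
      if "k \<in> {..3} - {i}" "j \<in> {..3} - {i}" "k < j" for k j by (rule glue) (use that pM in auto)
    show "F (p j) (simplex_vertex (if k < j then k else k - 1)) = p k"
      if "j \<in> {..3} - {i}" "k \<le> 3" "k \<noteq> j" for j k by (rule corner) (use that pM in auto)
    show "inj_on (\<psi> \<circ> p) {..3}" using comp_inj_on[OF p_inj] col im by metis
    show "\<sigma> \<in> (\<lambda>k. F (p k)) ` ({..3} - {i})" if "\<sigma> \<in> tris T" "p i \<in> corners 2 \<sigma>" for \<sigma>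
      unfolding M' using st[of \<sigma>] that i(2) tverts_corners[OF gd] csurf.Star_def[OF csurf_good[OF gd]] by blast
  qed simp
  then show ?thesis using i(2) by simp
qed

lemma fill:
  assumes "M = V" "tris T \<subseteq> F ` V" shows "fillable T \<psi>"
proof -
  have im: "p ` {..3} = V" using p by (simp add: bij_betw_def)
  have pM: "p k \<in> M" if "k \<le> 3" for k using that im assms(1) by auto
  show ?thesis
  proof (rule geometric_fill[OF gd, of "\<lambda>k. F (p k)" p])
    show "(2, F (p k)) \<in> T" if "k \<le> 3" for k using facets pM that by auto
    show "cell ({..2} - {j - 1}) (F (p k)) = cell ({..2} - {k}) (F (p j))"
      if "k < j" "j \<le> 3" for k j by (rule glue) (use that pM in auto)
    show "F (p j) (simplex_vertex (if k < j then k else k - 1)) = p k"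
      if "j \<le> 3" "k \<le> 3" "k \<noteq> j" for j k by (rule corner) (use that pM in auto)
    show "inj_on p {..3}" by (rule p_inj)
    show "tris T \<subseteq> (\<lambda>k. F (p k)) ` {..3}" using assms(2) im by (metis image_image)
  qed
qed

end

section \<open>Vertices of degree three\<close>

context csurf
begin

text \<open>Three spokes have to reach the three other colors, so their far ends are distinct, and
  each triangle at \<open>v\<close> omits exactly one of these ends.\<close>

lemma degree_three_link:
  assumes deg: "card (Star v) = 3" and c4: "card (scol v) = 4"
  obtains G V where "V = insert v (far v ` Sp v)" "card V = 4" "inj_on col V" "inj_on (far v) (Sp v)"
    "\<And>x. x \<in> V - {v} \<Longrightarrow> G x \<in> Star v \<and> verts (G x) = V - {x}" "Star v = G ` (V - {v})"
proof -
  have ne: "Star v \<noteq> {}" using deg by auto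
  have sc: "scol v = insert (col v) (col ` far v ` Sp v)" using scol_far[OF ne] by (simp add: image_image)
  define N where "N = far v ` Sp v"
  have fN: "finite N" using finite_Sp by (simp add: N_def)
  have cN: "card N \<le> 3" using card_image_le[OF finite_Sp] card_Sp deg by (metis N_def)
  have "4 \<le> Suc (card (col ` N))" using c4 fN unfolding sc N_def[symmetric] by (simp add: card_insert_if split: if_splits)
  then have cN3: "card N = 3" and ccN: "card (col ` N) = 3" using cN card_image_le[OF fN, of col] by linarith+
  have iN: "inj_on col N" using cN3 ccN fN eq_card_imp_inj_on by metis
  have iF: "inj_on (far v) (Sp v)" using cN3 card_Sp[of v] deg finite_Sp eq_card_imp_inj_on unfolding N_def by metis
  have vN: "v \<notin> N" "col v \<notin> col ` N" using far(2,3) unfolding N_def by force+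
  define V where "V = insert v N"
  have cV: "card V = 4" using vN cN3 fN by (simp add: V_def)
  have iV: "inj_on col V" using iN vN by (simp add: V_def)
  have vsub: "verts \<sigma> \<subseteq> V" if st: "\<sigma> \<in> Star v" for \<sigma>
  proof
    fix x assume x: "x \<in> verts \<sigma>"
    show "x \<in> V"
    proof (cases "x = v")
      case False
      then obtain g where "g \<in> Sp v" "far v g = x" using spoke_mem[OF st x] by blast
      then show ?thesis by (auto simp: V_def N_def)
    qed (simp add: V_def)
  qed
  \<comment> \<open>A spoke lies in only two of the three triangles at \<open>v\<close>.\<close>
  have miss: "\<exists>\<sigma>\<in>Star v. verts \<sigma> = V - {x}" if x: "x \<in> N" for x
  proof -
    obtain g where g: "g \<in> Sp v" "far v g = x" using x by (auto simp: N_def)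
    obtain \<sigma>0 where s0: "\<sigma>0 \<in> S" "g \<in> E \<sigma>0" "v \<in> ends g" using g(1) by (auto simp: Sp_def)
    have "card {\<sigma> \<in> S. g \<in> E \<sigma>} = 2" using two s0 by blast
    moreover have "{\<sigma> \<in> Star v. g \<in> E \<sigma>} = {\<sigma> \<in> S. g \<in> E \<sigma>}" using in_Star[OF _ _ s0(3)] by (auto simp: Star_def)
    ultimately have "{\<sigma> \<in> Star v. g \<in> E \<sigma>} \<noteq> Star v" using deg by auto
    then obtain \<sigma> where \<sigma>: "\<sigma> \<in> Star v" "g \<notin> E \<sigma>" by blast
    have xn: "x \<notin> verts \<sigma>"
    proof
      assume "x \<in> verts \<sigma>"
      then obtain g' where "g' \<in> Sp v" "g' \<in> E \<sigma>" "far v g' = x" using spoke_mem[OF \<sigma>(1)] far(2)[OF g(1)] g(2) by blast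
      then show False using inj_onD[OF iF, of g' g] g \<sigma>(2) by simp
    qed
    have "card (verts \<sigma>) = 3" using card_verts \<sigma>(1) by (simp add: Star_def)
    moreover have "card (V - {x}) = 3" using cV x by (simp add: V_def)
    moreover have "finite (V - {x})" using fN by (simp add: V_def)
    ultimately have "verts \<sigma> = V - {x}" using vsub[OF \<sigma>(1)] xn by (intro card_subset_eq) auto
    then show ?thesis using \<sigma>(1) by blast
  qed
  then obtain G where G: "\<And>x. x \<in> N \<Longrightarrow> G x \<in> Star v \<and> verts (G x) = V - {x}" by metis
  have "inj_on G N"
  proof (rule inj_onI)
    fix x y assume "x \<in> N" "y \<in> N" "G x = G y"
    then have "V - {x} = V - {y}" using G by metis
    then show "x = y" using \<open>x \<in> N\<close> by (auto simp: V_def)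
  qed
  then have "card (G ` N) = card (Star v)" using cN3 deg card_image by metis
  moreover have "G ` N \<subseteq> Star v" using G by blast
  ultimately have "Star v = G ` N" using card_subset_eq[OF finite_Star] by metis
  moreover have "V - {v} = N" using vN by (simp add: V_def)
  ultimately show ?thesis using that[of V G] cV iV iF G by (simp add: V_def N_def)
qed

text \<open>A triple that contains \<open>v\<close> is the corner set of a triangle and is ordered
  there. The link is the only other triple, and a local source or sink keeps it from being a
  directed cycle.\<close>

lemma linear_star:
  assumes G: "\<forall>x\<in>V - {v}. G x \<in> Star v \<and> verts (G x) = V - {x}" and St: "Star v = G ` (V - {v})"
    and V: "card V = 4" "v \<in> V" "V = insert v (far v ` Sp v)" "inj_on (far v) (Sp v)" and W: "W v"
  defines "r x y \<equiv> \<exists>\<sigma>\<in>Star v. arrow \<sigma> x y"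
  shows "x \<in> V \<Longrightarrow> y \<in> V \<Longrightarrow> x \<noteq> y \<Longrightarrow> r x y \<or> r y x"
    and "x \<in> V \<Longrightarrow> y \<in> V \<Longrightarrow> r x y \<Longrightarrow> \<not> r y x"
    and "\<sigma> \<in> Star v \<Longrightarrow> x \<in> verts \<sigma> \<Longrightarrow> y \<in> verts \<sigma> \<Longrightarrow> r x y \<Longrightarrow> arrow \<sigma> x y"
    and "x \<in> V \<Longrightarrow> y \<in> V \<Longrightarrow> z \<in> V \<Longrightarrow> r x y \<Longrightarrow> r y z \<Longrightarrow> r x z"
proof -
  have fV: "finite V" using V(1) by (metis card.infinite zero_neq_numeral)
  have GS: "\<sigma> \<in> S" "v \<in> verts \<sigma>" if "\<sigma> \<in> Star v" for \<sigma> using that by (auto simp: Star_def)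
  text \<open>Two different triangles at \<open>v\<close> have a spoke in common, and nothing else.\<close>
  have cons: "arrow \<tau> x y" if st: "\<sigma> \<in> Star v" "\<tau> \<in> Star v" "arrow \<sigma> x y" "x \<in> verts \<tau>" "y \<in> verts \<tau>" for \<sigma> \<tau> x y
  proof (cases "v \<in> {x, y}")
    case True
    have xy: "x \<noteq> y" "x \<in> verts \<sigma>" "y \<in> verts \<sigma>" using arrow_linear(4)[OF GS(1)[OF st(1)] st(3)] by auto
    define u where "u = (if x = v then y else x)"
    have u: "u \<in> verts \<sigma>" "u \<in> verts \<tau>" "u \<noteq> v" using True xy st(4,5) by (auto simp: u_def)
    obtain g where g: "g \<in> Sp v" "g \<in> E \<sigma>" "ends g = {v, u}" "far v g = u" by (rule spoke_mem[OF st(1) u(1,3)])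
    obtain h where h: "h \<in> Sp v" "h \<in> E \<tau>" "ends h = {v, u}" "far v h = u" by (rule spoke_mem[OF st(2) u(2,3)])
    have "g = h" using inj_onD[OF V(4), of g h] g h by simp
    have e: "ends g = {x, y}" using g(3) True xy(1) by (auto simp: u_def)
    show ?thesis using arrow_edge[OF GS(1)[OF st(1)] g(2) e] arrow_edge[OF GS(1)[OF st(2)] _ e] h(2) \<open>g = h\<close> st(3) by blast
  next
    case False
    have xy: "x \<noteq> y" "x \<in> verts \<sigma>" "y \<in> verts \<sigma>" using arrow_linear(4)[OF GS(1)[OF st(1)] st(3)] by auto
    obtain a where a: "a \<in> V - {v}" "\<sigma> = G a" using st(1) St by blast
    obtain b where b: "b \<in> V - {v}" "\<tau> = G b" using st(2) St by blast
    have sub: "{v, x, y, a} \<subseteq> V" "{v, x, y, b} \<subseteq> V" using xy st(4,5) a b G V(2) by auto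
    have "x \<noteq> a" "y \<noteq> a" "x \<noteq> b" "y \<noteq> b" using xy(2,3) st(4,5) a b G by auto
    then have "card {v, x, y, a} = 4" using False xy(1) a by auto
    then have "V = {v, x, y, a}" using card_subset_eq[OF fV sub(1)] V(1) by simp
    then have "a = b" using sub(2) b \<open>x \<noteq> b\<close> \<open>y \<noteq> b\<close> by auto
    then show ?thesis using st(3) a b by simp
  qed
  show c: "\<sigma> \<in> Star v \<Longrightarrow> x \<in> verts \<sigma> \<Longrightarrow> y \<in> verts \<sigma> \<Longrightarrow> r x y \<Longrightarrow> arrow \<sigma> x y" for \<sigma> x y
    using cons unfolding r_def by blast
  have common: "\<exists>\<sigma>\<in>Star v. {x, y} \<subseteq> verts \<sigma>" if xy: "x \<in> V" "y \<in> V" for x y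
  proof -
    have "card {v, x, y} \<le> 3" by (simp add: card_insert_if)
    then have "V - {v, x, y} \<noteq> {}" using V(1) card_mono[of "{v, x, y}" V] by auto
    then obtain a where "a \<in> V - {v, x, y}" by blast
    then show ?thesis using G xy by blast
  qed
  show tot: "x \<in> V \<Longrightarrow> y \<in> V \<Longrightarrow> x \<noteq> y \<Longrightarrow> r x y \<or> r y x" for x y
    using common[of x y] arrow_linear(1)[OF GS(1), of _ x y] unfolding r_def by blast
  show anti: "x \<in> V \<Longrightarrow> y \<in> V \<Longrightarrow> r x y \<Longrightarrow> \<not> r y x" for x y
  proof -
    assume a: "x \<in> V" "y \<in> V" "r x y"
    obtain \<sigma> where \<sigma>: "\<sigma> \<in> Star v" "{x, y} \<subseteq> verts \<sigma>" using common a(1,2) by blast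
    then have "arrow \<sigma> x y" using c a(3) by blast
    then show "\<not> r y x" using c[OF \<sigma>(1), of y x] \<sigma>(2) arrow_linear(2)[OF GS(1)[OF \<sigma>(1)]] by blast
  qed
  obtain k g where g: "g \<in> Sp v" "\<forall>\<sigma>\<in>S. g \<in> E \<sigma> \<longrightarrow> spoke k v \<sigma> = g" using W unfolding W_def by blast
  define m where "m = far v g"
  have mV: "m \<in> V" "m \<noteq> v" using g(1) V(3) far(2) by (auto simp: m_def)
  \<comment> \<open>The distinguished vertex \<open>m\<close> precedes both other vertices of the
    link, or follows both.\<close>
  have ext: "if k then r m x else r x m" if x: "x \<in> V" "x \<noteq> v" "x \<noteq> m" for x
  proof -
    obtain \<sigma> where \<sigma>: "\<sigma> \<in> Star v" "{x, m} \<subseteq> verts \<sigma>" using common x(1) mV(1) by blast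
    obtain h where h: "h \<in> Sp v" "h \<in> E \<sigma>" "far v h = m" 
      by (rule spoke_mem[OF \<sigma>(1) _ mV(2)]) (use \<sigma>(2) in auto)
    have hg: "h = g" using inj_onD[OF V(4), of h g] h g(1) by (simp add: m_def)
    have "spoke k v \<sigma> = g" using g(2) h(2) hg GS(1)[OF \<sigma>(1)] by blast
    moreover have "verts \<sigma> = {v, m, x}"
    proof -
      have "{v, m, x} \<subseteq> verts \<sigma>" using \<sigma> GS(2) by blast
      moreover have "card {v, m, x} = 3" using x mV by simp
      moreover have "card (verts \<sigma>) = 3" using card_verts GS(1) \<sigma>(1) by blast
      moreover have "finite (verts \<sigma>)" using card_verts GS(1) \<sigma>(1) by (metis card.infinite zero_neq_numeral)
      ultimately show ?thesis using card_subset_eq by metis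
    qed
    ultimately have "arr k \<sigma> m x" using spoke_iff[OF GS(1)[OF \<sigma>(1)], of v m x g k] x mV h(2) hg far(1)[OF g(1)] by (simp add: m_def)
    then show ?thesis using \<sigma>(1) unfolding r_def arr_def by auto
  qed
  show "x \<in> V \<Longrightarrow> y \<in> V \<Longrightarrow> z \<in> V \<Longrightarrow> r x y \<Longrightarrow> r y z \<Longrightarrow> r x z" for x y z
  proof -
    assume a: "x \<in> V" "y \<in> V" "z \<in> V" "r x y" "r y z"
    have d: "x \<noteq> y" "y \<noteq> z" "x \<noteq> z" using a anti by blast+
    show "r x z"
    proof (cases "v \<in> {x, y, z}")
      case True
      have "card {x, y, z} = 3" using d by simp
      then have "V - {x, y, z} \<noteq> {}" using V(1) card_mono[of "{x, y, z}" V] by auto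
      then obtain w where w: "w \<in> V" "w \<notin> {x, y, z}" by blast
      then have "G w \<in> Star v" "{x, y, z} \<subseteq> verts (G w)" using G True a(1-3) by auto
      then have "arrow (G w) x y" "arrow (G w) y z" using c a(4,5) by blast+
      then have "arrow (G w) x z" using arrow_linear(3)[OF GS(1)[OF \<open>G w \<in> Star v\<close>]] by blast
      then show ?thesis using \<open>G w \<in> Star v\<close> unfolding r_def by blast
    next
      case False
      have "card {v, x, y, z} = 4" using d False by simp
      moreover have "{v, x, y, z} \<subseteq> V" using a V(2) by blast
      ultimately have "V = {v, x, y, z}" using card_subset_eq[OF fV] V(1) by metis
      then consider "m = x" | "m = y" | "m = z" using mV by blast
      moreover have "\<not> r y x" "\<not> r z y" using anti[OF a(1,2,4)] anti[OF a(2,3,5)] by auto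
      moreover have "x \<noteq> v" "y \<noteq> v" "z \<noteq> v" using False by auto
      ultimately show ?thesis
        using ext[OF a(1)] ext[OF a(2)] ext[OF a(3)] d by cases (cases k, simp_all)+
    qed
  qed
qed

end

lemma remove_vertex:
  assumes gd: "good \<psi> T" and deg: "card (star T v) = 3" and c4: "card (tscol T \<psi> v) = 4" and W: "WT T v"
  shows "\<exists>T'. good \<psi> T' \<and> vertices T' = vertices T - {v} \<and> (fillable T' \<psi> \<longrightarrow> fillable T \<psi>)"
proof -
  interpret csurf "tris T" eds src tgt \<psi> by (rule csurf_good[OF gd])
  obtain G V where V: "V = insert v (far v ` Sp v)" "card V = 4" "inj_on \<psi> V" "inj_on (far v) (Sp v)"
    and G: "\<And>x. x \<in> V - {v} \<Longrightarrow> G x \<in> Star v \<and> verts (G x) = V - {x}" and St: "Star v = G ` (V - {v})"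
    by (rule degree_three_link[OF deg c4]) blast
  have vV: "v \<in> V" using V(1) by blast
  define r where "r x y \<longleftrightarrow> (\<exists>\<sigma>\<in>Star v. arrow \<sigma> x y)" for x y
  have G': "\<forall>x\<in>V - {v}. G x \<in> Star v \<and> verts (G x) = V - {x}" using G by blast
  note lin = linear_star[OF G' St V(2) vV V(1,4) W, folded r_def]
  obtain p :: "nat \<Rightarrow> real^3" where p: "bij_betw p {..3} V" "\<And>k k'. k < k' \<Longrightarrow> k' \<le> 3 \<Longrightarrow> r (p k) (p k')"
    by (rule linear_labels[where V = V and r = r]) (use V(2) lin in blast)+
  interpret ordered_tetra \<psi> T V "V - {v}" G p
  proof
    show "good \<psi> T" "bij_betw p {..3} V" "V - {v} \<subseteq> V" using gd p by auto
    show "G x \<in> tris T" if "x \<in> V - {v}" for x using G[OF that] by (simp add: Star_def)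
  next
    fix x and k k' :: nat assume a: "x \<in> V - {v}" "k < k'" "k' \<le> 3" "p k \<noteq> x" "p k' \<noteq> x"
    have "p k \<in> V" "p k' \<in> V" using bij_betwE[OF p(1)] a by auto
    then have "arrow (G x) (p k) (p k')" using lin(3)[of "G x" "p k" "p k'"] G[OF a(1)] a p(2)[OF a(2,3)] by auto
    then show "\<exists>e\<in>eds (G x). src e = p k \<and> tgt e = p k'" unfolding arrow_def .
  next
    fix x y assume a: "x \<in> V - {v}" "y \<in> V - {v}" "x \<noteq> y"
    have "card {v, x, y} = 3" using a by auto
    then have "V - {v, x, y} \<noteq> {}" using V(2) card_mono[of "{v, x, y}" V] by auto
    then obtain z where z: "z \<in> V" "z \<notin> {v, x, y}" by blast
    obtain g where g: "g \<in> Sp v" "g \<in> eds (G x)" "ends g = {v, z}" "far v g = z"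
      using spoke_mem[of "G x" v z] G[OF a(1)] z by auto
    obtain h where h: "h \<in> Sp v" "h \<in> eds (G y)" "far v h = z"
      using spoke_mem[of "G y" v z] G[OF a(2)] z by auto
    have "g = h" using inj_onD[OF V(4), of g h] g h by simp
    show "\<exists>e\<in>eds (G x) \<inter> eds (G y). x \<notin> {src e, tgt e} \<and> y \<notin> {src e, tgt e}"
    proof
      have "{src g, tgt g} = {v, z}" using g(3) by (simp add: ends_def)
      then show "x \<notin> {src g, tgt g} \<and> y \<notin> {src g, tgt g}" using a z by auto
      show "g \<in> eds (G x) \<inter> eds (G y)" using g(2) h(2) \<open>g = h\<close> by simp
    qed
  qed
  show ?thesis by (rule remove) (use vV V(3) St in auto)
qed

text \<open>
  If the link of \<open>v\<close> is a directed triangle, another vertex \<open>w\<close> of the same color is brought to a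
  triangle \<open>a b w\<close> with an edge \<open>a b\<close> in the link of \<open>v\<close>. Flipping first \<open>v b\<close> and then \<open>a b\<close> makes
  the third vertex \<open>c\<close> of the link of \<open>v\<close> a sink in the link of \<open>w\<close>.
\<close>

lemma break_cycle:
  assumes gd: "good \<psi> T" and v: "v \<in> vertices T" and w: "w \<in> vertices T" "w \<noteq> v" "\<psi> w = \<psi> v"
    and deg: "card (star T v) = 3" and c4: "card (tscol T \<psi> v) = 4" and nW: "\<not> WT T v"
  obtains T' w' where "reaches \<psi> T T'" "w' \<in> vertices T" "w' \<noteq> v" "\<psi> w' = \<psi> v" "WT T' w'"
proof -
  interpret T: csurf "tris T" eds src tgt \<psi> by (rule csurf_good[OF gd])
  have no: "x = v" if "\<sigma> \<in> star T v" "x \<in> tverts \<sigma>" "\<psi> x = \<psi> w" for \<sigma> x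
    using T.vert_colors[of \<sigma> x v] that w(3) by (auto simp: T.Star_def)
  obtain T1 A B e a0 b0 w' where r1: "reaches \<psi> T T1" and St1: "star T1 v = star T v"
    and h0: "thinge T1 A B e a0 b0 v w'" and w': "\<psi> w' = \<psi> w" "w' \<noteq> v"
    by (rule bring[OF gd v w(1,2) no])
  have gd1: "good \<psi> T1" by (rule reaches_good[OF r1])
  interpret S1: csurf "tris T1" eds src tgt \<psi> by (rule csurf_good[OF gd1])
  have nW1: "\<not> S1.W v" using nW W_cong_Star[OF T.csurf_axioms S1.csurf_axioms St1] by blast
  have sc1: "S1.scol v = T.scol v" unfolding S1.scol_def T.scol_def St1 ..
  \<comment> \<open>The ends of \<open>e\<close> are named so that \<open>e\<close> runs from
    \<open>a\<close> to \<open>b\<close>.\<close>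
  have "src e = a0 \<or> src e = b0" using h0 by (auto simp: S1.hinge_def S1.ends_def doubleton_eq_iff)
  then obtain a b where h: "S1.hinge A B e a b v w'" and se: "src e = a" using h0 S1.hinge_swap(2)[OF h0] by blast
  have A: "A \<in> tris T1" "B \<in> tris T1" "A \<noteq> B" "e \<in> eds A" "e \<in> eds B" "S1.ends e = {a, b}"
    and vA: "S1.verts A = {a, b, v}" and vB: "S1.verts B = {a, b, w'}" using h by (auto simp: S1.hinge_def)
  note dA = S1.three_distinct[OF A(1) vA] and dB = S1.three_distinct[OF A(2) vB]
  have AS: "A \<in> S1.Star v" using A(1) vA by (simp add: S1.Star_def)
  obtain g where g: "g \<in> S1.Sp v" "g \<in> eds A" "S1.ends g = {v, b}" "S1.far v g = b"
    by (rule S1.spoke_mem[OF AS, of b]) (use vA dA in auto)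
  obtain A' c1 c where h1: "S1.hinge A A' g v b c1 c"
    using S1.spoke_hinge[OF g(1,2) A(1)] unfolding g(4) by blast
  have A': "A' \<in> tris T1" "A' \<noteq> A" "g \<in> eds A'" and vA1: "S1.verts A = {v, b, c1}" and vA': "S1.verts A' = {v, b, c}"
    using h1 by (auto simp: S1.hinge_def)
  have "c1 = a" using vA vA1 dA S1.three_distinct[OF A(1) vA1] by auto
  then have h1: "S1.hinge A A' g v b a c" using h1 by simp
  note dA' = S1.three_distinct[OF A'(1) vA']
  have AS': "A' \<in> S1.Star v" using A'(1) vA' by (simp add: S1.Star_def)
  have ac: "\<psi> a \<noteq> \<psi> c"
  proof -
    have deg1: "card (S1.Star v) = 3" "card (S1.scol v) = 4" using St1 sc1 deg c4 by auto
    obtain G V where V: "inj_on \<psi> V" "\<And>x. x \<in> V - {v} \<Longrightarrow> G x \<in> S1.Star v \<and> S1.verts (G x) = V - {x}"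
      "S1.Star v = G ` (V - {v})"
      by (rule S1.degree_three_link[OF deg1]) blast
    obtain x where x: "x \<in> V - {v}" "A = G x" using AS V(3) by blast
    obtain y where y: "y \<in> V - {v}" "A' = G y" using AS' V(3) by blast
    have "x \<noteq> y" using A'(2) x y by blast
    have vs: "S1.verts A = V - {x}" "S1.verts A' = V - {y}" using V(2) x y by blast+
    then have "a \<in> V" "c \<in> V" using vA vA' by blast+
    moreover have "a \<noteq> c"
    proof
      assume "a = c"
      then have "V - {x} = V - {y}" using vs vA vA' by auto
      then show False using \<open>x \<noteq> y\<close> x y by blast
    qed
    ultimately show ?thesis using V(1) by (auto simp: inj_on_def)
  qed
  have ab: "S1.arrow A a b" using S1.arrow_edge[OF A(1,4,6)] se by simp
  \<comment> \<open>Otherwise \<open>b\<close> would be a local sink in the link of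
    \<open>v\<close>.\<close>
  have bc: "S1.arrow A' b c"
  proof (rule ccontr)
    assume "\<not> S1.arrow A' b c"
    then have cb: "S1.arrow A' c b" using S1.arrow_linear(1)[OF A'(1), of b c] vA' dA' by auto
    have "S1.spoke False v A = g"
      using S1.spoke_iff[OF A(1), of v b a g False] vA dA g ab by (auto simp: S1.arr_def)
    moreover have "S1.spoke False v A' = g"
      using S1.spoke_iff[OF A'(1), of v b c g False] vA' dA' A'(3) g cb by (auto simp: S1.arr_def)
    ultimately have "\<forall>\<sigma>\<in>tris T1. g \<in> eds \<sigma> \<longrightarrow> S1.spoke False v \<sigma> = g"
      using S1.hinge_only[OF h1] by metis
    then show False using nW1 g(1) unfolding S1.W_def by blast
  qed
  \<comment> \<open>By \<open>mixed_W\<close>, the edges at \<open>v\<close> either all leave it or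
    all enter it.\<close>
  have vc: "S1.arrow A' v c" if va: "S1.arrow A v a"
  proof (rule ccontr)
    assume "\<not> S1.arrow A' v c"
    then have cv: "S1.arrow A' c v" using S1.arrow_linear(1)[OF A'(1), of v c] vA' dA' by auto
    obtain p where p: "p \<in> eds A" "src p = v" "tgt p = a" using va by (auto simp: S1.arrow_def)
    obtain q where q: "q \<in> eds A'" "src q = c" "tgt q = v" using cv by (auto simp: S1.arrow_def)
    have "p \<in> S1.Sp v" "q \<in> S1.Sp v" using p q A(1) A'(1) by (auto simp: S1.Sp_def S1.ends_def)
    then show False using S1.mixed_W[of p v q] p q nW1 by blast
  qed
  \<comment> \<open>This permits the new edge of the first flip to run from \<open>a\<close> to
    \<open>c\<close>.\<close>
  have ok: "tarr True A' x c" if "x \<in> {v, b}" "tarr True A x a" for x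
    using that vc S1.arrow_linear(2)[OF A(1) ab] by (auto simp: S1.arr_def)
  obtain T2 C1 D1 f1 where fl1: "reaches \<psi> T1 T2" "flip \<psi> T1 T2 A A' C1 D1 g f1 v b a c" "tarr True C1 a c"
    using flip_directed[OF gd1 h1 ac ok] by blast
  interpret F: csurf_flip "tris T1" "tris T2" eds src tgt \<psi> A A' C1 D1 g f1 v b a c by (rule fl1(2))
  have gd2: "good \<psi> T2" by (rule reaches_good[OF fl1(1)])
  have "e \<noteq> g" using A(6) g(3) dA by (auto simp: doubleton_eq_iff)
  then have eD: "e \<in> eds D1" using F.ED A(4,6) by auto
  have "v \<notin> S1.verts B" using vB dA w'(2) by auto
  then have B2: "B \<in> tris T2" "B \<noteq> D1" using F.in_S' A(2,3) vA' F.new(2) by auto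
  have acD: "tarr True D1 a c" using F.arr_f fl1(3) by simp
  have bcD: "tarr True D1 b c" using csurf_flip.arr_C(2)[OF F.swap_ends, of True] bc by (simp add: S1.arr_def)
  \<comment> \<open>The second flip takes place between \<open>B\<close> and the new triangle with
    corners \<open>a\<close>, \<open>b\<close>, \<open>c\<close>, in which \<open>c\<close> comes
    last.\<close>
  have h2: "F.S'.hinge B D1 e a b w' c"
    unfolding F.S'.hinge_def using B2 F.CD_in(2) A(5,6) eD vB F.vD by auto
  have wc: "\<psi> w' \<noteq> \<psi> c" using S1.vert_colors[OF A'(1), of v c] vA' dA' w'(1) w(3) by auto
  obtain T3 C2 D2 f2 where fl2: "reaches \<psi> T2 T3" "flip \<psi> T2 T3 B D1 C2 D2 e f2 a b w' c"
    using flip_exists[OF gd2 h2 wc] by blast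
  interpret F2: csurf_flip "tris T2" "tris T3" eds src tgt \<psi> B D1 C2 D2 e f2 a b w' c by (rule fl2(2))
  have s1: "F2.S'.spoke False w' C2 = f2"
    using F2.S'.spoke_iff[OF F2.CD_in(1), of w' c a f2 False] F2.vC F2.dist F2.f(1) F2.EC F2.arr_C(2)[of True] acD
    by (auto simp: F2.S'.arr_def insert_commute)
  have s2: "F2.S'.spoke False w' D2 = f2"
    using F2.S'.spoke_iff[OF F2.CD_in(2), of w' c b f2 False] F2.vD F2.dist F2.f(1) F2.ED
      csurf_flip.arr_C(2)[OF F2.swap_ends, of True] bcD
    by (auto simp: F2.S'.arr_def insert_commute)
  have "\<forall>\<sigma>\<in>tris T3. f2 \<in> eds \<sigma> \<longrightarrow> F2.S'.spoke False w' \<sigma> = f2"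
    using s1 s2 F2.in_S' F2.f(2) by metis
  moreover have "f2 \<in> F2.S'.Sp w'" unfolding F2.S'.Sp_def using F2.CD_in(1) F2.EC F2.f(1) by blast
  ultimately have "WT T3 w'" unfolding F2.S'.W_def by blast
  moreover have "w' \<in> vertices T"
    using vertices_tris[OF gd1] A(2) vB r1 unfolding reaches_def by blast
  ultimately show ?thesis using that[OF reaches_trans[OF r1 reaches_trans[OF fl1(1) fl2(1)]]] w' w(3) by metis
qed

text \<open>Either \<open>v\<close> can be removed, or \<open>break_cycle\<close> provides another
  vertex of the same color that can. In both cases the other one keeps this color in use.\<close>

lemma reduce:
  assumes gd: "good \<psi> T" and C: "card C = 4" "\<psi> ` vertices T = C"
    and v: "v \<in> vertices T" "w \<in> vertices T" "w \<noteq> v" "\<psi> w = \<psi> v"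
  obtains T' x where "good \<psi> T'" "x \<in> vertices T" "vertices T' = vertices T - {x}" "\<psi> ` vertices T' = C"
    "fillable T' \<psi> \<longrightarrow> fillable T \<psi>"
proof -
  have remove: "\<exists>T'. good \<psi> T' \<and> vertices T' = vertices T - {x} \<and> (fillable T' \<psi> \<longrightarrow> fillable T \<psi>)"
    if r: "reaches \<psi> T T1" and x: "x \<in> vertices T" and W: "WT T1 x" for T1 x
  proof -
    have V1: "vertices T1 = vertices T" using r by (simp add: reaches_def)
    obtain T2 where T2: "reaches \<psi> T1 T2" "WT T1 x \<longrightarrow> WT T2 x" "tscol T2 \<psi> x = C" "card (star T2 x) = 3"
      using degree_three[OF reaches_good[OF r] C(1), of x] C(2) x V1 by metis
    have c4: "card (tscol T2 \<psi> x) = 4" using T2(3) C(1) by simp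
    obtain T3 where "good \<psi> T3" "vertices T3 = vertices T2 - {x}" "fillable T3 \<psi> \<longrightarrow> fillable T2 \<psi>"
      using remove_vertex[OF reaches_good[OF T2(1)] T2(4) c4] T2(2) W by blast
    then show ?thesis using r T2(1) unfolding reaches_def by blast
  qed
  have "\<exists>x y T1. reaches \<psi> T T1 \<and> x \<in> vertices T \<and> y \<in> vertices T \<and> y \<noteq> x \<and> \<psi> y = \<psi> x \<and> WT T1 x"
  proof -
    obtain T2 where T2: "reaches \<psi> T T2" "tscol T2 \<psi> v = C" "card (star T2 v) = 3"
      using degree_three[OF gd C v(1)] by metis
    have V2: "vertices T2 = vertices T" using T2(1) by (simp add: reaches_def)
    show ?thesis
    proof (cases "WT T2 v")
      case True
      then show ?thesis using T2(1) v by blast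
    next
      case False
      have c4: "card (tscol T2 \<psi> v) = 4" using T2(2) C(1) by simp
      obtain T3 w' where T3: "reaches \<psi> T2 T3" "w' \<in> vertices T2" "w' \<noteq> v" "\<psi> w' = \<psi> v" "WT T3 w'"
        by (rule break_cycle[OF reaches_good[OF T2(1)] _ _ v(3,4) T2(3) c4 False]) (use v V2 in auto)
      then have "w' \<in> vertices T" "v \<noteq> w'" "\<psi> v = \<psi> w'" using V2 by auto
      then show ?thesis using reaches_trans[OF T2(1) T3(1)] T3(5) v(1) by blast
    qed
  qed
  then obtain x y T1 where x: "reaches \<psi> T T1" "x \<in> vertices T" "y \<in> vertices T" "y \<noteq> x" "\<psi> y = \<psi> x" "WT T1 x"
    by blast
  obtain T' where T': "good \<psi> T'" "vertices T' = vertices T - {x}" "fillable T' \<psi> \<longrightarrow> fillable T \<psi>"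
    using remove[OF x(1,2,6)] by blast
  have "\<psi> ` (vertices T - {x}) = C"
  proof
    show "C \<subseteq> \<psi> ` (vertices T - {x})"
    proof
      fix k assume "k \<in> C"
      then obtain z where z: "z \<in> vertices T" "k = \<psi> z" using C(2) by blast
      show "k \<in> \<psi> ` (vertices T - {x})"
      proof (cases "z = x")
        case True
        then have "k = \<psi> y" using z(2) x(5) by simp
        then show ?thesis using x(3,4) by blast
      qed (use z in blast)
    qed
  qed (use C(2) in blast)
  then show ?thesis using that[OF T'(1) x(2) T'(2) _ T'(3)] T'(2) by simp
qed

text \<open>\<open>pairs\<close> supplies the edge between the remaining two vertices that
  \<open>no_parallel_edges\<close> asks for, so an edge is determined by its ends. Then a triangle
  is determined by its corners: two triangles with equal corners would share all edges and be the
  whole surface.\<close>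

lemma four_vertices_fill:
  assumes gd: "good \<psi> T" and V: "vertices T = V" "card V = 4"
    and pairs: "\<And>x y. x \<in> V \<Longrightarrow> y \<in> V \<Longrightarrow> \<exists>\<sigma>\<in>tris T. {x, y} \<subseteq> tverts \<sigma>"
  shows "fillable T \<psi>"
proof -
  interpret colored_sphere T by (rule good_colored[OF gd])
  interpret csurf "tris T" eds src tgt \<psi> by (rule csurf_good[OF gd])
  have fV: "finite V" using V(2) by (metis card.infinite zero_neq_numeral)
  have vV: "verts \<sigma> \<subseteq> V" if "\<sigma> \<in> tris T" for \<sigma> using V(1) vertices_tris[OF gd] that by blast
  have rest: "\<exists>c d. V = {x, y, c, d} \<and> c \<noteq> x \<and> c \<noteq> y \<and> d \<noteq> x \<and> d \<noteq> y \<and> c \<noteq> d" if xy: "x \<in> V" "y \<in> V" "x \<noteq> y" for x y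
  proof -
    have "card (V - {x, y}) = 2" using xy V(2) by (simp add: card_Diff_subset)
    then obtain c d where cd: "V - {x, y} = {c, d}" "c \<noteq> d" by (auto simp: card_2_iff)
    have "V = {x, y, c, d}" using cd(1) xy by blast
    then show ?thesis using cd by blast
  qed
  have edge1: "e = e'" if e: "\<sigma> \<in> tris T" "e \<in> eds \<sigma>" "\<tau> \<in> tris T" "e' \<in> eds \<tau>" "ends e = {x, y}" "ends e' = {x, y}"
    for \<sigma> \<tau> e e' x y
  proof (rule ccontr)
    assume ne: "e \<noteq> e'"
    have "x \<in> V" "y \<in> V" using vV[OF e(1)] ends_verts[OF e(2)] e(5) by auto
    moreover have "x \<noteq> y" using edge_ends(1)[OF e(1,2)] e(5) by (auto simp: ends_def doubleton_eq_iff)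
    ultimately have "\<exists>c d. V = {x, y, c, d} \<and> c \<noteq> x \<and> c \<noteq> y \<and> d \<noteq> x \<and> d \<noteq> y \<and> c \<noteq> d"
      by (rule rest)
    then obtain c d where cd: "V = {x, y, c, d}" "c \<noteq> x" "c \<noteq> y" "d \<noteq> x" "d \<noteq> y" "c \<noteq> d"
      by (elim exE conjE)
    have "c \<in> V" "d \<in> V" using cd(1) by auto
    then obtain \<rho> where \<rho>: "\<rho> \<in> tris T" "c \<in> verts \<rho>" "d \<in> verts \<rho>" using pairs[of c d] by auto
    obtain f where f: "f \<in> eds \<rho>" "ends f = {c, d}" using edge_between[OF \<rho> cd(6)] by blast
    have "vertices T = {x, y, c, d}" using V(1) cd(1) by simp
    moreover have "(1, e) \<in> T" "(1, e') \<in> T" "(1, f) \<in> T" using eds_in_T e(1-4) f(1) \<rho>(1) by blast+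
    moreover have "corners 1 e = {x, y}" "corners 1 e' = {x, y}" "corners 1 f = {c, d}"
      using e(5,6) f(2) unfolding ends_def ends_corners .
    ultimately show False using no_parallel_edges[of x y c d e e' f] cd(2-5) \<open>x \<noteq> y\<close> ne by simp
  qed
  have same: "\<sigma> = \<tau>" if st: "\<sigma> \<in> tris T" "\<tau> \<in> tris T" "verts \<sigma> = verts \<tau>" for \<sigma> \<tau>
  proof (rule ccontr)
    assume ne: "\<sigma> \<noteq> \<tau>"
    have tw: "e \<in> eds \<tau>" if st: "\<sigma> \<in> tris T" "\<tau> \<in> tris T" "verts \<sigma> = verts \<tau>" "e \<in> eds \<sigma>" for \<sigma> \<tau> e
    proof -
      have "{src e, tgt e} \<subseteq> verts \<tau>" "src e \<noteq> tgt e"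
        using ends_verts[OF st(4)] st(3) edge_ends(1)[OF st(1,4)] by (auto simp: ends_def)
      then obtain e' where "e' \<in> eds \<tau>" "ends e' = {src e, tgt e}" using edge_between[OF st(2), of "src e" "tgt e"] by blast
      then show ?thesis using edge1[OF st(1,4,2), of e' "src e" "tgt e"] by (simp add: ends_def)
    qed
    have "{\<sigma>, \<tau>} = tris T"
    proof (rule dual_conn)
      fix \<rho> \<rho>' e assume a: "\<rho> \<in> {\<sigma>, \<tau>}" "\<rho>' \<in> tris T" "e \<in> eds \<rho>" "e \<in> eds \<rho>'"
      have "e \<in> eds \<sigma>" "e \<in> eds \<tau>" using a(1,3) tw[OF st] tw[OF st(2,1) st(3)[symmetric]] by auto
      then have "{\<sigma>, \<tau>} \<subseteq> {\<rho> \<in> tris T. e \<in> eds \<rho>}" using st by blast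
      then have "{\<sigma>, \<tau>} = {\<rho> \<in> tris T. e \<in> eds \<rho>}"
        using two[OF st(1) \<open>e \<in> eds \<sigma>\<close>] ne finite_tris by (intro card_subset_eq) auto
      moreover have "\<rho>' \<in> {\<rho> \<in> tris T. e \<in> eds \<rho>}" using a(2,4) by simp
      ultimately show "\<rho>' \<in> {\<sigma>, \<tau>}" by simp
    qed (use st in auto)
    from this[symmetric] have "vertices T = verts \<sigma> \<union> verts \<tau>" unfolding vertices_tris[OF gd] by simp
    then have "V = verts \<sigma>" using V(1) st(3) by simp
    then show False using V(2) card_verts[OF st(1)] by simp
  qed
  \<comment> \<open>The two triangles at the edge \<open>y z\<close> have different third vertices,
    so both remaining vertices \<open>x\<close> and \<open>t\<close> occur there.\<close>
  have ex: "\<exists>\<sigma>\<in>tris T. verts \<sigma> = V - {x}" if x: "x \<in> V" for x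
  proof -
    have "card (V - {x}) = 3" using x V(2) by simp
    then have "V - {x} \<noteq> {}" by (metis card.empty zero_neq_numeral)
    then obtain y where y: "y \<in> V" "y \<noteq> x" by blast
    obtain z t where zt: "V = {x, y, z, t}" "z \<noteq> x" "z \<noteq> y" "t \<noteq> x" "t \<noteq> y" "z \<noteq> t" using rest[OF x y(1)] y(2) by blast
    obtain \<sigma> where \<sigma>: "\<sigma> \<in> tris T" "y \<in> verts \<sigma>" "z \<in> verts \<sigma>" using pairs[of y z] zt(1) by blast
    obtain g where g: "g \<in> eds \<sigma>" "ends g = {y, z}" using edge_between[OF \<sigma> not_sym[OF zt(3)]] by blast
    obtain \<tau> where \<tau>: "\<tau> \<in> tris T" "g \<in> eds \<tau>" "\<tau> \<noteq> \<sigma>" "{\<rho> \<in> tris T. g \<in> eds \<rho>} = {\<sigma>, \<tau>}"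
      by (rule incident_pair[OF g(1) \<sigma>(1)])
    obtain p where p: "verts \<sigma> = {y, z, p}" "p \<noteq> y" "p \<noteq> z" using third_vertex[OF \<sigma>(1) g] by metis
    obtain q where q: "verts \<tau> = {y, z, q}" "q \<noteq> y" "q \<noteq> z" using third_vertex[OF \<tau>(1,2) g(2)] by metis
    have "p \<noteq> q" using same[OF \<sigma>(1) \<tau>(1)] \<tau>(3) p q by auto
    moreover have "p \<in> V" "q \<in> V" using vV[OF \<sigma>(1)] vV[OF \<tau>(1)] p q by auto
    ultimately have "p = t \<or> q = t" using p q zt(1) by blast
    moreover have "V - {x} = {y, z, t}" using zt y(2) by auto
    ultimately show ?thesis using p(1) q(1) \<sigma>(1) \<tau>(1) by blast
  qed
  then obtain F where F: "\<And>x. x \<in> V \<Longrightarrow> F x \<in> tris T \<and> verts (F x) = V - {x}" by metis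
  define r where "r x y \<longleftrightarrow> (\<exists>\<sigma>\<in>tris T. arrow \<sigma> x y)" for x y
  have cons: "arrow \<tau> x y" if rxy: "r x y" "\<tau> \<in> tris T" "x \<in> verts \<tau>" "y \<in> verts \<tau>" for \<tau> x y
  proof -
    obtain \<sigma> e where e: "\<sigma> \<in> tris T" "e \<in> eds \<sigma>" "src e = x" "tgt e = y" using rxy(1) by (auto simp: r_def arrow_def)
    have "x \<noteq> y" using edge_ends(1)[OF e(1,2)] e(3,4) by simp
    then obtain e' where e': "e' \<in> eds \<tau>" "ends e' = {x, y}" using edge_between[OF rxy(2-4)] by blast
    have "e = e'" using edge1[OF e(1,2) rxy(2) e'(1), of x y] e e'(2) by (simp add: ends_def)
    then show ?thesis using e e'(1) by (auto simp: arrow_def)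
  qed
  have anti: "\<not> r y x" if xy: "r x y" for x y
  proof
    assume "r y x"
    then obtain \<tau> where \<tau>: "\<tau> \<in> tris T" "arrow \<tau> y x" by (auto simp: r_def)
    then have "arrow \<tau> x y" using cons[OF xy \<tau>(1)] arrow_linear(4)[OF \<tau>] by blast
    then show False using arrow_linear(2)[OF \<tau>(1)] \<tau>(2) by blast
  qed
  have tot: "r x y \<or> r y x" if xy: "x \<in> V" "y \<in> V" "x \<noteq> y" for x y
  proof -
    obtain \<sigma> where \<sigma>: "\<sigma> \<in> tris T" "x \<in> verts \<sigma>" "y \<in> verts \<sigma>" using pairs[OF xy(1,2)] by blast
    then show ?thesis using arrow_linear(1)[OF \<sigma> xy(3)] by (auto simp: r_def)
  qed
  have trans: "r x z" if a: "x \<in> V" "y \<in> V" "z \<in> V" "r x y" "r y z" for x y z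
  proof -
    have "card {x, y, z} \<le> 3" by (simp add: card_insert_if)
    then have "V - {x, y, z} \<noteq> {}" using V(2) card_mono[of "{x, y, z}" V] by auto
    then obtain w where w: "w \<in> V" "w \<notin> {x, y, z}" by blast
    then have "arrow (F w) x y" "arrow (F w) y z" using cons[OF a(4)] cons[OF a(5)] F[of w] a by auto
    then show ?thesis using arrow_linear(3)[of "F w" x y z] F[OF w(1)] by (auto simp: r_def)
  qed
  obtain p :: "nat \<Rightarrow> real^3" where p: "bij_betw p {..3} V" "\<And>k k'. k < k' \<Longrightarrow> k' \<le> 3 \<Longrightarrow> r (p k) (p k')"
    by (rule linear_labels[where V = V and r = r]) (use V(2) tot anti trans in blast)+
  interpret ordered_tetra \<psi> T V V F p
  proof
    show "good \<psi> T" "bij_betw p {..3} V" "V \<subseteq> V" using gd p by auto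
    show "F x \<in> tris T" if "x \<in> V" for x using F[OF that] by simp
  next
    fix x and k k' :: nat assume a: "x \<in> V" "k < k'" "k' \<le> 3" "p k \<noteq> x" "p k' \<noteq> x"
    have "p k \<in> V" "p k' \<in> V" using bij_betwE[OF p(1)] a by auto
    then have "arrow (F x) (p k) (p k')" using cons[OF p(2)[OF a(2,3)], of "F x"] F[OF a(1)] a by auto
    then show "\<exists>e\<in>eds (F x). src e = p k \<and> tgt e = p k'" unfolding arrow_def .
  next
    fix x y assume a: "x \<in> V" "y \<in> V" "x \<noteq> y"
    obtain c d where cd: "V = {x, y, c, d}" "c \<noteq> x" "c \<noteq> y" "d \<noteq> x" "d \<noteq> y" "c \<noteq> d" using rest[OF a] by blast
    obtain g where g: "g \<in> eds (F x)" "ends g = {c, d}"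
      by (rule edge_between[of "F x" c d]) (use F[OF a(1)] cd in auto)
    obtain h where h: "h \<in> eds (F y)" "ends h = {c, d}"
      by (rule edge_between[of "F y" c d]) (use F[OF a(2)] cd in auto)
    have "g = h" using edge1[of "F x" g "F y" h c d] F a g h by blast
    have "{src g, tgt g} = {c, d}" using g(2) by (simp add: ends_def)
    then have "x \<notin> {src g, tgt g} \<and> y \<notin> {src g, tgt g}" using cd by auto
    then show "\<exists>e\<in>eds (F x) \<inter> eds (F y). x \<notin> {src e, tgt e} \<and> y \<notin> {src e, tgt e}"
      using g(1) h(1) \<open>g = h\<close> by blast
  qed
  have "\<sigma> \<in> F ` V" if \<sigma>: "\<sigma> \<in> tris T" for \<sigma>
  proof -
    have "verts \<sigma> \<noteq> V" using card_verts[OF \<sigma>] V(2) by auto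
    then obtain x where x: "x \<in> V" "x \<notin> verts \<sigma>" using vV[OF \<sigma>] by blast
    have "verts \<sigma> = V - {x}"
      using card_verts[OF \<sigma>] V(2) x vV[OF \<sigma>] fV by (intro card_subset_eq) auto
    then have "\<sigma> = F x" using same[OF \<sigma>, of "F x"] F[OF x(1)] by simp
    then show ?thesis using x(1) by blast
  qed
  then show ?thesis by (intro fill) auto
qed

text \<open>If \<open>c\<close> and \<open>d\<close> lie in no common triangle, every triangle has
  the corners \<open>a b c\<close> or \<open>a b d\<close>, and triangles of both kinds meet along
  an edge \<open>a b\<close>. Its flip joins \<open>c\<close> to \<open>d\<close>. The pair
  \<open>a\<close>, \<open>b\<close> stays in a common triangle, because the second triangle at the
  edge \<open>a c\<close> survives.\<close>

lemma rainbow_fill: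
  assumes gd: "good \<psi> T" and V: "vertices T = V" "card V = 4" and col: "inj_on \<psi> V"
  shows "fillable T \<psi>"
proof (cases "\<forall>x\<in>V. \<forall>y\<in>V. \<exists>\<sigma>\<in>tris T. {x, y} \<subseteq> tverts \<sigma>")
  case True
  then show ?thesis using four_vertices_fill[OF gd V] by blast
next
  case False
  interpret csurf "tris T" eds src tgt \<psi> by (rule csurf_good[OF gd])
  have fV: "finite V" using V(2) by (metis card.infinite zero_neq_numeral)
  have vV: "verts \<sigma> \<subseteq> V" if "\<sigma> \<in> tris T" for \<sigma> using V(1) vertices_tris[OF gd] that by blast
  obtain c d where cd: "c \<in> V" "d \<in> V" "\<And>\<sigma>. \<sigma> \<in> tris T \<Longrightarrow> \<not> {c, d} \<subseteq> verts \<sigma>" using False by blast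
  obtain \<sigma>c \<sigma>d where s: "\<sigma>c \<in> tris T" "c \<in> verts \<sigma>c" "\<sigma>d \<in> tris T" "d \<in> verts \<sigma>d"
    using cd(1,2) V(1) vertices_tris[OF gd] by blast
  have "c \<noteq> d" using cd(3)[OF s(1)] s(2) by auto
  then have "card (V - {c, d}) = 2" using cd(1,2) V(2) by (simp add: card_Diff_subset)
  then obtain a b where ab: "V - {c, d} = {a, b}" "a \<noteq> b" by (auto simp: card_2_iff)
  have V': "V = {a, b, c, d}" and dist: "a \<noteq> c" "a \<noteq> d" "b \<noteq> c" "b \<noteq> d" using ab cd(1,2) by blast+
  have type: "verts \<sigma> = {a, b, c} \<or> verts \<sigma> = {a, b, d}" if \<sigma>: "\<sigma> \<in> tris T" for \<sigma>
  proof -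
    have c3: "card (verts \<sigma>) = 3" "verts \<sigma> \<subseteq> V" using card_verts[OF \<sigma>] vV[OF \<sigma>] by auto
    have "card {a, b, d} = 3" "card {a, b, c} = 3" using ab(2) dist by auto
    moreover have "verts \<sigma> \<subseteq> {a, b, d} \<or> verts \<sigma> \<subseteq> {a, b, c}" using c3(2) cd(3)[OF \<sigma>] V' by blast
    ultimately show ?thesis using c3(1) card_subset_eq[of "{a, b, d}" "verts \<sigma>"] card_subset_eq[of "{a, b, c}" "verts \<sigma>"] by auto
  qed
  have "Star c \<noteq> tris T" using cd(3)[OF s(3)] s(3,4) by (auto simp: Star_def)
  moreover have "Star c \<noteq> {}" "Star c \<subseteq> tris T" using s by (auto simp: Star_def)
  ultimately obtain A B e where AB: "A \<in> Star c" "B \<in> tris T" "e \<in> eds A" "e \<in> eds B" "B \<notin> Star c"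
    using dual_conn[of "Star c"] by blast
  have A: "A \<in> tris T" "verts A = {a, b, c}" using AB(1) type[of A] dist \<open>c \<noteq> d\<close> by (auto simp: Star_def)
  have B: "verts B = {a, b, d}" using AB(2,5) type[of B] by (auto simp: Star_def)
  have e: "ends e = {a, b}"
  proof -
    have "ends e \<subseteq> {a, b}" using ends_verts[OF AB(3)] ends_verts[OF AB(4)] A(2) B dist \<open>c \<noteq> d\<close> by blast
    moreover have "src e \<noteq> tgt e" by (rule edge_ends(1)[OF A(1) AB(3)])
    ultimately show ?thesis by (auto simp: ends_def)
  qed
  have h: "hinge A B e a b c d" unfolding hinge_def using A B AB e by auto
  have "\<psi> c \<noteq> \<psi> d" using col cd(1,2) \<open>c \<noteq> d\<close> by (auto simp: inj_on_def)
  then obtain T' C D f where fl: "reaches \<psi> T T'" "flip \<psi> T T' A B C D e f a b c d"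
    using flip_exists[OF gd h] by blast
  interpret F: csurf_flip "tris T" "tris T'" eds src tgt \<psi> A B C D e f a b c d by (rule fl(2))
  have V1: "vertices T' = V" using fl(1) V(1) by (simp add: reaches_def)
  obtain g where g: "g \<in> eds A" "ends g = {a, c}"
    by (rule edge_between[OF A(1), of a c]) (use A dist in auto)
  obtain \<tau> where \<tau>: "\<tau> \<in> tris T" "g \<in> eds \<tau>" "\<tau> \<noteq> A" "{\<rho> \<in> tris T. g \<in> eds \<rho>} = {A, \<tau>}"
    by (rule incident_pair[OF g(1) A(1)])
  have "c \<in> verts \<tau>" using ends_verts[OF \<tau>(2)] g(2) by blast
  then have "\<tau> \<noteq> B" using AB(2,5) by (auto simp: Star_def)
  then have \<tau>': "\<tau> \<in> tris T'" "{a, b} \<subseteq> verts \<tau>" using \<tau> F.in_S' type[OF \<tau>(1)] by auto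
  have "\<exists>\<sigma>\<in>tris T'. {x, y} \<subseteq> tverts \<sigma>" if "x \<in> V" "y \<in> V" for x y
  proof -
    have "{x, y} \<subseteq> {a, c, d} \<or> {x, y} \<subseteq> {b, c, d} \<or> {x, y} \<subseteq> {a, b}" using that V' by blast
    then show ?thesis using \<tau>' F.CD_in unfolding F.vC[symmetric] F.vD[symmetric] by blast
  qed
  then have "fillable T' \<psi>" using four_vertices_fill[OF reaches_good[OF fl(1)] V1 V(2)] by blast
  then show ?thesis using fl(1) by (simp add: reaches_def)
qed

text \<open>If the coloring is injective on the vertices, there are exactly four of them; otherwise
  a repeated color provides a vertex that can be removed without losing a color.\<close>

lemma strict_fill:
  assumes "good \<psi> T" and C: "card C = 4" "\<psi> ` vertices T = C"
  shows "fillable T \<psi>"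
  using assms(1,3)
proof (induction "card (vertices T)" arbitrary: T rule: less_induct)
  case less
  note gd = less.prems(1)
  interpret csurf "tris T" eds src tgt \<psi> by (rule csurf_good[OF gd])
  have "finite (verts \<sigma>)" if "\<sigma> \<in> tris T" for \<sigma> using card_verts[OF that] by (metis card.infinite zero_neq_numeral)
  then have fV: "finite (vertices T)" using vertices_tris[OF gd] fin by simp
  show ?case
  proof (cases "inj_on \<psi> (vertices T)")
    case True
    then have "card (vertices T) = 4" using card_image[OF True] less.prems(2) C(1) by simp
    then show ?thesis using rainbow_fill[OF gd refl] True by blast
  next
    case False
    then obtain v w where "v \<in> vertices T" "w \<in> vertices T" "w \<noteq> v" "\<psi> w = \<psi> v" unfolding inj_on_def by metis
    then obtain T' x where T': "good \<psi> T'" "x \<in> vertices T" "vertices T' = vertices T - {x}" "\<psi> ` vertices T' = C"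
      "fillable T' \<psi> \<longrightarrow> fillable T \<psi>"
      by (rule reduce[OF gd C(1) less.prems(2)])
    have "card (vertices T') < card (vertices T)" using T'(2,3) fV by (metis card_Diff1_less)
    then show ?thesis using less.hyps[OF _ T'(1,4)] T'(5) by blast
  qed
qed

theorem theorem1:
  fixes T :: "(real^3) simplices" and \<psi> :: "real^3 \<Rightarrow> 'c" and C :: "'c set"
  assumes "is_triangulation (top_of_set (sphere 0 1)) T"
    and "strict_four_coloring C T \<psi>"
  shows "\<exists>T'. is_triangulation (top_of_set (cball 0 1)) T' \<and>
    induced_triangulation (sphere 0 1) T' = T \<and>
    vertices T' \<subseteq> vertices T \<and>
    four_coloring C T' \<psi>"
proof -
  have C: "card C = 4" "\<psi> ` vertices T = C" and gd: "good \<psi> T"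
    using assms unfolding strict_four_coloring_def four_coloring_def good_def by auto
  obtain K where "is_triangulation (top_of_set (cball 0 1)) K" "induced_triangulation (sphere 0 1) K = T"
    "vertices K \<subseteq> vertices T" "proper_coloring K \<psi>"
    using strict_fill[OF gd C] unfolding fillable_def by blast
  then show ?thesis using C unfolding four_coloring_def by blast
qed

end
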